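(* Let $D$, $B$, $\gamma$, $f$ and $T>0$ be as in the context (non-layered background medium, $\gamma = I_3$ outside $D$, and either $(\mathrm{M})_+$ or $(\mathrm{M})_-$ holds). Suppose that $D$ and $B$ satisfy either (a) or (b): (a) $D$ has $C^1$ boundary $\partial D$ and $B$ satisfies condition (C); (b) $D$ and $B$ both satisfy condition (C) and $B$ is convex. Let $I_\tau$ ($\tau\ge 1$) be the indicator function defined in the context. Then: (i) if $T < 2\,\mathrm{dist}(D,B)$, then $\lim_{\tau\to\infty} e^{\tau T} I_\tau = 0$; (ii) if $T > 2\,\mathrm{dist}(D,B)$, then $\lim_{\tau\to\infty} e^{\tau T} I_\tau = -\infty$ if $(\mathrm{M})_+$ holds, and $\lim_{\tau\to\infty} e^{\tau T} I_\tau = +\infty$ if $(\mathrm{M})_-$ holds. Further, if $T > 2\,\mathrm{dist}(D,B)$ and either $(\mathrm{M})_+$ or $(\mathrm{M})_-$ holds, then $$\lim_{\tau\to\infty}\frac{1}{\tau}\log|I_\tau| = -2\,\mathrm{dist}(D,B).$$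
   Context: Setting. $I_3$ is the $3\times 3$ unit matrix; inequalities between symmetric matrices are in the sense of quadratic forms. $D\subset\mathbb{R}^3$ is a nonempty bounded measurable set with $\mathbb{R}^3\setminus D$ connected. $\gamma=(\gamma_{ij})$ is a real symmetric matrix-valued function with $\gamma_{ij}\in L^\infty(\mathbb{R}^3)$ and $\gamma(x)\ge c_0 I_3$ for a.e. $x\in\mathbb{R}^3$ for some constant $c_0>0$, and $\gamma(x)=I_3$ for $x\in\mathbb{R}^3\setminus D$. One of the following monotonicity conditions is assumed: $(\mathrm{M})_+$: $\inf_{x\in D}\gamma(x)>I_3$, i.e. there is $c>0$ with $\gamma(x)-I_3\ge cI_3$ for a.e. $x\in D$; $(\mathrm{M})_-$: $\sup_{x\in D}\gamma(x)<I_3$, i.e. there is $c>0$ with $I_3-\gamma(x)\ge cI_3$ for a.e. $x\in D$. $B\subset\mathbb{R}^3$ is a nonempty bounded open set with $\overline B\cap\overline D=\emptyset$. The real-valued function $f\in L^2(\mathbb{R}^3)$ satisfies the emission condition: $\mathrm{supp} f\subset\overline B$ and there is a constant $c_1>0$ such that either $f(x)\ge c_1$ for $x\in B$, or $-f(x)\ge c_1$ for $x\in B$. Put $L_\gamma u=\mathrm{div}(\gamma\nabla_x u)$. For fixed $T>0$, $u$ is the unique weak solution of $(\partial_t^2-L_\gamma)u=0$ in $(0,T)\times\mathbb{R}^3$, $u(0,x)=0$, $\partial_tu(0,x)=f(x)$ on $\mathbb{R}^3$; that is, $u\in L^2(0,T;H^1(\mathbb{R}^3))$, $\partial_tu\in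 L^2(0,T;L^2(\mathbb{R}^3))$, $\partial_t^2u\in L^2(0,T;(H^1(\mathbb{R}^3))')$, with $\langle\partial_t^2u(t,\cdot),\phi\rangle+\int_{\mathbb{R}^3}\gamma\nabla_xu(t,x)\cdot\nabla_x\phi(x)\,dx=0$ for a.e. $t\in(0,T)$ and all $\phi\in H^1(\mathbb{R}^3)$, and the initial conditions hold in the usual sense. Indicator function: for $\tau\ge1$, $$I_\tau=\int_{\mathbb{R}^3}f(x)\,(w(x;\tau)-v(x;\tau))\,dx,\qquad w(x;\tau)=\int_0^Te^{-\tau t}u(t,x)\,dt,$$ where $v(\cdot;\tau)$ is the $L^2$-solution of $(\Delta-\tau^2)v+f=0$ in $\mathbb{R}^3$, i.e. $v(x;\tau)=\frac1{4\pi}\int_B\frac{e^{-\tau|x-y|}}{|x-y|}f(y)\,dy$. $\mathrm{dist}(D,B)=\inf_{x\in D,\,y\in B}|x-y|$. Cones: for $x\in\mathbb{R}^3$, $h>0$, $\theta>0$, $n\in\mathbb{R}^3$ with $|n|=1$, $C(x,n,h,\theta)=\{y\in\mathbb{R}^3 : |y-x|\le h,\ (y-x)\cdot n\ge|y-x|\cos\theta\}$. A set $A\subset\mathbb{R}^3$ satisfies condition (C) if for every $x\in\partial A$ there is a cone $C(x,n,h,\theta)$ with vertex $x$ such that $C(x,n,h,\theta)\setminus\{x\}\subset A$. "$D$ has $C^1$ boundary" has the usual meaning: near each point of $\partial D$, after a rigid motion, $\partial D$ is the graph of a $C^1$ function and $D$ coincides, up to points of $\partial D$, with the region on one side of the graph.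 *)

theory Defs
  imports "HOL-Analysis.Analysis"
begin

type_synonym R3 = "real^3"

section \<open>Smooth functions\<close>

primrec Ck :: "nat \<Rightarrow> ('a::euclidean_space \<Rightarrow> real) \<Rightarrow> bool" where
  "Ck 0 g \<longleftrightarrow> continuous_on UNIV g"
| "Ck (Suc k) g \<longleftrightarrow> g differentiable_on UNIV \<and>
     (\<forall>b\<in>Basis. Ck k (\<lambda>x. frechet_derivative g (at x) b))"

definition test_functions :: "'a::euclidean_space set \<Rightarrow> ('a \<Rightarrow> real) set" where
  "test_functions S = {\<phi>. (\<forall>k. Ck k \<phi>) \<and>
     compact (closure {x. \<phi> x \<noteq> 0}) \<and> closure {x. \<phi> x \<noteq> 0} \<subseteq> S}"


section \<open>The spaces \<open>L\<^sup>2\<close>, \<open>H\<^sup>1\<close> and the dual of \<open>H\<^sup>1\<close> over three-space\<close>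

text \<open>Elements of these spaces are represented by functions, not by classes of functions that agree
  almost everywhere; the norms below are therefore seminorms on the representatives.\<close>

definition L2 :: "(R3 \<Rightarrow> real) set" where
  "L2 = {g. g \<in> borel_measurable lebesgue \<and> integrable lebesgue (\<lambda>x. (g x)\<^sup>2)}"

definition L2_norm :: "(R3 \<Rightarrow> real) \<Rightarrow> real" where
  "L2_norm g = sqrt (LINT x|lebesgue. (g x)\<^sup>2)"

definition has_weak_gradient :: "(R3 \<Rightarrow> real) \<Rightarrow> (R3 \<Rightarrow> R3) \<Rightarrow> bool" where
  "has_weak_gradient u G \<longleftrightarrow> u \<in> L2 \<and> (\<forall>i. (\<lambda>x. G x $ i) \<in> L2) \<and>
     (\<forall>\<phi>\<in>test_functions UNIV. \<forall>i.
        (LINT x|lebesgue. u x * frechet_derivative \<phi> (at x) (axis i 1))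
          = - (LINT x|lebesgue. G x $ i * \<phi> x))"

definition H1 :: "(R3 \<Rightarrow> real) set" where
  "H1 = {u. \<exists>G. has_weak_gradient u G}"

text \<open>The weak gradient is determined almost everywhere, so nothing below depends on the choice.\<close>

definition weak_gradient :: "(R3 \<Rightarrow> real) \<Rightarrow> R3 \<Rightarrow> R3" where
  "weak_gradient u = (SOME G. has_weak_gradient u G)"

definition H1_norm :: "(R3 \<Rightarrow> real) \<Rightarrow> real" where
  "H1_norm u = sqrt ((LINT x|lebesgue. (u x)\<^sup>2) + (LINT x|lebesgue. (norm (weak_gradient u x))\<^sup>2))"

text \<open>A bounded linear functional on \<open>H1\<close> is a function on all functions of which only the values on
  \<open>H1\<close> matter. Boundedness makes it respect equality almost everywhere.\<close>

definition H1_dual :: "((R3 \<Rightarrow> real) \<Rightarrow> real) set" where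
  "H1_dual = {l. (\<forall>\<phi>\<in>H1. \<forall>\<psi>\<in>H1. \<forall>a b. l (\<lambda>x. a * \<phi> x + b * \<psi> x) = a * l \<phi> + b * l \<psi>) \<and>
     (\<exists>K. \<forall>\<phi>\<in>H1. \<bar>l \<phi>\<bar> \<le> K * H1_norm \<phi>)}"

definition H1_dual_norm :: "((R3 \<Rightarrow> real) \<Rightarrow> real) \<Rightarrow> real" where
  "H1_dual_norm l = (SUP \<phi>\<in>{\<phi>\<in>H1. H1_norm \<phi> \<le> 1}. \<bar>l \<phi>\<bar>)"

text \<open>The embedding of \<open>L2\<close> into the dual of \<open>H1\<close>.\<close>

definition L2_functional :: "(R3 \<Rightarrow> real) \<Rightarrow> (R3 \<Rightarrow> real) \<Rightarrow> real" where
  "L2_functional g \<phi> = (LINT x|lebesgue. g x * \<phi> x)"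


section \<open>Functions of time with values in a function space\<close>

text \<open>A space is given by a set \<open>V\<close> of real-valued functions and a (semi)norm \<open>N\<close> on it, which is used
  with \<open>(L2, L2_norm)\<close>, \<open>(H1, H1_norm)\<close> and \<open>(H1_dual, H1_dual_norm)\<close>. The first definition is Bochner
  (strong) measurability, the second membership in the Bochner space of square integrable functions
  on the interval from 0 to \<open>T\<close>.\<close>

definition strongly_measurable ::
  "real \<Rightarrow> ('a \<Rightarrow> real) set \<Rightarrow> (('a \<Rightarrow> real) \<Rightarrow> real) \<Rightarrow> (real \<Rightarrow> 'a \<Rightarrow> real) \<Rightarrow> bool" where
  "strongly_measurable T V N u \<longleftrightarrow>
     (\<exists>s :: nat \<Rightarrow> real \<Rightarrow> 'a \<Rightarrow> real.
        (\<forall>n. simple_function (lebesgue_on {0<..<T}) (s n) \<and> s n ` {0<..<T} \<subseteq> V) \<and>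
        (AE t in lebesgue_on {0<..<T}. (\<lambda>n. N (s n t - u t)) \<longlonglongrightarrow> 0))"

definition Bochner_L2 ::
  "real \<Rightarrow> ('a \<Rightarrow> real) set \<Rightarrow> (('a \<Rightarrow> real) \<Rightarrow> real) \<Rightarrow> (real \<Rightarrow> 'a \<Rightarrow> real) \<Rightarrow> bool" where
  "Bochner_L2 T V N u \<longleftrightarrow> (AE t in lebesgue_on {0<..<T}. u t \<in> V) \<and>
     strongly_measurable T V N u \<and>
     integrable (lebesgue_on {0<..<T}) (\<lambda>t. (N (u t))\<^sup>2)"

text \<open>The initial value is that of the representative which is norm continuous up to the end points.\<close>

definition has_initial_value ::
  "real \<Rightarrow> ('a \<Rightarrow> real) set \<Rightarrow> (('a \<Rightarrow> real) \<Rightarrow> real) \<Rightarrow> (real \<Rightarrow> 'a \<Rightarrow> real) \<Rightarrow> ('a \<Rightarrow> real) \<Rightarrow> bool" where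
  "has_initial_value T V N u g \<longleftrightarrow>
     (\<exists>U. (\<forall>t\<in>{0..T}. U t \<in> V \<and> ((\<lambda>s. N (U s - U t)) \<longlongrightarrow> 0) (at t within {0..T})) \<and>
          (AE t in lebesgue_on {0<..<T}. N (U t - u t) = 0) \<and>
          N (U 0 - g) = 0)"

text \<open>\<open>q\<close> is the derivative of \<open>p\<close> in the sense of distributions on the interval from 0 to \<open>T\<close> with
  values in the dual of \<open>H1\<close>: the defining identity of vector-valued integrals is paired with the
  elements of \<open>H1\<close>.\<close>

definition has_weak_time_derivative ::
  "real \<Rightarrow> (real \<Rightarrow> (R3 \<Rightarrow> real) \<Rightarrow> real) \<Rightarrow> (real \<Rightarrow> (R3 \<Rightarrow> real) \<Rightarrow> real) \<Rightarrow> bool" where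
  "has_weak_time_derivative T p q \<longleftrightarrow>
     (\<forall>\<psi>\<in>test_functions {0<..<T}. \<forall>\<phi>\<in>H1.
        (LINT t|lebesgue_on {0<..<T}. deriv \<psi> t * p t \<phi>)
          = - (LINT t|lebesgue_on {0<..<T}. \<psi> t * q t \<phi>))"


section \<open>The wave equation\<close>

text \<open>Joint measurability selects a representative \<open>u t x\<close> of the Bochner class for which integrals over
  \<open>t\<close> at fixed \<open>x\<close> make sense for almost every \<open>x\<close>. The functions \<open>u'\<close> and \<open>u''\<close> are the first and second
  time derivative.\<close>

definition weak_wave_solution ::
  "real \<Rightarrow> (R3 \<Rightarrow> real^3^3) \<Rightarrow> (R3 \<Rightarrow> real) \<Rightarrow> (real \<Rightarrow> R3 \<Rightarrow> real) \<Rightarrow> bool" where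
  "weak_wave_solution T \<gamma> f u \<longleftrightarrow>
     (\<lambda>(t, x). u t x) \<in> borel_measurable (lebesgue_on ({0<..<T} \<times> UNIV)) \<and>
     Bochner_L2 T H1 H1_norm u \<and>
     (\<exists>u' u''.
        Bochner_L2 T L2 L2_norm u' \<and>
        has_weak_time_derivative T (\<lambda>t. L2_functional (u t)) (\<lambda>t. L2_functional (u' t)) \<and>
        Bochner_L2 T H1_dual H1_dual_norm u'' \<and>
        has_weak_time_derivative T (\<lambda>t. L2_functional (u' t)) u'' \<and>
        (AE t in lebesgue_on {0<..<T}. \<forall>\<phi>\<in>H1.
           u'' t \<phi> + (LINT x|lebesgue. (\<gamma> x *v weak_gradient (u t) x) \<bullet> weak_gradient \<phi> x) = 0) \<and>
        has_initial_value T L2 L2_norm u (\<lambda>x. 0) \<and>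
        has_initial_value T H1_dual H1_dual_norm (\<lambda>t. L2_functional (u' t)) (L2_functional f))"


section \<open>The coefficient matrix and the source\<close>

definition form_le :: "real^'n^'n \<Rightarrow> real^'n^'n \<Rightarrow> bool" where
  "form_le P Q \<longleftrightarrow> (\<forall>\<xi>. \<xi> \<bullet> (P *v \<xi>) \<le> \<xi> \<bullet> (Q *v \<xi>))"

definition Linf :: "(R3 \<Rightarrow> real) set" where
  "Linf = {g. g \<in> borel_measurable lebesgue \<and> (\<exists>K. AE x in lebesgue. \<bar>g x\<bar> \<le> K)}"

definition admissible_coefficient :: "R3 set \<Rightarrow> (R3 \<Rightarrow> real^3^3) \<Rightarrow> bool" where
  "admissible_coefficient D \<gamma> \<longleftrightarrow>
     (\<forall>x. transpose (\<gamma> x) = \<gamma> x) \<and>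
     (\<forall>i j. (\<lambda>x. \<gamma> x $ i $ j) \<in> Linf) \<and>
     (\<exists>c\<^sub>0>0. AE x in lebesgue. form_le (c\<^sub>0 *\<^sub>R mat 1) (\<gamma> x)) \<and>
     (AE x in lebesgue. x \<notin> D \<longrightarrow> \<gamma> x = mat 1)"

definition M_plus :: "R3 set \<Rightarrow> (R3 \<Rightarrow> real^3^3) \<Rightarrow> bool" where
  "M_plus D \<gamma> \<longleftrightarrow> (\<exists>c>0. AE x in lebesgue. x \<in> D \<longrightarrow> form_le (c *\<^sub>R mat 1) (\<gamma> x - mat 1))"

definition M_minus :: "R3 set \<Rightarrow> (R3 \<Rightarrow> real^3^3) \<Rightarrow> bool" where
  "M_minus D \<gamma> \<longleftrightarrow> (\<exists>c>0. AE x in lebesgue. x \<in> D \<longrightarrow> form_le (c *\<^sub>R mat 1) (mat 1 - \<gamma> x))"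

text \<open>The support of an element of \<open>L2\<close>: the complement of the largest open set on which it vanishes
  almost everywhere.\<close>

definition ess_support :: "(R3 \<Rightarrow> real) \<Rightarrow> R3 set" where
  "ess_support f = - \<Union>{S. open S \<and> (AE x in lebesgue. x \<in> S \<longrightarrow> f x = 0)}"

definition emission_condition :: "R3 set \<Rightarrow> (R3 \<Rightarrow> real) \<Rightarrow> bool" where
  "emission_condition B f \<longleftrightarrow> ess_support f \<subseteq> closure B \<and>
     (\<exists>c\<^sub>1>0. (AE x in lebesgue. x \<in> B \<longrightarrow> f x \<ge> c\<^sub>1) \<or> (AE x in lebesgue. x \<in> B \<longrightarrow> - f x \<ge> c\<^sub>1))"


section \<open>The indicator function\<close>

definition w_fun :: "real \<Rightarrow> (real \<Rightarrow> R3 \<Rightarrow> real) \<Rightarrow> real \<Rightarrow> R3 \<Rightarrow> real" where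
  "w_fun T u \<tau> x = (LINT t|lebesgue_on {0<..<T}. exp (- \<tau> * t) * u t x)"

definition v_fun :: "R3 set \<Rightarrow> (R3 \<Rightarrow> real) \<Rightarrow> real \<Rightarrow> R3 \<Rightarrow> real" where
  "v_fun B f \<tau> x = 1 / (4 * pi) *
     (LINT y|lebesgue_on B. exp (- \<tau> * norm (x - y)) / norm (x - y) * f y)"

definition indicator_function ::
  "real \<Rightarrow> R3 set \<Rightarrow> (R3 \<Rightarrow> real) \<Rightarrow> (real \<Rightarrow> R3 \<Rightarrow> real) \<Rightarrow> real \<Rightarrow> real" where
  "indicator_function T B f u \<tau> = (LINT x|lebesgue. f x * (w_fun T u \<tau> x - v_fun B f \<tau> x))"


section \<open>Boundary regularity\<close>

definition cone_at :: "R3 \<Rightarrow> R3 \<Rightarrow> real \<Rightarrow> real \<Rightarrow> R3 set" where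
  "cone_at x n h \<theta> = {y. norm (y - x) \<le> h \<and> (y - x) \<bullet> n \<ge> norm (y - x) * cos \<theta>}"

text \<open>The angle is bounded above because for a multiple of \<open>2 * pi\<close> the set \<open>cone_at x n h \<theta>\<close> degenerates
  to a line segment. Any upper bound between 0 and \<open>2 * pi\<close> gives the same condition.\<close>

definition cone_condition :: "R3 set \<Rightarrow> bool" where
  "cone_condition A \<longleftrightarrow> (\<forall>x\<in>frontier A. \<exists>n h \<theta>. norm n = 1 \<and> h > 0 \<and> 0 < \<theta> \<and> \<theta> < pi \<and>
     cone_at x n h \<theta> - {x} \<subseteq> A)"

definition has_C1_boundary :: "R3 set \<Rightarrow> bool" where
  "has_C1_boundary D \<longleftrightarrow>
     (\<forall>p\<in>frontier D. \<exists>S R. \<exists>b :: R3. \<exists>g :: real \<times> real \<Rightarrow> real.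
        open S \<and> p \<in> S \<and> orthogonal_transformation R \<and> Ck 1 g \<and>
        (\<forall>x\<in>S. let y = R x + b in
           (x \<in> frontier D \<longleftrightarrow> y $ 3 = g (y $ 1, y $ 2)) \<and>
           (x \<notin> frontier D \<longrightarrow> (x \<in> D \<longleftrightarrow> y $ 3 > g (y $ 1, y $ 2)))))"

end

theory Submission
  imports Defs "HOL-Computational_Algebra.Polynomial" "HOL-Real_Asymp.Real_Asymp"
begin

text \<open>The wave \<open>u\<close> enters only through its Laplace transform \<open>w\<close> over the finite time interval, which solves
  \<open>(\<tau>\<^sup>2 - L\<^sub>\<gamma>) w = f\<close> up to an error of relative size \<open>exp (- \<tau> * T)\<close> in the dual of \<open>H1\<close>, while \<open>v\<close> solves
  \<open>(\<tau>\<^sup>2 - \<Delta>) v = f\<close>. Testing the two equations with \<open>w\<close> and \<open>v\<close> gives energy identities which show that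
  \<open>- I\<close> (under \<open>M_plus\<close>) or \<open>I\<close> (under \<open>M_minus\<close>) is comparable to the integral of \<open>|grad v|\<^sup>2\<close> over \<open>D\<close>, up to
  errors \<open>exp (- 2 * \<tau> * T)\<close> and \<open>exp (- \<tau> * T) / \<tau>\<close>. Since \<open>v\<close> is the Yukawa potential of \<open>f\<close>, that integral is
  \<open>exp (- 2 * \<tau> * dist D B)\<close> up to powers of \<open>\<tau>\<close>. For the lower bound the assumptions on \<open>D\<close> and \<open>B\<close> provide a
  point of \<open>closure D\<close> with a unique nearest point in \<open>closure B\<close>, so that the contributions to \<open>grad v\<close> from near
  this point add up in one direction and all others are exponentially smaller; a cone at each of the
  two points makes the volumes involved at least of order \<open>\<tau>\<^sup>-\<^sup>3\<close>.\<close>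

text \<open>The residual in the equation of \<open>w\<close> is a functional \<open>F\<close> on
  \<open>H1\<close> with the factor \<open>exp (- \<tau> * T)\<close>. Tested with
  \<open>w - v\<close> it is absorbed by coercivity and leaves the square of that factor. Tested
  with \<open>v\<close> it costs the factor only once, but the energy norm of \<open>v\<close> is of
  order \<open>1 / \<tau>\<close>; without this gain, multiplying the error by
  \<open>exp (\<tau> * T)\<close> would leave something merely bounded. Two obstacles shape the
  rest. The wave is known only as a Bochner class with weak time derivatives, so \<open>w\<close>, a
  pointwise integral, has to be placed in \<open>H1\<close> by approximation, and its equation comes
  from a scalar integration by parts in time for each fixed test function. The kernel of
  \<open>v\<close> is singular and is integrated over \<open>B\<close> alone, so its equation is
  derived for a smoothed kernel and requires \<open>f\<close> to vanish almost everywhere on the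
  frontier of \<open>B\<close>; this is a second use of the cone condition on \<open>B\<close>,
  which makes the frontier a null set. The power \<open>\<tau> ^ 9\<close> in the lower bound stands
  for three volumes of order \<open>\<tau>\<^sup>-\<^sup>3\<close>: the squared integral over
  \<open>B\<close> contributes two, the integration over \<open>D\<close> one.\<close>

lemma Ck_SucI:
  assumes "\<And>x. (g has_derivative g' x) (at x)" "\<And>b. b \<in> Basis \<Longrightarrow> Ck k (\<lambda>x. g' x b)"
  shows "Ck (Suc k) g"
proof -
  have "frechet_derivative g (at x) = g' x" for x
    using frechet_derivative_at[OF assms(1)[of x]] by simp
  moreover have "g differentiable_on UNIV"
    using assms(1) by (auto simp: differentiable_on_def differentiable_def intro: has_derivative_at_withinI)
  ultimately show ?thesis using assms(2) by simp
qed

lemma Ck_Suc_has_derivative: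
  assumes "Ck (Suc k) g"
  shows "(g has_derivative frechet_derivative g (at x)) (at x)"
  using assms by (simp add: differentiable_on_def frechet_derivative_works)

lemma Ck_Suc_D: "Ck (Suc k) g \<Longrightarrow> Ck k g"
proof (induction k arbitrary: g)
  case 0
  then show ?case by (auto intro: differentiable_imp_continuous_on)
next
  case (Suc k)
  then show ?case by (metis Ck.simps(2))
qed

lemma Ck_const: "Ck k (\<lambda>x. c)"
proof (induction k arbitrary: c)
  case (Suc k)
  show ?case by (rule Ck_SucI[where g' = "\<lambda>x y. 0"]) (use Suc in auto)
qed auto

lemma Ck_add: "Ck k f \<Longrightarrow> Ck k g \<Longrightarrow> Ck k (\<lambda>x. f x + g x)"
proof (induction k arbitrary: f g)
  case 0
  then show ?case by (auto intro: continuous_intros)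
next
  case (Suc k)
  note d = Ck_Suc_has_derivative[OF Suc.prems(1)] Ck_Suc_has_derivative[OF Suc.prems(2)]
  show ?case
    by (rule Ck_SucI[OF has_derivative_add[OF d]]) (use Suc in auto)
qed

lemma Ck_mult: "Ck k f \<Longrightarrow> Ck k g \<Longrightarrow> Ck k (\<lambda>x. f x * g x)"
proof (induction k arbitrary: f g)
  case 0
  then show ?case by (auto intro: continuous_intros)
next
  case (Suc k)
  note d = Ck_Suc_has_derivative[OF Suc.prems(1)] Ck_Suc_has_derivative[OF Suc.prems(2)]
  have e: "Ck k (\<lambda>x. frechet_derivative f (at x) b)" "Ck k (\<lambda>x. frechet_derivative g (at x) b)"
    if "b \<in> Basis" for b using Suc.prems that by auto
  show ?case
    by (rule Ck_SucI[OF has_derivative_mult[OF d]])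
       (intro Ck_add Suc.IH Ck_Suc_D[OF Suc.prems(1)] Ck_Suc_D[OF Suc.prems(2)] e; assumption)
qed

lemma Ck_minus: "Ck k f \<Longrightarrow> Ck k (\<lambda>x. - f x)"
  using Ck_mult[OF Ck_const[of k "-1"]] by simp

lemma Ck_diff: "Ck k f \<Longrightarrow> Ck k g \<Longrightarrow> Ck k (\<lambda>x. f x - g x)"
  using Ck_add[OF _ Ck_minus, of k f g] by simp

lemma Ck_linear:
  assumes "bounded_linear f"
  shows "Ck k f"
proof (cases k)
  case 0
  then show ?thesis using assms by (simp add: linear_continuous_on)
next
  case (Suc j)
  show ?thesis unfolding Suc
    by (rule Ck_SucI[OF bounded_linear.has_derivative[OF assms has_derivative_ident]]) (rule Ck_const)
qed

lemma Ck_sum: "(\<And>i. i \<in> A \<Longrightarrow> Ck k (f i)) \<Longrightarrow> Ck k (\<lambda>x. \<Sum>i\<in>A. f i x)"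
  by (induction A rule: infinite_finite_induct) (auto intro: Ck_add Ck_const simp: Ck_const)

lemma Ck_prod: "(\<And>i. i \<in> A \<Longrightarrow> Ck k (f i)) \<Longrightarrow> Ck k (\<lambda>x. \<Prod>i\<in>A. f i x)"
  by (induction A rule: infinite_finite_induct) (auto intro: Ck_mult Ck_const simp: Ck_const)

text \<open>Radial cut-offs are built from the squared norm, a polynomial in the coordinates,
  because the norm itself is not differentiable at the centre.\<close>

lemma Ck_norm_sq: "Ck k (\<lambda>x::'a::euclidean_space. (norm (x - a))\<^sup>2)"
proof -
  have "Ck k (\<lambda>x::'a. \<Sum>b\<in>Basis. (x \<bullet> b - a \<bullet> b) * (x \<bullet> b - a \<bullet> b))"
    by (intro Ck_sum Ck_mult Ck_diff Ck_linear bounded_linear_inner_left Ck_const)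
  moreover have "(\<Sum>b\<in>Basis. (x \<bullet> b - a \<bullet> b) * (x \<bullet> b - a \<bullet> b)) = (norm (x - a))\<^sup>2" for x
    by (subst power2_norm_eq_inner, subst euclidean_inner) (simp only: inner_diff_left)
  ultimately show ?thesis by simp
qed

text \<open>The outer function comes as a sequence \<open>H\<close> in which every term is the
  derivative of its predecessor. The chain rule then only raises the index, and the induction on
  \<open>k\<close> closes for all indices at once. The set \<open>S\<close> admits outer functions
  that are smooth on a half line only, such as the reciprocal and the square root.\<close>

lemma Ck_compose:
  fixes H :: "nat \<Rightarrow> real \<Rightarrow> real" and g :: "'a::euclidean_space \<Rightarrow> real"
  assumes H: "\<And>j s. s \<in> S \<Longrightarrow> (H j has_real_derivative H (Suc j) s) (at s)"
    and g: "Ck k g" "\<And>x. g x \<in> S"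
  shows "Ck k (\<lambda>x. H j (g x))"
  using g(1)
proof (induction k arbitrary: j)
  case 0
  have "continuous_on S (H j)"
    using H by (meson DERIV_isCont continuous_at_imp_continuous_on)
  then show ?case
    using 0 g(2) by (auto intro!: continuous_on_compose2[of S "H j" UNIV g])
next
  case (Suc k)
  have d: "((\<lambda>x. H j (g x)) has_derivative (\<lambda>y. frechet_derivative g (at x) y * H (Suc j) (g x))) (at x)" for x
    using has_derivative_compose[OF Ck_Suc_has_derivative[OF Suc.prems, of x]
        H[OF g(2)[of x], of j, unfolded has_field_derivative_def]]
    by (simp add: mult.commute)
  show ?case
    by (rule Ck_SucI[OF d], intro Ck_mult Suc.IH Ck_Suc_D[OF Suc.prems]) (use Suc.prems in auto)
qed

lemma frechet_derivative_mult_real: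
  assumes "(f has_derivative f') (at x)" "(g has_derivative g') (at x)"
  shows "frechet_derivative (\<lambda>x. f x * g x :: real) (at x) = (\<lambda>h. f x * g' h + f' h * g x)"
  using frechet_derivative_at[OF has_derivative_mult[OF assms]] by simp

text \<open>The derivatives of \<open>exp (- 1 / t)\<close> are polynomials in \<open>1 / t\<close> times \<open>exp (- 1 / t)\<close>.\<close>

definition flat :: "real poly \<Rightarrow> real \<Rightarrow> real" where
  "flat p t = (if t > 0 then poly p (1 / t) * exp (- (1 / t)) else 0)"

primrec flat_poly :: "nat \<Rightarrow> real poly" where
  "flat_poly 0 = 1"
| "flat_poly (Suc k) = [:0, 0, 1:] * (flat_poly k - pderiv (flat_poly k))"

lemma poly_times_exp_tendsto_0: "((\<lambda>s::real. poly p s * exp (- s)) \<longlongrightarrow> 0) at_top"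
proof -
  have "((\<lambda>s::real. s ^ i * exp (- s)) \<longlongrightarrow> 0) at_top" for i
    using tendsto_power_div_exp_0[of i] by (simp add: exp_minus divide_inverse)
  then have "((\<lambda>s::real. \<Sum>i\<le>degree p. coeff p i * (s ^ i * exp (- s))) \<longlongrightarrow> (\<Sum>i\<le>degree p. coeff p i * 0)) at_top"
    by (intro tendsto_intros)
  then show ?thesis
    by (simp add: poly_altdef sum_distrib_right mult.assoc)
qed

lemma flat_tendsto_0: "((\<lambda>t. poly p (1 / t) * exp (- (1 / t))) \<longlongrightarrow> 0) (at_right (0::real))"
proof -
  have "filterlim (\<lambda>t::real. 1 / t) at_top (at_right 0)"
    using filterlim_inverse_at_top_right by (simp add: inverse_eq_divide)
  from filterlim_compose[OF poly_times_exp_tendsto_0 this] show ?thesis .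
qed

text \<open>For positive \<open>t\<close> the chain rule contributes \<open>1 / t\<^sup>2\<close>,
  which is the polynomial \<open>[:0, 0, 1:]\<close> in \<open>1 / t\<close>. At 0 the difference
  quotient is the expression defining \<open>flat (pCons 0 p)\<close> on the right and 0 on the
  left, so \<open>flat_tendsto_0\<close> applies to it as well.\<close>

lemma flat_has_derivative:
  "(flat p has_real_derivative flat ([:0, 0, 1:] * (p - pderiv p)) t) (at t)"
proof (cases t "0::real" rule: linorder_cases)
  case less
  have "((\<lambda>t. 0) has_real_derivative 0) (at t)" by simp
  then have "(flat p has_real_derivative 0) (at t)"
    by (rule has_field_derivative_transform_within_open[where S = "{..<0}"]) (use less in \<open>auto simp: flat_def\<close>)
  then show ?thesis using less by (simp add: flat_def)
next
  case greater
  have "((\<lambda>t. poly p (1 / t) * exp (- (1 / t))) has_real_derivative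
     poly ([:0, 0, 1:] * (p - pderiv p)) (1 / t) * exp (- (1 / t))) (at t)"
  proof -
    have 1: "((\<lambda>t. 1 / t) has_real_derivative - (1 / t\<^sup>2)) (at t)"
      using greater by (auto intro!: derivative_eq_intros simp: power2_eq_square)
    have 2: "((\<lambda>t. poly p (1 / t)) has_real_derivative poly (pderiv p) (1 / t) * (- (1 / t\<^sup>2))) (at t)"
      by (rule DERIV_chain2[OF poly_DERIV 1])
    have 3: "((\<lambda>t. exp (- (1 / t))) has_real_derivative exp (- (1 / t)) * - (- (1 / t\<^sup>2))) (at t)"
      by (rule DERIV_chain2[OF DERIV_exp DERIV_minus[OF 1]])
    have e: "poly ([:0, 0, 1:] * (p - pderiv p)) (1 / t) = (1 / t\<^sup>2) * (poly p (1 / t) - poly (pderiv p) (1 / t))"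
      by (simp add: power2_eq_square)
    from DERIV_mult[OF 2 3] show ?thesis
      unfolding e by (rule DERIV_cong) (simp add: algebra_simps)
  qed
  then have "(flat p has_real_derivative poly ([:0, 0, 1:] * (p - pderiv p)) (1 / t) * exp (- (1 / t))) (at t)"
    by (rule has_field_derivative_transform_within_open[where S = "{0<..}"]) (use greater in \<open>auto simp: flat_def\<close>)
  then show ?thesis using greater by (simp add: flat_def)
next
  case equal
  have *: "((\<lambda>y. flat p y / y) \<longlongrightarrow> 0) (at_right 0)"
  proof (rule Lim_transform_eventually[OF flat_tendsto_0[of "pCons 0 p"]])
    show "\<forall>\<^sub>F x in at_right 0. poly (pCons 0 p) (1 / x) * exp (- (1 / x)) = flat p x / x"
      by (auto simp: eventually_at_filter flat_def)
  qed
  have **: "((\<lambda>y. flat p y / y) \<longlongrightarrow> 0) (at_left 0)"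
    by (rule Lim_transform_eventually[OF tendsto_const]) (auto simp: eventually_at_filter flat_def)
  have "((\<lambda>y. flat p y / y) \<longlongrightarrow> 0) (at 0)"
    using * ** by (simp add: filterlim_at_split)
  then show ?thesis
    unfolding equal by (simp add: has_field_derivative_iff flat_def)
qed

lemma Ck_flat: "Ck k g \<Longrightarrow> Ck k (\<lambda>x. flat 1 (g x))"
  using Ck_compose[where S = UNIV and H = "\<lambda>j. flat (flat_poly j)" and j = 0, of k g] flat_has_derivative
  unfolding flat_poly.simps by blast

lemma flat_pos: "t > 0 \<Longrightarrow> flat 1 t > 0" and flat_0: "t \<le> 0 \<Longrightarrow> flat 1 t = 0" and flat_nonneg: "flat 1 t \<ge> 0"
  by (auto simp: flat_def)

text \<open>The usual smooth transition, equal to 0 up to 1 and to 1 from 2 on. The denominator is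
  positive because \<open>t - 1\<close> and \<open>2 - t\<close> cannot both be nonpositive.\<close>

definition step :: "real \<Rightarrow> real" where
  "step t = flat 1 (t - 1) / (flat 1 (t - 1) + flat 1 (2 - t))"

lemma step_denom: "flat 1 (t - 1) + flat 1 (2 - t) > 0"
  using flat_pos[of "t - 1"] flat_pos[of "2 - t"] flat_nonneg[of "t - 1"] flat_nonneg[of "2 - t"]
  by (cases "t > 1") auto

lemma step_0: "t \<le> 1 \<Longrightarrow> step t = 0" and step_1: "t \<ge> 2 \<Longrightarrow> step t = 1"
  using flat_pos[of "t - 1"] by (auto simp: step_def flat_0)

lemma step_nonneg: "0 \<le> step t" and step_le_1: "step t \<le> 1"
  using step_denom[of t] flat_nonneg[of "t - 1"] flat_nonneg[of "2 - t"] by (auto simp: step_def divide_simps)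

lemma Ck_inverse:
  assumes "Ck k g" "\<And>x. g x > 0"
  shows "Ck k (\<lambda>x. 1 / g x)"
proof -
  let ?H = "\<lambda>j s::real. (- 1) ^ j * fact j / s ^ Suc j"
  have "(?H j has_real_derivative ?H (Suc j) s) (at s)" if "s \<in> {0<..}" for j s
    using that
  proof -
    have "((\<lambda>s. (- 1) ^ j * fact j * inverse s ^ Suc j) has_real_derivative
        (- 1) ^ Suc j * fact (Suc j) * inverse s ^ Suc (Suc j)) (at s)"
      using that by (auto intro!: derivative_eq_intros simp del: power_Suc) (simp add: algebra_simps)
    then show ?thesis by (simp add: divide_inverse power_inverse)
  qed
  from Ck_compose[where H = ?H and j = 0 and S = "{0<..}", OF this assms(1)] assms(2) show ?thesis by simp
qed

lemma Ck_step: "Ck k g \<Longrightarrow> Ck k (\<lambda>x. step (g x))"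
proof -
  assume g: "Ck k g"
  have "Ck k (\<lambda>x. flat 1 (g x - 1) * (1 / (flat 1 (g x - 1) + flat 1 (2 - g x))))"
    by (intro Ck_mult Ck_inverse Ck_add Ck_flat Ck_diff Ck_const g step_denom)
  then show ?thesis by (simp add: step_def)
qed

section \<open>Derivatives on the real line and of the step function\<close>

lemma Basis_real_derivative:
  fixes g :: "real \<Rightarrow> real"
  assumes "(g has_derivative g') (at x)"
  shows "(g has_real_derivative g' 1) (at x)"
proof (rule has_derivative_imp_has_field_derivative[OF assms])
  from linear_cmul[OF has_derivative_linear[OF assms], of _ 1] show "y * g' 1 = g' y" for y
    unfolding real_scaleR_def mult_1_right by (rule sym)
qed

lemma Ck_Suc_DERIV:
  fixes g :: "real \<Rightarrow> real"
  assumes "Ck (Suc k) g"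
  shows "(g has_real_derivative deriv g x) (at x)" and "Ck k (deriv g)"
proof -
  have d: "(g has_real_derivative frechet_derivative g (at x) 1) (at x)" for x
    using Basis_real_derivative[OF Ck_Suc_has_derivative[OF assms]] .
  then have e: "deriv g x = frechet_derivative g (at x) 1" for x
    by (simp add: DERIV_imp_deriv)
  show "(g has_real_derivative deriv g x) (at x)" using d e by simp
  have "deriv g = (\<lambda>x. frechet_derivative g (at x) 1)" using e by auto
  then show "Ck k (deriv g)" using assms by simp
qed

lemma step_DERIV: "(step has_real_derivative deriv step x) (at x)"
  and continuous_deriv_step: "continuous_on UNIV (deriv step)"
proof -
  have s: "Ck (Suc k) step" for k
    using Ck_step[OF Ck_linear[OF bounded_linear_ident]] .
  show "(step has_real_derivative deriv step x) (at x)" by (rule Ck_Suc_DERIV[OF s])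
  show "continuous_on UNIV (deriv step)" using Ck_Suc_DERIV(2)[OF s[of 0]] by simp
qed

lemma deriv_step_0: assumes "t < 1 \<or> t > 2" shows "deriv step t = 0"
  using assms
proof
  assume "t < 1"
  have "((\<lambda>t. 0) has_real_derivative 0) (at t)" by simp
  then have "(step has_real_derivative 0) (at t)"
    by (rule has_field_derivative_transform_within_open[where S = "{..<1}"]) (use \<open>t < 1\<close> in \<open>auto simp: step_0\<close>)
  then show ?thesis by (rule DERIV_imp_deriv)
next
  assume "t > 2"
  have "((\<lambda>t. 1) has_real_derivative 0) (at t)" by simp
  then have "(step has_real_derivative 0) (at t)"
    by (rule has_field_derivative_transform_within_open[where S = "{2<..}"]) (use \<open>t > 2\<close> in \<open>auto simp: step_1\<close>)
  then show ?thesis by (rule DERIV_imp_deriv)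
qed

lemma deriv_step_bounded: obtains M where "M > 0" "\<And>t. \<bar>deriv step t\<bar> \<le> M"
proof -
  have "compact (deriv step ` {1..2})"
    using continuous_deriv_step by (intro compact_continuous_image) (auto intro: continuous_on_subset)
  then obtain M where M: "\<And>t. t \<in> {1..2} \<Longrightarrow> \<bar>deriv step t\<bar> \<le> M"
    by (force dest!: compact_imp_bounded simp: bounded_iff)
  have "\<bar>deriv step t\<bar> \<le> max M 1" for t
    using M[of t] deriv_step_0[of t] by (cases "t \<in> {1..2}") auto
  then show thesis by (intro that[of "max M 1"]) auto
qed

section \<open>The space of square integrable functions\<close>

definition ip :: "(R3 \<Rightarrow> real) \<Rightarrow> (R3 \<Rightarrow> real) \<Rightarrow> real" where
  "ip f g = (LINT x|lebesgue. f x * g x)"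

lemma L2_measurable: "f \<in> L2 \<Longrightarrow> f \<in> borel_measurable lebesgue"
  and L2_integrable_sq: "f \<in> L2 \<Longrightarrow> integrable lebesgue (\<lambda>x. (f x)\<^sup>2)"
  by (auto simp: L2_def)

lemma L2_mult:
  assumes f: "f \<in> L2" and g: "g \<in> L2"
  shows "integrable lebesgue (\<lambda>x. f x * g x)"
proof (rule Bochner_Integration.integrable_bound)
  show "integrable lebesgue (\<lambda>x. (f x)\<^sup>2 + (g x)\<^sup>2)"
    using f g by (intro Bochner_Integration.integrable_add L2_integrable_sq)
  show "(\<lambda>x. f x * g x) \<in> borel_measurable lebesgue"
    using f g by (intro borel_measurable_times L2_measurable)
  have "\<bar>a * b\<bar> \<le> a\<^sup>2 + b\<^sup>2" for a b :: real
  proof -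
    have "2 * (\<bar>a\<bar> * \<bar>b\<bar>) \<le> \<bar>a\<bar>\<^sup>2 + \<bar>b\<bar>\<^sup>2"
      using zero_le_power2[of "\<bar>a\<bar> - \<bar>b\<bar>"] by (simp only: power2_diff)
    moreover have "0 \<le> \<bar>a\<bar> * \<bar>b\<bar>" by simp
    ultimately show ?thesis unfolding abs_mult power2_abs by linarith
  qed
  then show "AE x in lebesgue. norm (f x * g x) \<le> norm ((f x)\<^sup>2 + (g x)\<^sup>2)"
    by auto
qed

lemma L2_cmult: "f \<in> L2 \<Longrightarrow> (\<lambda>x. c * f x) \<in> L2"
  by (auto simp: L2_def power_mult_distrib)

lemma L2_add:
  assumes f: "f \<in> L2" and g: "g \<in> L2"
  shows "(\<lambda>x. f x + g x) \<in> L2"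
proof -
  have "integrable lebesgue (\<lambda>x. (f x)\<^sup>2 + (g x)\<^sup>2 + 2 * (f x * g x))"
    using f g by (intro Bochner_Integration.integrable_add L2_integrable_sq integrable_mult_right L2_mult)
  then have "integrable lebesgue (\<lambda>x. (f x + g x)\<^sup>2)"
    by (simp add: power2_sum mult.assoc)
  then show ?thesis using f g by (auto simp: L2_def)
qed

lemma L2_minus: "f \<in> L2 \<Longrightarrow> (\<lambda>x. - f x) \<in> L2"
  using L2_cmult[of f "-1"] by simp

lemma L2_diff: "f \<in> L2 \<Longrightarrow> g \<in> L2 \<Longrightarrow> (\<lambda>x. f x - g x) \<in> L2"
  using L2_add[OF _ L2_minus, of f g] by simp

lemma L2_zero: "(\<lambda>x. 0) \<in> L2"
  by (simp add: L2_def)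

lemma L2_sum: "(\<And>i. i \<in> A \<Longrightarrow> f i \<in> L2) \<Longrightarrow> (\<lambda>x. \<Sum>i\<in>A. f i x) \<in> L2"
  by (induction A rule: infinite_finite_induct) (auto intro: L2_add L2_zero simp: L2_zero)

lemma L2_abs: "f \<in> L2 \<Longrightarrow> (\<lambda>x. \<bar>f x\<bar>) \<in> L2"
  by (auto simp: L2_def)

lemma L2_bound:
  assumes g: "g \<in> L2" and f: "f \<in> borel_measurable lebesgue" and b: "AE x in lebesgue. \<bar>f x\<bar> \<le> \<bar>g x\<bar>"
  shows "f \<in> L2"
proof -
  have "integrable lebesgue (\<lambda>x. (f x)\<^sup>2)"
    by (rule Bochner_Integration.integrable_bound[OF L2_integrable_sq[OF g]])
       (use b f in \<open>auto simp: abs_le_square_iff\<close>)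
  then show ?thesis using f by (simp add: L2_def)
qed

lemma L2_AE_cong:
  assumes "f \<in> L2" "AE x in lebesgue. f x = g x"
  shows "g \<in> L2"
proof (rule L2_bound[OF assms(1) borel_measurable_AE[OF L2_measurable[OF assms(1)] assms(2)]])
  show "AE x in lebesgue. \<bar>g x\<bar> \<le> \<bar>f x\<bar>"
    using assms(2) by eventually_elim simp
qed

lemma ip_commute: "ip f g = ip g f"
  by (simp add: ip_def mult.commute)

lemma ip_add_left: "f \<in> L2 \<Longrightarrow> g \<in> L2 \<Longrightarrow> h \<in> L2 \<Longrightarrow> ip (\<lambda>x. f x + g x) h = ip f h + ip g h"
  unfolding ip_def by (subst Bochner_Integration.integral_add[symmetric]) (auto intro: L2_mult simp: algebra_simps)

lemma ip_cmult_left: "ip (\<lambda>x. c * f x) h = c * ip f h"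
  unfolding ip_def by (simp add: mult.assoc)

lemma ip_diff_left: "f \<in> L2 \<Longrightarrow> g \<in> L2 \<Longrightarrow> h \<in> L2 \<Longrightarrow> ip (\<lambda>x. f x - g x) h = ip f h - ip g h"
  unfolding ip_def by (subst Bochner_Integration.integral_diff[symmetric]) (auto intro: L2_mult simp: algebra_simps)

lemma ip_sum_left:
  "(\<And>i. i \<in> A \<Longrightarrow> f i \<in> L2) \<Longrightarrow> h \<in> L2 \<Longrightarrow> ip (\<lambda>x. \<Sum>i\<in>A. f i x) h = (\<Sum>i\<in>A. ip (f i) h)"
  unfolding ip_def sum_distrib_right
  by (intro Bochner_Integration.integral_sum L2_mult)

lemma ip_add_right: "f \<in> L2 \<Longrightarrow> g \<in> L2 \<Longrightarrow> h \<in> L2 \<Longrightarrow> ip h (\<lambda>x. f x + g x) = ip h f + ip h g"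
  by (subst ip_commute, subst ip_add_left) (auto simp: ip_commute)

lemma ip_cmult_right: "ip h (\<lambda>x. c * f x) = c * ip h f"
  by (subst ip_commute, subst ip_cmult_left) (simp add: ip_commute)

lemma ip_diff_right: "f \<in> L2 \<Longrightarrow> g \<in> L2 \<Longrightarrow> h \<in> L2 \<Longrightarrow> ip h (\<lambda>x. f x - g x) = ip h f - ip h g"
  by (subst ip_commute, subst ip_diff_left) (auto simp: ip_commute)

lemma ip_cong_AE:
  assumes "f \<in> L2" "g \<in> L2" "AE x in lebesgue. f x = f' x" "AE x in lebesgue. g x = g' x"
  shows "ip f g = ip f' g'"
  unfolding ip_def
  using assms L2_measurable[OF L2_AE_cong[OF assms(1,3)]] L2_measurable[OF L2_AE_cong[OF assms(2,4)]]
  by (intro integral_cong_AE) (auto intro!: borel_measurable_times intro: L2_measurable)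

lemma ip_self: "ip f f = (L2_norm f)\<^sup>2" and ip_self_nonneg: "0 \<le> ip f f"
  by (auto simp: ip_def L2_norm_def power2_eq_square real_sqrt_mult_self)

lemma L2_norm_ip: "L2_norm f = sqrt (ip f f)"
  by (simp add: ip_def L2_norm_def power2_eq_square)

lemma L2_norm_nonneg: "0 \<le> L2_norm f"
  by (simp add: L2_norm_ip ip_self_nonneg)

text \<open>The discriminant criterion, shared by the Cauchy-Schwarz inequalities for
  \<open>ip\<close> and \<open>vip\<close>. For \<open>c = 0\<close> and \<open>b \<noteq> 0\<close>
  the affine function takes the value -1 at \<open>- (a + 1) / (2 * b)\<close>; otherwise the
  minimum, at \<open>- b / c\<close>, is inspected.\<close>

lemma quadratic_nonneg_imp:
  fixes a b c :: real
  assumes "\<And>t. 0 \<le> a + 2 * t * b + t\<^sup>2 * c" "0 \<le> a" "0 \<le> c"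
  shows "b\<^sup>2 \<le> a * c"
proof (cases "c = 0")
  case True
  have "b = 0"
  proof (rule ccontr)
    assume "b \<noteq> 0"
    with assms(1)[of "- (a + 1) / (2 * b)"] True show False by (simp add: field_simps)
  qed
  then show ?thesis using True by simp
next
  case False
  then have c: "c > 0" using assms by simp
  from assms(1)[of "- b / c"] c have "0 \<le> a - b\<^sup>2 / c"
    by (simp add: field_simps power2_eq_square)
  then show ?thesis using c by (simp add: field_simps)
qed

lemma ip_Cauchy_Schwarz:
  assumes "f \<in> L2" "g \<in> L2"
  shows "\<bar>ip f g\<bar> \<le> L2_norm f * L2_norm g"
proof -
  have "0 \<le> ip f f + 2 * t * ip f g + t\<^sup>2 * ip g g" for t
  proof -
    have "ip (\<lambda>x. f x + t * g x) (\<lambda>x. f x + t * g x) = ip f f + 2 * t * ip f g + t\<^sup>2 * ip g g"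
      using assms
      by (simp add: ip_add_left ip_add_right L2_add L2_cmult ip_cmult_left ip_cmult_right ip_commute[of g f]
          power2_eq_square algebra_simps)
    then show ?thesis using ip_self_nonneg by metis
  qed
  then have "(ip f g)\<^sup>2 \<le> ip f f * ip g g"
    by (intro quadratic_nonneg_imp ip_self_nonneg)
  then have "sqrt ((ip f g)\<^sup>2) \<le> sqrt (ip f f * ip g g)" by (rule real_sqrt_le_mono)
  then show ?thesis by (simp add: L2_norm_ip real_sqrt_mult)
qed

lemma L2_norm_cmult: "L2_norm (\<lambda>x. c * f x) = \<bar>c\<bar> * L2_norm f"
  by (simp add: L2_norm_ip ip_cmult_left ip_cmult_right real_sqrt_mult mult.assoc[symmetric])

lemma L2_norm_minus_commute: "L2_norm (\<lambda>x. f x - g x) = L2_norm (\<lambda>x. g x - f x)"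
  by (simp add: L2_norm_def power2_commute)

lemma L2_norm_triangle:
  assumes "f \<in> L2" "g \<in> L2"
  shows "L2_norm (\<lambda>x. f x + g x) \<le> L2_norm f + L2_norm g"
proof (rule power2_le_imp_le)
  have "(L2_norm (\<lambda>x. f x + g x))\<^sup>2 = (L2_norm f)\<^sup>2 + 2 * ip f g + (L2_norm g)\<^sup>2"
    using assms unfolding ip_self[symmetric]
    by (simp add: ip_add_left ip_add_right L2_add ip_commute[of g f])
  also have "\<dots> \<le> (L2_norm f + L2_norm g)\<^sup>2"
    using ip_Cauchy_Schwarz[OF assms] by (simp add: power2_sum)
  finally show "(L2_norm (\<lambda>x. f x + g x))\<^sup>2 \<le> (L2_norm f + L2_norm g)\<^sup>2" .
qed (simp add: L2_norm_nonneg)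

lemma L2_norm_triangle_diff:
  assumes "f \<in> L2" "g \<in> L2" "h \<in> L2"
  shows "L2_norm (\<lambda>x. f x - h x) \<le> L2_norm (\<lambda>x. f x - g x) + L2_norm (\<lambda>x. g x - h x)"
  using L2_norm_triangle[OF L2_diff[OF assms(1,2)] L2_diff[OF assms(2,3)]] by simp

lemma nn_integral_L2:
  assumes "f \<in> L2"
  shows "(\<integral>\<^sup>+x. ennreal ((f x)\<^sup>2) \<partial>lebesgue) = ennreal ((L2_norm f)\<^sup>2)"
  using nn_integral_eq_integral[OF L2_integrable_sq[OF assms]] by (simp add: L2_norm_def)

lemma L2_I:
  assumes "f \<in> borel_measurable lebesgue" "(\<integral>\<^sup>+x. ennreal ((f x)\<^sup>2) \<partial>lebesgue) \<le> ennreal c" "0 \<le> c"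
  shows "f \<in> L2" "L2_norm f \<le> sqrt c"
proof -
  have "integrable lebesgue (\<lambda>x. (f x)\<^sup>2)"
    using assms by (auto intro!: integrableI_bounded simp: le_less_trans[OF _ ennreal_less_top])
  then show f: "f \<in> L2" using assms by (simp add: L2_def)
  show "L2_norm f \<le> sqrt c"
    using assms(2,3) unfolding nn_integral_L2[OF f] by (simp add: real_le_rsqrt)
qed

lemma L2_norm_zero_AE:
  assumes "f \<in> L2" "L2_norm f = 0"
  shows "AE x in lebesgue. f x = 0"
proof -
  have "(\<integral>\<^sup>+x. ennreal ((f x)\<^sup>2) \<partial>lebesgue) = 0"
    using nn_integral_L2[OF assms(1)] assms(2) by simp
  then show ?thesis
    using L2_measurable[OF assms(1)] by (subst (asm) nn_integral_0_iff_AE) auto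
qed

lemma L2_dominated:
  assumes F: "\<And>i. F i \<in> borel_measurable lebesgue" and h: "h \<in> L2" and f: "f \<in> borel_measurable lebesgue"
    and b: "\<And>i. AE x in lebesgue. \<bar>F i x\<bar> \<le> \<bar>h x\<bar>"
    and lim: "AE x in lebesgue. (\<lambda>i. F i x) \<longlonglongrightarrow> f x"
  shows "\<And>i. F i \<in> L2" "f \<in> L2" "(\<lambda>i. L2_norm (\<lambda>x. f x - F i x)) \<longlonglongrightarrow> 0"
proof -
  show FL: "F i \<in> L2" for i by (rule L2_bound[OF h F b])
  have "AE x in lebesgue. \<forall>i. \<bar>F i x\<bar> \<le> \<bar>h x\<bar>"
    using b by (simp add: AE_all_countable)
  then have fb: "AE x in lebesgue. \<bar>f x\<bar> \<le> \<bar>h x\<bar>"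
    using lim
  proof eventually_elim
    case (elim x)
    then show ?case
      by (intro LIMSEQ_le_const2[OF tendsto_rabs]) auto
  qed
  show fL: "f \<in> L2" by (rule L2_bound[OF h f fb])
  have "(\<lambda>i. LINT x|lebesgue. (f x - F i x)\<^sup>2) \<longlonglongrightarrow> (LINT x|(lebesgue::R3 measure). 0)"
  proof (rule integral_dominated_convergence)
    show "integrable lebesgue (\<lambda>x. 4 * (h x)\<^sup>2)" using L2_integrable_sq[OF h] by simp
    show "AE x in lebesgue. norm ((f x - F i x)\<^sup>2) \<le> 4 * (h x)\<^sup>2" for i
      using fb b[of i]
    proof eventually_elim
      case (elim x)
      then have "\<bar>f x - F i x\<bar> \<le> \<bar>2 * h x\<bar>" by linarith
      then have "(f x - F i x)\<^sup>2 \<le> (2 * h x)\<^sup>2" by (simp add: abs_le_square_iff)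
      then show ?case by (simp add: power_mult_distrib)
    qed
    show "AE x in lebesgue. (\<lambda>i. (f x - F i x)\<^sup>2) \<longlonglongrightarrow> 0"
      using lim by eventually_elim (auto intro!: tendsto_eq_intros)
  qed (use F f in auto)
  then show "(\<lambda>i. L2_norm (\<lambda>x. f x - F i x)) \<longlonglongrightarrow> 0"
    unfolding L2_norm_def using tendsto_real_sqrt by fastforce
qed

text \<open>Riesz-Fischer for functions rather than classes. A subsequence with increments of norm
  below \<open>(1/2) ^ k\<close> has a square integrable sum of absolute increments, hence converges
  almost everywhere. The limit function is then compared with the whole sequence.\<close>

theorem L2_complete:
  assumes g: "\<And>n. g n \<in> L2"
    and C: "\<And>e. e > 0 \<Longrightarrow> \<exists>N. \<forall>m\<ge>N. \<forall>n\<ge>N. L2_norm (\<lambda>x. g m x - g n x) < e"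
  obtains h where "h \<in> L2" "(\<lambda>n. L2_norm (\<lambda>x. g n x - h x)) \<longlonglongrightarrow> 0"
proof -
  have "\<exists>N. \<forall>m\<ge>N. \<forall>n\<ge>N. L2_norm (\<lambda>x. g m x - g n x) < (1/2) ^ k" for k
    using C[of "(1/2)^k"] by simp
  then obtain N where N: "\<And>k m n. m \<ge> N k \<Longrightarrow> n \<ge> N k \<Longrightarrow> L2_norm (\<lambda>x. g m x - g n x) < (1/2) ^ k"
    by metis
  \<comment> \<open>Summing the thresholds makes \<open>r m\<close> at least \<open>N k\<close> for
    every \<open>k \<le> m\<close>, without a monotone choice of \<open>N\<close>.\<close>
  define r where "r k = (\<Sum>j\<le>k. N j)" for k
  have rN: "r m \<ge> N k" if "k \<le> m" for k m
    unfolding r_def by (rule member_le_sum) (use that in auto)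
  define d where "d k x = \<bar>g (r (Suc k)) x - g (r k) x\<bar>" for k x
  have dL: "d k \<in> L2" for k unfolding d_def by (intro L2_abs L2_diff g)
  have dn: "L2_norm (d k) \<le> (1/2)^k" for k
    using N[OF rN[of k "Suc k"] rN[of k k]] by (simp add: L2_norm_def d_def)
  have SL: "(\<lambda>x. \<Sum>k<K. d k x) \<in> L2" for K by (intro L2_sum dL)
  have Sn: "L2_norm (\<lambda>x. \<Sum>k<K. d k x) \<le> 2" for K
  proof -
    have "L2_norm (\<lambda>x. \<Sum>k<K. d k x) \<le> (\<Sum>k<K. (1/2)^k)"
    proof (induction K)
      case (Suc K)
      then show ?case using L2_norm_triangle[OF SL dL[of K], of K] dn[of K] by simp
    qed (simp add: L2_norm_def)
    also have "\<dots> \<le> (\<Sum>k. (1/2::real)^k)" by (rule sum_le_suminf) auto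
    finally show ?thesis by (simp add: suminf_geometric)
  qed
  have "AE x in lebesgue. (SUP K. ennreal ((\<Sum>k<K. d k x)\<^sup>2)) \<noteq> \<infinity>"
  proof (rule nn_integral_PInf_AE)
    show "(\<lambda>x. SUP K. ennreal ((\<Sum>k<K. d k x)\<^sup>2)) \<in> borel_measurable lebesgue"
      using L2_measurable[OF dL] by measurable
    have "(\<integral>\<^sup>+x. (SUP K. ennreal ((\<Sum>k<K. d k x)\<^sup>2)) \<partial>lebesgue) = (SUP K. \<integral>\<^sup>+x. ennreal ((\<Sum>k<K. d k x)\<^sup>2) \<partial>lebesgue)"
    proof (rule nn_integral_monotone_convergence_SUP)
      show "incseq (\<lambda>K x. ennreal ((\<Sum>k<K. d k x)\<^sup>2))"
        by (auto simp: incseq_def le_fun_def d_def intro!: ennreal_leI power_mono sum_mono2 sum_nonneg)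
      show "(\<lambda>x. ennreal ((\<Sum>k<K. d k x)\<^sup>2)) \<in> borel_measurable lebesgue" for K
        using L2_measurable[OF SL[of K]] by measurable
    qed
    also have "\<dots> \<le> ennreal 4"
    proof (rule SUP_least)
      fix K
      have "(L2_norm (\<lambda>x. \<Sum>k<K. d k x))\<^sup>2 \<le> 2\<^sup>2" by (rule power_mono[OF Sn L2_norm_nonneg])
      then show "(\<integral>\<^sup>+x. ennreal ((\<Sum>k<K. d k x)\<^sup>2) \<partial>lebesgue) \<le> ennreal 4"
        unfolding nn_integral_L2[OF SL] by (intro ennreal_leI) simp
    qed
    finally show "(\<integral>\<^sup>+x. (SUP K. ennreal ((\<Sum>k<K. d k x)\<^sup>2)) \<partial>lebesgue) \<noteq> \<infinity>"
      by (auto simp: top_unique)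
  qed
  then have conv: "AE x in lebesgue. (\<lambda>k. g (r k) x) \<longlonglongrightarrow> lim (\<lambda>k. g (r k) x)"
  proof eventually_elim
    case (elim x)
    then obtain c where c: "0 \<le> c" "(SUP K. ennreal ((\<Sum>k<K. d k x)\<^sup>2)) = ennreal c"
      by (cases "SUP K. ennreal ((\<Sum>k<K. d k x)\<^sup>2)") auto
    have dnn: "0 \<le> d k x" for k by (simp add: d_def)
    have "(\<Sum>k<K. d k x) \<le> sqrt c" for K
    proof -
      have "ennreal ((\<Sum>k<K. d k x)\<^sup>2) \<le> ennreal c" unfolding c(2)[symmetric] by (rule SUP_upper) simp
      then show ?thesis using c(1) by (simp add: real_le_rsqrt)
    qed
    then have "(\<Sum>k\<le>n. d k x) \<le> sqrt c" for n
      unfolding lessThan_Suc_atMost[symmetric] .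
    then have "summable (\<lambda>k. d k x)"
      by (rule bounded_imp_summable[of _ "sqrt c", OF dnn])
    then have "summable (\<lambda>k. g (r (Suc k)) x - g (r k) x)"
      unfolding d_def by (rule summable_rabs_cancel)
    then have "convergent (\<lambda>K. \<Sum>k<K. g (r (Suc k)) x - g (r k) x)"
      by (simp add: summable_iff_convergent)
    moreover have "(\<Sum>k<K. g (r (Suc k)) x - g (r k) x) = g (r K) x - g (r 0) x" for K
      by (rule sum_lessThan_telescope)
    ultimately have "convergent (\<lambda>K. g (r K) x - g (r 0) x)"
      by simp
    then have "convergent (\<lambda>K. (g (r K) x - g (r 0) x) + g (r 0) x)"
      by (intro convergent_add convergent_const)
    then show ?case by (simp add: convergent_LIMSEQ_iff)
  qed
  define h where "h x = lim (\<lambda>k. g (r k) x)" for x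
  have hm: "h \<in> borel_measurable lebesgue"
    unfolding h_def by (rule borel_measurable_lim_metric) (rule L2_measurable[OF g])
  \<comment> \<open>Fatou's lemma along the subsequence turns the bound on
    \<open>g (r m) - g n\<close> into the same bound on \<open>h - g n\<close>. It also gives
    membership in \<open>L2\<close>, from which \<open>h \<in> L2\<close> follows by adding one
    \<open>g n\<close>.\<close>
  have main: "(\<lambda>x. h x - g n x) \<in> L2 \<and> L2_norm (\<lambda>x. h x - g n x) \<le> (1/2)^k" if "n \<ge> N k" for n k
  proof -
    have "(\<integral>\<^sup>+x. ennreal ((h x - g n x)\<^sup>2) \<partial>lebesgue) = (\<integral>\<^sup>+x. liminf (\<lambda>m. ennreal ((g (r m) x - g n x)\<^sup>2)) \<partial>lebesgue)"
    proof (rule nn_integral_cong_AE, use conv in eventually_elim)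
      fix x assume "(\<lambda>k. g (r k) x) \<longlonglongrightarrow> lim (\<lambda>k. g (r k) x)"
      then have "(\<lambda>m. ennreal ((g (r m) x - g n x)\<^sup>2)) \<longlonglongrightarrow> ennreal ((h x - g n x)\<^sup>2)"
        unfolding h_def by (intro tendsto_intros)
      then show "ennreal ((h x - g n x)\<^sup>2) = liminf (\<lambda>m. ennreal ((g (r m) x - g n x)\<^sup>2))"
        using lim_imp_Liminf[of sequentially] by fastforce
    qed
    also have "\<dots> \<le> liminf (\<lambda>m. \<integral>\<^sup>+x. ennreal ((g (r m) x - g n x)\<^sup>2) \<partial>lebesgue)"
      by (intro nn_integral_liminf) (use L2_measurable[OF g] in measurable)
    also have "\<dots> \<le> liminf (\<lambda>m. ennreal (((1/2)^k)\<^sup>2))"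
    proof (rule Liminf_mono, rule eventually_sequentiallyI[of k])
      fix m assume "k \<le> m"
      have "(L2_norm (\<lambda>x. g (r m) x - g n x))\<^sup>2 \<le> ((1/2)^k)\<^sup>2"
        using N[OF rN[OF \<open>k \<le> m\<close>] that] by (intro power_mono L2_norm_nonneg) simp
      then show "(\<integral>\<^sup>+x. ennreal ((g (r m) x - g n x)\<^sup>2) \<partial>lebesgue) \<le> ennreal (((1/2)^k)\<^sup>2)"
        unfolding nn_integral_L2[OF L2_diff[OF g g]] by (rule ennreal_leI)
    qed
    also have "\<dots> = ennreal (((1/2)^k)\<^sup>2)" by (simp add: Liminf_const)
    finally have *: "(\<integral>\<^sup>+x. ennreal ((h x - g n x)\<^sup>2) \<partial>lebesgue) \<le> ennreal (((1/2)^k)\<^sup>2)" .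
    have hg: "(\<lambda>x. h x - g n x) \<in> borel_measurable lebesgue" using hm L2_measurable[OF g] by measurable
    from L2_I[OF hg *] show ?thesis by simp
  qed
  have "(\<lambda>x. (h x - g (N 0) x) + g (N 0) x) \<in> L2" by (intro L2_add g) (use main[of 0] in auto)
  then have "h \<in> L2" by simp
  moreover have "(\<lambda>n. L2_norm (\<lambda>x. g n x - h x)) \<longlonglongrightarrow> 0"
  proof (rule LIMSEQ_I)
    fix e :: real assume "e > 0"
    then obtain k where "(1/2::real)^k < e" using real_arch_pow_inv[of e "1/2"] by auto
    then show "\<exists>no. \<forall>n\<ge>no. norm (L2_norm (\<lambda>x. g n x - h x) - 0) < e"
      using main[of k] L2_norm_minus_commute[of _ h] L2_norm_nonneg
      by (intro exI[of _ "N k"]) (fastforce intro: le_less_trans)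
  qed
  ultimately show thesis by (rule that)
qed

section \<open>Test functions are dense\<close>

lemma test_functionsD:
  assumes "\<phi> \<in> test_functions S"
  shows "Ck k \<phi>" "compact (closure {x. \<phi> x \<noteq> 0})" "closure {x. \<phi> x \<noteq> 0} \<subseteq> S"
  using assms by (auto simp: test_functions_def)

lemma test_functions_UNIV_I:
  assumes "\<And>k. Ck k \<phi>" "bounded {x. \<phi> x \<noteq> 0}"
  shows "\<phi> \<in> test_functions UNIV"
  using assms by (auto simp: test_functions_def compact_closure)

lemma continuous_L2:
  fixes \<phi> :: "R3 \<Rightarrow> real"
  assumes c: "continuous_on UNIV \<phi>" and b: "bounded {x. \<phi> x \<noteq> 0}"
  shows "\<phi> \<in> L2"
proof -
  obtain R where R: "\<And>x. \<phi> x \<noteq> 0 \<Longrightarrow> norm x \<le> R"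
    using b by (auto simp: bounded_iff)
  have m: "\<phi> \<in> borel_measurable borel" using c by (rule borel_measurable_continuous_onI)
  have "set_integrable lborel (cball 0 R) (\<lambda>x. (\<phi> x)\<^sup>2)"
    unfolding set_integrable_def
    by (intro borel_integrable_compact continuous_intros continuous_on_subset[OF c]) auto
  moreover have "(\<lambda>x. indicat_real (cball 0 R) x *\<^sub>R (\<phi> x)\<^sup>2) = (\<lambda>x. (\<phi> x)\<^sup>2)"
    using R by (auto simp: fun_eq_iff indicator_def)
  ultimately have "integrable lborel (\<lambda>x. (\<phi> x)\<^sup>2)" by (simp add: set_integrable_def)
  moreover have "\<phi> \<in> borel_measurable lebesgue" using m by (simp add: measurable_completion)
  ultimately show ?thesis using m by (auto simp: L2_def integrable_completion)
qed

lemma test_functions_support_bounded: "\<phi> \<in> test_functions S \<Longrightarrow> bounded {x. \<phi> x \<noteq> 0}"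
  using bounded_subset[OF compact_imp_bounded[OF test_functionsD(2)] closure_subset] .

lemma test_functions_L2: "\<phi> \<in> test_functions UNIV \<Longrightarrow> \<phi> \<in> L2"
  using test_functionsD(1)[of \<phi> UNIV 0] by (intro continuous_L2 test_functions_support_bounded) auto

text \<open>Finitely many balls cover \<open>K\<close> while their doubles stay in \<open>U\<close>.
  With one bump per ball, \<open>1 - (\<Prod>x\<in>F. 1 - b x y)\<close> is 1 as soon as one bump is
  1, is 0 where all of them vanish, and stays between 0 and 1.\<close>

lemma smooth_Urysohn:
  fixes K :: "'a::euclidean_space set"
  assumes "compact K" "open U" "K \<subseteq> U"
  obtains \<phi> where "\<phi> \<in> test_functions UNIV" "\<And>x. 0 \<le> \<phi> x \<and> \<phi> x \<le> 1"
    "\<And>x. x \<in> K \<Longrightarrow> \<phi> x = 1" "\<And>x. x \<notin> U \<Longrightarrow> \<phi> x = 0"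
proof -
  have "\<exists>r>0. ball x (2 * r) \<subseteq> U" if "x \<in> K" for x
  proof -
    obtain e where "e > 0" "ball x e \<subseteq> U" using assms \<open>x \<in> K\<close> by (meson open_contains_ball subsetD)
    then show ?thesis by (intro exI[of _ "e/2"]) auto
  qed
  then obtain r where r: "\<And>x. x \<in> K \<Longrightarrow> r x > 0" "\<And>x. x \<in> K \<Longrightarrow> ball x (2 * r x) \<subseteq> U" by metis
  obtain F where F: "F \<subseteq> K" "finite F" "K \<subseteq> (\<Union>x\<in>F. ball x (r x))"
    using compactE_image[OF assms(1), of K "\<lambda>x. ball x (r x)"] r(1)
    by (metis (no_types, lifting) UN_I centre_in_ball open_ball subsetI)
  \<comment> \<open>The argument of \<open>step\<close> is at least 2 within distance
    \<open>r x\<close> of the centre and at most 1 from distance \<open>2 * r x\<close> on.\<close>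
  define b where "b x y = step (3 - (1 / (r x)\<^sup>2) * (norm (y - x))\<^sup>2)" for x y :: 'a
  have bC: "Ck k (b x)" for x k unfolding b_def
    by (intro Ck_step Ck_diff Ck_const Ck_mult Ck_norm_sq)
  have b1: "b x y = 1" if "x \<in> F" "y \<in> ball x (r x)" for x y
  proof -
    have "norm (y - x) \<le> r x" "r x > 0" using that r(1) F(1) by (auto simp: dist_norm norm_minus_commute)
    then have "(norm (y - x))\<^sup>2 \<le> (r x)\<^sup>2" by (intro power_mono) auto
    then show ?thesis unfolding b_def using \<open>r x > 0\<close> by (intro step_1) (simp add: field_simps)
  qed
  have b0: "y \<in> ball x (2 * r x)" if "x \<in> F" "b x y \<noteq> 0" for x y
  proof (rule ccontr)
    assume "y \<notin> ball x (2 * r x)"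
    then have "2 * r x \<le> norm (y - x)" "r x > 0" using that r(1) F(1) by (auto simp: dist_norm norm_minus_commute)
    then have "(2 * r x)\<^sup>2 \<le> (norm (y - x))\<^sup>2" by (intro power_mono) auto
    then have "2 \<le> (1 / (r x)\<^sup>2) * (norm (y - x))\<^sup>2"
    proof -
      have "2 * (r x)\<^sup>2 \<le> (2 * r x)\<^sup>2" by (simp add: power_mult_distrib)
      also have "\<dots> \<le> (norm (y - x))\<^sup>2" by fact
      finally show ?thesis using \<open>r x > 0\<close> by (simp add: pos_le_divide_eq)
    qed
    then have "b x y = 0" unfolding b_def by (intro step_0) simp
    with that show False by simp
  qed
  have b01: "0 \<le> b x y \<and> b x y \<le> 1" for x y by (simp add: b_def step_nonneg step_le_1)
  define \<phi> where "\<phi> y = 1 - (\<Prod>x\<in>F. (1 - b x y))" for y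
  have nz: "\<exists>x\<in>F. y \<in> ball x (2 * r x)" if "\<phi> y \<noteq> 0" for y
  proof (rule ccontr)
    assume "\<not> ?thesis"
    then have "\<And>x. x \<in> F \<Longrightarrow> b x y = 0" using b0 by blast
    then have "\<phi> y = 0" by (simp add: \<phi>_def)
    with that show False by simp
  qed
  show thesis
  proof
    show "\<phi> \<in> test_functions UNIV"
    proof (rule test_functions_UNIV_I)
      show "Ck k \<phi>" for k unfolding \<phi>_def by (intro Ck_diff Ck_const Ck_prod bC)
      have "bounded (\<Union>x\<in>F. ball x (2 * r x))" using F(2) by (intro bounded_UN) auto
      then show "bounded {x. \<phi> x \<noteq> 0}" by (rule bounded_subset) (use nz in auto)
    qed
    show "0 \<le> \<phi> x \<and> \<phi> x \<le> 1" for x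
      unfolding \<phi>_def using b01 by (auto intro!: prod_nonneg prod_le_1)
    show "\<phi> y = 1" if "y \<in> K" for y
    proof -
      obtain x where "x \<in> F" "y \<in> ball x (r x)" using F(3) \<open>y \<in> K\<close> by blast
      then have "1 - b x y = 0" using b1 by simp
      then have "(\<Prod>x\<in>F. (1 - b x y)) = 0" using F(2) \<open>x \<in> F\<close> by (auto intro: prod_zero)
      then show ?thesis by (simp add: \<phi>_def)
    qed
    show "\<phi> x = 0" if "x \<notin> U" for x
      using nz[of x] r(2) F(1) that by blast
  qed
qed

definition test_approximable :: "(R3 \<Rightarrow> real) \<Rightarrow> bool" where
  "test_approximable f \<longleftrightarrow> (\<forall>e>0. \<exists>\<phi>\<in>test_functions UNIV. L2_norm (\<lambda>x. f x - \<phi> x) < e)"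

lemma test_functions_cmult: "\<phi> \<in> test_functions UNIV \<Longrightarrow> (\<lambda>x. c * \<phi> x) \<in> test_functions UNIV"
  by (rule test_functions_UNIV_I)
     (auto intro!: Ck_mult Ck_const dest: test_functionsD intro: bounded_subset[OF test_functions_support_bounded])

lemma test_functions_add: 
  assumes "\<phi> \<in> test_functions UNIV" "\<psi> \<in> test_functions UNIV"
  shows "(\<lambda>x. \<phi> x + \<psi> x) \<in> test_functions UNIV"
proof (rule test_functions_UNIV_I)
  show "Ck k (\<lambda>x. \<phi> x + \<psi> x)" for k by (intro Ck_add test_functionsD(1)[OF assms(1)] test_functionsD(1)[OF assms(2)])
  show "bounded {x. \<phi> x + \<psi> x \<noteq> 0}"
    by (rule bounded_subset[of "{x. \<phi> x \<noteq> 0} \<union> {x. \<psi> x \<noteq> 0}"])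
       (use assms in \<open>auto intro: test_functions_support_bounded\<close>)
qed

lemma test_approximable_add:
  assumes "test_approximable f" "test_approximable g" "f \<in> L2" "g \<in> L2"
  shows "test_approximable (\<lambda>x. f x + g x)"
  unfolding test_approximable_def
proof safe
  fix e :: real assume "e > 0"
  obtain \<phi> where p: "\<phi> \<in> test_functions UNIV" "L2_norm (\<lambda>x. f x - \<phi> x) < e/2"
    using assms(1) \<open>e > 0\<close> by (metis half_gt_zero test_approximable_def)
  obtain \<psi> where q: "\<psi> \<in> test_functions UNIV" "L2_norm (\<lambda>x. g x - \<psi> x) < e/2"
    using assms(2) \<open>e > 0\<close> by (metis half_gt_zero test_approximable_def)
  have "L2_norm (\<lambda>x. (f x - \<phi> x) + (g x - \<psi> x)) < e"
    using L2_norm_triangle[OF L2_diff[OF assms(3) test_functions_L2[OF p(1)]] L2_diff[OF assms(4) test_functions_L2[OF q(1)]]] p(2) q(2)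
    by simp
  then show "\<exists>\<phi>\<in>test_functions UNIV. L2_norm (\<lambda>x. f x + g x - \<phi> x) < e"
    by (intro bexI[OF _ test_functions_add[OF p(1) q(1)]]) (simp add: algebra_simps)
qed

lemma test_approximable_cmult:
  assumes "test_approximable f"
  shows "test_approximable (\<lambda>x. c * f x)"
  unfolding test_approximable_def
proof safe
  fix e :: real assume "e > 0"
  then have "e / (\<bar>c\<bar> + 1) > 0" by simp
  then obtain \<phi> where p: "\<phi> \<in> test_functions UNIV" "L2_norm (\<lambda>x. f x - \<phi> x) < e/(\<bar>c\<bar>+1)"
    using assms by (metis test_approximable_def)
  have "L2_norm (\<lambda>x. c * f x - c * \<phi> x) = \<bar>c\<bar> * L2_norm (\<lambda>x. f x - \<phi> x)"
    unfolding L2_norm_cmult[symmetric] by (simp add: algebra_simps)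
  also have "\<dots> \<le> (\<bar>c\<bar> + 1) * L2_norm (\<lambda>x. f x - \<phi> x)"
    by (intro mult_right_mono L2_norm_nonneg) simp
  also have "\<dots> < e" using p(2) by (simp add: field_simps pos_less_divide_eq)
  finally show "\<exists>\<phi>\<in>test_functions UNIV. L2_norm (\<lambda>x. c * f x - \<phi> x) < e"
    by (intro bexI[OF _ test_functions_cmult[OF p(1)]])
qed

lemma test_approximable_limit:
  assumes "f \<in> L2" "\<And>i. F i \<in> L2" "\<And>i. test_approximable (F i)"
    "(\<lambda>i::nat. L2_norm (\<lambda>x. f x - F i x)) \<longlonglongrightarrow> 0"
  shows "test_approximable f"
  unfolding test_approximable_def
proof safe
  fix e :: real assume "e > 0"
  then have "\<forall>\<^sub>F i in sequentially. L2_norm (\<lambda>x. f x - F i x) < e / 2"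
    using order_tendstoD(2)[OF assms(4), of "e/2"] by simp
  then obtain i where i: "L2_norm (\<lambda>x. f x - F i x) < e / 2"
    by (auto simp: eventually_sequentially)
  obtain \<phi> where p: "\<phi> \<in> test_functions UNIV" "L2_norm (\<lambda>x. F i x - \<phi> x) < e/2"
    using assms(3) \<open>e > 0\<close> by (metis half_gt_zero test_approximable_def)
  then show "\<exists>\<phi>\<in>test_functions UNIV. L2_norm (\<lambda>x. f x - \<phi> x) < e"
    using L2_norm_triangle_diff[OF assms(1) assms(2)[of i] test_functions_L2[OF p(1)]] i
    by (intro bexI[OF _ p(1)]) simp
qed

lemma indicator_L2: "A \<in> sets lebesgue \<Longrightarrow> bounded A \<Longrightarrow> indicat_real A \<in> L2"
proof -
  assume A: "A \<in> sets lebesgue" "bounded A"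
  then have "A \<in> lmeasurable" by (simp add: bounded_set_imp_lmeasurable)
  then have "integrable lebesgue (indicat_real A)" by (intro integrable_real_indicator) (auto simp: fmeasurable_def)
  moreover have "(indicat_real A x)\<^sup>2 = indicat_real A x" for x by (simp add: indicator_def)
  ultimately show ?thesis using A by (simp add: L2_def)
qed

text \<open>Regularity of Lebesgue measure squeezes \<open>A\<close> between a compact
  \<open>C\<close> and an open \<open>U\<close>. A Urysohn function of this pair differs from the
  indicator by at most 1 and only on \<open>(A - C) \<union> (U - A)\<close>; each of the two pieces
  has measure below \<open>e\<^sup>2 / 4\<close>.\<close>

lemma test_approximable_indicator:
  assumes A: "A \<in> sets lebesgue" "bounded A"
  shows "test_approximable (indicat_real A)"
  unfolding test_approximable_def
proof safe
  fix e :: real assume "e > 0"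
  then have e4: "e\<^sup>2/4 > 0" by simp
  obtain C where C: "closed C" "C \<subseteq> A" "emeasure lebesgue (A - C) < ennreal (e\<^sup>2/4)"
    using sets_lebesgue_inner_closed[OF A(1) e4] by metis
  obtain U where U: "open U" "A \<subseteq> U" "emeasure lebesgue (U - A) < ennreal (e\<^sup>2/4)"
    using sets_lebesgue_outer_open[OF A(1) e4] by metis
  have "compact C" using C A by (meson bounded_subset compact_eq_bounded_closed)
  then obtain \<phi> where p: "\<phi> \<in> test_functions UNIV" "\<And>x. 0 \<le> \<phi> x \<and> \<phi> x \<le> 1"
    "\<And>x. x \<in> C \<Longrightarrow> \<phi> x = 1" "\<And>x. x \<notin> U \<Longrightarrow> \<phi> x = 0"
    using smooth_Urysohn[of C U] U C by blast
  have fL: "(\<lambda>x. indicat_real A x - \<phi> x) \<in> L2"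
    by (intro L2_diff indicator_L2 A test_functions_L2 p)
  have sq: "(indicat_real A x - \<phi> x)\<^sup>2 \<le> indicat_real (A - C) x + indicat_real (U - A) x" for x
    using p(2-4)[of x] U(2) C(2)
    by (auto simp: indicator_def power_le_one_iff)
  have "ennreal ((L2_norm (\<lambda>x. indicat_real A x - \<phi> x))\<^sup>2) = (\<integral>\<^sup>+x. ennreal ((indicat_real A x - \<phi> x)\<^sup>2) \<partial>lebesgue)"
    by (rule nn_integral_L2[OF fL, symmetric])
  also have "\<dots> \<le> (\<integral>\<^sup>+x. indicator (A - C) x + indicator (U - A) x \<partial>lebesgue)"
  proof (rule nn_integral_mono)
    fix x
    have "ennreal ((indicat_real A x - \<phi> x)\<^sup>2) \<le> ennreal (indicat_real (A - C) x + indicat_real (U - A) x)"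
      by (rule ennreal_leI[OF sq])
    also have "\<dots> = indicator (A - C) x + indicator (U - A) x"
      by (simp add: ennreal_plus ennreal_indicator)
    finally show "ennreal ((indicat_real A x - \<phi> x)\<^sup>2) \<le> indicator (A - C) x + indicator (U - A) x" .
  qed
  also have "\<dots> = emeasure lebesgue (A - C) + emeasure lebesgue (U - A)"
  proof -
    have "C \<in> sets lebesgue" "U \<in> sets lebesgue" using C U by auto
    then have [measurable]: "A - C \<in> sets lebesgue" "U - A \<in> sets lebesgue" using A by (auto intro: sets.Diff)
    show ?thesis by (subst nn_integral_add) auto
  qed
  also have "\<dots> < ennreal (e\<^sup>2/4) + ennreal (e\<^sup>2/4)"
    using C(3) U(3) by (rule add_strict_mono)
  also have "\<dots> = ennreal (e\<^sup>2/2)" using e4 by (subst ennreal_plus[symmetric]) auto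
  finally have "(L2_norm (\<lambda>x. indicat_real A x - \<phi> x))\<^sup>2 < e\<^sup>2 / 2"
    using e4 by (simp add: ennreal_less_iff)
  also have "\<dots> \<le> e\<^sup>2" by simp
  finally have "(L2_norm (\<lambda>x. indicat_real A x - \<phi> x))\<^sup>2 < e\<^sup>2" .
  then have "L2_norm (\<lambda>x. indicat_real A x - \<phi> x) < e"
    using \<open>e > 0\<close> by (auto intro: power2_less_imp_less)
  then show "\<exists>\<phi>\<in>test_functions UNIV. L2_norm (\<lambda>x. indicat_real A x - \<phi> x) < e" using p(1) by blast
qed

text \<open>Membership in \<open>L2\<close> is a premise inside the conclusion because the induction
  over measurable functions runs through summands and approximants that are recognised as elements
  of \<open>L2\<close> only by comparison with the function they build up.\<close>

lemma test_approximable_nonneg: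
  assumes "u \<in> borel_measurable lebesgue" "\<And>x. 0 \<le> u x"
  shows "u \<in> L2 \<longrightarrow> test_approximable u"
  using assms
proof (induction u rule: borel_measurable_induct_real)
  case (set A)
  show ?case
  proof
    assume L: "indicat_real A \<in> L2"
    \<comment> \<open>The set may be unbounded although its indicator is square integrable, so it is
      exhausted by its intersections with balls.\<close>
    define F where "F n = indicat_real (A \<inter> ball 0 (real n))" for n
    have AS: "A \<inter> ball 0 (real n) \<in> sets lebesgue" for n using set by (intro sets.Int) auto
    have Fm: "F n \<in> borel_measurable lebesgue" for n unfolding F_def using AS by simp
    have lim: "(\<lambda>n. F n x) \<longlonglongrightarrow> indicat_real A x" for x
    proof (rule tendsto_eventually, rule eventually_sequentiallyI[of "nat \<lceil>norm x\<rceil> + 1"])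
      fix n assume "nat \<lceil>norm x\<rceil> + 1 \<le> n"
      then have "norm x < real n" by linarith
      then show "F n x = indicat_real A x" by (simp add: F_def indicator_def)
    qed
    have b: "\<bar>F n x\<bar> \<le> \<bar>indicat_real A x\<bar>" for n x by (simp add: F_def indicator_def)
    note d = L2_dominated[where F = F, OF Fm L L2_measurable[OF L] AE_I2[OF b] AE_I2[OF lim]]
    show "test_approximable (indicat_real A)"
    proof (rule test_approximable_limit[OF L d(1) _ d(3)])
      show "test_approximable (F n)" for n
        unfolding F_def by (rule test_approximable_indicator[OF AS]) (auto intro: bounded_subset[OF bounded_ball])
    qed
  qed
next
  case (mult u c)
  show ?case
  proof
    assume L: "(\<lambda>x. c * u x) \<in> L2"
    show "test_approximable (\<lambda>x. c * u x)"
    proof (cases "c = 0")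
      case True
      have "(\<lambda>x. 0) \<in> test_functions UNIV" by (rule test_functions_UNIV_I) (auto intro: Ck_const)
      then show ?thesis using True by (auto simp: test_approximable_def L2_norm_def intro!: bexI[of _ "\<lambda>x. 0"])
    next
      case False
      then have "u \<in> L2" using L2_cmult[OF L, of "1/c"] by simp
      then show ?thesis using mult by (intro test_approximable_cmult) auto
    qed
  qed
next
  case (add u v)
  show ?case
  proof
    assume L: "(\<lambda>x. v x + u x) \<in> L2"
    have u: "u \<in> L2" "v \<in> L2"
      using add by (auto intro!: L2_bound[OF L] AE_I2)
    then show "test_approximable (\<lambda>x. v x + u x)" using add by (intro test_approximable_add) auto
  qed
next
  case (seq U)
  show ?case
  proof
    assume L: "u \<in> L2"
    have b: "\<bar>U i x\<bar> \<le> \<bar>u x\<bar>" for i x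
      using incseq_le[of "\<lambda>i. U i x" "u x" i] seq
      by (auto simp: incseq_def le_fun_def)
    have lim: "(\<lambda>i. U i x) \<longlonglongrightarrow> u x" for x using seq by simp
    note d = L2_dominated[where F = U, OF seq(1) L L2_measurable[OF L] AE_I2[OF b] AE_I2[OF lim]]
    show "test_approximable u"
      using test_approximable_limit[OF L d(1) _ d(3)] seq d(1) by blast
  qed
qed

theorem L2_test_dense:
  assumes "f \<in> L2" "e > 0"
  obtains \<phi> where "\<phi> \<in> test_functions UNIV" "L2_norm (\<lambda>x. f x - \<phi> x) < e"
proof -
  have m: "f \<in> borel_measurable lebesgue" using assms(1) by (rule L2_measurable)
  have p: "(\<lambda>x. max (f x) 0) \<in> L2" "(\<lambda>x. max (- f x) 0) \<in> L2"
    by (rule L2_bound[OF assms(1)]; use m in auto)+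
  have "test_approximable (\<lambda>x. max (f x) 0 + (-1) * max (- f x) 0)"
    using test_approximable_nonneg[OF L2_measurable[OF p(1)]] test_approximable_nonneg[OF L2_measurable[OF p(2)]] p
    by (intro test_approximable_add test_approximable_cmult L2_cmult) auto
  moreover have "(\<lambda>x. max (f x) 0 + (-1) * max (- f x) 0) = f" by auto
  ultimately have "test_approximable f" by (simp only:)
  then show thesis using that assms(2) unfolding test_approximable_def by blast
qed

text \<open>Density of the test functions: for \<open>\<phi>\<close> close to \<open>g\<close>, the
  squared norm of \<open>g\<close> equals \<open>ip g (\<lambda>x. g x - \<phi> x)\<close>, which
  Cauchy-Schwarz makes small.\<close>

lemma ip_test_zero_AE:
  assumes g: "g \<in> L2" and z: "\<And>\<phi>. \<phi> \<in> test_functions UNIV \<Longrightarrow> ip g \<phi> = 0"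
  shows "AE x in lebesgue. g x = 0"
proof -
  have "L2_norm g \<le> e" if "e > 0" for e
  proof -
    obtain \<phi> where p: "\<phi> \<in> test_functions UNIV" "L2_norm (\<lambda>x. g x - \<phi> x) < e" using L2_test_dense[OF g \<open>e > 0\<close>] .
    note pL = test_functions_L2[OF p(1)]
    have "(L2_norm g)\<^sup>2 = ip g (\<lambda>x. g x - \<phi> x)"
      using z[OF p(1)] by (simp add: ip_self ip_diff_right[OF g pL g])
    also have "\<dots> \<le> L2_norm g * L2_norm (\<lambda>x. g x - \<phi> x)"
      using ip_Cauchy_Schwarz[OF g L2_diff[OF g pL]] by simp
    also have "\<dots> \<le> L2_norm g * e" using p(2) by (intro mult_left_mono L2_norm_nonneg) simp
    finally show ?thesis
      using L2_norm_nonneg[of g] that by (cases "L2_norm g = 0") (auto simp: power2_eq_square)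
  qed
  then have "L2_norm g \<le> 0" using field_le_epsilon[of "L2_norm g" 0] by simp
  then show ?thesis using L2_norm_zero_AE[OF g] L2_norm_nonneg[of g] by simp
qed

section \<open>Weak gradients\<close>

definition vL2 :: "(R3 \<Rightarrow> R3) set" where
  "vL2 = {G. \<forall>i. (\<lambda>x. G x $ i) \<in> L2}"

definition vip :: "(R3 \<Rightarrow> R3) \<Rightarrow> (R3 \<Rightarrow> R3) \<Rightarrow> real" where
  "vip G H = (\<Sum>i\<in>UNIV. ip (\<lambda>x. G x $ i) (\<lambda>x. H x $ i))"

definition vnorm :: "(R3 \<Rightarrow> R3) \<Rightarrow> real" where
  "vnorm G = sqrt (vip G G)"

lemma vL2_D: "G \<in> vL2 \<Longrightarrow> (\<lambda>x. G x $ i) \<in> L2"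
  by (simp add: vL2_def)

lemma vL2_add: "G \<in> vL2 \<Longrightarrow> H \<in> vL2 \<Longrightarrow> (\<lambda>x. G x + H x) \<in> vL2"
  and vL2_diff: "G \<in> vL2 \<Longrightarrow> H \<in> vL2 \<Longrightarrow> (\<lambda>x. G x - H x) \<in> vL2"
  and vL2_scaleR: "G \<in> vL2 \<Longrightarrow> (\<lambda>x. c *\<^sub>R G x) \<in> vL2"
  and vL2_zero: "(\<lambda>x. 0) \<in> vL2"
  by (auto simp: vL2_def L2_zero intro: L2_add L2_diff L2_cmult)

lemma vip_commute: "vip G H = vip H G"
  by (simp add: vip_def ip_commute)

lemma vip_add_left: "G \<in> vL2 \<Longrightarrow> G' \<in> vL2 \<Longrightarrow> H \<in> vL2 \<Longrightarrow> vip (\<lambda>x. G x + G' x) H = vip G H + vip G' H"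
  by (simp add: vip_def ip_add_left vL2_D sum.distrib)

lemma vip_diff_left: "G \<in> vL2 \<Longrightarrow> G' \<in> vL2 \<Longrightarrow> H \<in> vL2 \<Longrightarrow> vip (\<lambda>x. G x - G' x) H = vip G H - vip G' H"
  by (simp add: vip_def ip_diff_left vL2_D sum_subtractf)

lemma vip_scaleR_left: "vip (\<lambda>x. c *\<^sub>R G x) H = c * vip G H"
  by (simp add: vip_def ip_cmult_left sum_distrib_left)

lemma vip_add_right: "G \<in> vL2 \<Longrightarrow> G' \<in> vL2 \<Longrightarrow> H \<in> vL2 \<Longrightarrow> vip H (\<lambda>x. G x + G' x) = vip H G + vip H G'"
  by (simp add: vip_def ip_add_right vL2_D sum.distrib)

lemma vip_diff_right: "G \<in> vL2 \<Longrightarrow> G' \<in> vL2 \<Longrightarrow> H \<in> vL2 \<Longrightarrow> vip H (\<lambda>x. G x - G' x) = vip H G - vip H G'"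
  by (simp add: vip_def ip_diff_right vL2_D sum_subtractf)

lemma vip_scaleR_right: "vip H (\<lambda>x. c *\<^sub>R G x) = c * vip H G"
  by (simp add: vip_def ip_cmult_right sum_distrib_left)

lemma vip_cong_AE:
  assumes "G \<in> vL2" "H \<in> vL2" "AE x in lebesgue. G x = G' x" "AE x in lebesgue. H x = H' x"
  shows "vip G H = vip G' H'"
  unfolding vip_def
proof (intro sum.cong ip_cong_AE vL2_D assms refl)
  show "AE x in lebesgue. G x $ i = G' x $ i" for i using assms(3) by eventually_elim simp
  show "AE x in lebesgue. H x $ i = H' x $ i" for i using assms(4) by eventually_elim simp
qed

lemma vip_self_nonneg: "0 \<le> vip G G"
  by (auto simp: vip_def intro!: sum_nonneg ip_self_nonneg)

lemma vnorm_nonneg: "0 \<le> vnorm G" and vip_self: "vip G G = (vnorm G)\<^sup>2"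
  by (auto simp: vnorm_def vip_self_nonneg)

lemma vip_integrable: "G \<in> vL2 \<Longrightarrow> H \<in> vL2 \<Longrightarrow> integrable lebesgue (\<lambda>x. G x \<bullet> H x)"
  and vip_eq: "G \<in> vL2 \<Longrightarrow> H \<in> vL2 \<Longrightarrow> vip G H = (LINT x|lebesgue. G x \<bullet> H x)"
  unfolding inner_vec_def inner_real_def vip_def ip_def
  by (auto intro!: Bochner_Integration.integrable_sum L2_mult vL2_D
      Bochner_Integration.integral_sum[symmetric])

lemma vip_Cauchy_Schwarz:
  assumes "G \<in> vL2" "H \<in> vL2"
  shows "\<bar>vip G H\<bar> \<le> vnorm G * vnorm H"
proof -
  have "0 \<le> vip G G + 2 * t * vip G H + t\<^sup>2 * vip H H" for t
  proof -
    let ?K = "\<lambda>x. G x + t *\<^sub>R H x"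
    have K: "?K \<in> vL2" by (intro vL2_add vL2_scaleR assms)
    have r: "vip L ?K = vip L G + t * vip L H" if "L \<in> vL2" for L
      using vip_add_right[OF assms(1) vL2_scaleR[OF assms(2)] that] vip_scaleR_right by simp
    have "vip ?K ?K = vip G ?K + t * vip H ?K"
      using vip_add_left[OF assms(1) vL2_scaleR[OF assms(2)] K] vip_scaleR_left by simp
    also have "\<dots> = vip G G + 2 * t * vip G H + t\<^sup>2 * vip H H"
      unfolding r[OF assms(1)] r[OF assms(2)] vip_commute[of H G] by (simp add: power2_eq_square algebra_simps)
    finally show ?thesis using vip_self_nonneg[of ?K] by linarith
  qed
  then have "(vip G H)\<^sup>2 \<le> vip G G * vip H H"
    by (intro quadratic_nonneg_imp vip_self_nonneg)
  then have "sqrt ((vip G H)\<^sup>2) \<le> sqrt (vip G G * vip H H)" by (rule real_sqrt_le_mono)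
  then show ?thesis by (simp add: vnorm_def real_sqrt_mult)
qed

lemma has_weak_gradient_iff:
  "has_weak_gradient u G \<longleftrightarrow> u \<in> L2 \<and> G \<in> vL2 \<and>
     (\<forall>\<phi>\<in>test_functions UNIV. \<forall>i. ip u (\<lambda>x. frechet_derivative \<phi> (at x) (axis i 1)) = - ip (\<lambda>x. G x $ i) \<phi>)"
  by (auto simp: has_weak_gradient_def vL2_def ip_def)

lemma frechet_derivative_zero_outside:
  assumes "x \<notin> closure {x. \<phi> x \<noteq> 0}"
  shows "frechet_derivative \<phi> (at x) v = (0::real)"
proof -
  have "(\<phi> has_derivative (\<lambda>v. 0)) (at x)"
  proof (rule has_derivative_transform_within_open[OF _ open_Compl[OF closed_closure]])
    show "((\<lambda>x. 0) has_derivative (\<lambda>v. 0)) (at x)" by simp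
    show "0 = \<phi> y" if "y \<in> - closure {x. \<phi> x \<noteq> 0}" for y
      using that closure_subset[of "{x. \<phi> x \<noteq> 0}"] by auto
  qed (use assms in auto)
  from frechet_derivative_at[OF this] show ?thesis by (metis)
qed

lemma test_functions_partial:
  fixes \<phi> :: "R3 \<Rightarrow> real"
  assumes "\<phi> \<in> test_functions UNIV"
  shows "(\<lambda>x. frechet_derivative \<phi> (at x) (axis i 1)) \<in> test_functions UNIV"
proof (rule test_functions_UNIV_I)
  have "axis i (1::real) \<in> (Basis :: R3 set)" by (simp add: axis_in_Basis_iff)
  then show "Ck k (\<lambda>x. frechet_derivative \<phi> (at x) (axis i 1))" for k
    using test_functionsD(1)[OF assms, of "Suc k"] by simp
  show "bounded {x. frechet_derivative \<phi> (at x) (axis i 1) \<noteq> 0}"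
    by (rule bounded_subset[OF compact_imp_bounded[OF test_functionsD(2)[OF assms]]])
       (use frechet_derivative_zero_outside in blast)
qed

lemma test_partial_L2: "\<phi> \<in> test_functions UNIV \<Longrightarrow> (\<lambda>x. frechet_derivative \<phi> (at x) (axis i 1)) \<in> L2"
  by (intro test_functions_L2 test_functions_partial)

text \<open>This is what makes the choice in \<open>weak_gradient\<close> harmless: a weak gradient
  obtained in any other way, even for a function changed on a null set, can be exchanged for it
  under an integral.\<close>

lemma has_weak_gradient_unique:
  assumes u: "has_weak_gradient u G" "has_weak_gradient u' G'" and e: "AE x in lebesgue. u x = u' x"
  shows "AE x in lebesgue. G x = G' x"
proof -
  note d = u[unfolded has_weak_gradient_iff]
  have "AE x in lebesgue. G x $ i - G' x $ i = 0" for i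
  proof (rule ip_test_zero_AE)
    show "(\<lambda>x. G x $ i - G' x $ i) \<in> L2" using d by (intro L2_diff vL2_D) auto
    fix \<phi> :: "R3 \<Rightarrow> real" assume p: "\<phi> \<in> test_functions UNIV"
    have "ip u (\<lambda>x. frechet_derivative \<phi> (at x) (axis i 1)) = ip u' (\<lambda>x. frechet_derivative \<phi> (at x) (axis i 1))"
      by (rule ip_cong_AE[OF _ test_partial_L2[OF p] e]) (use d in auto)
    then have "ip (\<lambda>x. G x $ i) \<phi> = ip (\<lambda>x. G' x $ i) \<phi>" using d p by force
    then show "ip (\<lambda>x. G x $ i - G' x $ i) \<phi> = 0"
      using d p by (subst ip_diff_left) (auto intro: vL2_D test_functions_L2)
  qed
  then have "AE x in lebesgue. \<forall>i. G x $ i - G' x $ i = 0"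
    by (subst AE_all_countable) auto
  then show ?thesis by eventually_elim (simp add: vec_eq_iff)
qed

lemma H1_weak_gradient: "u \<in> H1 \<Longrightarrow> has_weak_gradient u (weak_gradient u)"
  unfolding H1_def weak_gradient_def mem_Collect_eq by (erule someI_ex)

lemma H1_I: "has_weak_gradient u G \<Longrightarrow> u \<in> H1"
  by (auto simp: H1_def)

lemma H1_L2: "u \<in> H1 \<Longrightarrow> u \<in> L2" and H1_gradient_vL2: "u \<in> H1 \<Longrightarrow> weak_gradient u \<in> vL2"
  using H1_weak_gradient has_weak_gradient_iff by auto

lemma weak_gradient_AE: "has_weak_gradient u G \<Longrightarrow> AE x in lebesgue. weak_gradient u x = G x"
  by (rule has_weak_gradient_unique[OF H1_weak_gradient]) (auto intro: H1_I)

lemma has_weak_gradient_add: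
  assumes "has_weak_gradient u G" "has_weak_gradient u' G'"
  shows "has_weak_gradient (\<lambda>x. u x + u' x) (\<lambda>x. G x + G' x)"
  using assms unfolding has_weak_gradient_iff
  by (auto simp: ip_add_left test_partial_L2 test_functions_L2 vL2_D intro: L2_add vL2_add)

lemma has_weak_gradient_cmult:
  assumes "has_weak_gradient u G"
  shows "has_weak_gradient (\<lambda>x. c * u x) (\<lambda>x. c *\<^sub>R G x)"
  using assms unfolding has_weak_gradient_iff
  by (auto simp: ip_cmult_left intro: L2_cmult vL2_scaleR)

lemma has_weak_gradient_diff:
  assumes "has_weak_gradient u G" "has_weak_gradient u' G'"
  shows "has_weak_gradient (\<lambda>x. u x - u' x) (\<lambda>x. G x - G' x)"
  using has_weak_gradient_add[OF assms(1) has_weak_gradient_cmult[OF assms(2), of "-1"]] by simp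

lemma has_weak_gradient_zero: "has_weak_gradient (\<lambda>x. 0) (\<lambda>x. 0)"
  by (auto simp: has_weak_gradient_iff L2_zero vL2_zero ip_def)

lemma has_weak_gradient_sum:
  "(\<And>i. i \<in> A \<Longrightarrow> has_weak_gradient (u i) (G i)) \<Longrightarrow> has_weak_gradient (\<lambda>x. \<Sum>i\<in>A. u i x) (\<lambda>x. \<Sum>i\<in>A. G i x)"
  by (induction A rule: infinite_finite_induct) (auto intro: has_weak_gradient_add simp: has_weak_gradient_zero)

lemma ip_tendsto_left:
  assumes "\<And>n. g n \<in> L2" "h \<in> L2" "\<phi> \<in> L2" "(\<lambda>n. L2_norm (\<lambda>x. g n x - h x)) \<longlonglongrightarrow> 0"
  shows "(\<lambda>n. ip (g n) \<phi>) \<longlonglongrightarrow> ip h \<phi>"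
proof -
  have "(\<lambda>n. ip (g n) \<phi> - ip h \<phi>) \<longlonglongrightarrow> 0"
  proof (rule Lim_null_comparison)
    show "\<forall>\<^sub>F n in sequentially. norm (ip (g n) \<phi> - ip h \<phi>) \<le> L2_norm (\<lambda>x. g n x - h x) * L2_norm \<phi>"
      using ip_Cauchy_Schwarz[OF L2_diff[OF assms(1,2)] assms(3)] assms
      by (auto simp: ip_diff_left)
    show "(\<lambda>n. L2_norm (\<lambda>x. g n x - h x) * L2_norm \<phi>) \<longlonglongrightarrow> 0"
      using tendsto_mult_left_zero[OF assms(4)] .
  qed
  then show ?thesis by (simp add: LIM_zero_iff)
qed

text \<open>For a fixed test function both sides of the defining identity are continuous in
  \<open>L2\<close>. Closedness is the device that will put the Laplace transform of the wave into
  \<open>H1\<close>.\<close>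

lemma has_weak_gradient_closed:
  assumes "\<And>n. has_weak_gradient (u n) (G n)" "v \<in> L2" "H \<in> vL2"
    "(\<lambda>n. L2_norm (\<lambda>x. u n x - v x)) \<longlonglongrightarrow> 0"
    "\<And>i. (\<lambda>n. L2_norm (\<lambda>x. G n x $ i - H x $ i)) \<longlonglongrightarrow> 0"
  shows "has_weak_gradient v H"
proof -
  note d = assms(1)[unfolded has_weak_gradient_iff]
  have "ip v (\<lambda>x. frechet_derivative \<phi> (at x) (axis i 1)) = - ip (\<lambda>x. H x $ i) \<phi>"
    if p: "\<phi> \<in> test_functions UNIV" for \<phi> i
  proof (rule LIMSEQ_unique)
    show "(\<lambda>n. ip (u n) (\<lambda>x. frechet_derivative \<phi> (at x) (axis i 1))) \<longlonglongrightarrow> ip v (\<lambda>x. frechet_derivative \<phi> (at x) (axis i 1))"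
      by (rule ip_tendsto_left) (use d assms test_partial_L2[OF p] in auto)
    have "(\<lambda>n. - ip (\<lambda>x. G n x $ i) \<phi>) \<longlonglongrightarrow> - ip (\<lambda>x. H x $ i) \<phi>"
      by (intro tendsto_minus ip_tendsto_left) (use d assms vL2_D test_functions_L2[OF p] in auto)
    then show "(\<lambda>n. ip (u n) (\<lambda>x. frechet_derivative \<phi> (at x) (axis i 1))) \<longlonglongrightarrow> - ip (\<lambda>x. H x $ i) \<phi>"
      using d p by simp
  qed
  then show ?thesis using assms by (simp add: has_weak_gradient_iff)
qed

section \<open>The norm of \<open>H1\<close> and its dual\<close>

lemma H1_add: "u \<in> H1 \<Longrightarrow> v \<in> H1 \<Longrightarrow> (\<lambda>x. u x + v x) \<in> H1"
  and H1_diff: "u \<in> H1 \<Longrightarrow> v \<in> H1 \<Longrightarrow> (\<lambda>x. u x - v x) \<in> H1"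
  and H1_cmult: "u \<in> H1 \<Longrightarrow> (\<lambda>x. c * u x) \<in> H1"
  and H1_zero: "(\<lambda>x. 0) \<in> H1"
  unfolding H1_def
  by (blast intro: has_weak_gradient_add has_weak_gradient_diff has_weak_gradient_cmult has_weak_gradient_zero)+

lemma weak_gradient_add_AE: "u \<in> H1 \<Longrightarrow> v \<in> H1 \<Longrightarrow>
    AE x in lebesgue. weak_gradient (\<lambda>x. u x + v x) x = weak_gradient u x + weak_gradient v x"
  and weak_gradient_diff_AE: "u \<in> H1 \<Longrightarrow> v \<in> H1 \<Longrightarrow>
    AE x in lebesgue. weak_gradient (\<lambda>x. u x - v x) x = weak_gradient u x - weak_gradient v x"
  and weak_gradient_cmult_AE: "u \<in> H1 \<Longrightarrow>
    AE x in lebesgue. weak_gradient (\<lambda>x. c * u x) x = c *\<^sub>R weak_gradient u x"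
  by (intro weak_gradient_AE[OF has_weak_gradient_add] weak_gradient_AE[OF has_weak_gradient_diff]
      weak_gradient_AE[OF has_weak_gradient_cmult] H1_weak_gradient; assumption)+

lemma vip_norm_sq: "G \<in> vL2 \<Longrightarrow> (LINT x|lebesgue. (norm (G x))\<^sup>2) = vip G G"
  by (simp add: vip_eq power2_norm_eq_inner)

lemma H1_norm_sq: "u \<in> H1 \<Longrightarrow> (H1_norm u)\<^sup>2 = (L2_norm u)\<^sup>2 + (vnorm (weak_gradient u))\<^sup>2"
  unfolding H1_norm_def vip_norm_sq[OF H1_gradient_vL2]
  by (simp add: vip_self L2_norm_def)

lemma H1_norm_nonneg: "u \<in> H1 \<Longrightarrow> 0 \<le> H1_norm u"
  unfolding H1_norm_def by simp

lemma L2_norm_le_H1: "L2_norm u \<le> H1_norm u"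
  and vnorm_le_H1: "vnorm (weak_gradient u) \<le> H1_norm u" if "u \<in> H1"
proof -
  show "L2_norm u \<le> H1_norm u"
    by (rule power2_le_imp_le) (simp_all add: H1_norm_sq H1_norm_nonneg that)
  show "vnorm (weak_gradient u) \<le> H1_norm u"
    by (rule power2_le_imp_le) (simp_all add: H1_norm_sq H1_norm_nonneg that)
qed

lemma H1_norm_eq: "u \<in> H1 \<Longrightarrow> H1_norm u = sqrt ((L2_norm u)\<^sup>2 + (vnorm (weak_gradient u))\<^sup>2)"
  using H1_norm_nonneg[of u] by (simp add: H1_norm_sq[symmetric])

lemma vnorm_cong_AE: "G \<in> vL2 \<Longrightarrow> AE x in lebesgue. G x = H x \<Longrightarrow> vnorm G = vnorm H"
  unfolding vnorm_def using vip_cong_AE[of G G H H] by simp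

lemma vnorm_scaleR: "vnorm (\<lambda>x. c *\<^sub>R G x) = \<bar>c\<bar> * vnorm G"
  by (simp add: vnorm_def vip_scaleR_left vip_scaleR_right real_sqrt_mult mult.assoc[symmetric])

lemma vnorm_triangle:
  assumes "G \<in> vL2" "H \<in> vL2"
  shows "vnorm (\<lambda>x. G x + H x) \<le> vnorm G + vnorm H"
proof (rule power2_le_imp_le)
  have "(vnorm (\<lambda>x. G x + H x))\<^sup>2 = (vnorm G)\<^sup>2 + 2 * vip G H + (vnorm H)\<^sup>2"
    using assms unfolding vip_self[symmetric]
    by (simp add: vip_add_left vip_add_right vL2_add vip_commute[of H G])
  also have "\<dots> \<le> (vnorm G + vnorm H)\<^sup>2"
    using vip_Cauchy_Schwarz[OF assms] by (simp add: power2_sum)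
  finally show "(vnorm (\<lambda>x. G x + H x))\<^sup>2 \<le> (vnorm G + vnorm H)\<^sup>2" .
qed (simp add: vnorm_nonneg)

lemma H1_norm_triangle:
  assumes "u \<in> H1" "v \<in> H1"
  shows "H1_norm (\<lambda>x. u x + v x) \<le> H1_norm u + H1_norm v"
proof -
  have "vnorm (weak_gradient (\<lambda>x. u x + v x)) = vnorm (\<lambda>x. weak_gradient u x + weak_gradient v x)"
    by (intro vnorm_cong_AE H1_gradient_vL2 H1_add weak_gradient_add_AE assms)
  also have "\<dots> \<le> vnorm (weak_gradient u) + vnorm (weak_gradient v)"
    by (intro vnorm_triangle H1_gradient_vL2 assms)
  finally have 1: "vnorm (weak_gradient (\<lambda>x. u x + v x)) \<le> vnorm (weak_gradient u) + vnorm (weak_gradient v)" .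
  have 2: "L2_norm (\<lambda>x. u x + v x) \<le> L2_norm u + L2_norm v"
    by (intro L2_norm_triangle H1_L2 assms)
  have "sqrt ((L2_norm (\<lambda>x. u x + v x))\<^sup>2 + (vnorm (weak_gradient (\<lambda>x. u x + v x)))\<^sup>2)
     \<le> sqrt ((L2_norm u + L2_norm v)\<^sup>2 + (vnorm (weak_gradient u) + vnorm (weak_gradient v))\<^sup>2)"
    by (intro real_sqrt_le_mono add_mono power_mono 1 2 L2_norm_nonneg vnorm_nonneg)
  also have "\<dots> \<le> sqrt ((L2_norm u)\<^sup>2 + (vnorm (weak_gradient u))\<^sup>2) + sqrt ((L2_norm v)\<^sup>2 + (vnorm (weak_gradient v))\<^sup>2)"
    by (rule real_sqrt_sum_squares_triangle_ineq)
  finally show ?thesis by (simp add: H1_norm_eq assms H1_add)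
qed

lemma H1_norm_cmult:
  assumes "u \<in> H1"
  shows "H1_norm (\<lambda>x. c * u x) = \<bar>c\<bar> * H1_norm u"
proof -
  have "vnorm (weak_gradient (\<lambda>x. c * u x)) = \<bar>c\<bar> * vnorm (weak_gradient u)"
    unfolding vnorm_scaleR[symmetric]
    by (intro vnorm_cong_AE H1_gradient_vL2 H1_cmult weak_gradient_cmult_AE assms)
  then have "(L2_norm (\<lambda>x. c * u x))\<^sup>2 + (vnorm (weak_gradient (\<lambda>x. c * u x)))\<^sup>2
    = c\<^sup>2 * ((L2_norm u)\<^sup>2 + (vnorm (weak_gradient u))\<^sup>2)"
    by (simp add: L2_norm_cmult power_mult_distrib algebra_simps)
  then show ?thesis by (simp add: H1_norm_eq assms H1_cmult real_sqrt_mult)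
qed

lemma H1_norm_minus_commute:
  assumes "u \<in> H1" "v \<in> H1"
  shows "H1_norm (\<lambda>x. u x - v x) = H1_norm (\<lambda>x. v x - u x)"
  using H1_norm_cmult[OF H1_diff[OF assms], of "-1"] by simp

lemma H1_norm_triangle_diff:
  assumes "u \<in> H1" "v \<in> H1" "w \<in> H1"
  shows "H1_norm (\<lambda>x. u x - w x) \<le> H1_norm (\<lambda>x. u x - v x) + H1_norm (\<lambda>x. v x - w x)"
  using H1_norm_triangle[OF H1_diff[OF assms(1,2)] H1_diff[OF assms(2,3)]] by simp

text \<open>\<open>H1_dual_norm\<close> is a supremum of reals and means something only where it is
  bounded above, which membership in \<open>H1_dual\<close> ensures. A \<open>\<phi>\<close> of
  seminorm 0 cannot be normalised; there boundedness forces the value 0.\<close>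

lemma H1_dual_bound:
  assumes l: "l \<in> H1_dual" and p: "\<phi> \<in> H1"
  shows "\<bar>l \<phi>\<bar> \<le> H1_dual_norm l * H1_norm \<phi>"
proof -
  obtain K where K: "\<And>\<phi>. \<phi> \<in> H1 \<Longrightarrow> \<bar>l \<phi>\<bar> \<le> K * H1_norm \<phi>" using l unfolding H1_dual_def by blast
  have hom: "l (\<lambda>x. c * \<phi> x) = c * l \<phi>" for c
  proof -
    have "l (\<lambda>x. c * \<phi> x + 0 * \<phi> x) = c * l \<phi> + 0 * l \<phi>"
      using l p unfolding H1_dual_def by blast
    then show ?thesis by simp
  qed
  show ?thesis
  proof (cases "H1_norm \<phi> = 0")
    case True
    then show ?thesis using K[OF p] by simp
  next
    case False
    then have pos: "H1_norm \<phi> > 0" using H1_norm_nonneg[OF p] by simp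
    let ?c = "1 / H1_norm \<phi>"
    have "\<bar>l (\<lambda>x. ?c * \<phi> x)\<bar> \<le> H1_dual_norm l"
      unfolding H1_dual_norm_def
    proof (rule cSUP_upper)
      show "(\<lambda>x. ?c * \<phi> x) \<in> {\<phi> \<in> H1. H1_norm \<phi> \<le> 1}"
        using p pos H1_cmult[OF p] by (simp only: mem_Collect_eq H1_norm_cmult[OF p]) simp
      have "\<bar>l \<psi>\<bar> \<le> max K 0" if "\<psi> \<in> H1" "H1_norm \<psi> \<le> 1" for \<psi>
      proof -
        have "K * H1_norm \<psi> \<le> max K 0 * 1"
          using that H1_norm_nonneg[OF that(1)] by (intro mult_mono) auto
        then show ?thesis using K[OF that(1)] by simp
      qed
      then show "bdd_above ((\<lambda>\<phi>. \<bar>l \<phi>\<bar>) ` {\<phi> \<in> H1. H1_norm \<phi> \<le> 1})"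
        by (intro bdd_aboveI[of _ "max K 0"]) auto
    qed
    then show ?thesis using pos unfolding hom by (simp add: abs_mult field_simps)
  qed
qed

lemma H1_dual_diff:
  assumes "l \<in> H1_dual" "m \<in> H1_dual"
  shows "l - m \<in> H1_dual"
proof -
  obtain K L where K: "\<And>\<phi>. \<phi> \<in> H1 \<Longrightarrow> \<bar>l \<phi>\<bar> \<le> K * H1_norm \<phi>" and L: "\<And>\<phi>. \<phi> \<in> H1 \<Longrightarrow> \<bar>m \<phi>\<bar> \<le> L * H1_norm \<phi>"
    using assms unfolding H1_dual_def by blast
  have "\<bar>(l - m) \<phi>\<bar> \<le> (K + L) * H1_norm \<phi>" if "\<phi> \<in> H1" for \<phi>
    using K[OF that] L[OF that] by (simp add: algebra_simps)
  moreover have "(l - m) (\<lambda>x. a * \<phi> x + b * \<psi> x) = a * (l - m) \<phi> + b * (l - m) \<psi>"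
    if "\<phi> \<in> H1" "\<psi> \<in> H1" for \<phi> \<psi> a b
    using assms that by (simp add: H1_dual_def algebra_simps)
  ultimately show ?thesis unfolding H1_dual_def by blast
qed

lemma L2_functional_ip: "L2_functional g \<phi> = ip g \<phi>"
  by (simp add: L2_functional_def ip_def)

lemma L2_functional_H1_dual:
  assumes "g \<in> L2"
  shows "L2_functional g \<in> H1_dual"
proof -
  have "\<bar>L2_functional g \<phi>\<bar> \<le> L2_norm g * H1_norm \<phi>" if "\<phi> \<in> H1" for \<phi>
    unfolding L2_functional_ip
    using ip_Cauchy_Schwarz[OF assms H1_L2[OF that]] mult_left_mono[OF L2_norm_le_H1[OF that] L2_norm_nonneg[of g]]
    by linarith
  moreover have "L2_functional g (\<lambda>x. a * \<phi> x + b * \<psi> x) = a * L2_functional g \<phi> + b * L2_functional g \<psi>"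
    if "\<phi> \<in> H1" "\<psi> \<in> H1" for \<phi> \<psi> a b
    unfolding L2_functional_ip using that assms H1_L2
    by (simp add: ip_add_right L2_cmult ip_cmult_right)
  ultimately show ?thesis unfolding H1_dual_def by blast
qed

section \<open>Multiplication by bounded coefficients\<close>

lemma Linf_mult_L2:
  assumes "a \<in> Linf" "f \<in> L2"
  shows "(\<lambda>x. a x * f x) \<in> L2"
proof -
  obtain K where K: "AE x in lebesgue. \<bar>a x\<bar> \<le> K" using assms(1) by (auto simp: Linf_def)
  show ?thesis
  proof (rule L2_bound[OF L2_cmult[OF assms(2), of K]])
    show "(\<lambda>x. a x * f x) \<in> borel_measurable lebesgue"
      using assms L2_measurable[OF assms(2)] by (auto simp: Linf_def intro!: borel_measurable_times)
    show "AE x in lebesgue. \<bar>a x * f x\<bar> \<le> \<bar>K * f x\<bar>"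
      using K by eventually_elim (auto simp: abs_mult intro!: mult_right_mono)
  qed
qed

lemma matrix_mult_vL2:
  fixes A :: "R3 \<Rightarrow> real^3^3"
  assumes "\<And>i j. (\<lambda>x. A x $ i $ j) \<in> Linf" "G \<in> vL2"
  shows "(\<lambda>x. A x *v G x) \<in> vL2"
  unfolding vL2_def matrix_vector_mult_def
  by (auto intro!: L2_sum Linf_mult_L2 assms vL2_D)

lemma matrix_norm_bound:
  fixes A :: "R3 \<Rightarrow> real^3^3"
  assumes "\<And>i j. (\<lambda>x. A x $ i $ j) \<in> Linf"
  obtains M where "M \<ge> 0" "AE x in lebesgue. \<forall>v. norm (A x *v v) \<le> M * norm v"
proof -
  have "\<exists>K. AE x in lebesgue. \<bar>A x $ i $ j\<bar> \<le> K" for i j using assms by (auto simp: Linf_def)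
  then obtain K where K: "\<And>i j. AE x in lebesgue. \<bar>A x $ i $ j\<bar> \<le> K i j" by metis
  have "AE x in lebesgue. \<forall>i j. \<bar>A x $ i $ j\<bar> \<le> K i j"
    using K by (simp add: AE_all_countable)
  then have "AE x in lebesgue. \<forall>v. norm (A x *v v) \<le> (\<Sum>i\<in>UNIV. \<Sum>j\<in>UNIV. \<bar>K i j\<bar>) * norm v"
  proof eventually_elim
    case (elim x)
    show ?case
    proof
      fix v :: R3
      have "norm (A x *v v) \<le> (\<Sum>i\<in>UNIV. \<bar>(A x *v v) $ i\<bar>)" by (rule norm_le_l1_cart)
      also have "\<dots> \<le> (\<Sum>i\<in>UNIV. \<Sum>j\<in>UNIV. \<bar>K i j\<bar> * norm v)"
      proof (rule sum_mono)
        fix i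
        have "\<bar>(A x *v v) $ i\<bar> \<le> (\<Sum>j\<in>UNIV. \<bar>A x $ i $ j * v $ j\<bar>)"
          unfolding matrix_vector_mult_def by simp
        also have "\<dots> \<le> (\<Sum>j\<in>UNIV. \<bar>K i j\<bar> * norm v)"
          unfolding abs_mult using elim component_le_norm_cart[of v]
          by (intro sum_mono mult_mono) (auto intro: order_trans[OF _ abs_ge_self])
        finally show "\<bar>(A x *v v) $ i\<bar> \<le> (\<Sum>j\<in>UNIV. \<bar>K i j\<bar> * norm v)" .
      qed
      finally show "norm (A x *v v) \<le> (\<Sum>i\<in>UNIV. \<Sum>j\<in>UNIV. \<bar>K i j\<bar>) * norm v"
        by (simp add: sum_distrib_right)
    qed
  qed
  then show thesis by (intro that[of "\<Sum>i\<in>UNIV. \<Sum>j\<in>UNIV. \<bar>K i j\<bar>"]) (auto intro!: sum_nonneg)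
qed

lemma vip_mono:
  assumes "G \<in> vL2" "H \<in> vL2" "G' \<in> vL2" "H' \<in> vL2" "AE x in lebesgue. G x \<bullet> H x \<le> G' x \<bullet> H' x"
  shows "vip G H \<le> vip G' H'"
  unfolding vip_eq[OF assms(1,2)] vip_eq[OF assms(3,4)]
  by (intro integral_mono_AE vip_integrable assms)

lemma matrix_vnorm_bound:
  fixes A :: "R3 \<Rightarrow> real^3^3"
  assumes A: "\<And>i j. (\<lambda>x. A x $ i $ j) \<in> Linf" and G: "G \<in> vL2"
    and M: "0 \<le> M" "AE x in lebesgue. \<forall>v. norm (A x *v v) \<le> M * norm v"
  shows "vnorm (\<lambda>x. A x *v G x) \<le> M * vnorm G"
proof (rule power2_le_imp_le)
  have "vip (\<lambda>x. A x *v G x) (\<lambda>x. A x *v G x) \<le> vip (\<lambda>x. M *\<^sub>R G x) (\<lambda>x. M *\<^sub>R G x)"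
  proof (intro vip_mono matrix_mult_vL2 A G vL2_scaleR)
    show "AE x in lebesgue. (A x *v G x) \<bullet> (A x *v G x) \<le> (M *\<^sub>R G x) \<bullet> (M *\<^sub>R G x)"
      using M(2)
    proof eventually_elim
      case (elim x)
      then have "(norm (A x *v G x))\<^sup>2 \<le> (norm (M *\<^sub>R G x))\<^sup>2" using M(1) by (intro power_mono) auto
      then show ?case by (simp only: power2_norm_eq_inner)
    qed
  qed
  then show "(vnorm (\<lambda>x. A x *v G x))\<^sup>2 \<le> (M * vnorm G)\<^sup>2"
    by (simp add: vip_self vnorm_scaleR power_mult_distrib)
qed (simp add: M vnorm_nonneg)

section \<open>Integration by parts against smooth functions\<close>

abbreviation partial :: "3 \<Rightarrow> (R3 \<Rightarrow> real) \<Rightarrow> R3 \<Rightarrow> real" where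
  "partial i g x \<equiv> frechet_derivative g (at x) (axis i 1)"

definition smooth :: "('a::euclidean_space \<Rightarrow> real) \<Rightarrow> bool" where
  "smooth g \<longleftrightarrow> (\<forall>k. Ck k g)"

lemma smooth_has_derivative: "smooth g \<Longrightarrow> (g has_derivative frechet_derivative g (at x)) (at x)"
  unfolding smooth_def using Ck_Suc_has_derivative[of 0 g] by blast

lemma axis_Basis: "axis i (1::real) \<in> (Basis :: R3 set)"
  by (simp add: axis_in_Basis_iff)

lemma smooth_partial: "smooth g \<Longrightarrow> smooth (partial i g)"
  unfolding smooth_def using axis_Basis by (metis Ck.simps(2))

lemma smooth_continuous: "smooth g \<Longrightarrow> continuous_on UNIV g"
  unfolding smooth_def by (metis Ck.simps(1))

lemma smooth_borel: "smooth g \<Longrightarrow> g \<in> borel_measurable borel"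
  by (intro borel_measurable_continuous_onI smooth_continuous)

lemma test_smooth: "\<phi> \<in> test_functions S \<Longrightarrow> smooth \<phi>"
  by (simp add: smooth_def test_functionsD)

lemma partial_mult:
  assumes "smooth f" "smooth g"
  shows "partial i (\<lambda>x. f x * g x) x = f x * partial i g x + partial i f x * g x"
  by (simp add: frechet_derivative_mult_real[OF smooth_has_derivative smooth_has_derivative] assms)

lemma borel_lebesgue: "f \<in> borel_measurable borel \<Longrightarrow> f \<in> borel_measurable lebesgue"
  by (simp add: measurable_completion)

section \<open>Invariance of Lebesgue measure, and the vanishing integral of a derivative\<close>

lemma lborel_translate_nn:
  fixes f :: "R3 \<Rightarrow> ennreal"
  assumes "f \<in> borel_measurable borel"
  shows "(\<integral>\<^sup>+x. f (c + x) \<partial>lborel) = (\<integral>\<^sup>+x. f x \<partial>lborel)"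
proof -
  have "(\<integral>\<^sup>+x. f x \<partial>lborel) = (\<integral>\<^sup>+x. f x \<partial>distr lborel borel ((+) c))" by (simp add: lborel_distr_plus)
  also have "\<dots> = (\<integral>\<^sup>+x. f (c + x) \<partial>lborel)" using assms by (subst nn_integral_distr) auto
  finally show ?thesis by simp
qed

lemma lborel_uminus: "distr lborel borel uminus = (lborel :: R3 measure)"
proof -
  have "(lborel :: R3 measure) = density (distr lborel borel (\<lambda>x. 0 + (-1) *\<^sub>R x)) (\<lambda>_. ennreal (\<bar>-1\<bar> ^ DIM(R3)))"
    by (rule lborel_affine) simp
  then have "(lborel :: R3 measure) = density (distr lborel borel uminus) (\<lambda>_. 1)"
    by simp
  then show ?thesis by (simp add: density_1)
qed

lemma lborel_reflect_nn:
  fixes f :: "R3 \<Rightarrow> ennreal"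
  assumes "f \<in> borel_measurable borel"
  shows "(\<integral>\<^sup>+y. f (x - y) \<partial>lborel) = (\<integral>\<^sup>+x. f x \<partial>lborel)"
proof -
  have "(\<integral>\<^sup>+y. f (x - y) \<partial>lborel) = (\<integral>\<^sup>+y. f (x + y) \<partial>distr lborel borel uminus)"
    using assms by (subst nn_integral_distr) auto
  also have "\<dots> = (\<integral>\<^sup>+y. f (x + y) \<partial>lborel)" by (simp add: lborel_uminus)
  finally show ?thesis by (simp add: lborel_translate_nn assms)
qed

lemma lborel_translate:
  fixes f :: "R3 \<Rightarrow> real"
  assumes "f \<in> borel_measurable borel"
  shows "(LINT x|lborel. f (c + x)) = (LINT x|lborel. f x)"
proof -
  have "(LINT x|lborel. f x) = (LINT x|distr lborel borel ((+) c). f x)" by (simp add: lborel_distr_plus)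
  also have "\<dots> = (LINT x|lborel. f (c + x))" using assms by (subst integral_distr) auto
  finally show ?thesis by simp
qed

lemma lborel_translate_integrable:
  fixes f :: "R3 \<Rightarrow> real"
  assumes "integrable lborel f"
  shows "integrable lborel (\<lambda>x. f (c + x))"
proof -
  have "integrable (distr lborel borel ((+) c)) f" using assms by (simp add: lborel_distr_plus)
  then show ?thesis by (subst (asm) integrable_distr_eq) (use assms in auto)
qed

lemma continuous_support_bounded:
  fixes \<phi> :: "R3 \<Rightarrow> real"
  assumes c: "continuous_on UNIV \<phi>" and b: "bounded {x. \<phi> x \<noteq> 0}"
  obtains M R where "M > 0" "R > 0" "\<And>x. \<bar>\<phi> x\<bar> \<le> M" "\<And>x. \<phi> x \<noteq> 0 \<Longrightarrow> norm x \<le> R"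
proof -
  obtain R where R: "\<And>x. \<phi> x \<noteq> 0 \<Longrightarrow> norm x \<le> R" using b by (auto simp: bounded_iff)
  have "compact (\<phi> ` cball 0 R)"
    by (intro compact_continuous_image continuous_on_subset[OF c]) auto
  then have "bounded (\<phi> ` cball 0 R)" by (rule compact_imp_bounded)
  then obtain M where M: "\<And>x. x \<in> cball 0 R \<Longrightarrow> \<bar>\<phi> x\<bar> \<le> M" unfolding bounded_iff by force
  have "\<bar>\<phi> x\<bar> \<le> max M 1" for x
  proof (cases "\<phi> x = 0")
    case False
    then show ?thesis using M[of x] R[of x] by auto
  qed auto
  moreover have "\<phi> x \<noteq> 0 \<Longrightarrow> norm x \<le> max R 1" for x using R[of x] by auto
  ultimately show thesis by (intro that[of "max M 1" "max R 1"]) auto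
qed

lemma test_functions_bounded:
  assumes "\<phi> \<in> test_functions UNIV"
  obtains M R where "M > 0" "R > 0" "\<And>x::R3. \<bar>\<phi> x\<bar> \<le> M" "\<And>x. \<phi> x \<noteq> 0 \<Longrightarrow> norm x \<le> R"
  using continuous_support_bounded[OF smooth_continuous[OF test_smooth[OF assms]] test_functions_support_bounded[OF assms]]
  by metis

lemma bounded_support_integrable:
  fixes f :: "R3 \<Rightarrow> real"
  assumes "f \<in> borel_measurable borel" "\<And>x. \<bar>f x\<bar> \<le> M" "\<And>x. f x \<noteq> 0 \<Longrightarrow> norm x \<le> R"
  shows "integrable lborel f"
proof (rule Bochner_Integration.integrable_bound)
  have "emeasure lborel (cball (0::R3) R) < \<infinity>" by (rule emeasure_lborel_cball_finite)
  then show "integrable lborel (\<lambda>x. M * indicat_real (cball (0::R3) R) x)"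
    by (intro integrable_mult_right integrable_real_indicator) auto
  show "AE x in lborel. norm (f x) \<le> norm (M * indicat_real (cball 0 R) x)"
    using assms(2,3) by (auto simp: indicator_def intro: order_trans[OF _ abs_ge_self])
qed (use assms in auto)

lemma test_functions_integrable: "\<phi> \<in> test_functions UNIV \<Longrightarrow> integrable lborel (\<phi> :: R3 \<Rightarrow> real)"
  by (metis test_functions_bounded bounded_support_integrable smooth_borel test_smooth)

lemma smooth_line_derivative:
  fixes g :: "R3 \<Rightarrow> real"
  assumes "smooth g"
  shows "((\<lambda>t. g (x + t *\<^sub>R axis i 1)) has_real_derivative partial i g (x + t *\<^sub>R axis i 1)) (at t)"
proof -
  have d: "((\<lambda>t. x + t *\<^sub>R axis i (1::real)) has_derivative (\<lambda>h. h *\<^sub>R axis i 1)) (at t)"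
    by (auto intro!: derivative_eq_intros)
  have "((\<lambda>t. g (x + t *\<^sub>R axis i 1)) has_derivative
      (\<lambda>h. frechet_derivative g (at (x + t *\<^sub>R axis i 1)) (h *\<^sub>R axis i 1))) (at t)"
    using has_derivative_compose[OF d smooth_has_derivative[OF assms]] .
  from Basis_real_derivative[OF this] show ?thesis by simp
qed

text \<open>By translation invariance the integral of every difference quotient is 0. The mean value
  theorem bounds the quotients by the supremum of the partial derivative on one fixed ball, so
  dominated convergence carries the value 0 over to the derivative.\<close>

lemma test_partial_integral_zero:
  fixes \<phi> :: "R3 \<Rightarrow> real"
  assumes p: "\<phi> \<in> test_functions UNIV"
  shows "(LINT x|lborel. partial i \<phi> x) = 0"
proof -
  let ?e = "axis i (1::real) :: R3"
  \<comment> \<open>Increments of length at most 1 move the support by at most 1, hence the radius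
    \<open>R + 1\<close> of the dominating indicator.\<close>
  define h where "h n = 1 / real (Suc n)" for n
  have h: "h n > 0" "h n \<le> 1" for n by (auto simp: h_def field_simps)
  have h0: "h \<longlonglongrightarrow> 0" unfolding h_def by (rule LIMSEQ_Suc[OF lim_1_over_n])
  have sm: "smooth \<phi>" by (rule test_smooth[OF p])
  have [measurable]: "\<phi> \<in> borel_measurable borel" "partial i \<phi> \<in> borel_measurable borel"
    using smooth_borel sm smooth_partial by blast+
  obtain M R where MR: "M > 0" "\<And>x. \<bar>partial i \<phi> x\<bar> \<le> M" "R > 0" "\<And>x. partial i \<phi> x \<noteq> 0 \<Longrightarrow> norm x \<le> R"
    using test_functions_bounded[OF test_functions_partial[OF p, of i]] by metis
  have mvt: "\<exists>z. 0 < z \<and> z < h n \<and> \<phi> (x + h n *\<^sub>R ?e) - \<phi> x = h n * partial i \<phi> (x + z *\<^sub>R ?e)" for n x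
    using MVT2[OF h(1)[of n], of "\<lambda>t. \<phi> (x + t *\<^sub>R ?e)" "\<lambda>t. partial i \<phi> (x + t *\<^sub>R ?e)"]
      smooth_line_derivative[OF sm, of x i]
    by auto
  have bound: "\<bar>(\<phi> (x + h n *\<^sub>R ?e) - \<phi> x) / h n\<bar> \<le> M * indicat_real (cball 0 (R + 1)) x" for n x
  proof -
    obtain z where z: "0 < z" "z < h n" "\<phi> (x + h n *\<^sub>R ?e) - \<phi> x = h n * partial i \<phi> (x + z *\<^sub>R ?e)"
      using mvt by blast
    then have q: "(\<phi> (x + h n *\<^sub>R ?e) - \<phi> x) / h n = partial i \<phi> (x + z *\<^sub>R ?e)" using h[of n] by simp
    show ?thesis
    proof (cases "x \<in> cball 0 (R + 1)")
      case False
      have "norm x \<le> norm (x + z *\<^sub>R ?e) + norm (z *\<^sub>R ?e)"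
        using norm_triangle_ineq4[of "x + z *\<^sub>R ?e" "z *\<^sub>R ?e"] by simp
      then have "norm (x + z *\<^sub>R ?e) > R" using False z h(2)[of n] by simp
      then have "partial i \<phi> (x + z *\<^sub>R ?e) = 0" using MR(4) by force
      then show ?thesis unfolding q using MR(1) by (simp add: indicator_def)
    next
      case True
      then show ?thesis unfolding q using MR(2) by simp
    qed
  qed
  have zero: "(LINT x|lborel. (\<phi> (x + h n *\<^sub>R ?e) - \<phi> x) / h n) = 0" for n
  proof -
    have i: "integrable lborel \<phi>" by (rule test_functions_integrable[OF p])
    have "(LINT x|lborel. \<phi> (x + h n *\<^sub>R ?e) - \<phi> x) = 0"
      using lborel_translate[of \<phi> "h n *\<^sub>R ?e"] lborel_translate_integrable[OF i, of "h n *\<^sub>R ?e"] i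
      by (simp add: add.commute)
    then show ?thesis by simp
  qed
  have "(\<lambda>n. LINT x|lborel. (\<phi> (x + h n *\<^sub>R ?e) - \<phi> x) / h n) \<longlonglongrightarrow> (LINT x|lborel. partial i \<phi> x)"
  proof (rule integral_dominated_convergence)
    show "integrable lborel (\<lambda>x. M * indicat_real (cball (0::R3) (R + 1)) x)"
      using emeasure_lborel_cball_finite[of "0::R3" "R + 1"]
      by (intro integrable_mult_right integrable_real_indicator) auto
    show "AE x in lborel. norm ((\<phi> (x + h n *\<^sub>R ?e) - \<phi> x) / h n) \<le> M * indicat_real (cball 0 (R + 1)) x" for n
      using bound by simp
    have "(\<lambda>n. (\<phi> (x + h n *\<^sub>R ?e) - \<phi> x) / h n) \<longlonglongrightarrow> partial i \<phi> x" for x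
    proof -
      have "((\<lambda>t. (\<phi> (x + t *\<^sub>R ?e) - \<phi> (x + 0 *\<^sub>R ?e)) / (t - 0)) \<longlongrightarrow> partial i \<phi> (x + 0 *\<^sub>R ?e)) (at 0)"
        using smooth_line_derivative[OF sm, of x i 0] unfolding has_field_derivative_iff .
      then have "((\<lambda>t. (\<phi> (x + t *\<^sub>R ?e) - \<phi> x) / t) \<longlongrightarrow> partial i \<phi> x) (at 0)" by simp
      moreover have "filterlim h (at 0) sequentially"
        using h0 h(1) by (auto simp: filterlim_at intro!: always_eventually) (metis less_irrefl)
      ultimately show ?thesis by (rule filterlim_compose)
    qed
    then show "AE x in lborel. (\<lambda>n. (\<phi> (x + h n *\<^sub>R ?e) - \<phi> x) / h n) \<longlonglongrightarrow> partial i \<phi> x" by simp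
  qed measurable
  then show ?thesis unfolding zero by (simp add: LIMSEQ_const_iff)
qed

lemma smooth_test_mult:
  assumes "smooth g" "\<phi> \<in> test_functions UNIV"
  shows "(\<lambda>x. g x * \<phi> x) \<in> test_functions UNIV"
  by (rule test_functions_UNIV_I)
     (use assms test_functions_support_bounded[OF assms(2)] in
      \<open>auto simp: smooth_def test_functionsD intro!: Ck_mult elim: bounded_subset\<close>)

lemma smooth_test_parts:
  assumes g: "smooth g" and p: "\<phi> \<in> test_functions UNIV"
  shows "(LINT x|lborel. g x * partial i \<phi> x) = - (LINT x|lborel. partial i g x * \<phi> x)"
proof -
  have "partial i (\<lambda>x. g x * \<phi> x) x = g x * partial i \<phi> x + partial i g x * \<phi> x" for x
    by (rule partial_mult[OF g test_smooth[OF p]])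
  then have "(LINT x|lborel. g x * partial i \<phi> x + partial i g x * \<phi> x) = 0"
    using test_partial_integral_zero[OF smooth_test_mult[OF g p], of i] by simp
  moreover have "integrable lborel (\<lambda>x. g x * partial i \<phi> x)" "integrable lborel (\<lambda>x. partial i g x * \<phi> x)"
    by (intro test_functions_integrable smooth_test_mult smooth_partial test_functions_partial g p)+
  ultimately show ?thesis by simp
qed

text \<open>Equal to 1 up to radius \<open>n + 1\<close> and to 0 beyond twice that radius. The term
  \<open>x - 0\<close> keeps the shape of \<open>Ck_norm_sq\<close>.\<close>

definition cutoff :: "nat \<Rightarrow> R3 \<Rightarrow> real" where
  "cutoff n x = step (3 - (1 / (real (Suc n))\<^sup>2) * (norm (x - 0))\<^sup>2)"

lemma cutoff_test: "cutoff n \<in> test_functions UNIV"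
proof (rule test_functions_UNIV_I)
  show "Ck k (cutoff n)" for k
    unfolding cutoff_def by (intro Ck_step Ck_diff Ck_const Ck_mult Ck_norm_sq)
  have "norm x \<le> 2 * real (Suc n)" if "cutoff n x \<noteq> 0" for x
  proof (rule ccontr)
    assume "\<not> norm x \<le> 2 * real (Suc n)"
    then have "(2 * real (Suc n))\<^sup>2 \<le> (norm x)\<^sup>2" by (intro power_mono) auto
    moreover have "2 * (real (Suc n))\<^sup>2 \<le> (2 * real (Suc n))\<^sup>2"
      unfolding power_mult_distrib by (intro mult_right_mono) auto
    ultimately have "2 * (real (Suc n))\<^sup>2 \<le> (norm x)\<^sup>2" by linarith
    then have "cutoff n x = 0" unfolding cutoff_def by (intro step_0) (simp add: field_simps)
    with that show False by simp
  qed
  then show "bounded {x. cutoff n x \<noteq> 0}" by (auto simp: bounded_iff)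
qed

lemma cutoff_bounds: "0 \<le> cutoff n x" "cutoff n x \<le> 1"
  by (simp_all add: cutoff_def step_nonneg step_le_1)

lemma cutoff_tendsto: "(\<lambda>n. cutoff n x) \<longlonglongrightarrow> 1"
proof (rule tendsto_eventually, rule eventually_sequentiallyI[of "nat \<lceil>norm x\<rceil>"])
  fix n assume "nat \<lceil>norm x\<rceil> \<le> n"
  then have "norm x \<le> real (Suc n)" by linarith
  then have "(norm x)\<^sup>2 \<le> (real (Suc n))\<^sup>2" by (intro power_mono) auto
  then show "cutoff n x = 1" unfolding cutoff_def by (intro step_1) (simp add: field_simps)
qed

text \<open>All cut-offs are one profile rescaled by \<open>n + 1\<close>, so their gradients decay
  like the reciprocal. The derivative of the profile vanishes beyond radius
  \<open>2 * (n + 1)\<close>, and below it \<open>\<bar>x $ i\<bar>\<close> is at most that radius;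
  this gives the constant \<open>4 * M\<close>.\<close>

lemma cutoff_partial_bound:
  obtains M where "M > 0" "\<And>n x i. \<bar>partial i (cutoff n) x\<bar> \<le> M / real (Suc n)"
proof -
  obtain M where M: "M > 0" "\<And>t. \<bar>deriv step t\<bar> \<le> M" using deriv_step_bounded by metis
  have "\<bar>partial i (cutoff n) x\<bar> \<le> 4 * M / real (Suc n)" for n x i
  proof -
    let ?N = "real (Suc n)"
    let ?s = "3 - (1 / ?N\<^sup>2) * (x \<bullet> x)"
    have d: "((\<lambda>x::R3. 3 - c * (x \<bullet> x)) has_derivative (\<lambda>h. - (c * (2 * (x \<bullet> h))))) (at x)" for c
      by (auto intro!: derivative_eq_intros simp: inner_commute)
    have "((\<lambda>x. step (3 - (1 / ?N\<^sup>2) * (x \<bullet> x))) has_derivative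
        (\<lambda>h. - ((1 / ?N\<^sup>2) * (2 * (x \<bullet> h))) * deriv step ?s)) (at x)"
      using has_derivative_compose[OF d[of "1 / ?N\<^sup>2"] step_DERIV[unfolded has_field_derivative_def]]
      by (simp only: mult.commute)
    then have "frechet_derivative (\<lambda>x. step (3 - (1 / ?N\<^sup>2) * (x \<bullet> x))) (at x)
      = (\<lambda>h. - ((1 / ?N\<^sup>2) * (2 * (x \<bullet> h))) * deriv step ?s)"
      by (rule frechet_derivative_at[symmetric])
    moreover have "cutoff n = (\<lambda>x. step (3 - (1 / ?N\<^sup>2) * (x \<bullet> x)))"
      by (auto simp: cutoff_def power2_norm_eq_inner)
    ultimately have e: "partial i (cutoff n) x = - ((1 / ?N\<^sup>2) * (2 * x $ i)) * deriv step ?s"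
      by (simp add: inner_axis)
    show ?thesis
    proof (cases "norm x \<le> 2 * ?N")
      case True
      have xi: "\<bar>x $ i\<bar> \<le> 2 * ?N" using component_le_norm_cart[of x i] True by linarith
      have "\<bar>partial i (cutoff n) x\<bar> = (1 / ?N\<^sup>2) * (2 * \<bar>x $ i\<bar>) * \<bar>deriv step ?s\<bar>"
        unfolding e by (simp add: abs_mult)
      also have "\<dots> \<le> (1 / ?N\<^sup>2) * (2 * (2 * ?N)) * M"
        by (intro mult_mono mult_nonneg_nonneg mult_left_mono xi M(2)) auto
      also have "\<dots> = 4 * M / ?N"
      proof -
        have "(1 / N\<^sup>2) * (2 * (2 * N)) * M = 4 * M / N" if "N > 0" for N :: real
          using that by (simp add: power2_eq_square)
        from this[of ?N] show ?thesis by simp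
      qed
      finally show ?thesis .
    next
      case False
      then have "(2 * ?N)\<^sup>2 < (norm x)\<^sup>2" by (intro power_strict_mono) auto
      moreover have "2 * ?N\<^sup>2 \<le> (2 * ?N)\<^sup>2"
        unfolding power_mult_distrib by (intro mult_right_mono) auto
      ultimately have "2 * ?N\<^sup>2 < x \<bullet> x" unfolding power2_norm_eq_inner by linarith
      then have "?s < 1" by (simp add: field_simps)
      then have "deriv step ?s = 0" by (intro deriv_step_0) auto
      then show ?thesis unfolding e using M(1) by simp
    qed
  qed
  then show thesis by (intro that[of "4 * M"]) (use M in auto)
qed

text \<open>For \<open>u = 1\<close> and \<open>g = 0\<close> this is the vanishing of the integral of a derivative; for a weak
  derivative \<open>g\<close> of \<open>u\<close> it enlarges the class of test functions.\<close>

lemma integration_by_parts_noncompact: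
  assumes parts: "\<And>\<phi>. \<phi> \<in> test_functions UNIV \<Longrightarrow>
      (LINT x|lebesgue. u x * partial i \<phi> x) = - (LINT x|lebesgue. g x * \<phi> x)"
    and m: "u \<in> borel_measurable lebesgue" "g \<in> borel_measurable lebesgue"
    and \<psi>: "smooth \<psi>"
    and int: "integrable lebesgue (\<lambda>x. u x * \<psi> x)" "integrable lebesgue (\<lambda>x. u x * partial i \<psi> x)"
      "integrable lebesgue (\<lambda>x. g x * \<psi> x)"
  shows "(LINT x|lebesgue. u x * partial i \<psi> x) = - (LINT x|lebesgue. g x * \<psi> x)"
proof -
  obtain M where M: "M > 0" "\<And>n x i. \<bar>partial i (cutoff n) x\<bar> \<le> M / real (Suc n)"
    using cutoff_partial_bound by metis
  note sc = test_smooth[OF cutoff_test]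
  have [measurable]: "\<psi> \<in> borel_measurable lebesgue" "partial i \<psi> \<in> borel_measurable lebesgue"
    "cutoff n \<in> borel_measurable lebesgue" "partial i (cutoff n) \<in> borel_measurable lebesgue" for n
    using \<psi> sc by (auto intro!: borel_lebesgue smooth_borel smooth_partial)
  note [measurable] = m
  have Mn: "M / real (Suc n) \<le> M" for n using M(1) by (simp add: field_simps)
  have i1: "integrable lebesgue (\<lambda>x. u x * (\<psi> x * partial i (cutoff n) x))" for n
  proof (rule Bochner_Integration.integrable_bound[OF integrable_mult_right[OF int(1), of M]])
    show "AE x in lebesgue. norm (u x * (\<psi> x * partial i (cutoff n) x)) \<le> norm (M * (u x * \<psi> x))"
    proof (rule AE_I2)
      fix x
      have "\<bar>partial i (cutoff n) x\<bar> \<le> \<bar>M\<bar>" using M(2)[of n x i] Mn[of n] by linarith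
      then have "\<bar>u x * \<psi> x\<bar> * \<bar>partial i (cutoff n) x\<bar> \<le> \<bar>u x * \<psi> x\<bar> * \<bar>M\<bar>" by (intro mult_left_mono) auto
      then show "norm (u x * (\<psi> x * partial i (cutoff n) x)) \<le> norm (M * (u x * \<psi> x))"
        by (simp add: abs_mult mult_ac)
    qed
  qed measurable
  have i2: "integrable lebesgue (\<lambda>x. u x * (partial i \<psi> x * cutoff n x))" for n
  proof (rule Bochner_Integration.integrable_bound[OF int(2)])
    show "AE x in lebesgue. norm (u x * (partial i \<psi> x * cutoff n x)) \<le> norm (u x * partial i \<psi> x)"
      using cutoff_bounds[of n] by (auto simp: abs_mult mult.assoc[symmetric] intro!: mult_left_le)
  qed measurable
  \<comment> \<open>The identity for the test function \<open>\<psi> * cutoff n\<close>. After the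
    product rule only the term carrying the derivative of the cut-off has to disappear in the
    limit.\<close>
  have eq: "(LINT x|lebesgue. u x * (\<psi> x * partial i (cutoff n) x)) + (LINT x|lebesgue. u x * (partial i \<psi> x * cutoff n x))
     = - (LINT x|lebesgue. g x * (\<psi> x * cutoff n x))" for n
    unfolding Bochner_Integration.integral_add[OF i1 i2, symmetric]
    using parts[OF smooth_test_mult[OF \<psi> cutoff_test[of n]]]
    by (simp add: partial_mult[OF \<psi> sc] ring_distribs)
  have "(\<lambda>n. LINT x|lebesgue. u x * (\<psi> x * partial i (cutoff n) x)) \<longlonglongrightarrow> (LINT x|(lebesgue::R3 measure). 0)"
  proof (rule integral_dominated_convergence)
    show "integrable lebesgue (\<lambda>x. norm (M * (u x * \<psi> x)))" using int(1) by (intro integrable_norm integrable_mult_right)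
    show "AE x in lebesgue. norm (u x * (\<psi> x * partial i (cutoff n) x)) \<le> norm (M * (u x * \<psi> x))" for n
    proof (rule AE_I2)
      fix x
      have "\<bar>partial i (cutoff n) x\<bar> \<le> \<bar>M\<bar>" using M(2)[of n x i] Mn[of n] by linarith
      then have "\<bar>u x * \<psi> x\<bar> * \<bar>partial i (cutoff n) x\<bar> \<le> \<bar>u x * \<psi> x\<bar> * \<bar>M\<bar>" by (intro mult_left_mono) auto
      then show "norm (u x * (\<psi> x * partial i (cutoff n) x)) \<le> norm (M * (u x * \<psi> x))"
        by (simp add: abs_mult mult_ac)
    qed
    have "(\<lambda>n. partial i (cutoff n) x) \<longlonglongrightarrow> 0" for x
    proof (rule Lim_null_comparison)
      show "\<forall>\<^sub>F n in sequentially. norm (partial i (cutoff n) x) \<le> M * (1 / real (Suc n))" using M(2) by auto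
      show "(\<lambda>n. M * (1 / real (Suc n))) \<longlonglongrightarrow> 0"
        using tendsto_mult_right_zero[OF LIMSEQ_Suc[OF lim_1_over_n]] .
    qed
    then show "AE x in lebesgue. (\<lambda>n. u x * (\<psi> x * partial i (cutoff n) x)) \<longlonglongrightarrow> 0"
      by (auto intro!: tendsto_mult_right_zero)
  qed measurable
  moreover have "(\<lambda>n. LINT x|lebesgue. u x * (partial i \<psi> x * cutoff n x)) \<longlonglongrightarrow> (LINT x|lebesgue. u x * partial i \<psi> x)"
  proof (rule integral_dominated_convergence)
    show "integrable lebesgue (\<lambda>x. norm (u x * partial i \<psi> x))" using int(2) by (rule integrable_norm)
    show "AE x in lebesgue. norm (u x * (partial i \<psi> x * cutoff n x)) \<le> norm (u x * partial i \<psi> x)" for n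
      using cutoff_bounds[of n] by (auto simp: abs_mult mult.assoc[symmetric] intro!: mult_left_le)
    show "AE x in lebesgue. (\<lambda>n. u x * (partial i \<psi> x * cutoff n x)) \<longlonglongrightarrow> u x * partial i \<psi> x"
      using tendsto_mult[OF tendsto_const tendsto_mult[OF tendsto_const cutoff_tendsto]] by simp
  qed measurable
  moreover have "(\<lambda>n. LINT x|lebesgue. g x * (\<psi> x * cutoff n x)) \<longlonglongrightarrow> (LINT x|lebesgue. g x * \<psi> x)"
  proof (rule integral_dominated_convergence)
    show "integrable lebesgue (\<lambda>x. norm (g x * \<psi> x))" using int(3) by (rule integrable_norm)
    show "AE x in lebesgue. norm (g x * (\<psi> x * cutoff n x)) \<le> norm (g x * \<psi> x)" for n
      using cutoff_bounds[of n] by (auto simp: abs_mult mult.assoc[symmetric] intro!: mult_left_le)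
    show "AE x in lebesgue. (\<lambda>n. g x * (\<psi> x * cutoff n x)) \<longlonglongrightarrow> g x * \<psi> x"
      using tendsto_mult[OF tendsto_const tendsto_mult[OF tendsto_const cutoff_tendsto]] by simp
  qed measurable
  ultimately have "(\<lambda>n. (LINT x|lebesgue. u x * (\<psi> x * partial i (cutoff n) x)) + (LINT x|lebesgue. u x * (partial i \<psi> x * cutoff n x)))
       \<longlonglongrightarrow> (LINT x|(lebesgue::R3 measure). 0) + (LINT x|lebesgue. u x * partial i \<psi> x)
     \<and> (\<lambda>n. - (LINT x|lebesgue. g x * (\<psi> x * cutoff n x))) \<longlonglongrightarrow> - (LINT x|lebesgue. g x * \<psi> x)"
    by (intro conjI tendsto_add tendsto_minus)
  then have l: "(\<lambda>n. (LINT x|lebesgue. u x * (\<psi> x * partial i (cutoff n) x)) + (LINT x|lebesgue. u x * (partial i \<psi> x * cutoff n x)))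
       \<longlonglongrightarrow> (LINT x|(lebesgue::R3 measure). 0) + (LINT x|lebesgue. u x * partial i \<psi> x)"
     and r: "(\<lambda>n. - (LINT x|lebesgue. g x * (\<psi> x * cutoff n x))) \<longlonglongrightarrow> - (LINT x|lebesgue. g x * \<psi> x)"
    by auto
  from LIMSEQ_unique[OF l r[folded eq]] show ?thesis by simp
qed

section \<open>Integrals of radial functions\<close>

text \<open>A layer-cake formula in place of polar coordinates: \<open>F (norm z)\<close> is the
  integral of \<open>k\<close> over all \<open>s \<ge> norm z\<close>, and by Tonelli the inner
  integral over \<open>z\<close> becomes the volume of the ball of radius \<open>s\<close>.\<close>

lemma nn_integral_radial:
  fixes F k :: "real \<Rightarrow> real"
  assumes k[measurable]: "k \<in> borel_measurable borel" and k0: "\<And>s. s > 0 \<Longrightarrow> 0 \<le> k s"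
    and F: "\<And>r. r > 0 \<Longrightarrow> (\<integral>\<^sup>+s. ennreal (k s) * indicator {r..} s \<partial>lborel) = ennreal (F r)"
  shows "(\<integral>\<^sup>+(z::R3). ennreal (F (norm z)) \<partial>lborel) = (\<integral>\<^sup>+s. ennreal (4/3 * pi * (k s * s^3)) * indicator {0..} s \<partial>lborel)"
proof -
  have "(\<integral>\<^sup>+(z::R3). ennreal (F (norm z)) \<partial>lborel)
     = (\<integral>\<^sup>+(z::R3). (\<integral>\<^sup>+s. ennreal (k s) * indicator {norm z..} s * indicator {0<..} s \<partial>lborel) \<partial>lborel)"
  proof (rule nn_integral_cong_AE)
    have "AE z in (lborel::R3 measure). z \<noteq> 0" by (rule AE_lborel_singleton)
    then show "AE z in (lborel::R3 measure). ennreal (F (norm z)) = (\<integral>\<^sup>+s. ennreal (k s) * indicator {norm z..} s * indicator {0<..} s \<partial>lborel)"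
    proof eventually_elim
      case (elim z)
      then have "norm z > 0" by simp
      then show ?case
        unfolding F[OF \<open>norm z > 0\<close>, symmetric]
      proof (intro nn_integral_cong)
        fix s
        have "0 < s" if "norm z \<le> s" using that \<open>norm z > 0\<close> by linarith
        then show "ennreal (k s) * indicator {norm z..} s = ennreal (k s) * indicator {norm z..} s * indicator {0<..} s"
          by (auto simp: indicator_def)
      qed
    qed
  qed
  also have "\<dots> = (\<integral>\<^sup>+s. (\<integral>\<^sup>+(z::R3). ennreal (k s) * indicator {norm z..} s * indicator {0<..} s \<partial>lborel) \<partial>lborel)"
  proof (rule lborel_pair.Fubini'[symmetric])
    have "{x::R3 \<times> real. norm (fst x) \<le> snd x} \<in> sets borel"
      by (intro borel_closed closed_Collect_le continuous_intros)
    then have [measurable]: "{x::R3 \<times> real. norm (fst x) \<le> snd x} \<in> sets (lborel \<Otimes>\<^sub>M lborel)"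
      unfolding lborel_prod by simp
    have "(\<lambda>(z::R3, s). ennreal (k s) * indicator {norm z..} s * indicator {0<..} s)
      = (\<lambda>x. ennreal (k (snd x)) * indicator {x::R3 \<times> real. norm (fst x) \<le> snd x} x * indicator {0<..} (snd x))"
      by (auto simp: indicator_def fun_eq_iff)
    also have "\<dots> \<in> borel_measurable (lborel \<Otimes>\<^sub>M lborel)" by measurable
    finally show "case_prod (\<lambda>(z::R3) s. ennreal (k s) * indicator {norm z..} s * indicator {0<..} s) \<in> borel_measurable (lborel \<Otimes>\<^sub>M lborel)" .
  qed
  also have "\<dots> = (\<integral>\<^sup>+s. ennreal (4/3 * pi * (k s * s^3)) * indicator {0..} s \<partial>lborel)"
  proof (rule nn_integral_cong)
    fix s :: real
    have "(\<integral>\<^sup>+(z::R3). ennreal (k s) * indicator {norm z..} s * indicator {0<..} s \<partial>lborel)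
       = (\<integral>\<^sup>+(z::R3). ennreal (k s) * indicator {0<..} s * indicator (cball 0 s) z \<partial>lborel)"
      by (intro nn_integral_cong) (auto simp: indicator_def)
    also have "\<dots> = ennreal (k s) * indicator {0<..} s * emeasure lborel (cball (0::R3) s)"
      by (rule nn_integral_cmult_indicator) auto
    also have "\<dots> = ennreal (4/3 * pi * (k s * s^3)) * indicator {0..} s"
    proof (cases "s > 0")
      case True
      then have "emeasure lborel (cball (0::R3) s) = ennreal (4/3 * pi * s^3)"
        by (subst emeasure_cball) (auto simp: unit_ball_vol_numeral fact_numeral)
      then show ?thesis using True k0[OF True]
        by (simp add: ennreal_mult'[symmetric] ennreal_mult''[symmetric] mult_ac)
    qed (auto simp: indicator_def)
    finally show "(\<integral>\<^sup>+(z::R3). ennreal (k s) * indicator {norm z..} s * indicator {0<..} s \<partial>lborel)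
      = ennreal (4/3 * pi * (k s * s^3)) * indicator {0..} s" .
  qed
  finally show ?thesis .
qed

text \<open>The kernel \<open>?k\<close> is minus the derivative of
  \<open>exp (- a * s) / s\<^sup>2\<close>. The radial integral that remains has an elementary
  antiderivative. The result is the integrability of the majorant \<open>kap\<close> for all
  regularised kernels.\<close>

lemma nn_integral_inverse_square_exp:
  assumes a: "a > 0"
  shows "(\<integral>\<^sup>+(z::R3). ennreal (exp (- a * norm z) / (norm z)\<^sup>2) \<partial>lborel) = ennreal (4 * pi / a)"
proof -
  let ?k = "\<lambda>s::real. (2 / s^3 + a / s\<^sup>2) * exp (- a * s)"
  have "(\<integral>\<^sup>+(z::R3). ennreal (exp (- a * norm z) / (norm z)\<^sup>2) \<partial>lborel)
     = (\<integral>\<^sup>+s. ennreal (4/3 * pi * (?k s * s^3)) * indicator {0..} s \<partial>lborel)"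
  proof (rule nn_integral_radial)
    fix r :: real assume r: "r > 0"
    have "(\<integral>\<^sup>+s. ennreal (?k s) * indicator {r..} s \<partial>lborel) = ennreal (0 - (- (exp (- a * r) / r\<^sup>2)))"
    proof (rule nn_integral_FTC_atLeast)
      show "((\<lambda>s. - (exp (- a * s) / s\<^sup>2)) has_real_derivative ?k s) (at s)" if "r \<le> s" for s
        using that r by (auto intro!: derivative_eq_intros simp: field_simps power2_eq_square power3_eq_cube)
      show "((\<lambda>s. - (exp (- a * s) / s\<^sup>2)) \<longlongrightarrow> 0) at_top" using a by real_asymp
      show "0 \<le> ?k s" if "r \<le> s" for s using that r a by auto
    qed measurable
    then show "(\<integral>\<^sup>+s. ennreal (?k s) * indicator {r..} s \<partial>lborel) = ennreal (exp (- a * r) / r\<^sup>2)" by simp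
  qed (use a in auto)
  also have "\<dots> = (\<integral>\<^sup>+s. ennreal (4/3 * pi * ((2 + a * s) * exp (- a * s))) * indicator {0..} s \<partial>lborel)"
  proof (rule nn_integral_cong_AE)
    have "AE s in (lborel::real measure). s \<noteq> 0" by (rule AE_lborel_singleton)
    then show "AE s in lborel. ennreal (4/3 * pi * (?k s * s^3)) * indicator {0..} s =
        ennreal (4/3 * pi * ((2 + a * s) * exp (- a * s))) * indicator {0..} s"
    proof eventually_elim
      case (elim s)
      then have "?k s * s^3 = (2 + a * s) * exp (- a * s)" by (simp add: field_simps power2_eq_square power3_eq_cube)
      then show ?case by (simp only:)
    qed
  qed
  also have "\<dots> = ennreal (0 - (4/3 * pi * (- ((3 / a + 0) * exp (- a * 0)))))"
  proof (rule nn_integral_FTC_atLeast)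
    show "((\<lambda>s. 4/3 * pi * (- ((3 / a + s) * exp (- a * s)))) has_real_derivative 4/3 * pi * ((2 + a * s) * exp (- a * s))) (at s)" for s
      using a by (auto intro!: derivative_eq_intros simp: field_simps)
    show "((\<lambda>s. 4/3 * pi * (- ((3 / a + s) * exp (- a * s)))) \<longlongrightarrow> 0) at_top" using a by real_asymp
    show "0 \<le> 4/3 * pi * ((2 + a * s) * exp (- a * s))" if "0 \<le> s" for s using that a by auto
  qed measurable
  finally show ?thesis by simp
qed

text \<open>The same computation for \<open>exp (- a * s) / s\<close>. Its exact value is the mass
  \<open>1 / \<tau>\<^sup>2\<close> of the Yukawa kernel, and through it the limit mass 1 of the
  approximate identity.\<close>

lemma nn_integral_inverse_exp:
  assumes a: "a > 0"
  shows "(\<integral>\<^sup>+(z::R3). ennreal (exp (- a * norm z) / norm z) \<partial>lborel) = ennreal (4 * pi / a\<^sup>2)"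
proof -
  let ?k = "\<lambda>s::real. (1 / s\<^sup>2 + a / s) * exp (- a * s)"
  have "(\<integral>\<^sup>+(z::R3). ennreal (exp (- a * norm z) / norm z) \<partial>lborel)
     = (\<integral>\<^sup>+s. ennreal (4/3 * pi * (?k s * s^3)) * indicator {0..} s \<partial>lborel)"
  proof (rule nn_integral_radial)
    fix r :: real assume r: "r > 0"
    have "(\<integral>\<^sup>+s. ennreal (?k s) * indicator {r..} s \<partial>lborel) = ennreal (0 - (- (exp (- a * r) / r)))"
    proof (rule nn_integral_FTC_atLeast)
      show "((\<lambda>s. - (exp (- a * s) / s)) has_real_derivative ?k s) (at s)" if "r \<le> s" for s
        using that r by (auto intro!: derivative_eq_intros simp: field_simps power2_eq_square)
      show "((\<lambda>s. - (exp (- a * s) / s)) \<longlongrightarrow> 0) at_top" using a by real_asymp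
      show "0 \<le> ?k s" if "r \<le> s" for s using that r a by auto
    qed measurable
    then show "(\<integral>\<^sup>+s. ennreal (?k s) * indicator {r..} s \<partial>lborel) = ennreal (exp (- a * r) / r)" by simp
  qed (use a in auto)
  also have "\<dots> = (\<integral>\<^sup>+s. ennreal (4/3 * pi * ((s + a * s\<^sup>2) * exp (- a * s))) * indicator {0..} s \<partial>lborel)"
  proof (rule nn_integral_cong_AE)
    have "AE s in (lborel::real measure). s \<noteq> 0" by (rule AE_lborel_singleton)
    then show "AE s in lborel. ennreal (4/3 * pi * (?k s * s^3)) * indicator {0..} s =
        ennreal (4/3 * pi * ((s + a * s\<^sup>2) * exp (- a * s))) * indicator {0..} s"
    proof eventually_elim
      case (elim s)
      then have "?k s * s^3 = (s + a * s\<^sup>2) * exp (- a * s)" by (simp add: field_simps power2_eq_square power3_eq_cube)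
      then show ?case by (simp only:)
    qed
  qed
  also have "\<dots> = ennreal (0 - (4/3 * pi * (- ((0\<^sup>2 + 3 * 0 / a + 3 / a\<^sup>2) * exp (- a * 0)))))"
  proof (rule nn_integral_FTC_atLeast)
    show "((\<lambda>s. 4/3 * pi * (- ((s\<^sup>2 + 3 * s / a + 3 / a\<^sup>2) * exp (- a * s)))) has_real_derivative
        4/3 * pi * ((s + a * s\<^sup>2) * exp (- a * s))) (at s)" for s
      using a by (auto intro!: derivative_eq_intros simp: field_simps power2_eq_square)
    show "((\<lambda>s. 4/3 * pi * (- ((s\<^sup>2 + 3 * s / a + 3 / a\<^sup>2) * exp (- a * s)))) \<longlongrightarrow> 0) at_top" using a by real_asymp
    show "0 \<le> 4/3 * pi * ((s + a * s\<^sup>2) * exp (- a * s))" if "0 \<le> s" for s using that a by auto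
  qed measurable
  finally show ?thesis by simp
qed

section \<open>Convolution\<close>

definition conv :: "(R3 \<Rightarrow> real) \<Rightarrow> (R3 \<Rightarrow> real) \<Rightarrow> R3 \<Rightarrow> real" where
  "conv K f x = (LINT y|lborel. K (x - y) * f y)"

text \<open>Convolution and Fubini take place on the product of two copies of \<open>lborel\<close>,
  where measurability of \<open>f y\<close> as a function of the pair is automatic for Borel
  functions but not for Lebesgue measurable ones. Every element of \<open>L2\<close> is therefore
  first replaced by a Borel representative.\<close>

definition L2b :: "(R3 \<Rightarrow> real) set" where
  "L2b = {f \<in> L2. f \<in> borel_measurable borel}"

lemma L2b_D: "f \<in> L2b \<Longrightarrow> f \<in> L2" "f \<in> L2b \<Longrightarrow> f \<in> borel_measurable borel"
  by (auto simp: L2b_def)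

lemma L2_borel_representative:
  assumes "f \<in> L2"
  obtains f' where "f' \<in> L2b" "AE x in lebesgue. f x = f' x"
proof -
  obtain f' where f': "f' \<in> borel_measurable lborel" "AE x in lborel. f x = f' x"
    using completion_ex_borel_measurable_real[OF L2_measurable[OF assms]] by auto
  then have "AE x in lebesgue. f x = f' x" by (intro AE_completion)
  moreover from L2_AE_cong[OF assms this] f' have "f' \<in> L2b" by (simp add: L2b_def)
  ultimately show thesis by (rule that[rotated])
qed

lemma L2b_diff: "f \<in> L2b \<Longrightarrow> g \<in> L2b \<Longrightarrow> (\<lambda>x. f x - g x) \<in> L2b"
  by (auto simp: L2b_def intro: L2_diff)

lemma test_L2b: "\<phi> \<in> test_functions UNIV \<Longrightarrow> \<phi> \<in> L2b"
  by (simp add: L2b_def test_functions_L2 smooth_borel test_smooth)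

lemma ip_lborel: "f \<in> borel_measurable borel \<Longrightarrow> g \<in> borel_measurable borel \<Longrightarrow> ip f g = (LINT x|lborel. f x * g x)"
  unfolding ip_def by (rule integral_completion) auto

lemma nn_integral_L2b:
  assumes "f \<in> L2b"
  shows "(\<integral>\<^sup>+x. ennreal ((f x)\<^sup>2) \<partial>lborel) = ennreal ((L2_norm f)\<^sup>2)"
  using nn_integral_L2[OF L2b_D(1)[OF assms]] L2b_D(2)[OF assms] by (simp add: nn_integral_completion)

lemma nn_integral_abs: "integrable M K \<Longrightarrow> (\<integral>\<^sup>+x. ennreal \<bar>K x\<bar> \<partial>M) = ennreal (LINT x|M. \<bar>K x :: real\<bar>)"
  by (rule nn_integral_eq_integral) auto

lemma kernel_nn_fst:
  assumes K: "integrable lborel (K :: R3 \<Rightarrow> real)" and g: "g \<in> L2b"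
  shows "(\<integral>\<^sup>+x. (\<integral>\<^sup>+y. ennreal (\<bar>K (x - y)\<bar> * (g x)\<^sup>2) \<partial>lborel) \<partial>lborel) = ennreal ((LINT z|lborel. \<bar>K z\<bar>) * (L2_norm g)\<^sup>2)"
proof -
  have [measurable]: "K \<in> borel_measurable borel" "g \<in> borel_measurable borel" using K L2b_D(2)[OF g] by auto
  let ?k = "LINT z|lborel. \<bar>K z\<bar>"
  have "(\<integral>\<^sup>+y. ennreal (\<bar>K (x - y)\<bar> * (g x)\<^sup>2) \<partial>lborel) = ennreal ?k * ennreal ((g x)\<^sup>2)" for x
  proof -
    have "(\<integral>\<^sup>+y. ennreal (\<bar>K (x - y)\<bar> * (g x)\<^sup>2) \<partial>lborel) = (\<integral>\<^sup>+y. ennreal \<bar>K (x - y)\<bar> \<partial>lborel) * ennreal ((g x)\<^sup>2)"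
      by (simp add: ennreal_mult nn_integral_multc)
    also have "(\<integral>\<^sup>+y. ennreal \<bar>K (x - y)\<bar> \<partial>lborel) = (\<integral>\<^sup>+y. ennreal \<bar>K y\<bar> \<partial>lborel)"
      by (rule lborel_reflect_nn[of "\<lambda>y. ennreal \<bar>K y\<bar>"]) simp
    finally show ?thesis using nn_integral_abs[OF K] by simp
  qed
  then show ?thesis by (simp add: nn_integral_cmult nn_integral_L2b[OF g] ennreal_mult)
qed

lemma kernel_nn_snd:
  assumes K: "integrable lborel (K :: R3 \<Rightarrow> real)" and f: "f \<in> L2b"
  shows "(\<integral>\<^sup>+x. (\<integral>\<^sup>+y. ennreal (\<bar>K (x - y)\<bar> * (f y)\<^sup>2) \<partial>lborel) \<partial>lborel) = ennreal ((LINT z|lborel. \<bar>K z\<bar>) * (L2_norm f)\<^sup>2)"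
proof -
  have [measurable]: "K \<in> borel_measurable borel" "f \<in> borel_measurable borel" using K L2b_D(2)[OF f] by auto
  let ?k = "LINT z|lborel. \<bar>K z\<bar>"
  have "(\<integral>\<^sup>+x. ennreal (\<bar>K (x - y)\<bar> * (f y)\<^sup>2) \<partial>lborel) = ennreal ?k * ennreal ((f y)\<^sup>2)" for y
  proof -
    have "(\<integral>\<^sup>+x. ennreal (\<bar>K (x - y)\<bar> * (f y)\<^sup>2) \<partial>lborel) = (\<integral>\<^sup>+x. ennreal \<bar>K (x - y)\<bar> \<partial>lborel) * ennreal ((f y)\<^sup>2)"
      by (simp add: ennreal_mult nn_integral_multc)
    also have "(\<integral>\<^sup>+x. ennreal \<bar>K (x - y)\<bar> \<partial>lborel) = (\<integral>\<^sup>+y. ennreal \<bar>K y\<bar> \<partial>lborel)"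
      using lborel_translate_nn[of "\<lambda>y. ennreal \<bar>K y\<bar>" "- y"] by simp
    finally show ?thesis using nn_integral_abs[OF K] by simp
  qed
  then have "(\<integral>\<^sup>+y. (\<integral>\<^sup>+x. ennreal (\<bar>K (x - y)\<bar> * (f y)\<^sup>2) \<partial>lborel) \<partial>lborel) = ennreal (?k * (L2_norm f)\<^sup>2)"
    by (simp add: nn_integral_cmult nn_integral_L2b[OF f] ennreal_mult)
  moreover have "(\<integral>\<^sup>+y. (\<integral>\<^sup>+x. ennreal (\<bar>K (x - y)\<bar> * (f y)\<^sup>2) \<partial>lborel) \<partial>lborel)
    = (\<integral>\<^sup>+x. (\<integral>\<^sup>+y. ennreal (\<bar>K (x - y)\<bar> * (f y)\<^sup>2) \<partial>lborel) \<partial>lborel)"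
    by (rule lborel_pair.Fubini') measurable
  ultimately show ?thesis by simp
qed

lemma abs_mult_le_squares: "\<bar>a * b\<bar> \<le> a\<^sup>2 + b\<^sup>2" for a b :: real
proof -
  have "2 * (\<bar>a\<bar> * \<bar>b\<bar>) \<le> \<bar>a\<bar>\<^sup>2 + \<bar>b\<bar>\<^sup>2"
    using zero_le_power2[of "\<bar>a\<bar> - \<bar>b\<bar>"] by (simp only: power2_diff)
  moreover have "0 \<le> \<bar>a\<bar> * \<bar>b\<bar>" by simp
  ultimately show ?thesis unfolding abs_mult power2_abs by linarith
qed

text \<open>Bounding \<open>\<bar>f y * g x\<bar>\<close> by
  \<open>(f y)\<^sup>2 + (g x)\<^sup>2\<close> separates the variables; in each of the two terms the
  free variable is integrated out against \<open>K\<close> first.\<close>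

lemma conv_pair_integrable:
  assumes K: "integrable lborel (K :: R3 \<Rightarrow> real)" and f: "f \<in> L2b" and g: "g \<in> L2b"
  shows "integrable (lborel \<Otimes>\<^sub>M lborel) (\<lambda>(x, y). K (x - y) * f y * g x)"
proof -
  have [measurable]: "K \<in> borel_measurable borel" "f \<in> borel_measurable borel" "g \<in> borel_measurable borel"
    using K L2b_D(2)[OF f] L2b_D(2)[OF g] by auto
  let ?k = "LINT z|lborel. \<bar>K z\<bar>"
  show ?thesis
  proof (rule integrableI_bounded)
    show "(\<lambda>(x, y). K (x - y) * f y * g x) \<in> borel_measurable (lborel \<Otimes>\<^sub>M lborel)" by measurable
    have "(\<integral>\<^sup>+z. ennreal (norm (case z of (x, y) \<Rightarrow> K (x - y) * f y * g x)) \<partial>(lborel \<Otimes>\<^sub>M lborel))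
       = (\<integral>\<^sup>+x. (\<integral>\<^sup>+y. ennreal (norm (K (x - y) * f y * g x)) \<partial>lborel) \<partial>lborel)"
      by (subst lborel.nn_integral_fst[symmetric]) auto
    also have "\<dots> \<le> (\<integral>\<^sup>+x. (\<integral>\<^sup>+y. ennreal (\<bar>K (x - y)\<bar> * (f y)\<^sup>2) + ennreal (\<bar>K (x - y)\<bar> * (g x)\<^sup>2) \<partial>lborel) \<partial>lborel)"
    proof (intro nn_integral_mono)
      fix x y :: R3
      have "\<bar>K (x - y)\<bar> * \<bar>f y * g x\<bar> \<le> \<bar>K (x - y)\<bar> * ((f y)\<^sup>2 + (g x)\<^sup>2)"
        by (intro mult_left_mono abs_mult_le_squares) auto
      then have "norm (K (x - y) * f y * g x) \<le> \<bar>K (x - y)\<bar> * (f y)\<^sup>2 + \<bar>K (x - y)\<bar> * (g x)\<^sup>2"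
        by (simp add: abs_mult algebra_simps)
      from ennreal_leI[OF this]
      show "ennreal (norm (K (x - y) * f y * g x)) \<le> ennreal (\<bar>K (x - y)\<bar> * (f y)\<^sup>2) + ennreal (\<bar>K (x - y)\<bar> * (g x)\<^sup>2)"
        by (subst ennreal_plus[symmetric]) auto
    qed
    also have "\<dots> = ennreal (?k * (L2_norm f)\<^sup>2) + ennreal (?k * (L2_norm g)\<^sup>2)"
      unfolding kernel_nn_fst[OF K g, symmetric] kernel_nn_snd[OF K f, symmetric]
      by (subst nn_integral_add[symmetric]) (auto intro!: nn_integral_cong nn_integral_add)
    also have "\<dots> < \<infinity>" by simp
    finally show "(\<integral>\<^sup>+z. ennreal (norm (case z of (x, y) \<Rightarrow> K (x - y) * f y * g x)) \<partial>(lborel \<Otimes>\<^sub>M lborel)) < \<infinity>" .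
  qed
qed

lemma conv_measurable [measurable]:
  assumes [measurable]: "K \<in> borel_measurable borel" "f \<in> borel_measurable borel"
  shows "conv K f \<in> borel_measurable borel"
proof -
  have "(\<lambda>x. LINT y|lborel. K (x - y) * f y) \<in> borel_measurable borel"
    by (rule lborel.borel_measurable_lebesgue_integral) measurable
  then show ?thesis by (simp add: conv_def[abs_def])
qed

text \<open>Young's inequality, by Cauchy-Schwarz after writing the modulus of the integrand as
  \<open>sqrt \<bar>K\<bar>\<close> times \<open>sqrt \<bar>K\<bar> * \<bar>f\<bar>\<close>. At
  points where the integral does not converge, the default value 0 of the convolution satisfies the
  pointwise bound as well.\<close>

lemma conv_L2:
  assumes K: "integrable lborel (K :: R3 \<Rightarrow> real)" and f: "f \<in> L2b"
  shows "conv K f \<in> L2b" "L2_norm (conv K f) \<le> (LINT z|lborel. \<bar>K z\<bar>) * L2_norm f"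
proof -
  have [measurable]: "K \<in> borel_measurable borel" "f \<in> borel_measurable borel" using K L2b_D(2)[OF f] by auto
  let ?k = "LINT z|lborel. \<bar>K z\<bar>"
  have k: "?k \<ge> 0" by simp
  have pw: "ennreal ((conv K f x)\<^sup>2) \<le> ennreal ?k * (\<integral>\<^sup>+y. ennreal (\<bar>K (x - y)\<bar> * (f y)\<^sup>2) \<partial>lborel)" for x
  proof -
    have "ennreal \<bar>conv K f x\<bar> \<le> (\<integral>\<^sup>+y. ennreal \<bar>K (x - y) * f y\<bar> \<partial>lborel)"
    proof (cases "integrable lborel (\<lambda>y. K (x - y) * f y)")
      case True
      then show ?thesis unfolding conv_def using integral_norm_bound_ennreal[OF True] by simp
    qed (simp add: conv_def not_integrable_integral_eq)
    also have "\<dots> = (\<integral>\<^sup>+y. ennreal (sqrt \<bar>K (x - y)\<bar>) * ennreal (sqrt \<bar>K (x - y)\<bar> * \<bar>f y\<bar>) \<partial>lborel)"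
      by (intro nn_integral_cong) (simp add: ennreal_mult[symmetric] abs_mult mult.assoc[symmetric])
    finally have "(ennreal \<bar>conv K f x\<bar>)\<^sup>2 \<le> (\<integral>\<^sup>+y. ennreal (sqrt \<bar>K (x - y)\<bar>) * ennreal (sqrt \<bar>K (x - y)\<bar> * \<bar>f y\<bar>) \<partial>lborel)\<^sup>2"
      by (intro power_mono) auto
    also have "\<dots> \<le> (\<integral>\<^sup>+y. (ennreal (sqrt \<bar>K (x - y)\<bar>))\<^sup>2 \<partial>lborel) * (\<integral>\<^sup>+y. (ennreal (sqrt \<bar>K (x - y)\<bar> * \<bar>f y\<bar>))\<^sup>2 \<partial>lborel)"
      by (rule Cauchy_Schwarz_nn_integral) measurable
    also have "(\<integral>\<^sup>+y. (ennreal (sqrt \<bar>K (x - y)\<bar>))\<^sup>2 \<partial>lborel) = (\<integral>\<^sup>+y. ennreal \<bar>K (x - y)\<bar> \<partial>lborel)"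
      by (simp add: ennreal_power)
    also have "\<dots> = ennreal ?k"
      using lborel_reflect_nn[of "\<lambda>y. ennreal \<bar>K y\<bar>" x] nn_integral_abs[OF K] by simp
    also have "(\<integral>\<^sup>+y. (ennreal (sqrt \<bar>K (x - y)\<bar> * \<bar>f y\<bar>))\<^sup>2 \<partial>lborel) = (\<integral>\<^sup>+y. ennreal (\<bar>K (x - y)\<bar> * (f y)\<^sup>2) \<partial>lborel)"
      by (simp add: ennreal_power power_mult_distrib)
    finally show ?thesis by (simp add: ennreal_power)
  qed
  have "(\<integral>\<^sup>+x. ennreal ((conv K f x)\<^sup>2) \<partial>lebesgue) = (\<integral>\<^sup>+x. ennreal ((conv K f x)\<^sup>2) \<partial>lborel)"
    by (rule nn_integral_completion) 
  also have "\<dots> \<le> (\<integral>\<^sup>+x. ennreal ?k * (\<integral>\<^sup>+y. ennreal (\<bar>K (x - y)\<bar> * (f y)\<^sup>2) \<partial>lborel) \<partial>lborel)"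
    by (intro nn_integral_mono pw)
  also have "\<dots> = ennreal (?k * (?k * (L2_norm f)\<^sup>2))"
  proof -
    have "(\<integral>\<^sup>+x. ennreal ?k * (\<integral>\<^sup>+y. ennreal (\<bar>K (x - y)\<bar> * (f y)\<^sup>2) \<partial>lborel) \<partial>lborel)
      = ennreal ?k * (\<integral>\<^sup>+x. (\<integral>\<^sup>+y. ennreal (\<bar>K (x - y)\<bar> * (f y)\<^sup>2) \<partial>lborel) \<partial>lborel)"
      by (rule nn_integral_cmult) measurable
    also have "\<dots> = ennreal (?k * (?k * (L2_norm f)\<^sup>2))"
      unfolding kernel_nn_snd[OF K f] using k by (rule ennreal_mult'[symmetric])
    finally show ?thesis .
  qed
  finally have b: "(\<integral>\<^sup>+x. ennreal ((conv K f x)\<^sup>2) \<partial>lebesgue) \<le> ennreal (?k * (?k * (L2_norm f)\<^sup>2))" .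
  have m: "conv K f \<in> borel_measurable lebesgue" by (rule borel_lebesgue) measurable
  have "0 \<le> ?k * (?k * (L2_norm f)\<^sup>2)" using k by (intro mult_nonneg_nonneg) auto
  note L = L2_I[OF m b this]
  show "conv K f \<in> L2b" using L(1) by (simp add: L2b_def)
  have "?k * (?k * (L2_norm f)\<^sup>2) = (?k * L2_norm f)\<^sup>2" by (simp add: power2_eq_square mult_ac)
  then show "L2_norm (conv K f) \<le> ?k * L2_norm f"
    using L(2) k L2_norm_nonneg[of f] by simp
qed

text \<open>For fixed \<open>y\<close> the inner integral pairs a translate of the kernel with
  \<open>g\<close>. This is the place where integration by parts can act, on a smooth function of
  \<open>x\<close>.\<close>

lemma conv_Fubini:
  assumes K: "integrable lborel (K :: R3 \<Rightarrow> real)" and f: "f \<in> L2b" and g: "g \<in> L2b"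
  shows "ip (conv K f) g = (LINT y|lborel. f y * (LINT x|lborel. K (x - y) * g x))"
proof -
  have [measurable]: "K \<in> borel_measurable borel" "f \<in> borel_measurable borel" "g \<in> borel_measurable borel"
    using K L2b_D(2)[OF f] L2b_D(2)[OF g] by auto
  have "ip (conv K f) g = (LINT x|lborel. (LINT y|lborel. K (x - y) * f y * g x))"
    by (subst ip_lborel) (auto simp: conv_def)
  also have "\<dots> = (LINT y|lborel. (LINT x|lborel. K (x - y) * f y * g x))"
    by (rule lborel_pair.Fubini_integral[symmetric]) (rule conv_pair_integrable[OF K f g])
  also have "\<dots> = (LINT y|lborel. f y * (LINT x|lborel. K (x - y) * g x))"
    by (intro Bochner_Integration.integral_cong refl) (simp add: mult_ac flip: integral_mult_right_zero)
  finally show ?thesis .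
qed

lemma ip_conv_bound:
  assumes "integrable lborel (K :: R3 \<Rightarrow> real)" "f \<in> L2b" "g \<in> L2b"
  shows "\<bar>ip (conv K f) g\<bar> \<le> (LINT z|lborel. \<bar>K z\<bar>) * L2_norm f * L2_norm g"
  using ip_Cauchy_Schwarz[OF L2b_D(1)[OF conv_L2(1)[OF assms(1,2)]] L2b_D(1)[OF assms(3)]]
    mult_right_mono[OF conv_L2(2)[OF assms(1,2)] L2_norm_nonneg[of g]] by linarith

lemma ip_conv_pair:
  assumes K: "integrable lborel (K :: R3 \<Rightarrow> real)" and f: "f \<in> L2b" and g: "g \<in> L2b"
  shows "ip (conv K f) g = (LINT (x, y)|(lborel \<Otimes>\<^sub>M lborel). K (x - y) * f y * g x)"
proof -
  have [measurable]: "K \<in> borel_measurable borel" "f \<in> borel_measurable borel" "g \<in> borel_measurable borel"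
    using K L2b_D(2)[OF f] L2b_D(2)[OF g] by auto
  have "ip (conv K f) g = (LINT x|lborel. (LINT y|lborel. K (x - y) * f y * g x))"
    by (subst ip_lborel) (auto simp: conv_def)
  also have "\<dots> = (LINT (x, y)|(lborel \<Otimes>\<^sub>M lborel). K (x - y) * f y * g x)"
    by (rule lborel_pair.integral_fst[OF conv_pair_integrable[OF K f g]])
  finally show ?thesis .
qed

lemma ip_conv_kernel_diff:
  assumes K: "integrable lborel (K :: R3 \<Rightarrow> real)" "integrable lborel K'" and f: "f \<in> L2b" and g: "g \<in> L2b"
  shows "ip (conv (\<lambda>z. K z - K' z) f) g = ip (conv K f) g - ip (conv K' f) g"
  unfolding ip_conv_pair[OF K(1) f g] ip_conv_pair[OF K(2) f g]
    ip_conv_pair[OF Bochner_Integration.integrable_diff[OF K] f g]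
  by (subst Bochner_Integration.integral_diff[symmetric])
     (use conv_pair_integrable[OF _ f g] K in \<open>auto simp: split_beta' algebra_simps\<close>)

lemma ip_conv_left_diff:
  assumes K: "integrable lborel (K :: R3 \<Rightarrow> real)" and f: "f \<in> L2b" "f' \<in> L2b" and g: "g \<in> L2b"
  shows "ip (conv K (\<lambda>z. f z - f' z)) g = ip (conv K f) g - ip (conv K f') g"
  unfolding ip_conv_pair[OF K f(1) g] ip_conv_pair[OF K f(2) g] ip_conv_pair[OF K L2b_diff[OF f] g]
  by (subst Bochner_Integration.integral_diff[symmetric])
     (use conv_pair_integrable[OF K _ g] f in \<open>auto simp: split_beta' algebra_simps\<close>)

lemma ip_conv_tendsto:
  assumes K: "\<And>n::nat. integrable lborel (K n :: R3 \<Rightarrow> real)" "integrable lborel K'"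
    and l: "(\<lambda>n. LINT z|lborel. \<bar>K n z - K' z\<bar>) \<longlonglongrightarrow> 0" and f: "f \<in> L2b" and g: "g \<in> L2b"
  shows "(\<lambda>n. ip (conv (K n) f) g) \<longlonglongrightarrow> ip (conv K' f) g"
proof -
  have "(\<lambda>n. ip (conv (K n) f) g - ip (conv K' f) g) \<longlonglongrightarrow> 0"
  proof (rule Lim_null_comparison)
    show "\<forall>\<^sub>F n in sequentially. norm (ip (conv (K n) f) g - ip (conv K' f) g)
       \<le> (LINT z|lborel. \<bar>K n z - K' z\<bar>) * L2_norm f * L2_norm g"
      using ip_conv_bound[OF Bochner_Integration.integrable_diff[OF K] f g]
      by (simp add: ip_conv_kernel_diff[OF K f g])
    show "(\<lambda>n. (LINT z|lborel. \<bar>K n z - K' z\<bar>) * L2_norm f * L2_norm g) \<longlonglongrightarrow> 0"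
      using l by (auto intro!: tendsto_mult_left_zero)
  qed
  then show ?thesis by (simp add: LIM_zero_iff)
qed

section \<open>The regularised Yukawa kernel\<close>

text \<open>Replacing \<open>norm z\<close> by \<open>sqrt ((norm z)\<^sup>2 + e\<^sup>2)\<close> in the Yukawa kernel gives a smooth kernel whose image
  under \<open>\<tau>\<^sup>2 - \<Delta>\<close> is the nonnegative approximate identity \<open>yrho\<close>.\<close>

definition Rr :: "real \<Rightarrow> R3 \<Rightarrow> real" where
  "Rr e z = sqrt ((norm (z - 0))\<^sup>2 + e\<^sup>2)"

definition yk :: "real \<Rightarrow> real \<Rightarrow> R3 \<Rightarrow> real" where
  "yk \<tau> e z = exp (- \<tau> * Rr e z) * (1 / Rr e z) * (1 / (4 * pi))"

text \<open>With the profile \<open>exp (- \<tau> * s) / (4 * pi * s)\<close> of the kernel,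
  \<open>ykA\<close> is minus its derivative divided by \<open>s\<close>, so that the gradient of
  the kernel is \<open>- ykA\<close> times the position vector; \<open>ykB\<close> is minus the
  derivative of \<open>ykA\<close>.\<close>

definition ykA :: "real \<Rightarrow> real \<Rightarrow> real" where
  "ykA \<tau> s = (\<tau> / s\<^sup>2 + 1 / s^3) * exp (- \<tau> * s) / (4 * pi)"

definition ykB :: "real \<Rightarrow> real \<Rightarrow> real" where
  "ykB \<tau> s = (\<tau>\<^sup>2 / s\<^sup>2 + 3 * \<tau> / s^3 + 3 / s^4) * exp (- \<tau> * s) / (4 * pi)"

definition ykd :: "real \<Rightarrow> real \<Rightarrow> 3 \<Rightarrow> R3 \<Rightarrow> real" where
  "ykd \<tau> e i z = - (ykA \<tau> (Rr e z) * z $ i)"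

definition ykdd :: "real \<Rightarrow> real \<Rightarrow> 3 \<Rightarrow> R3 \<Rightarrow> real" where
  "ykdd \<tau> e i z = ykB \<tau> (Rr e z) * (z $ i)\<^sup>2 / Rr e z - ykA \<tau> (Rr e z)"

definition yrho :: "real \<Rightarrow> real \<Rightarrow> R3 \<Rightarrow> real" where
  "yrho \<tau> e z = e\<^sup>2 * ykB \<tau> (Rr e z) / Rr e z"

lemma Rr_0: "Rr 0 z = norm z"
  by (simp add: Rr_def)

lemma Rr_sq: "(Rr e z)\<^sup>2 = (norm z)\<^sup>2 + e\<^sup>2"
  by (simp add: Rr_def)

lemma Rr_ge_norm: "norm z \<le> Rr e z"
  unfolding Rr_def by (rule real_le_rsqrt) simp

lemma Rr_ge: "e > 0 \<Longrightarrow> e \<le> Rr e z"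
  unfolding Rr_def by (rule real_le_rsqrt) simp

lemma Rr_pos: "e > 0 \<Longrightarrow> Rr e z > 0"
  using Rr_ge[of e z] by linarith

lemma smooth_Rr: assumes "e > 0" shows "smooth (Rr e)"
proof -
  \<comment> \<open>The product of the exponents met when \<open>s powr (1/2)\<close> is
    differentiated \<open>j\<close> times.\<close>
  define c where "c j = (\<Prod>i<j. (1/2 - real i))" for j :: nat
  define H where "H j s = c j * s powr (1/2 - real j)" for j and s :: real
  have "(H j has_real_derivative H (Suc j) s) (at s)" if "s \<in> {0<..}" for j s
  proof -
    have "((\<lambda>s. c j * s powr (1/2 - real j)) has_real_derivative c j * ((1/2 - real j) * s powr ((1/2 - real j) - 1))) (at s)"
      using that by (intro DERIV_cmult has_real_derivative_powr) simp
    moreover have "c j * ((1/2 - real j) * s powr ((1/2 - real j) - 1)) = H (Suc j) s"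
      by (simp add: H_def c_def algebra_simps)
    ultimately show ?thesis unfolding H_def[of j, abs_def] by simp
  qed
  note Hd = this
  have "Ck k (\<lambda>z::R3. H 0 ((norm (z - 0))\<^sup>2 + e\<^sup>2))" for k
  proof (rule Ck_compose[where S = "{0<..}" and H = H and j = 0, OF Hd])
    show "Ck k (\<lambda>z::R3. (norm (z - 0))\<^sup>2 + e\<^sup>2)" by (intro Ck_add Ck_norm_sq Ck_const)
    show "(norm (z - 0))\<^sup>2 + e\<^sup>2 \<in> {0<..}" for z :: R3 using assms by (simp add: add_nonneg_pos)
  qed
  moreover have "H 0 s = sqrt s" if "s \<ge> 0" for s
    using that by (simp add: H_def c_def powr_half_sqrt)
  ultimately show ?thesis by (simp add: smooth_def Rr_def[abs_def])
qed

lemma Ck_exp: "Ck k g \<Longrightarrow> Ck k (\<lambda>x. exp (g x :: real))"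
  using Ck_compose[where S = UNIV and H = "\<lambda>j. exp" and j = 0, of k g] DERIV_exp by blast

lemma smooth_yk: "e > 0 \<Longrightarrow> smooth (yk \<tau> e)"
  unfolding smooth_def yk_def[abs_def]
  using smooth_Rr[unfolded smooth_def] Rr_pos
  by (intro allI Ck_mult Ck_exp Ck_inverse Ck_const) auto

lemma has_derivative_Rr:
  assumes "e > 0"
  shows "(Rr e has_derivative (\<lambda>h. (z \<bullet> h) / Rr e z)) (at z)"
proof -
  have d: "((\<lambda>z::R3. z \<bullet> z + e\<^sup>2) has_derivative (\<lambda>h. 2 * (z \<bullet> h))) (at z)"
    by (auto intro!: derivative_eq_intros simp: inner_commute)
  have p: "z \<bullet> z + e\<^sup>2 > 0" using assms by (simp add: add_nonneg_pos)
  have "((\<lambda>z. sqrt (z \<bullet> z + e\<^sup>2)) has_derivative (\<lambda>h. (inverse (sqrt (z \<bullet> z + e\<^sup>2)) / 2) * (2 * (z \<bullet> h)))) (at z)"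
    using has_derivative_compose[OF d DERIV_real_sqrt[OF p, unfolded has_field_derivative_def]] .
  moreover have "Rr e = (\<lambda>z. sqrt (z \<bullet> z + e\<^sup>2))" unfolding Rr_def[abs_def] power2_norm_eq_inner diff_zero ..
  moreover have "(inverse S / 2) * (2 * a) = a / S" for S a :: real by (simp add: field_simps)
  ultimately show ?thesis by (simp only:)
qed

lemma partial_yk:
  assumes e: "e > 0"
  shows "partial i (yk \<tau> e) = ykd \<tau> e i"
proof
  fix z
  let ?s = "Rr e z"
  have s: "?s > 0" by (rule Rr_pos[OF e])
  have "((\<lambda>s. exp (- \<tau> * s) * (1 / s) * (1 / (4 * pi))) has_real_derivative - (ykA \<tau> ?s * ?s)) (at ?s)"
    using s by (auto intro!: derivative_eq_intros simp: ykA_def field_simps power2_eq_square power3_eq_cube)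
  from has_derivative_compose[OF has_derivative_Rr[OF e] this[unfolded has_field_derivative_def]]
  have "(yk \<tau> e has_derivative (\<lambda>h. - (ykA \<tau> ?s * ?s) * ((z \<bullet> h) / ?s))) (at z)"
    by (simp add: yk_def[abs_def])
  from frechet_derivative_at[OF this, symmetric] show "partial i (yk \<tau> e) z = ykd \<tau> e i z"
    using s by (simp add: ykd_def inner_axis)
qed

lemma partial_ykd:
  assumes e: "e > 0"
  shows "partial i (ykd \<tau> e i) = ykdd \<tau> e i"
proof
  fix z
  let ?s = "Rr e z"
  have s: "?s > 0" by (rule Rr_pos[OF e])
  have "(ykA \<tau> has_real_derivative - ykB \<tau> ?s) (at ?s)"
    unfolding ykA_def[abs_def]
    using s by (auto intro!: derivative_eq_intros simp: ykB_def field_simps power2_eq_square power3_eq_cube power4_eq_xxxx)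
  from has_derivative_compose[OF has_derivative_Rr[OF e] this[unfolded has_field_derivative_def]]
  have 1: "((\<lambda>z. ykA \<tau> (Rr e z)) has_derivative (\<lambda>h. - ykB \<tau> ?s * ((z \<bullet> h) / ?s))) (at z)" .
  have 2: "((\<lambda>z::R3. z $ i) has_derivative (\<lambda>h. h $ i)) (at z)"
    by (rule bounded_linear_imp_has_derivative) (rule bounded_linear_vec_nth)
  have "(ykd \<tau> e i has_derivative (\<lambda>h. - (ykA \<tau> ?s * h $ i + - ykB \<tau> ?s * ((z \<bullet> h) / ?s) * z $ i))) (at z)"
    unfolding ykd_def[abs_def] by (rule has_derivative_minus[OF has_derivative_mult[OF 1 2]])
  from frechet_derivative_at[OF this, symmetric] show "partial i (ykd \<tau> e i) z = ykdd \<tau> e i z"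
    using s by (simp add: ykdd_def inner_axis power2_eq_square)
qed

lemma smooth_ykd: "e > 0 \<Longrightarrow> smooth (ykd \<tau> e i)"
  using smooth_partial[OF smooth_yk] partial_yk by metis

lemma smooth_ykdd: "e > 0 \<Longrightarrow> smooth (ykdd \<tau> e i)"
  using smooth_partial[OF smooth_ykd] partial_ykd by metis

text \<open>For \<open>s = Rr e z\<close> the squared coordinates add up to
  \<open>s\<^sup>2 - e\<^sup>2\<close>. With \<open>s\<^sup>2\<close> alone the two sides of the
  Yukawa equation would cancel, as they do off the origin for the true kernel; what is left over is
  exactly the \<open>e\<^sup>2\<close> term that defines \<open>yrho\<close>.\<close>

lemma yrho_eq:
  assumes e: "e > 0"
  shows "yrho \<tau> e z = \<tau>\<^sup>2 * yk \<tau> e z - (\<Sum>i\<in>UNIV. ykdd \<tau> e i z)"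
proof -
  let ?s = "Rr e z"
  have s: "?s > 0" by (rule Rr_pos[OF e])
  have "(norm z)\<^sup>2 = (\<Sum>i\<in>UNIV. (z $ i)\<^sup>2)"
    unfolding power2_norm_eq_inner inner_vec_def by (simp add: power2_eq_square)
  then have n: "(\<Sum>i\<in>UNIV. (z $ i)\<^sup>2) = ?s\<^sup>2 - e\<^sup>2"
    unfolding Rr_sq by simp
  have "(\<Sum>i\<in>UNIV. ykdd \<tau> e i z) = ykB \<tau> ?s / ?s * (\<Sum>i\<in>UNIV. (z $ i)\<^sup>2) - 3 * ykA \<tau> ?s"
    by (simp add: ykdd_def sum_subtractf sum_distrib_left)
  also have "\<dots> = ykB \<tau> ?s * ?s - yrho \<tau> e z - 3 * ykA \<tau> ?s"
    unfolding n using s by (simp add: yrho_def field_simps power2_eq_square)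
  finally have S: "(\<Sum>i\<in>UNIV. ykdd \<tau> e i z) = ykB \<tau> ?s * ?s - yrho \<tau> e z - 3 * ykA \<tau> ?s" .
  have "ykB \<tau> ?s * ?s - 3 * ykA \<tau> ?s = \<tau>\<^sup>2 * yk \<tau> e z"
    using s by (simp add: ykB_def ykA_def yk_def divide_simps power2_eq_square power3_eq_cube power4_eq_xxxx)
       (simp add: algebra_simps)
  then show ?thesis unfolding S by simp
qed

lemma yrho_nonneg: "e > 0 \<Longrightarrow> \<tau> > 0 \<Longrightarrow> yrho \<tau> e z \<ge> 0"
  using Rr_pos[of e z] by (auto simp: yrho_def ykB_def)

text \<open>A single integrable majorant, uniform in \<open>e\<close>, for the kernel, its gradient
  and the first moment density of \<open>yrho\<close>. Half of the exponential decay is given up to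
  absorb the powers of \<open>\<tau>\<close>.\<close>

definition kap :: "real \<Rightarrow> R3 \<Rightarrow> real" where
  "kap \<tau> z = exp (- (\<tau> / 2) * norm z) / (norm z)\<^sup>2"

lemma kap_nonneg: "0 \<le> kap \<tau> z"
  by (simp add: kap_def)

lemma kap_integrable:
  assumes "\<tau> > 0"
  shows "integrable lborel (kap \<tau>)"
proof (rule integrableI_bounded)
  have "(\<integral>\<^sup>+z. ennreal (norm (kap \<tau> z)) \<partial>lborel) = ennreal (4 * pi / (\<tau> / 2))"
    using nn_integral_inverse_square_exp[of "\<tau> / 2"] assms by (simp add: kap_def)
  then show "(\<integral>\<^sup>+z. ennreal (norm (kap \<tau> z)) \<partial>lborel) < \<infinity>" by simp
  show "kap \<tau> \<in> borel_measurable lborel" unfolding kap_def[abs_def] by measurable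
qed

text \<open>In terms of \<open>x = \<tau> * r\<close> this is
  \<open>x\<^sup>2 + 3 * x + 3 \<le> 25 * exp (x / 2)\<close>. It adds up from
  \<open>x\<^sup>2 \<le> 16 * exp (x / 2)\<close>, \<open>x \<le> 2 * exp (x / 2)\<close> and
  \<open>1 \<le> exp (x / 2)\<close>, since 16 + 6 + 3 = 25.\<close>

lemma kernel_poly_bound:
  fixes r \<tau> :: real
  assumes r: "r > 0" and t: "\<tau> > 0"
  shows "(\<tau>\<^sup>2 + 3 * \<tau> / r + 3 / r\<^sup>2) * exp (- \<tau> * r) \<le> 25 * (exp (- (\<tau> / 2) * r) / r\<^sup>2)"
proof -
  let ?x = "\<tau> * r"
  have x: "?x > 0" using r t by simp
  have e1: "?x / 4 \<le> exp (?x / 4)" using exp_ge_add_one_self[of "?x / 4"] by linarith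
  then have "(?x / 4)\<^sup>2 \<le> (exp (?x / 4))\<^sup>2" using x by (intro power_mono) auto
  then have 2: "?x\<^sup>2 \<le> 16 * exp (?x / 2)" by (simp add: power_divide exp_double[symmetric])
  have 1: "?x \<le> 2 * exp (?x / 2)" using exp_ge_add_one_self[of "?x / 2"] by linarith
  have 0: "1 \<le> exp (?x / 2)" using x by simp
  have "?x\<^sup>2 + 3 * ?x + 3 \<le> 25 * exp (?x / 2)" using 0 1 2 by linarith
  then have "(?x\<^sup>2 + 3 * ?x + 3) * exp (- \<tau> * r) \<le> 25 * exp (?x / 2) * exp (- \<tau> * r)" by (intro mult_right_mono) auto
  also have "25 * exp (?x / 2) * exp (- \<tau> * r) = 25 * exp (- (\<tau> / 2) * r)" by (simp add: exp_add[symmetric])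
  finally have "(?x\<^sup>2 + 3 * ?x + 3) * exp (- \<tau> * r) / r\<^sup>2 \<le> 25 * exp (- (\<tau> / 2) * r) / r\<^sup>2"
    by (intro divide_right_mono) auto
  moreover have "(?x\<^sup>2 + 3 * ?x + 3) * exp (- \<tau> * r) / r\<^sup>2 = (\<tau>\<^sup>2 + 3 * \<tau> / r + 3 / r\<^sup>2) * exp (- \<tau> * r)"
    using r by (simp add: field_simps power2_eq_square)
  ultimately show ?thesis by simp
qed

lemma pi4_ge: "a \<ge> 0 \<Longrightarrow> a / (4 * pi) \<le> a"
proof -
  assume "a \<ge> 0"
  moreover have "4 * pi \<ge> 1" using pi_ge_two by linarith
  ultimately have "a * 1 \<le> a * (4 * pi)" by (intro mult_left_mono)
  then show ?thesis by (simp add: field_simps)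
qed

lemma poly_exp_antimono:
  fixes r s \<tau> a b c :: real
  assumes "0 < r" "r \<le> s" "\<tau> > 0" "0 \<le> a" "0 \<le> b" "0 \<le> c"
  shows "(a + b / s + c / s\<^sup>2) * exp (- \<tau> * s) \<le> (a + b / r + c / r\<^sup>2) * exp (- \<tau> * r)"
proof (rule mult_mono)
  have "b / s \<le> b / r" using assms by (intro divide_left_mono) auto
  moreover have "c / s\<^sup>2 \<le> c / r\<^sup>2" using assms by (intro divide_left_mono power_mono) auto
  ultimately show "a + b / s + c / s\<^sup>2 \<le> a + b / r + c / r\<^sup>2" by simp
qed (use assms in auto)

text \<open>Each quantity reduces to \<open>(a + b / s + c / s\<^sup>2) * exp (- \<tau> * s)\<close>
  at \<open>s = Rr e z\<close>, with coefficients below those of \<open>kernel_poly_bound\<close>,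
  and this expression decreases as \<open>s\<close> grows from \<open>norm z\<close>. The first two
  bounds include the limit kernel at \<open>e = 0\<close>; in the third the factor
  \<open>e\<^sup>2\<close> is replaced by the larger \<open>s\<^sup>2\<close>.\<close>

lemma yk_kap:
  assumes z: "z \<noteq> 0" and t: "\<tau> > 0"
  shows "\<bar>yk \<tau> e z\<bar> \<le> (25 / \<tau>) * kap \<tau> z"
    and "\<bar>ykd \<tau> e i z\<bar> \<le> 25 * kap \<tau> z"
    and "0 < e \<Longrightarrow> \<bar>yrho \<tau> e z * norm z\<bar> \<le> 25 * kap \<tau> z"
proof -
  let ?s = "Rr e z" and ?r = "norm z"
  have r: "?r > 0" using z by simp
  have s: "?r \<le> ?s" by (rule Rr_ge_norm)
  then have s0: "?s > 0" using r by linarith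
  have K: "(\<tau>\<^sup>2 + 3 * \<tau> / ?r + 3 / ?r\<^sup>2) * exp (- \<tau> * ?r) \<le> 25 * kap \<tau> z"
    using kernel_poly_bound[OF r t] by (simp add: kap_def)
  have P: "(a + b / ?s + c / ?s\<^sup>2) * exp (- \<tau> * ?s) \<le> 25 * kap \<tau> z"
    if "0 \<le> a" "0 \<le> b" "0 \<le> c" "a \<le> \<tau>\<^sup>2" "b \<le> 3 * \<tau>" "c \<le> 3" for a b c
  proof -
    have "(a + b / ?s + c / ?s\<^sup>2) * exp (- \<tau> * ?s) \<le> (\<tau>\<^sup>2 + 3 * \<tau> / ?s + 3 / ?s\<^sup>2) * exp (- \<tau> * ?s)"
      using that s0 by (intro mult_right_mono add_mono divide_right_mono) auto
    also have "\<dots> \<le> (\<tau>\<^sup>2 + 3 * \<tau> / ?r + 3 / ?r\<^sup>2) * exp (- \<tau> * ?r)"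
      by (rule poly_exp_antimono[OF r s t]) (use t in auto)
    finally show ?thesis using K by linarith
  qed
  have "\<bar>yk \<tau> e z\<bar> = (1 / \<tau>) * ((0 + \<tau> / ?s + 0 / ?s\<^sup>2) * exp (- \<tau> * ?s)) / (4 * pi)"
    using s0 t by (simp add: yk_def)
  also have "\<dots> \<le> (1 / \<tau>) * ((0 + \<tau> / ?s + 0 / ?s\<^sup>2) * exp (- \<tau> * ?s))"
    using s0 t by (intro pi4_ge) auto
  also have "\<dots> \<le> (1 / \<tau>) * (25 * kap \<tau> z)" using t by (intro mult_left_mono P) auto
  finally show "\<bar>yk \<tau> e z\<bar> \<le> (25 / \<tau>) * kap \<tau> z" by simp
  have A: "ykA \<tau> ?s \<ge> 0" using s0 t by (simp add: ykA_def)
  have "\<bar>ykd \<tau> e i z\<bar> = ykA \<tau> ?s * \<bar>z $ i\<bar>" using A by (simp add: ykd_def abs_mult)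
  also have "\<dots> \<le> ykA \<tau> ?s * ?s"
    using A s component_le_norm_cart[of z i] by (intro mult_left_mono) auto
  also have "\<dots> = ((0 + \<tau> / ?s + 1 / ?s\<^sup>2) * exp (- \<tau> * ?s)) / (4 * pi)"
    using s0 by (simp add: ykA_def field_simps power2_eq_square power3_eq_cube)
  also have "\<dots> \<le> (0 + \<tau> / ?s + 1 / ?s\<^sup>2) * exp (- \<tau> * ?s)"
    using s0 t by (intro pi4_ge) auto
  also have "\<dots> \<le> 25 * kap \<tau> z" by (rule P) (use t in auto)
  finally show "\<bar>ykd \<tau> e i z\<bar> \<le> 25 * kap \<tau> z" .
  assume e: "0 < e"
  have B: "ykB \<tau> ?s \<ge> 0" using s0 t by (simp add: ykB_def)
  have es: "e\<^sup>2 \<le> ?s\<^sup>2" using Rr_ge[OF e, of z] e by (intro power_mono) auto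
  have "\<bar>yrho \<tau> e z * norm z\<bar> = e\<^sup>2 * (ykB \<tau> ?s / ?s * ?r)"
    using B s0 by (simp add: yrho_def abs_mult)
  also have "\<dots> \<le> ?s\<^sup>2 * (ykB \<tau> ?s / ?s * ?s)"
    using B s0 s es by (intro mult_mono mult_left_mono) auto
  also have "\<dots> = ((\<tau>\<^sup>2 + 3 * \<tau> / ?s + 3 / ?s\<^sup>2) * exp (- \<tau> * ?s)) / (4 * pi)"
    using s0 by (simp add: ykB_def field_simps power2_eq_square power3_eq_cube power4_eq_xxxx)
  also have "\<dots> \<le> (\<tau>\<^sup>2 + 3 * \<tau> / ?s + 3 / ?s\<^sup>2) * exp (- \<tau> * ?s)"
    using s0 t by (intro pi4_ge) auto
  also have "\<dots> \<le> 25 * kap \<tau> z" by (rule P) (use t in auto)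
  finally show "\<bar>yrho \<tau> e z * norm z\<bar> \<le> 25 * kap \<tau> z" .
qed

lemma exp_decay_integrable:
  assumes t: "\<tau> > 0" and m: "g \<in> borel_measurable borel" and b: "\<And>z::R3. \<bar>g z\<bar> \<le> C * exp (- \<tau> * norm z)"
  shows "integrable lborel g" "g \<in> L2b"
proof -
  have E: "integrable lborel (\<lambda>z::R3. exp (- \<tau> * norm z))"
  proof (rule Bochner_Integration.integrable_bound[OF integrable_mult_right[OF kap_integrable[OF t], of "25 / \<tau>\<^sup>2"]])
    have "AE z in (lborel::R3 measure). z \<noteq> 0" by (rule AE_lborel_singleton)
    then show "AE z::R3 in lborel. norm (exp (- \<tau> * norm z)) \<le> norm (25 / \<tau>\<^sup>2 * kap \<tau> z)"
    proof eventually_elim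
      case (elim z)
      then have "(\<tau>\<^sup>2 + 3 * \<tau> / norm z + 3 / (norm z)\<^sup>2) * exp (- \<tau> * norm z) \<le> 25 * kap \<tau> z"
        using kernel_poly_bound[of "norm z" \<tau>] t by (simp add: kap_def)
      moreover have "\<tau>\<^sup>2 * exp (- \<tau> * norm z) \<le> (\<tau>\<^sup>2 + 3 * \<tau> / norm z + 3 / (norm z)\<^sup>2) * exp (- \<tau> * norm z)"
        using t by (intro mult_right_mono) auto
      ultimately have "\<tau>\<^sup>2 * exp (- \<tau> * norm z) \<le> 25 * kap \<tau> z" by linarith
      then have "exp (- \<tau> * norm z) \<le> 25 / \<tau>\<^sup>2 * kap \<tau> z" using t by (simp add: field_simps)
      moreover have "0 \<le> 25 / \<tau>\<^sup>2 * kap \<tau> z" by (simp add: kap_nonneg)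
      ultimately show ?case by (metis abs_of_nonneg exp_ge_zero real_norm_def)
    qed
  qed measurable
  have "\<bar>g z\<bar> \<le> \<bar>C\<bar> * exp (- \<tau> * norm z)" for z
    using b[of z] mult_right_mono[OF abs_ge_self[of C], of "exp (- \<tau> * norm z)"] exp_ge_zero order_trans by blast
  note b' = this
  show "integrable lborel g"
    by (rule Bochner_Integration.integrable_bound[OF integrable_mult_right[OF E, of "\<bar>C\<bar>"]])
       (use b' m in \<open>auto simp: abs_mult\<close>)
  have "integrable lborel (\<lambda>z. (g z)\<^sup>2)"
  proof (rule Bochner_Integration.integrable_bound[OF integrable_mult_right[OF E, of "C\<^sup>2"]])
    show "AE z in lborel. norm ((g z)\<^sup>2) \<le> norm (C\<^sup>2 * exp (- \<tau> * norm z))"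
    proof (rule AE_I2)
      fix z
      have "(g z)\<^sup>2 \<le> (\<bar>C\<bar> * exp (- \<tau> * norm z))\<^sup>2"
        using power_mono[OF b'[of z], of 2] by simp
      also have "\<dots> = C\<^sup>2 * (exp (- \<tau> * norm z) * exp (- \<tau> * norm z))" by (simp add: power2_eq_square mult_ac)
      also have "\<dots> \<le> C\<^sup>2 * (1 * exp (- \<tau> * norm z))"
        using t by (intro mult_left_mono mult_right_mono) auto
      finally show "norm ((g z)\<^sup>2) \<le> norm (C\<^sup>2 * exp (- \<tau> * norm z))" by simp
    qed
  qed (use m in auto)
  then show "g \<in> L2b" using m by (simp add: L2b_def L2_def integrable_completion borel_lebesgue)
qed

text \<open>These bounds blow up as \<open>e\<close> tends to 0 but have no singularity at the
  origin. For fixed \<open>e\<close> they place the kernel and its derivatives in the integrable or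
  square integrable functions, as integration by parts without compact support demands.\<close>

lemma yk_decay:
  assumes e: "e > 0" and t: "\<tau> > 0"
  shows "\<bar>yk \<tau> e z\<bar> \<le> (1 / e) * exp (- \<tau> * norm z)"
    and "\<bar>ykd \<tau> e i z\<bar> \<le> (\<tau> / e + 1 / e\<^sup>2) * exp (- \<tau> * norm z)"
    and "\<bar>ykdd \<tau> e i z\<bar> \<le> (\<tau>\<^sup>2 / e + 4 * \<tau> / e\<^sup>2 + 4 / e^3) * exp (- \<tau> * norm z)"
proof -
  let ?s = "Rr e z"
  have s: "e \<le> ?s" "?s > 0" using Rr_ge[OF e] Rr_pos[OF e] by auto
  have E: "exp (- \<tau> * ?s) \<le> exp (- \<tau> * norm z)" using Rr_ge_norm[of z e] t by simp
  have M: "a * exp (- \<tau> * ?s) / (4 * pi) \<le> b * exp (- \<tau> * norm z)" if "0 \<le> a" "a \<le> b" for a b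
  proof -
    have "a * exp (- \<tau> * ?s) / (4 * pi) \<le> a * exp (- \<tau> * ?s)" using that by (intro pi4_ge) auto
    also have "\<dots> \<le> b * exp (- \<tau> * norm z)" using that E by (intro mult_mono) auto
    finally show ?thesis .
  qed
  have i1: "1 / ?s \<le> 1 / e" using s e by (intro divide_left_mono) auto
  have i2: "1 / ?s\<^sup>2 \<le> 1 / e\<^sup>2" using s e by (intro divide_left_mono power_mono) auto
  have i3: "1 / ?s^3 \<le> 1 / e^3" using s e by (intro divide_left_mono power_mono) auto
  have "\<bar>yk \<tau> e z\<bar> = (1 / ?s) * exp (- \<tau> * ?s) / (4 * pi)" using s by (simp add: yk_def)
  also have "\<dots> \<le> (1 / e) * exp (- \<tau> * norm z)" using s i1 by (intro M) auto
  finally show "\<bar>yk \<tau> e z\<bar> \<le> (1 / e) * exp (- \<tau> * norm z)" .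
  have A: "ykA \<tau> ?s \<ge> 0" using s t by (simp add: ykA_def)
  have B: "ykB \<tau> ?s \<ge> 0" using s t by (simp add: ykB_def)
  have zi: "\<bar>z $ i\<bar> \<le> ?s" using component_le_norm_cart[of z i] Rr_ge_norm[of z e] by linarith
  have "\<bar>ykd \<tau> e i z\<bar> = ykA \<tau> ?s * \<bar>z $ i\<bar>" using A by (simp add: ykd_def abs_mult)
  also have "\<dots> \<le> ykA \<tau> ?s * ?s" using A zi by (intro mult_left_mono)
  also have "\<dots> = (\<tau> * (1 / ?s) + 1 / ?s\<^sup>2) * exp (- \<tau> * ?s) / (4 * pi)"
    using s by (simp add: ykA_def field_simps power2_eq_square power3_eq_cube)
  also have "\<dots> \<le> (\<tau> * (1 / e) + 1 / e\<^sup>2) * exp (- \<tau> * norm z)"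
    using s t i1 i2 by (intro M add_mono mult_left_mono) auto
  finally show "\<bar>ykd \<tau> e i z\<bar> \<le> (\<tau> / e + 1 / e\<^sup>2) * exp (- \<tau> * norm z)" by simp
  have "\<bar>ykdd \<tau> e i z\<bar> \<le> \<bar>ykB \<tau> ?s * (z $ i)\<^sup>2 / ?s\<bar> + \<bar>ykA \<tau> ?s\<bar>"
    unfolding ykdd_def by (rule abs_triangle_ineq4)
  also have "\<dots> = ykB \<tau> ?s * (z $ i)\<^sup>2 / ?s + ykA \<tau> ?s" using A B s by simp
  also have "\<dots> \<le> ykB \<tau> ?s * ?s\<^sup>2 / ?s + ykA \<tau> ?s"
    using A B s power_mono[OF zi, of 2] by (intro add_right_mono divide_right_mono mult_left_mono) auto
  also have "\<dots> = (\<tau>\<^sup>2 * (1 / ?s) + 4 * \<tau> * (1 / ?s\<^sup>2) + 4 * (1 / ?s^3)) * exp (- \<tau> * ?s) / (4 * pi)"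
    using s by (simp add: ykA_def ykB_def divide_simps power2_eq_square power3_eq_cube power4_eq_xxxx)
       (simp add: algebra_simps)
  also have "\<dots> \<le> (\<tau>\<^sup>2 * (1 / e) + 4 * \<tau> * (1 / e\<^sup>2) + 4 * (1 / e^3)) * exp (- \<tau> * norm z)"
    using s t i1 i2 i3 by (intro M add_mono mult_left_mono add_nonneg_nonneg) auto
  finally show "\<bar>ykdd \<tau> e i z\<bar> \<le> (\<tau>\<^sup>2 / e + 4 * \<tau> / e\<^sup>2 + 4 / e^3) * exp (- \<tau> * norm z)" by simp
qed

lemma yk_reg:
  assumes e: "e > 0" and t: "\<tau> > 0"
  shows "integrable lborel (yk \<tau> e)" "integrable lborel (ykd \<tau> e i)" "integrable lborel (ykdd \<tau> e i)"
    "ykd \<tau> e i \<in> L2b" "ykdd \<tau> e i \<in> L2b"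
  by (rule exp_decay_integrable[OF t] smooth_borel smooth_yk smooth_ykd smooth_ykdd e yk_decay[OF e t])+

lemma Ck_shift: "Ck k g \<Longrightarrow> Ck k (\<lambda>x. g (x - y))"
  and frechet_shift: "(g has_derivative frechet_derivative g (at (x - y))) (at (x - y)) \<Longrightarrow>
     frechet_derivative (\<lambda>x. g (x - y)) (at x) = frechet_derivative g (at (x - y))"
  for g :: "'a::euclidean_space \<Rightarrow> real"
proof -
  have d: "((\<lambda>x. g (x - y)) has_derivative frechet_derivative g (at (x - y))) (at x)"
    if "(g has_derivative frechet_derivative g (at (x - y))) (at (x - y))" for g :: "'a \<Rightarrow> real" and x
  proof -
    have "((\<lambda>x. x - y) has_derivative (\<lambda>h. h)) (at x)" by (auto intro!: derivative_eq_intros)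
    from has_derivative_compose[OF this that] show ?thesis .
  qed
  show "frechet_derivative (\<lambda>x. g (x - y)) (at x) = frechet_derivative g (at (x - y))"
    if "(g has_derivative frechet_derivative g (at (x - y))) (at (x - y))"
    using frechet_derivative_at[OF d[OF that]] by simp
  show "Ck k g \<Longrightarrow> Ck k (\<lambda>x. g (x - y))"
  proof (induction k arbitrary: g)
    case 0
    then have c: "continuous_on UNIV g" by simp
    have "continuous_on UNIV (\<lambda>x. g (x - y))"
      by (rule continuous_on_compose2[OF c]) (auto intro!: continuous_intros)
    then show ?case by simp
  next
    case (Suc k)
    show ?case
      by (rule Ck_SucI[OF d[OF Ck_Suc_has_derivative[OF Suc.prems]]])
         (use Suc in auto)
  qed
qed

lemma smooth_shift: "smooth g \<Longrightarrow> smooth (\<lambda>x. g (x - y))"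
  by (simp add: smooth_def Ck_shift)

lemma partial_shift: "smooth g \<Longrightarrow> partial i (\<lambda>x. g (x - y)) x = partial i g (x - y)"
  by (simp add: frechet_shift smooth_has_derivative)

lemma L2b_shift:
  assumes "g \<in> L2b"
  shows "(\<lambda>x. g (x - y)) \<in> L2b"
proof -
  have m: "g \<in> borel_measurable borel" by (rule L2b_D(2)[OF assms])
  have "integrable lborel (\<lambda>x. (g x)\<^sup>2)"
    using L2_integrable_sq[OF L2b_D(1)[OF assms]] m by (simp add: integrable_completion)
  from lborel_translate_integrable[OF this, of "- y"]
  have "integrable lborel (\<lambda>x. (g (x - y))\<^sup>2)" by simp
  moreover have "(\<lambda>x. g (x - y)) \<in> borel_measurable borel" using m by measurable
  ultimately show ?thesis by (simp add: L2b_def L2_def integrable_completion borel_lebesgue)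
qed

section \<open>The regularised kernels as the parameter tends to 0\<close>

lemma kernel_L1_tendsto:
  assumes t: "\<tau> > 0" and m: "\<And>n::nat. K n \<in> borel_measurable borel" "K' \<in> borel_measurable borel"
    and b: "\<And>n z. z \<noteq> 0 \<Longrightarrow> \<bar>K n z\<bar> \<le> C * kap \<tau> z" "\<And>z. z \<noteq> 0 \<Longrightarrow> \<bar>K' z\<bar> \<le> C * kap \<tau> z"
    and l: "\<And>z. z \<noteq> 0 \<Longrightarrow> (\<lambda>n. K n z) \<longlonglongrightarrow> K' z"
  shows "integrable lborel (K n)" "integrable lborel K'" "(\<lambda>n. LINT z|lborel. \<bar>K n z - K' z\<bar>) \<longlonglongrightarrow> 0"
proof -
  have nz: "AE z in (lborel::R3 measure). z \<noteq> 0" by (rule AE_lborel_singleton)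
  note I = integrable_mult_right[OF kap_integrable[OF t], of C]
  have ab: "norm a \<le> norm c" if "\<bar>a\<bar> \<le> c" for a c :: real using that by simp
  have "AE z in lborel. norm (K n z) \<le> norm (C * kap \<tau> z)" for n
    using nz by eventually_elim (rule ab[OF b(1)])
  then show "integrable lborel (K n)" for n
    by (intro Bochner_Integration.integrable_bound[OF I]) (use m in auto)
  have "AE z in lborel. norm (K' z) \<le> norm (C * kap \<tau> z)"
    using nz by eventually_elim (rule ab[OF b(2)])
  then show "integrable lborel K'"
    by (intro Bochner_Integration.integrable_bound[OF I]) (use m in auto)
  have "(\<lambda>n. LINT z|lborel. \<bar>K n z - K' z\<bar>) \<longlonglongrightarrow> (LINT z|(lborel::R3 measure). 0)"
  proof (rule integral_dominated_convergence)
    show "integrable lborel (\<lambda>z. 2 * (C * kap \<tau> z))" using I by (rule integrable_mult_right)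
    show "AE z in lborel. norm \<bar>K n z - K' z\<bar> \<le> 2 * (C * kap \<tau> z)" for n
      using nz
    proof eventually_elim
      case (elim z)
      have "\<bar>K n z\<bar> \<le> C * kap \<tau> z" "\<bar>K' z\<bar> \<le> C * kap \<tau> z" using b[OF elim] by auto
      then show ?case by simp
    qed
    show "AE z in lborel. (\<lambda>n. \<bar>K n z - K' z\<bar>) \<longlonglongrightarrow> 0"
      using nz
    proof eventually_elim
      case (elim z)
      have "(\<lambda>n. \<bar>K n z - K' z\<bar>) \<longlonglongrightarrow> \<bar>K' z - K' z\<bar>" by (intro tendsto_intros l elim)
      then show ?case by simp
    qed
  qed (use m in auto)
  then show "(\<lambda>n. LINT z|lborel. \<bar>K n z - K' z\<bar>) \<longlonglongrightarrow> 0" by simp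
qed

definition eps :: "nat \<Rightarrow> real" where "eps n = 1 / real (Suc n)"

lemma eps_pos: "eps n > 0" and eps_tendsto: "eps \<longlonglongrightarrow> 0"
  unfolding eps_def[abs_def] using LIMSEQ_Suc[OF lim_1_over_n] by auto

lemma Rr_eps_tendsto: "(\<lambda>n. Rr (eps n) z) \<longlonglongrightarrow> norm z"
proof -
  have "(\<lambda>n. sqrt ((norm (z - 0))\<^sup>2 + (eps n)\<^sup>2)) \<longlonglongrightarrow> sqrt ((norm (z - 0))\<^sup>2 + 0\<^sup>2)"
    by (intro tendsto_intros eps_tendsto)
  then show ?thesis by (simp add: Rr_def)
qed

lemma Rr_measurable [measurable]: "Rr e \<in> borel_measurable borel"
  unfolding Rr_def[abs_def] by measurable

lemma yk_measurable [measurable]: "yk \<tau> e \<in> borel_measurable borel" "ykd \<tau> e i \<in> borel_measurable borel"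
  "yrho \<tau> e \<in> borel_measurable borel"
  unfolding yk_def[abs_def] ykd_def[abs_def] yrho_def[abs_def] ykA_def ykB_def by measurable

lemma yk_L1:
  assumes t: "\<tau> > 0"
  shows "integrable lborel (yk \<tau> 0)" "(\<lambda>n. LINT z|lborel. \<bar>yk \<tau> (eps n) z - yk \<tau> 0 z\<bar>) \<longlonglongrightarrow> 0"
proof -
  have l: "(\<lambda>n. yk \<tau> (eps n) z) \<longlonglongrightarrow> yk \<tau> 0 z" if "z \<noteq> 0" for z
    unfolding yk_def Rr_0 by (intro tendsto_intros Rr_eps_tendsto) (use that in auto)
  note * = kernel_L1_tendsto[where K = "\<lambda>n. yk \<tau> (eps n)" and K' = "yk \<tau> 0", OF t yk_measurable(1) yk_measurable(1)
      yk_kap(1)[OF _ t] yk_kap(1)[OF _ t] l]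
  show "integrable lborel (yk \<tau> 0)" "(\<lambda>n. LINT z|lborel. \<bar>yk \<tau> (eps n) z - yk \<tau> 0 z\<bar>) \<longlonglongrightarrow> 0"
    using * by auto
qed

lemma ykd_L1:
  assumes t: "\<tau> > 0"
  shows "integrable lborel (ykd \<tau> 0 i)" "(\<lambda>n. LINT z|lborel. \<bar>ykd \<tau> (eps n) i z - ykd \<tau> 0 i z\<bar>) \<longlonglongrightarrow> 0"
proof -
  have l: "(\<lambda>n. ykd \<tau> (eps n) i z) \<longlonglongrightarrow> ykd \<tau> 0 i z" if "z \<noteq> 0" for z
    unfolding ykd_def ykA_def Rr_0 by (intro tendsto_intros Rr_eps_tendsto) (use that in auto)
  note * = kernel_L1_tendsto[where K = "\<lambda>n. ykd \<tau> (eps n) i" and K' = "ykd \<tau> 0 i", OF t yk_measurable(2) yk_measurable(2)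
      yk_kap(2)[OF _ t] yk_kap(2)[OF _ t] l]
  show "integrable lborel (ykd \<tau> 0 i)" "(\<lambda>n. LINT z|lborel. \<bar>ykd \<tau> (eps n) i z - ykd \<tau> 0 i z\<bar>) \<longlonglongrightarrow> 0"
    using * by auto
qed

text \<open>Off the origin the factor \<open>e\<^sup>2\<close> sends the density to 0, and
  \<open>kap\<close> dominates. A vanishing first moment expresses that the mass of
  \<open>yrho\<close> concentrates at the origin.\<close>

lemma yrho_norm_tendsto:
  assumes t: "\<tau> > 0"
  shows "integrable lborel (\<lambda>z. yrho \<tau> (eps n) z * norm z)"
    "(\<lambda>n. LINT z|lborel. yrho \<tau> (eps n) z * norm z) \<longlonglongrightarrow> 0"
proof -
  have l: "(\<lambda>n. yrho \<tau> (eps n) z * norm z) \<longlonglongrightarrow> 0" if "z \<noteq> 0" for z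
  proof -
    have "(\<lambda>n. yrho \<tau> (eps n) z * norm z) \<longlonglongrightarrow> 0\<^sup>2 * ykB \<tau> (norm z) / norm z * norm z"
      unfolding yrho_def ykB_def by (intro tendsto_intros Rr_eps_tendsto eps_tendsto) (use that in auto)
    then show ?thesis by simp
  qed
  have "0 \<le> 25 * kap \<tau> z" for z by (simp add: kap_nonneg)
  then have b0: "\<bar>0\<bar> \<le> 25 * kap \<tau> z" for z by simp
  have m: "(\<lambda>z. yrho \<tau> (eps n) z * norm z) \<in> borel_measurable borel" for n by measurable
  note * = kernel_L1_tendsto[where K = "\<lambda>n z. yrho \<tau> (eps n) z * norm z" and K' = "\<lambda>z. 0", OF t m borel_measurable_const
      yk_kap(3)[OF _ t eps_pos] b0 l]
  show "integrable lborel (\<lambda>z. yrho \<tau> (eps n) z * norm z)" using * by auto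
  have "\<bar>yrho \<tau> (eps n) z * norm z - 0\<bar> = yrho \<tau> (eps n) z * norm z" for n z
    using yrho_nonneg[OF eps_pos t] by simp
  then show "(\<lambda>n. LINT z|lborel. yrho \<tau> (eps n) z * norm z) \<longlonglongrightarrow> 0"
    using * by simp
qed

lemma integral_yk_0:
  assumes t: "\<tau> > 0"
  shows "(LINT z|lborel. yk \<tau> 0 z) = 1 / \<tau>\<^sup>2"
proof -
  have "(\<integral>\<^sup>+(z::R3). ennreal (exp (- \<tau> * norm z) / norm z) \<partial>lborel) = ennreal (4 * pi / \<tau>\<^sup>2)"
    by (rule nn_integral_inverse_exp[OF t])
  then have "(LINT z|(lborel::R3 measure). exp (- \<tau> * norm z) / norm z) = 4 * pi / \<tau>\<^sup>2"
    by (subst integral_eq_nn_integral) auto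
  then have "(LINT z|(lborel::R3 measure). (exp (- \<tau> * norm z) / norm z) * (1 / (4 * pi))) = 1 / \<tau>\<^sup>2"
    by (subst integral_mult_left_zero) simp
  then show ?thesis by (simp add: yk_def Rr_0)
qed

text \<open>Integration by parts for the constant function 1, whose weak derivative is 0, against
  the gradient kernel.\<close>

lemma integral_ykdd:
  assumes t: "\<tau> > 0" and e: "e > 0"
  shows "(LINT z|lborel. ykdd \<tau> e i z) = 0"
proof -
  have i: "integrable lebesgue (ykd \<tau> e i)" "integrable lebesgue (ykdd \<tau> e i)"
    using yk_reg[OF e t] smooth_borel[OF smooth_ykd[OF e]] smooth_borel[OF smooth_ykdd[OF e]]
    by (auto simp: integrable_completion)
  have "(LINT x|lebesgue. 1 * partial i (ykd \<tau> e i) x) = - (LINT x|lebesgue. 0 * ykd \<tau> e i x)"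
  proof (rule integration_by_parts_noncompact)
    fix \<phi> :: "R3 \<Rightarrow> real" assume p: "\<phi> \<in> test_functions UNIV"
    have "partial i \<phi> \<in> borel_measurable borel" by (rule smooth_borel[OF test_smooth[OF test_functions_partial[OF p]]])
    then show "(LINT x|lebesgue. 1 * partial i \<phi> x) = - (LINT x|lebesgue. 0 * \<phi> x)"
      using test_partial_integral_zero[OF p, of i] by (simp add: integral_completion)
  qed (use i in \<open>auto simp: partial_ykd[OF e] smooth_ykd[OF e]\<close>)
  then show ?thesis
    using smooth_borel[OF smooth_ykdd[OF e]] by (simp add: partial_ykd[OF e] integral_completion)
qed

lemma yrho_integrable:
  assumes t: "\<tau> > 0" and e: "e > 0"
  shows "integrable lborel (yrho \<tau> e)" "(LINT z|lborel. yrho \<tau> e z) = \<tau>\<^sup>2 * (LINT z|lborel. yk \<tau> e z)"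
proof -
  note r = yk_reg[OF e t]
  have s: "integrable lborel (\<lambda>z. \<tau>\<^sup>2 * yk \<tau> e z)" "integrable lborel (\<lambda>z. \<Sum>i\<in>UNIV. ykdd \<tau> e i z)"
    using r by auto
  have eq: "yrho \<tau> e = (\<lambda>z. \<tau>\<^sup>2 * yk \<tau> e z - (\<Sum>i\<in>UNIV. ykdd \<tau> e i z))" using yrho_eq[OF e] by auto
  show "integrable lborel (yrho \<tau> e)" unfolding eq using s by (rule Bochner_Integration.integrable_diff)
  show "(LINT z|lborel. yrho \<tau> e z) = \<tau>\<^sup>2 * (LINT z|lborel. yk \<tau> e z)"
    unfolding eq Bochner_Integration.integral_diff[OF s]
    using r by (simp add: Bochner_Integration.integral_sum integral_ykdd[OF t e])
qed

text \<open>In \<open>yrho = \<tau>\<^sup>2 * yk - \<Delta> yk\<close> the second derivatives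
  integrate to 0, so the mass tends to \<open>\<tau>\<^sup>2 * (1 / \<tau>\<^sup>2)\<close>. Since
  \<open>yrho\<close> is nonnegative, convergence of the masses also bounds the norms of the
  kernels.\<close>

lemma yrho_mass:
  assumes t: "\<tau> > 0"
  shows "(\<lambda>n. LINT z|lborel. yrho \<tau> (eps n) z) \<longlonglongrightarrow> 1"
    "\<exists>C. \<forall>n. (LINT z|lborel. \<bar>yrho \<tau> (eps n) z\<bar>) \<le> C"
proof -
  have "(\<lambda>n. (LINT z|lborel. yk \<tau> (eps n) z) - (LINT z|lborel. yk \<tau> 0 z)) \<longlonglongrightarrow> 0"
  proof (rule Lim_null_comparison[OF _ yk_L1(2)[OF t]])
    have "\<bar>(LINT z|lborel. yk \<tau> (eps n) z) - (LINT z|lborel. yk \<tau> 0 z)\<bar> \<le> (LINT z|lborel. \<bar>yk \<tau> (eps n) z - yk \<tau> 0 z\<bar>)" for n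
      unfolding Bochner_Integration.integral_diff[OF yk_reg(1)[OF eps_pos t] yk_L1(1)[OF t], symmetric]
      by (rule integral_abs_bound)
    then show "\<forall>\<^sub>F n in sequentially. norm ((LINT z|lborel. yk \<tau> (eps n) z) - (LINT z|lborel. yk \<tau> 0 z))
       \<le> (LINT z|lborel. \<bar>yk \<tau> (eps n) z - yk \<tau> 0 z\<bar>)" by simp
  qed
  then have "(\<lambda>n. LINT z|lborel. yk \<tau> (eps n) z) \<longlonglongrightarrow> 1 / \<tau>\<^sup>2"
    unfolding integral_yk_0[OF t] by (simp add: LIM_zero_iff)
  then have "(\<lambda>n. \<tau>\<^sup>2 * (LINT z|lborel. yk \<tau> (eps n) z)) \<longlonglongrightarrow> \<tau>\<^sup>2 * (1 / \<tau>\<^sup>2)" by (intro tendsto_intros)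
  then show lim: "(\<lambda>n. LINT z|lborel. yrho \<tau> (eps n) z) \<longlonglongrightarrow> 1"
    using t by (simp add: yrho_integrable(2)[OF t eps_pos])
  have "Bseq (\<lambda>n. LINT z|lborel. yrho \<tau> (eps n) z)"
    by (rule convergent_imp_Bseq) (use lim in \<open>auto simp: convergent_def\<close>)
  then obtain C where "\<And>n. \<bar>LINT z|lborel. yrho \<tau> (eps n) z\<bar> \<le> C" by (auto simp: Bseq_def)
  moreover have "\<bar>yrho \<tau> (eps n) z\<bar> = yrho \<tau> (eps n) z" for n z using yrho_nonneg[OF eps_pos t] by simp
  ultimately have "(LINT z|lborel. \<bar>yrho \<tau> (eps n) z\<bar>) \<le> C" for n by (metis (no_types, lifting) abs_le_D1 Bochner_Integration.integral_cong)
  then show "\<exists>C. \<forall>n. (LINT z|lborel. \<bar>yrho \<tau> (eps n) z\<bar>) \<le> C" by blast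
qed

lemma test_Lipschitz:
  fixes \<phi> :: "R3 \<Rightarrow> real"
  assumes p: "\<phi> \<in> test_functions UNIV"
  obtains L where "L \<ge> 0" "\<And>x y. \<bar>\<phi> x - \<phi> y\<bar> \<le> L * norm (x - y)"
proof -
  have "\<exists>M. \<forall>x. \<bar>partial i \<phi> x\<bar> \<le> M" for i
    using test_functions_bounded[OF test_functions_partial[OF p, of i]] by metis
  then obtain M where M: "\<And>i x. \<bar>partial i \<phi> x\<bar> \<le> M i" by metis
  note d = smooth_has_derivative[OF test_smooth[OF p]]
  have "onorm (frechet_derivative \<phi> (at x)) \<le> (\<Sum>i\<in>UNIV. M i)" for x
  proof (rule onorm_le)
    fix h :: R3
    have lin: "linear (frechet_derivative \<phi> (at x))" using d by (rule has_derivative_linear)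
    have "h = (\<Sum>i\<in>UNIV. h $ i *\<^sub>R axis i 1)"
      by (simp add: basis_expansion flip: scalar_mult_eq_scaleR)
    then have "frechet_derivative \<phi> (at x) h = frechet_derivative \<phi> (at x) (\<Sum>i\<in>UNIV. h $ i *\<^sub>R axis i 1)"
      by (rule arg_cong)
    also have "\<dots> = (\<Sum>i\<in>UNIV. h $ i * partial i \<phi> x)"
      by (simp add: linear_sum[OF lin] linear_cmul[OF lin])
    finally have "frechet_derivative \<phi> (at x) h = (\<Sum>i\<in>UNIV. h $ i * partial i \<phi> x)" .
    then have "\<bar>frechet_derivative \<phi> (at x) h\<bar> = \<bar>\<Sum>i\<in>UNIV. h $ i * partial i \<phi> x\<bar>" by simp
    also have "\<dots> \<le> (\<Sum>i\<in>UNIV. \<bar>h $ i * partial i \<phi> x\<bar>)" by (rule sum_abs)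
    also have "\<dots> \<le> (\<Sum>i\<in>UNIV. norm h * M i)"
      unfolding abs_mult using M component_le_norm_cart[of h] by (intro sum_mono mult_mono) auto
    finally show "norm (frechet_derivative \<phi> (at x) h) \<le> (\<Sum>i\<in>UNIV. M i) * norm h"
      by (simp add: sum_distrib_right sum_distrib_left mult.commute)
  qed
  then have "norm (\<phi> x - \<phi> y) \<le> (\<Sum>i\<in>UNIV. M i) * norm (x - y)" for x y
    using differentiable_bound[of UNIV \<phi> "\<lambda>x. frechet_derivative \<phi> (at x)"] d by auto
  moreover have "0 \<le> (\<Sum>i\<in>UNIV. M i)" using M by (intro sum_nonneg) (metis abs_ge_zero order_trans)
  ultimately show thesis by (intro that) auto
qed

text \<open>For a Lipschitz function the convolution differs from the mass times the function by at
  most the Lipschitz constant times the first moment, uniformly in \<open>x\<close>.\<close>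

lemma yrho_test_tendsto:
  assumes t: "\<tau> > 0" and f: "f \<in> test_functions UNIV" and g: "g \<in> test_functions UNIV"
  shows "(\<lambda>n. ip (conv (yrho \<tau> (eps n)) f) g) \<longlonglongrightarrow> ip f g"
proof -
  obtain L where L: "L \<ge> 0" "\<And>x y. \<bar>f x - f y\<bar> \<le> L * norm (x - y)" using test_Lipschitz[OF f] by metis
  obtain Mf where Mf: "Mf > 0" "\<And>x. \<bar>f x\<bar> \<le> Mf" using test_functions_bounded[OF f] by metis
  have [measurable]: "f \<in> borel_measurable borel" "g \<in> borel_measurable borel"
    using f g by (auto intro: smooth_borel test_smooth)
  define m where "m n = (LINT z|lborel. yrho \<tau> (eps n) z)" for n
  define d where "d n = (LINT z|lborel. yrho \<tau> (eps n) z * norm z)" for n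
  note ri = yrho_integrable(1)[OF t eps_pos]
  have refl: "integrable lborel (\<lambda>y. h (x - y)) \<and> (LINT y|lborel. h (x - y)) = (LINT z|lborel. h z)"
    if h: "integrable lborel h" for h :: "R3 \<Rightarrow> real" and x
  proof -
    have [measurable]: "h \<in> borel_measurable borel" using h by auto
    have 1: "integrable lborel (\<lambda>y. h (x + y))" by (rule lborel_translate_integrable[OF h])
    then have "integrable (distr lborel borel uminus) (\<lambda>y. h (x + y))" by (simp add: lborel_uminus)
    then have "integrable lborel (\<lambda>y. h (x - y))" by (subst (asm) integrable_distr_eq) auto
    moreover have "(LINT y|lborel. h (x - y)) = (LINT y|distr lborel borel uminus. h (x + y))"
      by (subst integral_distr) auto
    moreover have "\<dots> = (LINT y|lborel. h y)" by (simp add: lborel_uminus lborel_translate)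
    ultimately show ?thesis by simp
  qed
  have pw: "\<bar>conv (yrho \<tau> (eps n)) f x - m n * f x\<bar> \<le> L * d n" for n x
  proof -
    have i1: "integrable lborel (\<lambda>y. yrho \<tau> (eps n) (x - y) * f y)"
    proof (rule Bochner_Integration.integrable_bound[OF integrable_mult_right[OF conjunct1[OF refl[OF ri]], of Mf n x]])
      show "AE y in lborel. norm (yrho \<tau> (eps n) (x - y) * f y) \<le> norm (Mf * yrho \<tau> (eps n) (x - y))"
        using Mf by (auto simp: abs_mult mult.commute intro!: mult_right_mono)
    qed measurable
    have i2: "integrable lborel (\<lambda>y. yrho \<tau> (eps n) (x - y) * f x)"
      using conjunct1[OF refl[OF ri[of n], of x]] by simp
    have i3: "integrable lborel (\<lambda>y. yrho \<tau> (eps n) (x - y) * norm (x - y))"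
      using refl[OF yrho_norm_tendsto(1)[OF t, of n], of x] by simp
    have "conv (yrho \<tau> (eps n)) f x - m n * f x = (LINT y|lborel. yrho \<tau> (eps n) (x - y) * f y - yrho \<tau> (eps n) (x - y) * f x)"
      unfolding Bochner_Integration.integral_diff[OF i1 i2] using refl[OF ri[of n], of x]
      by (simp add: conv_def m_def)
    also have "\<bar>\<dots>\<bar> \<le> (LINT y|lborel. \<bar>yrho \<tau> (eps n) (x - y) * f y - yrho \<tau> (eps n) (x - y) * f x\<bar>)"
      by (rule integral_abs_bound)
    also have "\<dots> \<le> (LINT y|lborel. L * (yrho \<tau> (eps n) (x - y) * norm (x - y)))"
    proof (rule integral_mono)
      show "integrable lborel (\<lambda>y. \<bar>yrho \<tau> (eps n) (x - y) * f y - yrho \<tau> (eps n) (x - y) * f x\<bar>)"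
        using i1 i2 by auto
      show "integrable lborel (\<lambda>y. L * (yrho \<tau> (eps n) (x - y) * norm (x - y)))" using i3 by auto
      fix y
      have "\<bar>yrho \<tau> (eps n) (x - y) * f y - yrho \<tau> (eps n) (x - y) * f x\<bar> = yrho \<tau> (eps n) (x - y) * \<bar>f y - f x\<bar>"
        using yrho_nonneg[OF eps_pos t, of n "x - y"] by (simp add: right_diff_distrib[symmetric] abs_mult)
      also have "\<dots> \<le> yrho \<tau> (eps n) (x - y) * (L * norm (x - y))"
        using L(2)[of y x] yrho_nonneg[OF eps_pos t, of n "x - y"] by (intro mult_left_mono) (auto simp: norm_minus_commute)
      finally show "\<bar>yrho \<tau> (eps n) (x - y) * f y - yrho \<tau> (eps n) (x - y) * f x\<bar> \<le> L * (yrho \<tau> (eps n) (x - y) * norm (x - y))"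
        by (simp add: mult_ac)
    qed
    also have "\<dots> = L * d n"
      using refl[OF yrho_norm_tendsto(1)[OF t, of n], of x] by (simp add: d_def)
    finally show ?thesis .
  qed
  have gi: "integrable lborel (\<lambda>x. \<bar>g x\<bar>)" using test_functions_integrable[OF g] by auto
  have fL: "f \<in> L2b" and gL: "g \<in> L2b" using f g by (auto intro: test_L2b)
  have cL: "conv (yrho \<tau> (eps n)) f \<in> L2b" for n by (rule conv_L2[OF ri fL])
  have diff: "\<bar>ip (conv (yrho \<tau> (eps n)) f) g - m n * ip f g\<bar> \<le> L * d n * (LINT x|lborel. \<bar>g x\<bar>)" for n
  proof -
    have mf: "(\<lambda>x. m n * f x) \<in> L2" by (intro L2_cmult L2b_D(1) fL)
    have "ip (conv (yrho \<tau> (eps n)) f) g - m n * ip f g = ip (\<lambda>x. conv (yrho \<tau> (eps n)) f x - m n * f x) g"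
      by (simp add: ip_diff_left[OF L2b_D(1)[OF cL] mf L2b_D(1)[OF gL]] ip_cmult_left)
    also have "\<dots> = (LINT x|lborel. (conv (yrho \<tau> (eps n)) f x - m n * f x) * g x)"
      by (rule ip_lborel) (use L2b_D(2)[OF cL] in auto)
    also have "\<bar>\<dots>\<bar> \<le> (LINT x|lborel. \<bar>(conv (yrho \<tau> (eps n)) f x - m n * f x) * g x\<bar>)" by (rule integral_abs_bound)
    also have "\<dots> \<le> (LINT x|lborel. L * d n * \<bar>g x\<bar>)"
    proof (rule integral_mono')
      show "integrable lborel (\<lambda>x. L * d n * \<bar>g x\<bar>)" using gi by auto
      show "\<bar>(conv (yrho \<tau> (eps n)) f x - m n * f x) * g x\<bar> \<le> L * d n * \<bar>g x\<bar>" for x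
        unfolding abs_mult by (intro mult_right_mono pw) auto
      have "0 \<le> d n"
        unfolding d_def
        by (intro Bochner_Integration.integral_nonneg mult_nonneg_nonneg yrho_nonneg[OF eps_pos t] norm_ge_zero)
      then show "0 \<le> L * d n * \<bar>g x\<bar>" for x using L(1) by simp
    qed
    finally show ?thesis by simp
  qed
  have d0: "d \<longlonglongrightarrow> 0" unfolding d_def[abs_def] by (rule yrho_norm_tendsto(2)[OF t])
  have m1: "m \<longlonglongrightarrow> 1" unfolding m_def[abs_def] by (rule yrho_mass(1)[OF t])
  have "(\<lambda>n. ip (conv (yrho \<tau> (eps n)) f) g - m n * ip f g) \<longlonglongrightarrow> 0"
  proof (rule Lim_null_comparison)
    show "\<forall>\<^sub>F n in sequentially. norm (ip (conv (yrho \<tau> (eps n)) f) g - m n * ip f g) \<le> L * d n * (LINT x|lborel. \<bar>g x\<bar>)"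
      using diff by simp
    show "(\<lambda>n. L * d n * (LINT x|lborel. \<bar>g x\<bar>)) \<longlonglongrightarrow> 0"
      using d0 by (auto intro!: tendsto_mult_left_zero tendsto_mult_right_zero)
  qed
  moreover have "(\<lambda>n. m n * ip f g) \<longlonglongrightarrow> 1 * ip f g" by (intro tendsto_mult m1 tendsto_const)
  ultimately have "(\<lambda>n. (ip (conv (yrho \<tau> (eps n)) f) g - m n * ip f g) + m n * ip f g) \<longlonglongrightarrow> 0 + 1 * ip f g"
    by (rule tendsto_add)
  then show ?thesis by simp
qed

text \<open>An argument with three thirds of \<open>e\<close> for abstract functionals, so that it
  can be applied to the two arguments of the pairing in turn.\<close>

lemma dense_limit:
  assumes f: "f \<in> L2b"
    and bnd: "\<And>n h. h \<in> L2b \<Longrightarrow> \<bar>T n h\<bar> \<le> C * L2_norm h"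
    and bnd0: "\<And>h. h \<in> L2b \<Longrightarrow> \<bar>S h\<bar> \<le> C * L2_norm h"
    and diff: "\<And>n h k. h \<in> L2b \<Longrightarrow> k \<in> L2b \<Longrightarrow> T n (\<lambda>x. h x - k x) = T n h - T n k"
    and diff0: "\<And>h k. h \<in> L2b \<Longrightarrow> k \<in> L2b \<Longrightarrow> S (\<lambda>x. h x - k x) = S h - S k"
    and lim: "\<And>h. h \<in> test_functions UNIV \<Longrightarrow> (\<lambda>n::nat. T n h) \<longlonglongrightarrow> (S h :: real)"
  shows "(\<lambda>n. T n f) \<longlonglongrightarrow> S f"
proof (rule LIMSEQ_I)
  fix e :: real assume e: "e > 0"
  define c where "c = \<bar>C\<bar> + 1"
  have c: "c > 0" by (simp add: c_def)
  then have "e / (3 * c) > 0" using e by simp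
  then obtain h where h: "h \<in> test_functions UNIV" "L2_norm (\<lambda>x. f x - h x) < e / (3 * c)"
    using L2_test_dense[OF L2b_D(1)[OF f]] by metis
  have hL: "h \<in> L2b" by (rule test_L2b[OF h(1)])
  have k: "C * L2_norm (\<lambda>x. f x - h x) < e / 3"
  proof -
    have "C * L2_norm (\<lambda>x. f x - h x) \<le> c * L2_norm (\<lambda>x. f x - h x)"
      unfolding c_def by (intro mult_right_mono L2_norm_nonneg) auto
    also have "\<dots> < c * (e / (3 * c))" using c by (intro mult_strict_left_mono h)
    finally show ?thesis using c by simp
  qed
  obtain N where N: "\<And>n. n \<ge> N \<Longrightarrow> \<bar>T n h - S h\<bar> < e / 3"
    using LIMSEQ_D[OF lim[OF h(1)], of "e / 3"] e by auto
  have "norm (T n f - S f) < e" if "n \<ge> N" for n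
  proof -
    have "\<bar>T n f - T n h\<bar> < e / 3" using bnd[OF L2b_diff[OF f hL], of n] k by (simp add: diff[OF f hL])
    moreover have "\<bar>S f - S h\<bar> < e / 3" using bnd0[OF L2b_diff[OF f hL]] k by (simp add: diff0[OF f hL])
    ultimately show ?thesis using N[OF that] unfolding real_norm_def by arith
  qed
  then show "\<exists>no. \<forall>n\<ge>no. norm (T n f - S f) < e" by blast
qed

lemma yrho_tendsto:
  assumes t: "\<tau> > 0" and f: "f \<in> L2b" and g: "g \<in> L2b"
  shows "(\<lambda>n. ip (conv (yrho \<tau> (eps n)) f) g) \<longlonglongrightarrow> ip f g"
proof -
  obtain C where C: "\<And>n. (LINT z|lborel. \<bar>yrho \<tau> (eps n) z\<bar>) \<le> C" using yrho_mass(2)[OF t] by blast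
  note ri = yrho_integrable(1)[OF t eps_pos]
  have B: "\<bar>ip (conv (yrho \<tau> (eps n)) f) g\<bar> \<le> max C 1 * L2_norm f * L2_norm g" if "f \<in> L2b" "g \<in> L2b" for n f g
  proof -
    have "(LINT z|lborel. \<bar>yrho \<tau> (eps n) z\<bar>) * L2_norm f * L2_norm g \<le> max C 1 * L2_norm f * L2_norm g"
      using C[of n] by (intro mult_right_mono L2_norm_nonneg) auto
    then show ?thesis using ip_conv_bound[OF ri that, of n] by linarith
  qed
  have B0: "\<bar>ip f g\<bar> \<le> max C 1 * L2_norm f * L2_norm g" if "f \<in> L2b" "g \<in> L2b" for f g
  proof -
    have "1 * (L2_norm f * L2_norm g) \<le> max C 1 * (L2_norm f * L2_norm g)"
      by (intro mult_right_mono mult_nonneg_nonneg L2_norm_nonneg) auto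
    then show ?thesis using ip_Cauchy_Schwarz[OF L2b_D(1)[OF that(1)] L2b_D(1)[OF that(2)]] by (simp add: mult.assoc)
  qed
  have step1: "(\<lambda>n. ip (conv (yrho \<tau> (eps n)) f) g) \<longlonglongrightarrow> ip f g" if g: "g \<in> test_functions UNIV" for g
  proof (rule dense_limit[where T = "\<lambda>n f. ip (conv (yrho \<tau> (eps n)) f) g" and S = "\<lambda>f. ip f g" and C = "max C 1 * L2_norm g", OF f])
    note gL = test_L2b[OF g]
    show "\<bar>ip (conv (yrho \<tau> (eps n)) h) g\<bar> \<le> max C 1 * L2_norm g * L2_norm h" if "h \<in> L2b" for n h
      using B[OF that gL, of n] by (simp add: mult_ac)
    show "\<bar>ip h g\<bar> \<le> max C 1 * L2_norm g * L2_norm h" if "h \<in> L2b" for h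
      using B0[OF that gL] by (simp add: mult_ac)
    show "ip (conv (yrho \<tau> (eps n)) (\<lambda>x. h x - k x)) g = ip (conv (yrho \<tau> (eps n)) h) g - ip (conv (yrho \<tau> (eps n)) k) g"
      if "h \<in> L2b" "k \<in> L2b" for n h k by (rule ip_conv_left_diff[OF ri that gL])
    show "ip (\<lambda>x. h x - k x) g = ip h g - ip k g" if "h \<in> L2b" "k \<in> L2b" for h k
      by (rule ip_diff_left) (use that gL L2b_D in auto)
    show "(\<lambda>n. ip (conv (yrho \<tau> (eps n)) h) g) \<longlonglongrightarrow> ip h g" if "h \<in> test_functions UNIV" for h
      by (rule yrho_test_tendsto[OF t that g])
  qed
  show ?thesis
  proof (rule dense_limit[where T = "\<lambda>n g. ip (conv (yrho \<tau> (eps n)) f) g" and S = "\<lambda>g. ip f g" and C = "max C 1 * L2_norm f", OF g])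
    note cL = L2b_D(1)[OF conv_L2(1)[OF ri f]]
    show "\<bar>ip (conv (yrho \<tau> (eps n)) f) h\<bar> \<le> max C 1 * L2_norm f * L2_norm h" if "h \<in> L2b" for n h
      using B[OF f that, of n] by (simp add: mult_ac)
    show "\<bar>ip f h\<bar> \<le> max C 1 * L2_norm f * L2_norm h" if "h \<in> L2b" for h
      using B0[OF f that] by (simp add: mult_ac)
    show "ip (conv (yrho \<tau> (eps n)) f) (\<lambda>x. h x - k x) = ip (conv (yrho \<tau> (eps n)) f) h - ip (conv (yrho \<tau> (eps n)) f) k"
      if "h \<in> L2b" "k \<in> L2b" for n h k
      by (rule ip_diff_right) (use that cL L2b_D in auto)
    show "ip f (\<lambda>x. h x - k x) = ip f h - ip f k" if "h \<in> L2b" "k \<in> L2b" for h k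
      by (rule ip_diff_right) (use that f L2b_D in auto)
  qed (rule step1)
qed

section \<open>The Yukawa potential\<close>

text \<open>Kernel and gradient kernel are both integrable up to \<open>e = 0\<close>, and both
  converge in the mean. The identity holds for smooth kernels by parts in \<open>x\<close> at fixed
  \<open>y\<close>, and every pairing with a test function passes to the limit.\<close>

lemma yukawa_weak_gradient:
  assumes t: "\<tau> > 0" and f: "f \<in> L2b"
  shows "has_weak_gradient (conv (yk \<tau> 0) f) (\<lambda>x. \<chi> i. conv (ykd \<tau> 0 i) f x)"
  unfolding has_weak_gradient_iff
proof (intro conjI ballI allI)
  show "conv (yk \<tau> 0) f \<in> L2" by (rule L2b_D(1)[OF conv_L2(1)[OF yk_L1(1)[OF t] f]])
  show "(\<lambda>x. \<chi> i. conv (ykd \<tau> 0 i) f x) \<in> vL2"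
    unfolding vL2_def using L2b_D(1)[OF conv_L2(1)[OF ykd_L1(1)[OF t] f]] by simp
  fix \<phi> :: "R3 \<Rightarrow> real" and i assume p: "\<phi> \<in> test_functions UNIV"
  have pL: "\<phi> \<in> L2b" "partial i \<phi> \<in> L2b" using p by (auto intro: test_L2b test_functions_partial)
  have e: "ip (conv (yk \<tau> (eps n)) f) (partial i \<phi>) = - ip (conv (ykd \<tau> (eps n) i) f) \<phi>" for n
  proof -
    have "(LINT x|lborel. yk \<tau> (eps n) (x - y) * partial i \<phi> x) = - (LINT x|lborel. ykd \<tau> (eps n) i (x - y) * \<phi> x)" for y
      using smooth_test_parts[OF smooth_shift[OF smooth_yk[OF eps_pos]] p, of \<tau> n y i]
      by (simp add: partial_shift[OF smooth_yk[OF eps_pos]] fun_cong[OF partial_yk[OF eps_pos]])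
    then show ?thesis
      by (simp add: conv_Fubini[OF yk_reg(1)[OF eps_pos t] f pL(2)] conv_Fubini[OF yk_reg(2)[OF eps_pos t] f pL(1)])
  qed
  have l: "(\<lambda>n. ip (conv (yk \<tau> (eps n)) f) (partial i \<phi>)) \<longlonglongrightarrow> ip (conv (yk \<tau> 0) f) (partial i \<phi>)"
    by (rule ip_conv_tendsto[OF yk_reg(1)[OF eps_pos t] yk_L1[OF t] f pL(2)])
  have r: "(\<lambda>n. - ip (conv (ykd \<tau> (eps n) i) f) \<phi>) \<longlonglongrightarrow> - ip (conv (ykd \<tau> 0 i) f) \<phi>"
    by (intro tendsto_minus ip_conv_tendsto[OF yk_reg(2)[OF eps_pos t] ykd_L1[OF t] f pL(1)])
  have "ip (conv (yk \<tau> 0) f) (partial i \<phi>) = - ip (conv (ykd \<tau> 0 i) f) \<phi>"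
    by (rule LIMSEQ_unique[OF l r[folded e]])
  then show "ip (conv (yk \<tau> 0) f) (partial i \<phi>) = - ip (\<lambda>x. (\<chi> i. conv (ykd \<tau> 0 i) f x) $ i) \<phi>" by simp
qed

lemma conv_cmult: "conv (\<lambda>z. c * K z) f = (\<lambda>x. c * conv K f x)"
  by (rule ext) (simp add: conv_def mult.assoc)

text \<open>Here the roles are exchanged: \<open>\<phi>\<close> only has a weak gradient, and the
  translated kernel \<open>ykd\<close> serves as its test function. It has no compact support, hence
  the enlarged integration by parts. The resulting equation has the convolution of
  \<open>yrho\<close> with \<open>f\<close> on the right, which tends to \<open>f\<close>
  weakly.\<close>

lemma yukawa_equation:
  assumes t: "\<tau> > 0" and f: "f \<in> L2b" and p: "\<phi> \<in> H1"
  shows "vip (\<lambda>x. \<chi> i. conv (ykd \<tau> 0 i) f x) (weak_gradient \<phi>) + \<tau>\<^sup>2 * ip (conv (yk \<tau> 0) f) \<phi> = ip f \<phi>"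
proof -
  note G = H1_weak_gradient[OF p]
  obtain \<phi>' where p': "\<phi>' \<in> L2b" "AE x in lebesgue. \<phi> x = \<phi>' x"
    using L2_borel_representative[OF H1_L2[OF p]] by metis
  have "\<exists>g. g \<in> L2b \<and> (AE x in lebesgue. weak_gradient \<phi> x $ i = g x)" for i
    using L2_borel_representative[OF vL2_D[OF H1_gradient_vL2[OF p], of i]] by metis
  then obtain g where g: "\<And>i. g i \<in> L2b" "\<And>i. AE x in lebesgue. weak_gradient \<phi> x $ i = g i x" by metis
  have parts: "ip (conv (ykd \<tau> (eps n) i) f) (g i) = - ip (conv (ykdd \<tau> (eps n) i) f) \<phi>'" for n i
  proof -
    let ?e = "eps n"
    have "(LINT x|lborel. ykd \<tau> ?e i (x - y) * g i x) = - (LINT x|lborel. ykdd \<tau> ?e i (x - y) * \<phi>' x)" for y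
    proof -
      let ?\<psi> = "\<lambda>x. ykd \<tau> ?e i (x - y)"
      have s: "smooth ?\<psi>" by (rule smooth_shift[OF smooth_ykd[OF eps_pos]])
      have pt: "partial i ?\<psi> x = ykdd \<tau> ?e i (x - y)" for x
        by (simp add: partial_shift[OF smooth_ykd[OF eps_pos]] fun_cong[OF partial_ykd[OF eps_pos]])
      have L: "?\<psi> \<in> L2b" "(\<lambda>x. ykdd \<tau> ?e i (x - y)) \<in> L2b"
        by (intro L2b_shift yk_reg[OF eps_pos t])+
      have "(LINT x|lebesgue. \<phi> x * partial i ?\<psi> x) = - (LINT x|lebesgue. weak_gradient \<phi> x $ i * ?\<psi> x)"
      proof (rule integration_by_parts_noncompact)
        show "(LINT x|lebesgue. \<phi> x * partial i \<eta> x) = - (LINT x|lebesgue. weak_gradient \<phi> x $ i * \<eta> x)"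
          if "\<eta> \<in> test_functions UNIV" for \<eta>
          using G that unfolding has_weak_gradient_def by blast
        show "integrable lebesgue (\<lambda>x. \<phi> x * ?\<psi> x)" "integrable lebesgue (\<lambda>x. \<phi> x * partial i ?\<psi> x)"
          "integrable lebesgue (\<lambda>x. weak_gradient \<phi> x $ i * ?\<psi> x)"
          unfolding pt
          using L2_mult[OF H1_L2[OF p] L2b_D(1)[OF L(1)]] L2_mult[OF H1_L2[OF p] L2b_D(1)[OF L(2)]]
            L2_mult[OF vL2_D[OF H1_gradient_vL2[OF p]] L2b_D(1)[OF L(1)]] by auto
      qed (use s H1_L2[OF p] vL2_D[OF H1_gradient_vL2[OF p]] in \<open>auto intro: L2_measurable\<close>)
      then have "ip \<phi> (\<lambda>x. ykdd \<tau> ?e i (x - y)) = - ip (\<lambda>x. weak_gradient \<phi> x $ i) ?\<psi>"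
        by (simp add: ip_def pt)
      moreover have "ip \<phi> (\<lambda>x. ykdd \<tau> ?e i (x - y)) = ip \<phi>' (\<lambda>x. ykdd \<tau> ?e i (x - y))"
        by (rule ip_cong_AE[OF H1_L2[OF p] L2b_D(1)[OF L(2)] p'(2)]) simp
      moreover have "ip (\<lambda>x. weak_gradient \<phi> x $ i) ?\<psi> = ip (g i) ?\<psi>"
        by (rule ip_cong_AE[OF vL2_D[OF H1_gradient_vL2[OF p]] L2b_D(1)[OF L(1)] g(2)]) simp
      ultimately have "ip ?\<psi> (g i) = - ip (\<lambda>x. ykdd \<tau> ?e i (x - y)) \<phi>'"
        by (simp add: ip_commute)
      then show ?thesis
        using L p' g by (simp add: ip_lborel L2b_D)
    qed
    then show ?thesis
      by (simp add: conv_Fubini[OF yk_reg(2)[OF eps_pos t] f g(1)] conv_Fubini[OF yk_reg(3)[OF eps_pos t] f p'(1)])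
  qed
  have eq: "(\<Sum>i\<in>UNIV. ip (conv (ykd \<tau> (eps n) i) f) (g i)) + \<tau>\<^sup>2 * ip (conv (yk \<tau> (eps n)) f) \<phi>'
     = ip (conv (yrho \<tau> (eps n)) f) \<phi>'" for n
  proof -
    let ?e = "eps n"
    note r = yk_reg[OF eps_pos t, of n]
    have i0: "integrable lborel (\<lambda>z. \<tau>\<^sup>2 * yk \<tau> ?e z)" using r(1) by auto
    note i1 = Bochner_Integration.integrable_diff[OF i0 r(3)[of 1]]
    note i2 = Bochner_Integration.integrable_diff[OF i1 r(3)[of 2]]
    have "yrho \<tau> ?e = (\<lambda>z. \<tau>\<^sup>2 * yk \<tau> ?e z - ykdd \<tau> ?e 1 z - ykdd \<tau> ?e 2 z - ykdd \<tau> ?e 3 z)"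
      by (rule ext) (simp add: yrho_eq[OF eps_pos] sum_3)
    then have "ip (conv (yrho \<tau> ?e) f) \<phi>' = ip (conv (\<lambda>z. \<tau>\<^sup>2 * yk \<tau> ?e z) f) \<phi>' - ip (conv (ykdd \<tau> ?e 1) f) \<phi>'
       - ip (conv (ykdd \<tau> ?e 2) f) \<phi>' - ip (conv (ykdd \<tau> ?e 3) f) \<phi>'"
      by (simp add: ip_conv_kernel_diff[OF i2 r(3)[of 3] f p'(1)] ip_conv_kernel_diff[OF i1 r(3)[of 2] f p'(1)]
          ip_conv_kernel_diff[OF i0 r(3)[of 1] f p'(1)])
    then show ?thesis by (simp add: sum_3 parts conv_cmult ip_cmult_left)
  qed
  have "(\<lambda>n. (\<Sum>i\<in>UNIV. ip (conv (ykd \<tau> (eps n) i) f) (g i)) + \<tau>\<^sup>2 * ip (conv (yk \<tau> (eps n)) f) \<phi>')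
    \<longlonglongrightarrow> (\<Sum>i\<in>UNIV. ip (conv (ykd \<tau> 0 i) f) (g i)) + \<tau>\<^sup>2 * ip (conv (yk \<tau> 0) f) \<phi>'"
    by (intro tendsto_add tendsto_sum tendsto_mult tendsto_const
        ip_conv_tendsto[OF yk_reg(2)[OF eps_pos t] ykd_L1[OF t] f g(1)]
        ip_conv_tendsto[OF yk_reg(1)[OF eps_pos t] yk_L1[OF t] f p'(1)])
  from LIMSEQ_unique[OF this yrho_tendsto[OF t f p'(1), folded eq]]
  have "(\<Sum>i\<in>UNIV. ip (conv (ykd \<tau> 0 i) f) (g i)) + \<tau>\<^sup>2 * ip (conv (yk \<tau> 0) f) \<phi>' = ip f \<phi>'" .
  moreover have "ip f \<phi>' = ip f \<phi>"
    by (rule ip_cong_AE[symmetric, OF L2b_D(1)[OF f] H1_L2[OF p] _ p'(2)]) simp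
  moreover have "ip (conv (yk \<tau> 0) f) \<phi>' = ip (conv (yk \<tau> 0) f) \<phi>"
    by (rule ip_cong_AE[symmetric, OF L2b_D(1)[OF conv_L2(1)[OF yk_L1(1)[OF t] f]] H1_L2[OF p] _ p'(2)]) simp
  moreover have "ip (conv (ykd \<tau> 0 i) f) (g i) = ip (conv (ykd \<tau> 0 i) f) (\<lambda>x. weak_gradient \<phi> x $ i)" for i
    by (rule ip_cong_AE[symmetric, OF L2b_D(1)[OF conv_L2(1)[OF ykd_L1(1)[OF t] f]] vL2_D[OF H1_gradient_vL2[OF p]] _ g(2)]) simp
  ultimately show ?thesis by (simp add: vip_def)
qed

text \<open>The potential is defined by an integral over \<open>B\<close>, so the equation with the full right-hand side \<open>f\<close>
  needs \<open>f\<close> to vanish almost everywhere outside \<open>B\<close>, and not only outside its closure.\<close>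

theorem v_fun_equation:
  assumes t: "\<tau> > 0" and f: "f \<in> L2" and B: "B \<in> sets lebesgue" and z: "AE x in lebesgue. x \<notin> B \<longrightarrow> f x = 0"
  obtains G where "has_weak_gradient (v_fun B f \<tau>) G"
    "\<And>x i. G x $ i = - (LINT y|lebesgue. ykA \<tau> (norm (x - y)) * (x - y) $ i * f y)"
    "\<And>\<phi>. \<phi> \<in> H1 \<Longrightarrow> vip G (weak_gradient \<phi>) + \<tau>\<^sup>2 * ip (v_fun B f \<tau>) \<phi> = ip f \<phi>"
proof -
  obtain f' where f': "f' \<in> L2b" "AE x in lebesgue. f x = f' x" using L2_borel_representative[OF f] by metis
  have fm: "f \<in> borel_measurable lebesgue" by (rule L2_measurable[OF f])
  have [measurable]: "f' \<in> borel_measurable borel" using f' L2b_D by auto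
  have rep: "(LINT y|lebesgue. K (x - y) * f y) = conv K f' x" if [measurable]: "K \<in> borel_measurable borel" for K x
  proof -
    have "(LINT y|lebesgue. K (x - y) * f y) = (LINT y|lebesgue. K (x - y) * f' y)"
    proof (rule integral_cong_AE)
      show "(\<lambda>y. K (x - y) * f y) \<in> borel_measurable lebesgue"
        by (intro borel_measurable_times fm borel_lebesgue) measurable
      show "(\<lambda>y. K (x - y) * f' y) \<in> borel_measurable lebesgue" by (intro borel_lebesgue) measurable
      show "AE y in lebesgue. K (x - y) * f y = K (x - y) * f' y" using f'(2) by eventually_elim simp
    qed
    also have "\<dots> = conv K f' x" unfolding conv_def by (rule integral_completion) measurable
    finally show ?thesis .
  qed
  have v: "v_fun B f \<tau> = conv (yk \<tau> 0) f'"
  proof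
    fix x
    have "(LINT y|lebesgue_on B. exp (- \<tau> * norm (x - y)) / norm (x - y) * f y)
      = (LINT y|lebesgue. indicat_real B y *\<^sub>R (exp (- \<tau> * norm (x - y)) / norm (x - y) * f y))"
      using B by (subst integral_restrict_space) auto
    also have "\<dots> = (LINT y|lebesgue. exp (- \<tau> * norm (x - y)) / norm (x - y) * f y)"
    proof (rule integral_cong_AE)
      have m: "(\<lambda>y. exp (- \<tau> * norm (x - y)) / norm (x - y) * f y) \<in> borel_measurable lebesgue"
        by (intro borel_measurable_times fm borel_lebesgue) measurable
      then show "(\<lambda>y. exp (- \<tau> * norm (x - y)) / norm (x - y) * f y) \<in> borel_measurable lebesgue" .
      show "(\<lambda>y. indicat_real B y *\<^sub>R (exp (- \<tau> * norm (x - y)) / norm (x - y) * f y)) \<in> borel_measurable lebesgue"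
        using m B by (intro borel_measurable_scaleR borel_measurable_indicator)
      show "AE y in lebesgue. indicat_real B y *\<^sub>R (exp (- \<tau> * norm (x - y)) / norm (x - y) * f y) = exp (- \<tau> * norm (x - y)) / norm (x - y) * f y"
        using z by eventually_elim (auto simp: indicator_def)
    qed
    finally have "v_fun B f \<tau> x = 1 / (4 * pi) * (LINT y|lebesgue. exp (- \<tau> * norm (x - y)) / norm (x - y) * f y)"
      unfolding v_fun_def by (simp only:)
    also have "\<dots> = (LINT y|lebesgue. (1 / (4 * pi)) * (exp (- \<tau> * norm (x - y)) / norm (x - y) * f y))"
      by (rule integral_mult_right_zero[symmetric])
    also have "\<dots> = (LINT y|lebesgue. yk \<tau> 0 (x - y) * f y)"
      by (intro Bochner_Integration.integral_cong refl) (simp add: yk_def Rr_0 mult_ac)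
    finally show "v_fun B f \<tau> x = conv (yk \<tau> 0) f' x" by (simp add: rep)
  qed
  show thesis
  proof (rule that)
    show "has_weak_gradient (v_fun B f \<tau>) (\<lambda>x. \<chi> i. conv (ykd \<tau> 0 i) f' x)"
      unfolding v by (rule yukawa_weak_gradient[OF t f'(1)])
    show "(\<chi> i. conv (ykd \<tau> 0 i) f' x) $ i = - (LINT y|lebesgue. ykA \<tau> (norm (x - y)) * (x - y) $ i * f y)" for x i
    proof -
      have "(\<chi> i. conv (ykd \<tau> 0 i) f' x) $ i = (LINT y|lebesgue. ykd \<tau> 0 i (x - y) * f y)"
        by (simp add: rep)
      also have "\<dots> = (LINT y|lebesgue. - (ykA \<tau> (norm (x - y)) * (x - y) $ i * f y))"
        by (intro Bochner_Integration.integral_cong refl) (simp add: ykd_def Rr_0)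
      finally show ?thesis by simp
    qed
    fix \<phi> assume p: "\<phi> \<in> H1"
    have "ip f' \<phi> = ip f \<phi>"
      by (rule ip_cong_AE[symmetric, OF f H1_L2[OF p] f'(2)]) simp
    then show "vip (\<lambda>x. \<chi> i. conv (ykd \<tau> 0 i) f' x) (weak_gradient \<phi>) + \<tau>\<^sup>2 * ip (v_fun B f \<tau>) \<phi> = ip f \<phi>"
      unfolding v using yukawa_equation[OF t f'(1) p] by simp
  qed
qed

section \<open>Integration over the time interval\<close>

abbreviation tm :: "real \<Rightarrow> real measure" where
  "tm T \<equiv> lebesgue_on {0<..<T}"

lemma tm_sets [simp]: "{0<..<T::real} \<inter> space lebesgue \<in> sets lebesgue"
  by simp

lemma space_tm [simp]: "space (tm T) = {0<..<T}"
  by (simp add: space_restrict_space)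

lemma finite_tm: "finite_measure (tm T)"
proof (rule finite_measureI)
  have "emeasure (tm T) (space (tm T)) = emeasure lborel {0<..<T}"
    by (simp add: emeasure_restrict_space)
  then show "emeasure (tm T) (space (tm T)) \<noteq> \<infinity>"
    by (cases "0 \<le> T") auto
qed

text \<open>Completeness of Lebesgue measure, transported to the interval by extension with 0. It
  supplies measurability of quantities that the hypotheses identify only almost everywhere.\<close>

lemma tm_measurable_AE_cong:
  fixes f g :: "real \<Rightarrow> real"
  assumes f: "f \<in> borel_measurable (tm T)" and ae: "AE t in tm T. f t = g t"
  shows "g \<in> borel_measurable (tm T)"
proof -
  have "(\<lambda>t. indicator {0<..<T} t *\<^sub>R f t) \<in> borel_measurable lebesgue"
    using f by (subst (asm) borel_measurable_restrict_space_iff) auto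
  moreover have "AE t in lebesgue. indicator {0<..<T} t *\<^sub>R f t = indicator {0<..<T} t *\<^sub>R g t"
    using ae by (subst (asm) AE_restrict_space_iff) (auto elim!: eventually_mono simp: indicator_def)
  ultimately have "(\<lambda>t. indicator {0<..<T} t *\<^sub>R g t) \<in> borel_measurable lebesgue"
    by (rule borel_measurable_AE)
  then show ?thesis by (subst borel_measurable_restrict_space_iff) auto
qed

lemma tm_measurable_AE_limit:
  fixes F :: "nat \<Rightarrow> real \<Rightarrow> real"
  assumes F: "\<And>n. F n \<in> borel_measurable (tm T)" and l: "AE t in tm T. (\<lambda>n. F n t) \<longlonglongrightarrow> g t"
  shows "g \<in> borel_measurable (tm T)"
proof (rule tm_measurable_AE_cong)
  show "(\<lambda>t. lim (\<lambda>n. F n t)) \<in> borel_measurable (tm T)" by (rule borel_measurable_lim_metric[OF F])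
  show "AE t in tm T. lim (\<lambda>n. F n t) = g t" using l by eventually_elim (rule limI)
qed

lemma tm_dominated:
  fixes F :: "nat \<Rightarrow> real \<Rightarrow> real"
  assumes F: "\<And>n. F n \<in> borel_measurable (tm T)" and l: "AE t in tm T. (\<lambda>n. F n t) \<longlonglongrightarrow> g t"
    and h: "integrable (tm T) h" and b: "\<And>n. AE t in tm T. \<bar>F n t\<bar> \<le> h t"
  shows "\<And>n. integrable (tm T) (F n)" "integrable (tm T) g" "(\<lambda>n. LINT t|tm T. F n t) \<longlonglongrightarrow> (LINT t|tm T. g t)"
proof -
  have g: "g \<in> borel_measurable (tm T)" by (rule tm_measurable_AE_limit[OF F l])
  have b': "AE t in tm T. norm (F n t) \<le> h t" for n using b[of n] by simp
  show "\<And>n. integrable (tm T) (F n)" "integrable (tm T) g" "(\<lambda>n. LINT t|tm T. F n t) \<longlonglongrightarrow> (LINT t|tm T. g t)"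
    using integrable_dominated_convergence[OF g F h l b'] integrable_dominated_convergence2[OF g F h l b']
      integral_dominated_convergence[OF g F h l b'] by auto
qed

lemma tm_integrable_bound:
  fixes f :: "real \<Rightarrow> real"
  assumes "f \<in> borel_measurable (tm T)" "AE t in tm T. \<bar>f t\<bar> \<le> C"
  shows "integrable (tm T) f"
  by (rule finite_measure.integrable_const_bound[OF finite_tm, of _ C]) (use assms in auto)

lemma tm_integrable_sq_imp:
  fixes f :: "real \<Rightarrow> real"
  assumes "f \<in> borel_measurable (tm T)" "integrable (tm T) (\<lambda>t. (f t)\<^sup>2)"
  shows "integrable (tm T) f"
proof (rule Bochner_Integration.integrable_bound[OF Bochner_Integration.integrable_add[OF assms(2) finite_measure.integrable_const[OF finite_tm, of T "1::real"]]])
  show "AE t in tm T. norm (f t) \<le> norm ((f t)\<^sup>2 + 1)"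
  proof (rule AE_I2)
    fix t
    have "\<bar>f t * 1\<bar> \<le> (f t)\<^sup>2 + 1\<^sup>2" by (rule abs_mult_le_squares)
    then show "norm (f t) \<le> norm ((f t)\<^sup>2 + 1)" by simp
  qed
qed (rule assms(1))

section \<open>The Laplace transform and joint measurability\<close>

text \<open>The Lebesgue measure of the product is the completion of a product, so a function
  measurable for it need not have measurable sections and Fubini does not apply directly. A Borel
  function agreeing almost everywhere has good sections, and the exceptional null set is small in
  almost every section in both directions.\<close>

lemma jointly_measurable_representative:
  assumes "(\<lambda>(t, x). u t x) \<in> borel_measurable (lebesgue_on ({0<..<T} \<times> (UNIV :: R3 set)))"
  obtains g :: "real \<times> R3 \<Rightarrow> real" where "g \<in> borel_measurable borel"
    "AE t in lebesgue. AE x in lebesgue. indicat_real {0<..<T} t * u t x = g (t, x)"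
    "AE x in lebesgue. AE t in lebesgue. indicat_real {0<..<T} t * u t x = g (t, x)"
proof -
  let ?S = "{0<..<T} \<times> (UNIV :: R3 set)"
  let ?U = "\<lambda>z::real \<times> R3. indicat_real ?S z *\<^sub>R (case z of (t, x) \<Rightarrow> u t x)"
  have S: "?S \<inter> space lebesgue \<in> sets lebesgue" by (simp add: open_Times)
  have "?U \<in> borel_measurable lebesgue"
    using assms by (subst (asm) borel_measurable_restrict_space_iff[OF S])
  then obtain g where g: "g \<in> borel_measurable lborel" "AE z in lborel. ?U z = g z"
    using completion_ex_borel_measurable_real[of ?U lborel] by auto
  have "AE z in (lborel \<Otimes>\<^sub>M lborel). ?U z = g z" unfolding lborel_prod by (rule g(2))
  then obtain N where N: "{z \<in> space (lborel \<Otimes>\<^sub>M lborel). \<not> ?U z = g z} \<subseteq> N"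
    "emeasure (lborel \<Otimes>\<^sub>M lborel) N = 0" "N \<in> sets (lborel \<Otimes>\<^sub>M lborel)" by (rule AE_E)
  have NP: "?U (t, x) = g (t, x)" if "(t, x) \<notin> N" for t x
  proof (rule ccontr)
    assume "?U (t, x) \<noteq> g (t, x)"
    then have "(t, x) \<in> N" by (intro subsetD[OF N(1)]) (simp add: space_pair_measure)
    with that show False by simp
  qed
  have "AE z in (lborel \<Otimes>\<^sub>M lborel). z \<notin> N" using N by (intro AE_not_in) (simp add: null_sets_def)
  then have 1: "AE t in lborel. AE x in lborel. (t, x) \<notin> N" by (rule lborel_pair.AE_pair)
  have [measurable]: "N \<in> sets (lborel \<Otimes>\<^sub>M lborel)" by fact
  have "{z \<in> space (lborel \<Otimes>\<^sub>M lborel). (fst z, snd z) \<notin> N} \<in> sets (lborel \<Otimes>\<^sub>M lborel)" by measurable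
  from lborel_pair.AE_commute[of "\<lambda>t x. (t, x) \<notin> N", OF this] 1
  have 2: "AE x in lborel. AE t in lborel. (t, x) \<notin> N" by simp
  have e: "indicat_real {0<..<T} t * u t x = ?U (t, x)" for t x by (simp add: indicator_def)
  show thesis
  proof
    show "g \<in> borel_measurable borel" using g by simp
    have "AE t in lborel. AE x in lebesgue. indicat_real {0<..<T} t * u t x = g (t, x)"
      using 1
    proof eventually_elim
      case (elim t)
      then have "AE x in lborel. indicat_real {0<..<T} t * u t x = g (t, x)"
        by eventually_elim (unfold e, erule NP)
      then show ?case by (rule AE_completion)
    qed
    then show "AE t in lebesgue. AE x in lebesgue. indicat_real {0<..<T} t * u t x = g (t, x)" by (rule AE_completion)
    have "AE x in lborel. AE t in lebesgue. indicat_real {0<..<T} t * u t x = g (t, x)"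
      using 2
    proof eventually_elim
      case (elim x)
      then have "AE t in lborel. indicat_real {0<..<T} t * u t x = g (t, x)"
        by eventually_elim (unfold e, erule NP)
      then show ?case by (rule AE_completion)
    qed
    then show "AE x in lebesgue. AE t in lebesgue. indicat_real {0<..<T} t * u t x = g (t, x)" by (rule AE_completion)
  qed
qed

text \<open>\<open>w_fun\<close> integrates over \<open>t\<close> at fixed \<open>x\<close>, whereas
  the hypotheses describe \<open>u t\<close> as an element of \<open>L2\<close> at fixed
  \<open>t\<close>. Fubini for the Borel representative connects the two: the majorant
  \<open>m\<close> gives square integrability on the product, and Cauchy-Schwarz in \<open>t\<close>
  that of the time integral.\<close>

lemma w_fun_L2:
  assumes jm: "(\<lambda>(t, x). u t x) \<in> borel_measurable (lebesgue_on ({0<..<T} \<times> (UNIV :: R3 set)))"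
    and uL: "AE t in tm T. u t \<in> L2"
    and m: "integrable (tm T) (\<lambda>t. (m t)\<^sup>2)" "AE t in tm T. L2_norm (u t) \<le> m t" and tau: "\<tau> \<ge> 0" and T: "T > 0"
  shows "w_fun T u \<tau> \<in> L2"
    "\<And>\<phi>. \<phi> \<in> L2 \<Longrightarrow> ip (w_fun T u \<tau>) \<phi> = (LINT t|tm T. exp (- \<tau> * t) * ip (u t) \<phi>)"
proof -
  obtain g :: "real \<times> R3 \<Rightarrow> real" where g[measurable]: "g \<in> borel_measurable borel"
    and g1: "AE t in lebesgue. AE x in lebesgue. indicat_real {0<..<T} t * u t x = g (t, x)"
    and g2: "AE x in lebesgue. AE t in lebesgue. indicat_real {0<..<T} t * u t x = g (t, x)"
    using jointly_measurable_representative[OF jm] by blast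
  have gp[measurable]: "g \<in> borel_measurable (lborel \<Otimes>\<^sub>M lborel)" using g unfolding lborel_prod by simp
  have gs[measurable]: "(\<lambda>t. g (t, x)) \<in> borel_measurable borel" "(\<lambda>x. g (t, x)) \<in> borel_measurable borel" for t x
    by (rule measurable_compose[OF _ g], intro borel_measurable_continuous_onI continuous_intros)+
  have uL': "AE t in lebesgue. t \<in> {0<..<T} \<longrightarrow> u t \<in> L2"
    using uL by (subst (asm) AE_restrict_space_iff) auto
  have m': "AE t in lebesgue. t \<in> {0<..<T} \<longrightarrow> L2_norm (u t) \<le> m t"
    using m(2) by (subst (asm) AE_restrict_space_iff) auto
  \<comment> \<open>The weight carries the indicator of the interval, so that all integrals below
    run over the whole line with respect to \<open>lborel\<close>.\<close>
  define k where "k t = indicat_real {0<..<T} t * exp (- \<tau> * t)" for t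
  have k[measurable]: "k \<in> borel_measurable borel" unfolding k_def[abs_def] by measurable
  have k01: "0 \<le> k t" "k t \<le> indicat_real {0<..<T} t" for t using tau by (auto simp: k_def indicator_def)
  have kk: "k t * indicat_real {0<..<T} t = k t" for t by (simp add: k_def indicator_def)
  define w0 where "w0 x = (LINT t|lborel. k t * g (t, x))" for x
  have w0m[measurable]: "w0 \<in> borel_measurable borel"
  proof -
    have "(\<lambda>x. LINT t|lborel. k t * g (t, x)) \<in> borel_measurable lborel"
    proof (rule lborel.borel_measurable_lebesgue_integral)
      have "(\<lambda>z. g (snd z, fst z)) \<in> borel_measurable (lborel \<Otimes>\<^sub>M (lborel :: real measure))"
        by (rule measurable_compose[OF _ gp]) measurable
      then show "(\<lambda>(x, t). k t * g (t, x)) \<in> borel_measurable (lborel \<Otimes>\<^sub>M lborel)"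
        unfolding split_beta' by measurable
    qed
    then show ?thesis by (simp add: w0_def[abs_def])
  qed
  have ww: "AE x in lebesgue. w0 x = w_fun T u \<tau> x"
    using g2
  proof eventually_elim
    case (elim x)
    have e: "AE t in lebesgue. k t * g (t, x) = indicat_real {0<..<T} t *\<^sub>R (exp (- \<tau> * t) * u t x)"
      using elim by eventually_elim (auto simp: k_def indicator_def)
    have m1: "(\<lambda>t. k t * g (t, x)) \<in> borel_measurable lebesgue" by (rule measurable_completion) measurable
    have "w_fun T u \<tau> x = (LINT t|lebesgue. indicat_real {0<..<T} t *\<^sub>R (exp (- \<tau> * t) * u t x))"
      unfolding w_fun_def by (subst integral_restrict_space) auto
    also have "\<dots> = (LINT t|lebesgue. k t * g (t, x))"
      by (rule integral_cong_AE[OF borel_measurable_AE[OF m1 e] m1]) (use e in \<open>auto elim: eventually_mono\<close>)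
    also have "\<dots> = w0 x" unfolding w0_def by (rule integral_completion) measurable
    finally show ?case by simp
  qed
  have g_sq: "AE t in lebesgue. (\<integral>\<^sup>+x. ennreal ((g (t, x))\<^sup>2) \<partial>lborel) \<le> ennreal ((m t)\<^sup>2) * indicator {0<..<T} t"
    using g1 uL' m'
  proof eventually_elim
    case (elim t)
    have "(\<integral>\<^sup>+x. ennreal ((g (t, x))\<^sup>2) \<partial>lborel) = (\<integral>\<^sup>+x. ennreal ((g (t, x))\<^sup>2) \<partial>lebesgue)"
      by (rule nn_integral_completion[symmetric])
    also have "\<dots> = (\<integral>\<^sup>+x. ennreal ((indicat_real {0<..<T} t * u t x)\<^sup>2) \<partial>lebesgue)"
      by (intro nn_integral_cong_AE) (use elim(1) in \<open>auto elim!: eventually_mono\<close>)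
    also have "\<dots> \<le> ennreal ((m t)\<^sup>2) * indicator {0<..<T} t"
    proof (cases "t \<in> {0<..<T}")
      case True
      then have "(L2_norm (u t))\<^sup>2 \<le> (m t)\<^sup>2" using elim L2_norm_nonneg by (intro power_mono) auto
      then show ?thesis using True elim nn_integral_L2[of "u t"] by (simp add: ennreal_leI)
    qed simp
    finally show ?case .
  qed
  have G: "(\<integral>\<^sup>+t. (\<integral>\<^sup>+x. ennreal ((g (t, x))\<^sup>2) \<partial>lborel) \<partial>lborel) < \<infinity>"
  proof -
    have "(\<integral>\<^sup>+t. (\<integral>\<^sup>+x. ennreal ((g (t, x))\<^sup>2) \<partial>lborel) \<partial>lborel) = (\<integral>\<^sup>+t. (\<integral>\<^sup>+x. ennreal ((g (t, x))\<^sup>2) \<partial>lborel) \<partial>lebesgue)"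
      by (rule nn_integral_completion[symmetric])
    also have "\<dots> \<le> (\<integral>\<^sup>+t. ennreal ((m t)\<^sup>2) * indicator {0<..<T} t \<partial>lebesgue)"
      by (rule nn_integral_mono_AE[OF g_sq])
    also have "\<dots> = (\<integral>\<^sup>+t. ennreal ((m t)\<^sup>2) \<partial>tm T)" by (subst nn_integral_restrict_space) auto
    also have "\<dots> < \<infinity>" using m(1) by (simp add: nn_integral_eq_integral)
    finally show ?thesis .
  qed
  have kL: "(\<integral>\<^sup>+t. ennreal ((k t)\<^sup>2) \<partial>lborel) \<le> ennreal T"
  proof -
    have "(k t)\<^sup>2 \<le> indicat_real {0<..<T} t" for t
      using k01[of t] by (auto simp: indicator_def power_le_one_iff split: if_splits)
    then have "(\<integral>\<^sup>+t. ennreal ((k t)\<^sup>2) \<partial>lborel) \<le> (\<integral>\<^sup>+t. indicator {0<..<T} t \<partial>lborel)"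
      by (intro nn_integral_mono) (metis ennreal_indicator ennreal_leI)
    also have "\<dots> = ennreal T" using T by simp
    finally show ?thesis .
  qed
  have w0_sq: "ennreal ((w0 x)\<^sup>2) \<le> ennreal T * (\<integral>\<^sup>+t. ennreal ((g (t, x))\<^sup>2) \<partial>lborel)" for x
  proof -
    have "ennreal \<bar>w0 x\<bar> \<le> (\<integral>\<^sup>+t. ennreal \<bar>k t * g (t, x)\<bar> \<partial>lborel)"
    proof (cases "integrable lborel (\<lambda>t. k t * g (t, x))")
      case True
      then show ?thesis unfolding w0_def using integral_norm_bound_ennreal[OF True] by simp
    qed (simp add: w0_def not_integrable_integral_eq)
    also have "\<dots> = (\<integral>\<^sup>+t. ennreal (k t) * ennreal \<bar>g (t, x)\<bar> \<partial>lborel)"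
      using k01(1) by (simp add: abs_mult ennreal_mult)
    finally have "(ennreal \<bar>w0 x\<bar>)\<^sup>2 \<le> (\<integral>\<^sup>+t. ennreal (k t) * ennreal \<bar>g (t, x)\<bar> \<partial>lborel)\<^sup>2" by (intro power_mono) auto
    also have "\<dots> \<le> (\<integral>\<^sup>+t. (ennreal (k t))\<^sup>2 \<partial>lborel) * (\<integral>\<^sup>+t. (ennreal \<bar>g (t, x)\<bar>)\<^sup>2 \<partial>lborel)"
      by (rule Cauchy_Schwarz_nn_integral) measurable
    also have "\<dots> \<le> ennreal T * (\<integral>\<^sup>+t. ennreal ((g (t, x))\<^sup>2) \<partial>lborel)"
      using kL k01(1) by (intro mult_mono) (auto simp: ennreal_power)
    finally show ?thesis by (simp add: ennreal_power)
  qed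
  have w0L: "w0 \<in> L2b"
  proof -
    have "(\<integral>\<^sup>+x. ennreal ((w0 x)\<^sup>2) \<partial>lebesgue) = (\<integral>\<^sup>+x. ennreal ((w0 x)\<^sup>2) \<partial>lborel)"
      by (rule nn_integral_completion)
    also have "\<dots> \<le> (\<integral>\<^sup>+x. ennreal T * (\<integral>\<^sup>+t. ennreal ((g (t, x))\<^sup>2) \<partial>lborel) \<partial>lborel)"
      by (intro nn_integral_mono w0_sq)
    also have "\<dots> = ennreal T * (\<integral>\<^sup>+x. (\<integral>\<^sup>+t. ennreal ((g (t, x))\<^sup>2) \<partial>lborel) \<partial>lborel)"
      by (rule nn_integral_cmult) measurable
    also have "(\<integral>\<^sup>+x. (\<integral>\<^sup>+t. ennreal ((g (t, x))\<^sup>2) \<partial>lborel) \<partial>lborel) = (\<integral>\<^sup>+t. (\<integral>\<^sup>+x. ennreal ((g (t, x))\<^sup>2) \<partial>lborel) \<partial>lborel)"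
      by (rule lborel_pair.Fubini') measurable
    finally have fin: "(\<integral>\<^sup>+x. ennreal ((w0 x)\<^sup>2) \<partial>lebesgue) < \<infinity>"
      using G by (auto simp: ennreal_mult_less_top elim!: le_less_trans)
    have "integrable lebesgue (\<lambda>x. (w0 x)\<^sup>2)"
      by (rule integrableI_bounded) (use fin borel_lebesgue[OF w0m] in auto)
    then show ?thesis using w0m by (simp add: L2b_def L2_def borel_lebesgue)
  qed
  show wL: "w_fun T u \<tau> \<in> L2" by (rule L2_AE_cong[OF L2b_D(1)[OF w0L] ww])
  fix \<phi> :: "R3 \<Rightarrow> real" assume p: "\<phi> \<in> L2"
  obtain \<phi>' where p': "\<phi>' \<in> L2b" "AE x in lebesgue. \<phi> x = \<phi>' x" using L2_borel_representative[OF p] by metis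
  have [measurable]: "\<phi>' \<in> borel_measurable borel" using p' L2b_D by auto
  have int: "integrable (lborel \<Otimes>\<^sub>M lborel) (\<lambda>(t, x). k t * g (t, x) * \<phi>' x)"
  proof (rule integrableI_bounded)
    show "(\<lambda>(t, x). k t * g (t, x) * \<phi>' x) \<in> borel_measurable (lborel \<Otimes>\<^sub>M lborel)" by measurable
    have "(\<integral>\<^sup>+z. ennreal (norm (case z of (t, x) \<Rightarrow> k t * g (t, x) * \<phi>' x)) \<partial>(lborel \<Otimes>\<^sub>M lborel))
       = (\<integral>\<^sup>+t. (\<integral>\<^sup>+x. ennreal (norm (k t * g (t, x) * \<phi>' x)) \<partial>lborel) \<partial>lborel)"
      by (subst lborel.nn_integral_fst[symmetric]) auto
    also have "\<dots> \<le> (\<integral>\<^sup>+t. (\<integral>\<^sup>+x. ennreal ((g (t, x))\<^sup>2) + indicator {0<..<T} t * ennreal ((\<phi>' x)\<^sup>2) \<partial>lborel) \<partial>lborel)"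
    proof (intro nn_integral_mono)
      fix t :: real and x :: R3
      show "ennreal (norm (k t * g (t, x) * \<phi>' x)) \<le> ennreal ((g (t, x))\<^sup>2) + indicator {0<..<T} t * ennreal ((\<phi>' x)\<^sup>2)"
      proof (cases "t \<in> {0<..<T}")
        case True
        have "k t * \<bar>g (t, x) * \<phi>' x\<bar> \<le> 1 * ((g (t, x))\<^sup>2 + (\<phi>' x)\<^sup>2)"
          using k01[of t] True by (intro mult_mono abs_mult_le_squares) auto
        then have "norm (k t * g (t, x) * \<phi>' x) \<le> (g (t, x))\<^sup>2 + (\<phi>' x)\<^sup>2"
          using k01(1)[of t] by (simp add: abs_mult mult.assoc)
        from ennreal_leI[OF this] show ?thesis using True by (simp add: ennreal_plus)
      qed (simp add: k_def)
    qed
    also have "\<dots> = (\<integral>\<^sup>+t. (\<integral>\<^sup>+x. ennreal ((g (t, x))\<^sup>2) \<partial>lborel) + indicator {0<..<T} t * ennreal ((L2_norm \<phi>')\<^sup>2) \<partial>lborel)"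
      by (intro nn_integral_cong) (simp add: nn_integral_add nn_integral_cmult nn_integral_L2b[OF p'(1)])
    also have "\<dots> = (\<integral>\<^sup>+t. (\<integral>\<^sup>+x. ennreal ((g (t, x))\<^sup>2) \<partial>lborel) \<partial>lborel) + ennreal T * ennreal ((L2_norm \<phi>')\<^sup>2)"
      using T by (subst nn_integral_add) (auto simp: nn_integral_multc)
    also have "\<dots> < \<infinity>" using G by (simp add: ennreal_mult_less_top)
    finally show "(\<integral>\<^sup>+z. ennreal (norm (case z of (t, x) \<Rightarrow> k t * g (t, x) * \<phi>' x)) \<partial>(lborel \<Otimes>\<^sub>M lborel)) < \<infinity>" .
  qed
  have inner: "AE t in lebesgue. (LINT x|lborel. k t * g (t, x) * \<phi>' x) = indicat_real {0<..<T} t *\<^sub>R (exp (- \<tau> * t) * ip (u t) \<phi>)"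
    using g1 uL'
  proof eventually_elim
    case (elim t)
    show ?case
    proof (cases "t \<in> {0<..<T}")
      case True
      have "(LINT x|lborel. k t * g (t, x) * \<phi>' x) = k t * (LINT x|lborel. g (t, x) * \<phi>' x)"
        by (simp add: mult.assoc)
      also have "(LINT x|lborel. g (t, x) * \<phi>' x) = ip (\<lambda>x. g (t, x)) \<phi>'" by (rule ip_lborel[symmetric]) measurable
      also have "\<dots> = ip (u t) \<phi>"
        by (rule ip_cong_AE[symmetric, OF _ p _ p'(2)]) (use elim True in auto)
      finally show ?thesis using True by (simp add: k_def)
    qed (simp add: k_def)
  qed
  have "ip (w_fun T u \<tau>) \<phi> = ip w0 \<phi>'"
    by (rule ip_cong_AE[symmetric, OF L2b_D(1)[OF w0L] L2b_D(1)[OF p'(1)] ww]) (use p'(2) in \<open>auto elim: eventually_mono\<close>)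
  also have "\<dots> = (LINT x|lborel. (LINT t|lborel. k t * g (t, x) * \<phi>' x))"
    by (subst ip_lborel) (auto simp: w0_def)
  also have "\<dots> = (LINT t|lborel. (LINT x|lborel. k t * g (t, x) * \<phi>' x))"
    by (rule lborel_pair.Fubini_integral) (rule int)
  also have "\<dots> = (LINT t|lebesgue. (LINT x|lborel. k t * g (t, x) * \<phi>' x))"
  proof (rule integral_completion[symmetric])
    show "(\<lambda>t. LINT x|lborel. k t * g (t, x) * \<phi>' x) \<in> borel_measurable lborel"
      by (rule lborel.borel_measurable_lebesgue_integral) measurable
  qed
  also have "\<dots> = (LINT t|lebesgue. indicat_real {0<..<T} t *\<^sub>R (exp (- \<tau> * t) * ip (u t) \<phi>))"
  proof -
    have "(\<lambda>t. LINT x|lborel. k t * g (t, x) * \<phi>' x) \<in> borel_measurable lborel"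
      by (rule lborel.borel_measurable_lebesgue_integral) measurable
    then have m1: "(\<lambda>t. LINT x|lborel. k t * g (t, x) * \<phi>' x) \<in> borel_measurable lebesgue" by (rule measurable_completion)
    show ?thesis by (rule integral_cong_AE[OF m1 borel_measurable_AE[OF m1 inner] inner])
  qed
  also have "\<dots> = (LINT t|tm T. exp (- \<tau> * t) * ip (u t) \<phi>)" by (subst integral_restrict_space) auto
  finally show "ip (w_fun T u \<tau>) \<phi> = (LINT t|tm T. exp (- \<tau> * t) * ip (u t) \<phi>)" .
qed

section \<open>The Laplace transform of the wave as an element of \<open>H1\<close>\<close>

lemma H1_norm_ge_0: "0 \<le> H1_norm u"
  by (simp add: H1_norm_def)

lemma ip_diff_H1_bound:
  assumes "a \<in> H1" "b \<in> H1" "\<phi> \<in> L2"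
  shows "\<bar>ip a \<phi> - ip b \<phi>\<bar> \<le> L2_norm \<phi> * H1_norm (\<lambda>x. a x - b x)"
proof -
  have "\<bar>ip a \<phi> - ip b \<phi>\<bar> \<le> L2_norm (\<lambda>x. a x - b x) * L2_norm \<phi>"
    using ip_Cauchy_Schwarz[OF L2_diff[OF H1_L2[OF assms(1)] H1_L2[OF assms(2)]] assms(3)]
    by (simp add: ip_diff_left H1_L2 assms)
  also have "\<dots> \<le> H1_norm (\<lambda>x. a x - b x) * L2_norm \<phi>"
    by (intro mult_right_mono L2_norm_le_H1 H1_diff assms L2_norm_nonneg)
  finally show ?thesis by (simp add: mult.commute)
qed

lemma vip_diff_H1_bound:
  assumes "a \<in> H1" "b \<in> H1" "\<Phi> \<in> vL2"
  shows "\<bar>vip (weak_gradient a) \<Phi> - vip (weak_gradient b) \<Phi>\<bar> \<le> vnorm \<Phi> * H1_norm (\<lambda>x. a x - b x)"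
proof -
  have "vip (weak_gradient a) \<Phi> - vip (weak_gradient b) \<Phi> = vip (\<lambda>x. weak_gradient a x - weak_gradient b x) \<Phi>"
    by (simp add: vip_diff_left H1_gradient_vL2 assms)
  also have "\<dots> = vip (weak_gradient (\<lambda>x. a x - b x)) \<Phi>"
    by (rule vip_cong_AE[symmetric, OF H1_gradient_vL2[OF H1_diff[OF assms(1,2)]] assms(3) weak_gradient_diff_AE[OF assms(1,2)]]) simp
  finally have "\<bar>vip (weak_gradient a) \<Phi> - vip (weak_gradient b) \<Phi>\<bar> \<le> vnorm (weak_gradient (\<lambda>x. a x - b x)) * vnorm \<Phi>"
    using vip_Cauchy_Schwarz[OF H1_gradient_vL2[OF H1_diff[OF assms(1,2)]] assms(3)] by simp
  also have "\<dots> \<le> H1_norm (\<lambda>x. a x - b x) * vnorm \<Phi>"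
    by (intro mult_right_mono vnorm_le_H1 H1_diff assms vnorm_nonneg)
  finally show ?thesis by (simp add: mult.commute)
qed

lemma H1_norm_diff_abs:
  assumes "a \<in> H1" "b \<in> H1" "c \<in> H1"
  shows "\<bar>H1_norm (\<lambda>x. a x - b x) - H1_norm (\<lambda>x. a x - c x)\<bar> \<le> H1_norm (\<lambda>x. b x - c x)"
  using H1_norm_triangle_diff[OF assms(1,2,3)] H1_norm_triangle_diff[OF assms(1,3,2)]
    H1_norm_minus_commute[OF assms(2,3)] by linarith

text \<open>Strong measurability provides simple functions converging almost everywhere but no
  common majorant. Setting a value to 0 whenever it is too large compared with \<open>u t\<close>
  yields one, keeps the functions simple, and does not disturb the limit.\<close>

lemma Bochner_H1_approx:
  assumes B: "Bochner_L2 T H1 H1_norm u"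
  obtains s :: "nat \<Rightarrow> real \<Rightarrow> R3 \<Rightarrow> real" where
    "\<And>n. simple_function (tm T) (s n)" "\<And>n t. t \<in> {0<..<T} \<Longrightarrow> s n t \<in> H1"
    "AE t in tm T. (\<lambda>n. H1_norm (\<lambda>x. s n t x - u t x)) \<longlonglongrightarrow> 0"
    "\<And>n. integrable (tm T) (\<lambda>t. H1_norm (\<lambda>x. s n t x - u t x))"
    "(\<lambda>n. LINT t|tm T. H1_norm (\<lambda>x. s n t x - u t x)) \<longlonglongrightarrow> 0"
    "(\<lambda>t. H1_norm (u t)) \<in> borel_measurable (tm T)"
proof -
  have uH: "AE t in tm T. u t \<in> H1" and isq: "integrable (tm T) (\<lambda>t. (H1_norm (u t))\<^sup>2)"
    using B by (auto simp: Bochner_L2_def)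
  obtain s where s: "\<And>n. simple_function (tm T) (s n)" "\<And>n. s n ` {0<..<T} \<subseteq> H1"
    and sl: "AE t in tm T. (\<lambda>n. H1_norm (s n t - u t)) \<longlonglongrightarrow> 0"
    using B by (auto simp: Bochner_L2_def strongly_measurable_def)
  define m where "m t = H1_norm (u t)" for t
  have m0: "0 \<le> m t" for t by (simp add: m_def H1_norm_ge_0)
  have mm: "m \<in> borel_measurable (tm T)"
  proof -
    have "(\<lambda>t. sqrt ((H1_norm (u t))\<^sup>2)) \<in> borel_measurable (tm T)" using isq by measurable
    then show ?thesis by (simp add: m_def[abs_def] H1_norm_ge_0)
  qed
  have mi: "integrable (tm T) m" by (rule tm_integrable_sq_imp[OF mm]) (use isq in \<open>simp add: m_def\<close>)
  \<comment> \<open>Once \<open>s n t\<close> is within distance 1 of \<open>u t\<close> its norm is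
    below \<open>m t + 1\<close>, so the truncation is eventually inactive, also where
    \<open>m t\<close> is 0.\<close>
  define r where "r n t = (if H1_norm (s n t) \<le> 2 * m t + 1 then s n t else (\<lambda>x. 0))" for n t
  have sm: "(\<lambda>t. H1_norm (s n t)) \<in> borel_measurable (tm T)" for n
    by (rule borel_measurable_simple_function) (rule simple_function_compose1[OF s(1)])
  have rs: "simple_function (tm T) (r n)" for n
    unfolding r_def
  proof (rule simple_function_If)
    have "{t \<in> space (tm T). H1_norm (s n t) \<le> 2 * m t + 1} \<in> sets (tm T)"
      using sm[of n] mm by measurable
    then show "{t \<in> space (tm T). H1_norm (s n t) \<le> 2 * m t + 1} \<in> sets (tm T)" .
  qed (auto simp: s(1))
  have rH: "r n t \<in> H1" if "t \<in> {0<..<T}" for n t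
    using that s(2)[of n] H1_zero by (auto simp: r_def)
  have z: "H1_norm (\<lambda>x. 0) = 0" using H1_norm_cmult[OF H1_zero, of 0] by simp
  have rb: "H1_norm (r n t) \<le> 2 * m t + 1" for n t
    using z m0[of t] by (auto simp: r_def)
  have inT: "AE t in tm T. t \<in> {0<..<T}" by (rule AE_I2) simp
  have rl: "AE t in tm T. (\<lambda>n. H1_norm (\<lambda>x. r n t x - u t x)) \<longlonglongrightarrow> 0"
    using sl uH inT
  proof eventually_elim
    case (elim t)
    have sl': "(\<lambda>n. H1_norm (\<lambda>x. s n t x - u t x)) \<longlonglongrightarrow> 0" using elim(1) by (simp add: fun_diff_def)
    then have "\<forall>\<^sub>F n in sequentially. H1_norm (\<lambda>x. s n t x - u t x) < 1" by (rule order_tendstoD) simp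
    then have "\<forall>\<^sub>F n in sequentially. H1_norm (\<lambda>x. s n t x - u t x) = H1_norm (\<lambda>x. r n t x - u t x)"
    proof eventually_elim
      case (elim n)
      have sH: "s n t \<in> H1" using s(2)[of n] \<open>t \<in> {0<..<T}\<close> by auto
      have "H1_norm (s n t) \<le> H1_norm (\<lambda>x. s n t x - u t x) + H1_norm (u t)"
        using H1_norm_triangle[OF H1_diff[OF sH \<open>u t \<in> H1\<close>] \<open>u t \<in> H1\<close>] by simp
      then have "H1_norm (s n t) \<le> 2 * m t + 1" using elim m0[of t] by (simp add: m_def)
      then show ?case by (simp add: r_def)
    qed
    then show ?case using sl' by (rule Lim_transform_eventually[rotated])
  qed
  \<comment> \<open>A seminorm of a difference with \<open>u t\<close> is not a function of finitely
    many values; its measurability comes from the differences of two simple functions, in the limit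
    of one of them.\<close>
  have dm: "(\<lambda>t. H1_norm (\<lambda>x. r n t x - u t x)) \<in> borel_measurable (tm T)" for n
  proof (rule tm_measurable_AE_limit)
    show "(\<lambda>t. H1_norm (\<lambda>x. r n t x - r j t x)) \<in> borel_measurable (tm T)" for j
      by (rule borel_measurable_simple_function)
         (rule simple_function_compose2[OF rs rs, where h = "\<lambda>a b. H1_norm (\<lambda>x. a x - b x)"])
    show "AE t in tm T. (\<lambda>j. H1_norm (\<lambda>x. r n t x - r j t x)) \<longlonglongrightarrow> H1_norm (\<lambda>x. r n t x - u t x)"
      using rl uH inT
    proof eventually_elim
      case (elim t)
      have "(\<lambda>j. H1_norm (\<lambda>x. r n t x - r j t x) - H1_norm (\<lambda>x. r n t x - u t x)) \<longlonglongrightarrow> 0"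
        by (rule Lim_null_comparison[OF _ elim(1)])
           (use H1_norm_diff_abs[OF rH rH] elim in auto)
      then show ?case by (simp add: LIM_zero_iff)
    qed
  qed
  have db: "AE t in tm T. \<bar>H1_norm (\<lambda>x. r n t x - u t x)\<bar> \<le> 3 * m t + 1" for n
    using uH inT
  proof eventually_elim
    case (elim t)
    have "H1_norm (\<lambda>x. r n t x + - 1 * u t x) \<le> H1_norm (r n t) + H1_norm (\<lambda>x. - 1 * u t x)"
      by (rule H1_norm_triangle[OF rH[OF elim(2)] H1_cmult[OF elim(1)]])
    then have "H1_norm (\<lambda>x. r n t x - u t x) \<le> H1_norm (r n t) + m t"
      using H1_norm_cmult[OF elim(1), of "-1"] by (simp add: m_def)
    then show ?case using rb[of n t] H1_norm_ge_0[of "\<lambda>x. r n t x - u t x"] by simp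
  qed
  have bi: "integrable (tm T) (\<lambda>t. 3 * m t + 1)"
    using mi finite_measure.integrable_const[OF finite_tm, of T "1::real"] by auto
  note D = tm_dominated[OF dm rl bi db]
  have D3: "(\<lambda>n. LINT t|tm T. H1_norm (\<lambda>x. r n t x - u t x)) \<longlonglongrightarrow> 0" using D(3) by simp
  show thesis
    by (rule that[OF rs rH rl D(1) D3]) (use mm in \<open>simp_all add: m_def[abs_def]\<close>)
qed

text \<open>A simple function takes finitely many values on measurable pieces of the interval, so
  any function \<open>g\<close> of its values can be summed out. Applied to pairings, it identifies
  the Bochner integral of a simple function with an explicit finite combination of elements of
  \<open>H1\<close>.\<close>

lemma simple_function_integral_sum:
  assumes s: "simple_function (tm T) s" and k: "k \<in> borel_measurable (tm T)" "\<And>t. \<bar>k t\<bar> \<le> 1"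
  shows "(LINT t|tm T. k t * g (s t)) = (\<Sum>h\<in>s ` {0<..<T}. (LINT t|tm T. k t * indicat_real (s -` {h} \<inter> {0<..<T}) t) * g h)"
proof -
  have fin: "finite (s ` {0<..<T})" and me: "s -` {h} \<inter> {0<..<T} \<in> sets (tm T)" for h
    using simple_functionD[OF s] by auto
  have "(LINT t|tm T. k t * g (s t)) = (LINT t|tm T. (\<Sum>h\<in>s ` {0<..<T}. k t * indicat_real (s -` {h} \<inter> {0<..<T}) t * g h))"
  proof (rule Bochner_Integration.integral_cong[OF refl])
    fix t assume "t \<in> space (tm T)"
    then have t: "t \<in> {0<..<T}" by simp
    have "(\<Sum>h\<in>s ` {0<..<T}. k t * indicat_real (s -` {h} \<inter> {0<..<T}) t * g h)
       = (\<Sum>h\<in>s ` {0<..<T}. if h = s t then k t * g (s t) else 0)"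
      using t by (intro sum.cong) (auto simp: indicator_def)
    also have "\<dots> = k t * g (s t)" using fin t by (simp add: sum.delta')
    finally show "k t * g (s t) = (\<Sum>h\<in>s ` {0<..<T}. k t * indicat_real (s -` {h} \<inter> {0<..<T}) t * g h)" by simp
  qed
  also have "\<dots> = (\<Sum>h\<in>s ` {0<..<T}. (LINT t|tm T. k t * indicat_real (s -` {h} \<inter> {0<..<T}) t * g h))"
  proof (rule Bochner_Integration.integral_sum)
    fix h
    have "integrable (tm T) (\<lambda>t. k t * indicat_real (s -` {h} \<inter> {0<..<T}) t)"
    proof (rule tm_integrable_bound)
      show "(\<lambda>t. k t * indicat_real (s -` {h} \<inter> {0<..<T}) t) \<in> borel_measurable (tm T)"
        using k(1) me by (intro borel_measurable_times borel_measurable_indicator)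
      show "AE t in tm T. \<bar>k t * indicat_real (s -` {h} \<inter> {0<..<T}) t\<bar> \<le> 1"
        using k(2) by (intro AE_I2) (simp add: indicator_def)
    qed
    then show "integrable (tm T) (\<lambda>t. k t * indicat_real (s -` {h} \<inter> {0<..<T}) t * g h)" by simp
  qed
  finally show ?thesis by simp
qed

text \<open>Everything is done by duality. The weighted time integrals \<open>W n\<close> of simple
  approximations are finite combinations in \<open>H1\<close>; their pairings, and those of their
  gradients \<open>G n\<close>, converge at the rate \<open>\<delta> n\<close> times the norm of the
  test object. Testing with differences turns this into convergence of \<open>W n\<close> to
  \<open>w_fun\<close> and a Cauchy property of \<open>G n\<close>; completeness and closedness of
  the weak gradient finish the argument.\<close>

theorem w_fun_H1:
  assumes jm: "(\<lambda>(t, x). u t x) \<in> borel_measurable (lebesgue_on ({0<..<T} \<times> (UNIV :: R3 set)))"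
    and B: "Bochner_L2 T H1 H1_norm u" and tau: "\<tau> \<ge> 0" and T: "T > 0"
  shows "w_fun T u \<tau> \<in> H1"
    "\<And>\<phi>. \<phi> \<in> L2 \<Longrightarrow> ip (w_fun T u \<tau>) \<phi> = (LINT t|tm T. exp (- \<tau> * t) * ip (u t) \<phi>)"
    "\<And>\<Phi>. \<Phi> \<in> vL2 \<Longrightarrow> vip (weak_gradient (w_fun T u \<tau>)) \<Phi> = (LINT t|tm T. exp (- \<tau> * t) * vip (weak_gradient (u t)) \<Phi>)"
    "\<And>\<Phi>. \<Phi> \<in> vL2 \<Longrightarrow> integrable (tm T) (\<lambda>t. vip (weak_gradient (u t)) \<Phi>)"
proof -
  have uH: "AE t in tm T. u t \<in> H1" and isq: "integrable (tm T) (\<lambda>t. (H1_norm (u t))\<^sup>2)"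
    using B by (auto simp: Bochner_L2_def)
  obtain s :: "nat \<Rightarrow> real \<Rightarrow> R3 \<Rightarrow> real" where s: "\<And>n. simple_function (tm T) (s n)" "\<And>n t. t \<in> {0<..<T} \<Longrightarrow> s n t \<in> H1"
    and sl: "AE t in tm T. (\<lambda>n. H1_norm (\<lambda>x. s n t x - u t x)) \<longlonglongrightarrow> 0"
    and di: "\<And>n. integrable (tm T) (\<lambda>t. H1_norm (\<lambda>x. s n t x - u t x))"
    and d0: "(\<lambda>n. LINT t|tm T. H1_norm (\<lambda>x. s n t x - u t x)) \<longlonglongrightarrow> 0"
    and mm: "(\<lambda>t. H1_norm (u t)) \<in> borel_measurable (tm T)"
    by (rule Bochner_H1_approx[OF B]) (rule that; assumption)
  have mi: "integrable (tm T) (\<lambda>t. H1_norm (u t))" by (rule tm_integrable_sq_imp[OF mm isq])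
  define \<delta> where "\<delta> n = (LINT t|tm T. H1_norm (\<lambda>x. s n t x - u t x))" for n
  have \<delta>0: "\<delta> \<longlonglongrightarrow> 0" using d0 by (simp add: \<delta>_def[abs_def])
  have \<delta>nn: "0 \<le> \<delta> n" for n
    unfolding \<delta>_def by (intro Bochner_Integration.integral_nonneg H1_norm_ge_0)
  have inT: "AE t in tm T. t \<in> {0<..<T}" by (rule AE_I2) simp
  \<comment> \<open>Agrees with the exponential on the interval and is bounded by 1 on the whole
    line, since \<open>exp (- \<tau> * t)\<close> is not for negative \<open>t\<close>.\<close>
  define k where "k t = (if t > 0 then exp (- \<tau> * t) else 0)" for t
  have km: "k \<in> borel_measurable (tm T)"
  proof -
    have "k \<in> borel_measurable borel" unfolding k_def[abs_def] by measurable
    then have "k \<in> borel_measurable lebesgue" by (simp add: measurable_completion)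
    then show ?thesis by (rule measurable_restrict_space1)
  qed
  have k01: "0 \<le> k t" "k t \<le> 1" "\<bar>k t\<bar> \<le> 1" for t using tau by (auto simp: k_def)
  have keq: "(LINT t|tm T. k t * h t) = (LINT t|tm T. exp (- \<tau> * t) * h t)" for h :: "real \<Rightarrow> real"
    by (rule Bochner_Integration.integral_cong) (auto simp: k_def)

  \<comment> \<open>Stated for any functional that is Lipschitz for the \<open>H1\<close> seminorm
    and vanishes at 0; it is applied to the pairing with \<open>\<phi>\<close> and to the pairing of
    the weak gradient with \<open>\<Phi>\<close>.\<close>
  have lim: "integrable (tm T) (\<lambda>t. l (u t))"
    "\<bar>(LINT t|tm T. k t * l (s n t)) - (LINT t|tm T. k t * l (u t))\<bar> \<le> c * \<delta> n"
    if l: "\<And>a b. a \<in> H1 \<Longrightarrow> b \<in> H1 \<Longrightarrow> \<bar>l a - l b\<bar> \<le> c * H1_norm (\<lambda>x. a x - b x)" and l0: "l (\<lambda>x. 0) = 0" and c: "c \<ge> 0"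
    for l :: "(R3 \<Rightarrow> real) \<Rightarrow> real" and c n
  proof -
    have sm: "(\<lambda>t. l (s n t)) \<in> borel_measurable (tm T)" for n
      by (rule borel_measurable_simple_function) (rule simple_function_compose1[OF s(1)])
    have um: "(\<lambda>t. l (u t)) \<in> borel_measurable (tm T)"
    proof (rule tm_measurable_AE_limit[OF sm])
      show "AE t in tm T. (\<lambda>n. l (s n t)) \<longlonglongrightarrow> l (u t)"
        using sl uH inT
      proof eventually_elim
        case (elim t)
        have "(\<lambda>n. l (s n t) - l (u t)) \<longlonglongrightarrow> 0"
          by (rule Lim_null_comparison[OF _ tendsto_mult_right_zero[OF elim(1), of c]])
             (use l[OF s(2) elim(2)] elim(3) in auto)
        then show ?case by (simp add: LIM_zero_iff)
      qed
    qed
    show ui: "integrable (tm T) (\<lambda>t. l (u t))"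
    proof (rule Bochner_Integration.integrable_bound[OF integrable_mult_right[OF mi, of c] um])
      show "AE t in tm T. norm (l (u t)) \<le> norm (c * H1_norm (u t))"
        using uH
      proof eventually_elim
        case (elim t)
        show ?case using l[OF elim H1_zero] l0 c H1_norm_ge_0[of "u t"] by (simp add: abs_mult)
      qed
    qed
    have kui: "integrable (tm T) (\<lambda>t. k t * l (u t))"
      by (rule Bochner_Integration.integrable_bound[OF ui])
         (use um km k01(3) in \<open>auto simp: abs_mult intro!: mult_left_le_one_le\<close>)
    have dm: "(\<lambda>t. l (s n t) - l (u t)) \<in> borel_measurable (tm T)" using sm um by measurable
    have db: "AE t in tm T. \<bar>l (s n t) - l (u t)\<bar> \<le> c * H1_norm (\<lambda>x. s n t x - u t x)"
      using uH inT by eventually_elim (rule l[OF s(2)])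
    have kdi: "integrable (tm T) (\<lambda>t. k t * (l (s n t) - l (u t)))"
    proof (rule Bochner_Integration.integrable_bound[OF integrable_mult_right[OF di[of n], of c]])
      show "(\<lambda>t. k t * (l (s n t) - l (u t))) \<in> borel_measurable (tm T)" using km dm by measurable
      show "AE t in tm T. norm (k t * (l (s n t) - l (u t))) \<le> norm (c * H1_norm (\<lambda>x. s n t x - u t x))"
        using db
      proof eventually_elim
        case (elim t)
        have "\<bar>k t\<bar> * \<bar>l (s n t) - l (u t)\<bar> \<le> 1 * \<bar>l (s n t) - l (u t)\<bar>" using k01(3) by (intro mult_right_mono) auto
        then have "norm (k t * (l (s n t) - l (u t))) \<le> c * H1_norm (\<lambda>x. s n t x - u t x)"
          using elim by (simp add: abs_mult)
        then show ?case by simp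
      qed
    qed
    have ksi: "integrable (tm T) (\<lambda>t. k t * l (s n t))"
      using Bochner_Integration.integrable_add[OF kdi kui] by (simp add: algebra_simps)
    have "(LINT t|tm T. k t * l (s n t)) - (LINT t|tm T. k t * l (u t)) = (LINT t|tm T. k t * (l (s n t) - l (u t)))"
      using Bochner_Integration.integral_diff[OF ksi kui] by (simp add: algebra_simps)
    also have "\<bar>\<dots>\<bar> \<le> (LINT t|tm T. \<bar>k t * (l (s n t) - l (u t))\<bar>)" by (rule integral_abs_bound)
    also have "\<dots> \<le> (LINT t|tm T. c * H1_norm (\<lambda>x. s n t x - u t x))"
    proof (rule integral_mono_AE)
      show "AE t in tm T. \<bar>k t * (l (s n t) - l (u t))\<bar> \<le> c * H1_norm (\<lambda>x. s n t x - u t x)"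
        using db
      proof eventually_elim
        case (elim t)
        have "\<bar>k t\<bar> * \<bar>l (s n t) - l (u t)\<bar> \<le> 1 * \<bar>l (s n t) - l (u t)\<bar>" using k01(3) by (intro mult_right_mono) auto
        then show ?case using elim by (simp add: abs_mult)
      qed
    qed (use kdi di in auto)
    finally show "\<bar>(LINT t|tm T. k t * l (s n t)) - (LINT t|tm T. k t * l (u t))\<bar> \<le> c * \<delta> n"
      by (simp add: \<delta>_def)
  qed

  define C where "C n h = (LINT t|tm T. k t * indicat_real (s n -` {h} \<inter> {0<..<T}) t)" for n h
  define W where "W n x = (\<Sum>h\<in>s n ` {0<..<T}. C n h * h x)" for n x
  define G where "G n x = (\<Sum>h\<in>s n ` {0<..<T}. C n h *\<^sub>R weak_gradient h x)" for n x
  have hH: "h \<in> H1" if "h \<in> s n ` {0<..<T}" for h n using that s(2) by auto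
  have WG: "has_weak_gradient (W n) (G n)" for n
    unfolding W_def[abs_def] G_def[abs_def]
    by (intro has_weak_gradient_sum has_weak_gradient_cmult H1_weak_gradient hH)
  have WL: "W n \<in> L2" and GL: "G n \<in> vL2" for n using WG[of n] by (auto simp: has_weak_gradient_iff)
  have Wip: "ip (W n) \<phi> = (LINT t|tm T. k t * ip (s n t) \<phi>)" if p: "\<phi> \<in> L2" for n \<phi>
  proof -
    have "ip (W n) \<phi> = (\<Sum>h\<in>s n ` {0<..<T}. C n h * ip h \<phi>)"
      unfolding W_def[abs_def] using p hH H1_L2 by (subst ip_sum_left) (auto intro: L2_cmult simp: ip_cmult_left)
    also have "\<dots> = (LINT t|tm T. k t * ip (s n t) \<phi>)"
      unfolding C_def by (rule simple_function_integral_sum[OF s(1) km k01(3), symmetric])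
    finally show ?thesis .
  qed
  have Gvip: "vip (G n) \<Phi> = (LINT t|tm T. k t * vip (weak_gradient (s n t)) \<Phi>)" if p: "\<Phi> \<in> vL2" for n \<Phi>
  proof -
    have "vip (G n) \<Phi> = (\<Sum>i\<in>UNIV. \<Sum>h\<in>s n ` {0<..<T}. C n h * ip (\<lambda>x. weak_gradient h x $ i) (\<lambda>x. \<Phi> x $ i))"
      unfolding vip_def G_def[abs_def]
    proof (rule sum.cong[OF refl])
      fix i
      have "(\<lambda>x. (\<Sum>h\<in>s n ` {0<..<T}. C n h *\<^sub>R weak_gradient h x) $ i) = (\<lambda>x. \<Sum>h\<in>s n ` {0<..<T}. C n h * weak_gradient h x $ i)"
        by simp
      then have "ip (\<lambda>x. (\<Sum>h\<in>s n ` {0<..<T}. C n h *\<^sub>R weak_gradient h x) $ i) (\<lambda>x. \<Phi> x $ i)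
        = ip (\<lambda>x. \<Sum>h\<in>s n ` {0<..<T}. C n h * weak_gradient h x $ i) (\<lambda>x. \<Phi> x $ i)" by (simp only:)
      also have "\<dots> = (\<Sum>h\<in>s n ` {0<..<T}. ip (\<lambda>x. C n h * weak_gradient h x $ i) (\<lambda>x. \<Phi> x $ i))"
        by (intro ip_sum_left L2_cmult vL2_D H1_gradient_vL2 hH p)
      finally show "ip (\<lambda>x. (\<Sum>h\<in>s n ` {0<..<T}. C n h *\<^sub>R weak_gradient h x) $ i) (\<lambda>x. \<Phi> x $ i)
        = (\<Sum>h\<in>s n ` {0<..<T}. C n h * ip (\<lambda>x. weak_gradient h x $ i) (\<lambda>x. \<Phi> x $ i))"
        by (simp add: ip_cmult_left)
    qed
    also have "\<dots> = (\<Sum>h\<in>s n ` {0<..<T}. C n h * vip (weak_gradient h) \<Phi>)"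
      by (subst sum.swap) (simp add: vip_def sum_distrib_left)
    also have "\<dots> = (LINT t|tm T. k t * vip (weak_gradient (s n t)) \<Phi>)"
      unfolding C_def by (rule simple_function_integral_sum[OF s(1) km k01(3), symmetric])
    finally show ?thesis .
  qed
  have ip0: "ip (\<lambda>x. 0) \<phi> = 0" for \<phi> by (simp add: ip_def)
  have vip0: "vip (weak_gradient (\<lambda>x. 0)) \<Phi> = 0" if "\<Phi> \<in> vL2" for \<Phi>
    using vip_diff_H1_bound[OF H1_zero H1_zero that]
      vip_cong_AE[OF H1_gradient_vL2[OF H1_zero] that weak_gradient_AE[OF has_weak_gradient_zero] AE_I2[OF refl]]
    by (simp add: vip_def ip_def)
  have Wlim: "\<bar>ip (W n) \<phi> - (LINT t|tm T. k t * ip (u t) \<phi>)\<bar> \<le> L2_norm \<phi> * \<delta> n" if p: "\<phi> \<in> L2" for n \<phi>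
    unfolding Wip[OF p] by (rule lim(2)[where l = "\<lambda>a. ip a \<phi>", OF ip_diff_H1_bound[OF _ _ p] ip0 L2_norm_nonneg])
  have Glim: "\<bar>vip (G n) \<Phi> - (LINT t|tm T. k t * vip (weak_gradient (u t)) \<Phi>)\<bar> \<le> vnorm \<Phi> * \<delta> n" if p: "\<Phi> \<in> vL2" for n \<Phi>
    unfolding Gvip[OF p]
    by (rule lim(2)[where l = "\<lambda>a. vip (weak_gradient a) \<Phi>", OF vip_diff_H1_bound[OF _ _ p] vip0[OF p] vnorm_nonneg])

  have uL: "AE t in tm T. u t \<in> L2" using uH by eventually_elim (rule H1_L2)
  have uLn: "AE t in tm T. L2_norm (u t) \<le> H1_norm (u t)" using uH by eventually_elim (rule L2_norm_le_H1)
  note w = w_fun_L2[OF jm uL isq uLn tau T]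
  show ipw: "ip (w_fun T u \<tau>) \<phi> = (LINT t|tm T. exp (- \<tau> * t) * ip (u t) \<phi>)" if "\<phi> \<in> L2" for \<phi> by (rule w(2)[OF that])
  \<comment> \<open>Tested with the difference itself, the squared norm is at most the norm times
    \<open>\<delta> n\<close>.\<close>
  have ww: "L2_norm (\<lambda>x. W n x - w_fun T u \<tau> x) \<le> \<delta> n" for n
  proof -
    let ?d = "\<lambda>x. W n x - w_fun T u \<tau> x"
    have dL: "?d \<in> L2" by (intro L2_diff WL w(1))
    have "(L2_norm ?d)\<^sup>2 = ip (W n) ?d - ip (w_fun T u \<tau>) ?d"
      unfolding ip_self[symmetric] by (rule ip_diff_left[OF WL w(1) dL])
    also have "\<dots> \<le> L2_norm ?d * \<delta> n"
      using Wlim[OF dL, of n] by (simp add: keq w(2)[OF dL])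
    finally show ?thesis
      using L2_norm_nonneg[of ?d] \<delta>nn[of n]
      by (cases "L2_norm ?d = 0") (auto simp: power2_eq_square)
  qed
  have GG: "vnorm (\<lambda>x. G n x - G m x) \<le> \<delta> n + \<delta> m" for n m
  proof -
    let ?d = "\<lambda>x. G n x - G m x"
    have dL: "?d \<in> vL2" by (intro vL2_diff GL)
    have "(vnorm ?d)\<^sup>2 = vip (G n) ?d - vip (G m) ?d"
      unfolding vip_self[symmetric] by (rule vip_diff_left[OF GL GL dL])
    also have "\<dots> \<le> vnorm ?d * \<delta> n + vnorm ?d * \<delta> m"
      using Glim[OF dL, of n] Glim[OF dL, of m] by linarith
    finally show ?thesis
      using vnorm_nonneg[of ?d] \<delta>nn[of n] \<delta>nn[of m]
      by (cases "vnorm ?d = 0") (auto simp: power2_eq_square distrib_left[symmetric])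
  qed
  have comp: "L2_norm (\<lambda>x. F x $ i) \<le> vnorm F" if "F \<in> vL2" for F i
  proof (rule power2_le_imp_le)
    have "ip (\<lambda>x. F x $ i) (\<lambda>x. F x $ i) \<le> vip F F"
      unfolding vip_def by (rule member_le_sum) (auto simp: ip_self_nonneg)
    then show "(L2_norm (\<lambda>x. F x $ i))\<^sup>2 \<le> (vnorm F)\<^sup>2" by (simp add: ip_self vip_self)
  qed (rule vnorm_nonneg)
  have "\<exists>H. H \<in> L2 \<and> (\<lambda>n. L2_norm (\<lambda>x. G n x $ i - H x)) \<longlonglongrightarrow> 0" for i
  proof -
    have "\<exists>N. \<forall>m\<ge>N. \<forall>n\<ge>N. L2_norm (\<lambda>x. G m x $ i - G n x $ i) < e" if e: "e > 0" for e
    proof -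
      obtain N where N: "\<And>n. n \<ge> N \<Longrightarrow> \<bar>\<delta> n\<bar> < e / 2" using LIMSEQ_D[OF \<delta>0, of "e/2"] e by auto
      have "L2_norm (\<lambda>x. G m x $ i - G n x $ i) < e" if "m \<ge> N" "n \<ge> N" for m n
        using comp[OF vL2_diff[OF GL[of m] GL[of n]], of i] GG[of m n] N[OF that(1)] N[OF that(2)] by simp
      then show ?thesis by blast
    qed
    note cauchy = this
    obtain h where "h \<in> L2" "(\<lambda>n. L2_norm (\<lambda>x. G n x $ i - h x)) \<longlonglongrightarrow> 0"
      by (rule L2_complete[of "\<lambda>n x. G n x $ i", OF vL2_D[OF GL] cauchy])
    then show ?thesis by blast
  qed
  then have "\<forall>i. \<exists>H. H \<in> L2 \<and> (\<lambda>n. L2_norm (\<lambda>x. G n x $ i - H x)) \<longlonglongrightarrow> 0" by blast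
  from choice[OF this] obtain H where "\<forall>i. H i \<in> L2 \<and> (\<lambda>n. L2_norm (\<lambda>x. G n x $ i - H i x)) \<longlonglongrightarrow> 0"
    by blast
  then have H: "\<And>i. H i \<in> L2" "\<And>i. (\<lambda>n. L2_norm (\<lambda>x. G n x $ i - H i x)) \<longlonglongrightarrow> 0" by auto
  define HH where "HH x = (\<chi> i. H i x)" for x
  have HL: "HH \<in> vL2" using H(1) by (simp add: vL2_def HH_def)
  have Wconv: "(\<lambda>n. L2_norm (\<lambda>x. W n x - w_fun T u \<tau> x)) \<longlonglongrightarrow> 0"
    by (rule Lim_null_comparison[OF _ \<delta>0]) (use ww L2_norm_nonneg in auto)
  have hw: "has_weak_gradient (w_fun T u \<tau>) HH"
    by (rule has_weak_gradient_closed[OF WG w(1) HL Wconv]) (use H(2) in \<open>simp add: HH_def\<close>)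
  show "w_fun T u \<tau> \<in> H1" by (rule H1_I[OF hw])
  fix \<Phi> :: "R3 \<Rightarrow> R3" assume p: "\<Phi> \<in> vL2"
  show "integrable (tm T) (\<lambda>t. vip (weak_gradient (u t)) \<Phi>)"
    by (rule lim(1)[where l = "\<lambda>a. vip (weak_gradient a) \<Phi>", OF vip_diff_H1_bound[OF _ _ p] vip0[OF p] vnorm_nonneg])
  have l1: "(\<lambda>n. vip (G n) \<Phi>) \<longlonglongrightarrow> vip HH \<Phi>"
    unfolding vip_def
  proof (intro tendsto_sum ip_tendsto_left)
    show "(\<lambda>n. L2_norm (\<lambda>x. G n x $ i - HH x $ i)) \<longlonglongrightarrow> 0" for i using H(2) by (simp add: HH_def)
  qed (use p HL GL vL2_D in auto)
  have "(\<lambda>n. vip (G n) \<Phi> - (LINT t|tm T. k t * vip (weak_gradient (u t)) \<Phi>)) \<longlonglongrightarrow> 0"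
    by (rule Lim_null_comparison[OF _ tendsto_mult_right_zero[OF \<delta>0, of "vnorm \<Phi>"]]) (use Glim[OF p] in auto)
  then have l2: "(\<lambda>n. vip (G n) \<Phi>) \<longlonglongrightarrow> (LINT t|tm T. k t * vip (weak_gradient (u t)) \<Phi>)" by (simp add: LIM_zero_iff)
  have "vip (weak_gradient (w_fun T u \<tau>)) \<Phi> = vip HH \<Phi>"
    by (rule vip_cong_AE[OF H1_gradient_vL2[OF H1_I[OF hw]] p weak_gradient_AE[OF hw]]) simp
  also have "\<dots> = (LINT t|tm T. exp (- \<tau> * t) * vip (weak_gradient (u t)) \<Phi>)"
    using LIMSEQ_unique[OF l1 l2] by (simp add: keq)
  finally show "vip (weak_gradient (w_fun T u \<tau>)) \<Phi> = (LINT t|tm T. exp (- \<tau> * t) * vip (weak_gradient (u t)) \<Phi>)" .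
qed

section \<open>Integration by parts in time\<close>

lemma tm_continuous_integrable:
  fixes g :: "real \<Rightarrow> real"
  assumes "continuous_on {0..T} g"
  shows "g \<in> borel_measurable (tm T)" "integrable (tm T) g" "(LINT t|tm T. g t) = integral {0..T} g"
proof -
  show m: "g \<in> borel_measurable (tm T)"
    by (intro continuous_imp_measurable_on_sets_lebesgue continuous_on_subset[OF assms]) auto
  have "bounded (g ` {0..T})" by (intro compact_imp_bounded compact_continuous_image assms) simp
  then obtain C where C: "\<forall>t\<in>{0..T}. \<bar>g t\<bar> \<le> C" unfolding bounded_iff by auto
  show i: "integrable (tm T) g"
    by (rule tm_integrable_bound[OF m, of C]) (use C in \<open>auto intro!: AE_I2\<close>)
  show "(LINT t|tm T. g t) = integral {0..T} g"
    by (simp add: lebesgue_integral_eq_integral[OF i] integral_open_interval_real)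
qed

lemma tm_FTC:
  assumes "0 \<le> T" "continuous_on {0..T} h'" "\<And>t. (h has_real_derivative h' t) (at t)"
  shows "(LINT t|tm T. h' t) = h T - h 0"
proof -
  have "(h' has_integral h T - h 0) {0..T}"
    by (rule fundamental_theorem_of_calculus[OF assms(1)])
       (use assms(3) in \<open>auto simp: has_real_derivative_iff_has_vector_derivative[symmetric] intro: has_field_derivative_at_within\<close>)
  then show ?thesis using tm_continuous_integrable(3)[OF assms(2)] by (simp add: integral_unique)
qed

text \<open>The kernels have integral 1, height at most \<open>M * a n\<close> and a support of
  width \<open>4 / a n\<close>. Their product \<open>4 * M\<close> bounds the integral of the
  modulus, so no sign of \<open>\<rho>\<close> enters. The point \<open>c\<close> may be an end
  point of the interval.\<close>

lemma tm_delta_limit: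
  fixes g :: "real \<Rightarrow> real" and \<rho> :: "nat \<Rightarrow> real \<Rightarrow> real" and a :: "nat \<Rightarrow> real"
  assumes g: "continuous_on {0..T} g" and c: "c \<in> {0..T}" and \<rho>: "\<And>n. continuous_on {0..T} (\<rho> n)"
    and b: "\<And>n t. \<bar>\<rho> n t\<bar> \<le> M * a n" and z: "\<And>n t. \<bar>t - c\<bar> > 2 / a n \<Longrightarrow> \<rho> n t = 0"
    and one: "\<And>n. (LINT t|tm T. \<rho> n t) = 1" and a: "\<And>n. a n > 0" "filterlim a at_top sequentially"
  shows "(\<lambda>n. LINT t|tm T. g t * \<rho> n t) \<longlonglongrightarrow> g c"
proof (rule LIMSEQ_I)
  fix e :: real assume e: "e > 0"
  have M0: "M \<ge> 0" using order_trans[OF abs_ge_zero b[of 0 0]] a(1)[of 0] by (simp add: zero_le_mult_iff)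
  define e' where "e' = e / (4 * M + 1)"
  have e': "e' > 0" using e M0 by (simp add: e'_def)
  obtain d where d: "d > 0" "\<And>t. t \<in> {0..T} \<Longrightarrow> \<bar>t - c\<bar> < d \<Longrightarrow> \<bar>g t - g c\<bar> < e'"
    using g c e' unfolding continuous_on_iff dist_real_def by metis
  have "\<forall>\<^sub>F n in sequentially. a n > 2 / d" using a(2) by (simp add: filterlim_at_top_dense)
  then obtain N where N: "\<And>n. n \<ge> N \<Longrightarrow> a n > 2 / d" by (auto simp: eventually_sequentially)
  have "norm ((LINT t|tm T. g t * \<rho> n t) - g c) < e" if "n \<ge> N" for n
  proof -
    have an: "2 / a n < d" using N[OF that] a(1)[of n] d(1) by (simp add: field_simps)
    have i1: "integrable (tm T) (\<lambda>t. g t * \<rho> n t)" "integrable (tm T) (\<lambda>t. g c * \<rho> n t)"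
      by (intro tm_continuous_integrable(2) continuous_intros g \<rho>)+
    have i2: "integrable (tm T) (\<lambda>t. \<bar>(g t - g c) * \<rho> n t\<bar>)"
      by (intro tm_continuous_integrable(2) continuous_intros g \<rho>)
    let ?J = "{c - 2 / a n..c + 2 / a n}"
    have iJ: "integrable (tm T) (\<lambda>t. indicat_real ?J t)"
    proof (rule tm_integrable_bound)
      have "indicat_real ?J \<in> borel_measurable lebesgue" by (intro borel_measurable_indicator) auto
      then show "indicat_real ?J \<in> borel_measurable (tm T)" by (rule measurable_restrict_space1)
      show "AE t in tm T. \<bar>indicat_real ?J t\<bar> \<le> 1" by (intro AE_I2) (simp add: indicator_def)
    qed
    have J: "(LINT t|tm T. indicat_real ?J t) \<le> 4 / a n"
    proof -
      have "(LINT t|tm T. indicat_real ?J t) = (LINT t|lebesgue. indicat_real {0<..<T} t *\<^sub>R indicat_real ?J t)"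
        by (subst integral_restrict_space) auto
      also have "\<dots> \<le> (LINT t|lebesgue. indicat_real ?J t)"
      proof (rule integral_mono')
        show "integrable lebesgue (indicat_real ?J)"
        proof (rule integrable_real_indicator)
          have le: "c - 2 / a n \<le> c + 2 / a n" using a(1)[of n] by simp
          show "emeasure lebesgue ?J < \<infinity>" using emeasure_lborel_Icc[OF le] by simp
        qed auto
      qed (auto simp: indicator_def)
      also have "\<dots> = 4 / a n" using a(1)[of n] by (simp add: field_simps)
      finally show ?thesis .
    qed
    have "(LINT t|tm T. g t * \<rho> n t) - g c = (LINT t|tm T. g t * \<rho> n t - g c * \<rho> n t)"
      unfolding Bochner_Integration.integral_diff[OF i1] by (simp add: one)
    also have "\<bar>\<dots>\<bar> \<le> (LINT t|tm T. \<bar>g t * \<rho> n t - g c * \<rho> n t\<bar>)" by (rule integral_abs_bound)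
    also have "\<dots> = (LINT t|tm T. \<bar>(g t - g c) * \<rho> n t\<bar>)" by (simp add: left_diff_distrib)
    also have "\<dots> \<le> (LINT t|tm T. e' * (M * a n) * indicat_real ?J t)"
    proof (rule integral_mono)
      show "integrable (tm T) (\<lambda>t. e' * (M * a n) * indicat_real ?J t)" using iJ by auto
      fix t assume "t \<in> space (tm T)"
      then have t: "t \<in> {0..T}" by simp
      show "\<bar>(g t - g c) * \<rho> n t\<bar> \<le> e' * (M * a n) * indicat_real ?J t"
      proof (cases "t \<in> ?J")
        case True
        then have "\<bar>t - c\<bar> < d" using an by auto
        then have "\<bar>g t - g c\<bar> \<le> e'" using d(2)[OF t] by simp
        then show ?thesis using True e' b[of n t] by (simp add: abs_mult mult_mono)
      next
        case False
        then have "\<bar>t - c\<bar> > 2 / a n" by auto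
        then have "\<rho> n t = 0" by (rule z)
        then show ?thesis using e' M0 a(1)[of n] by simp
      qed
    qed (rule i2)
    also have "\<dots> = e' * (M * a n) * (LINT t|tm T. indicat_real ?J t)" by simp
    also have "\<dots> \<le> e' * (M * a n) * (4 / a n)" using J e' M0 a(1)[of n] by (intro mult_left_mono) auto
    also have "\<dots> = e' * (4 * M)" using a(1)[of n] by (simp add: field_simps)
    also have "\<dots> < e' * (4 * M + 1)" using e' by (intro mult_strict_left_mono) auto
    also have "\<dots> = e" using M0 by (simp add: e'_def)
    finally show ?thesis by simp
  qed
  then show "\<exists>no. \<forall>n\<ge>no. norm ((LINT t|tm T. g t * \<rho> n t) - g c) < e" by blast
qed

text \<open>Admissible test functions vanish near both end points, so the exponential is multiplied
  by two cut-offs. The derivatives of the cut-offs concentrate at 0 and \<open>T\<close> and produce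
  the boundary terms, evaluated on the continuous representative \<open>P\<close> because
  \<open>p\<close> is determined only almost everywhere.\<close>

lemma time_integration_by_parts:
  assumes T: "T > 0" and P: "continuous_on {0..T} P" and p: "AE t in tm T. P t = p t" and r: "integrable (tm T) r"
    and w: "\<And>\<psi>. \<psi> \<in> test_functions {0<..<T} \<Longrightarrow> (LINT t|tm T. deriv \<psi> t * p t) = - (LINT t|tm T. \<psi> t * r t)"
  shows "(LINT t|tm T. exp (- \<tau> * t) * r t) = exp (- \<tau> * T) * P T - P 0 + \<tau> * (LINT t|tm T. exp (- \<tau> * t) * p t)"
proof -
  define E where "E t = exp (- \<tau> * t)" for t :: real
  \<comment> \<open>The summand \<open>4 / T\<close> makes \<open>a n * T\<close> larger than 4,
    which keeps the transition zones near 0 and near \<open>T\<close>, each within distance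
    \<open>2 / a n\<close> of its end point, disjoint.\<close>
  define a where "a n = real n + 4 / T + 1" for n
  have a0: "a n > 0" for n unfolding a_def using T by (simp add: add_nonneg_pos)
  have aT: "a n * T > 4" for n
  proof -
    have "a n * T = (real n + 1) * T + 4" using T by (simp add: a_def field_simps)
    then show ?thesis using T by (simp add: add_nonneg_pos)
  qed
  have atop: "filterlim a at_top sequentially"
    unfolding a_def[abs_def] by real_asymp
  define \<chi>1 where "\<chi>1 n t = step (a n * t)" for n t
  define \<chi>2 where "\<chi>2 n t = step (a n * T - a n * t)" for n t
  define \<psi> where "\<psi> n t = E t * (\<chi>1 n t * \<chi>2 n t)" for n t
  define \<rho>1 where "\<rho>1 n t = deriv step (a n * t) * a n" for n t
  define \<rho>2 where "\<rho>2 n t = deriv step (a n * T - a n * t) * a n" for n t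
  have d1: "(\<chi>1 n has_real_derivative \<rho>1 n t) (at t)" for n t
    unfolding \<chi>1_def[abs_def] \<rho>1_def by (rule DERIV_chain2[OF step_DERIV]) (auto intro!: derivative_eq_intros)
  have d2: "(\<chi>2 n has_real_derivative - \<rho>2 n t) (at t)" for n t
  proof -
    have "((\<lambda>t. a n * T - a n * t) has_real_derivative - a n) (at t)" by (auto intro!: derivative_eq_intros)
    from DERIV_chain2[OF step_DERIV this] show ?thesis unfolding \<chi>2_def[abs_def] \<rho>2_def by simp
  qed
  have dE: "(E has_real_derivative - \<tau> * E t) (at t)" for t
    unfolding E_def[abs_def] by (auto intro!: derivative_eq_intros)
  have zero1: "\<chi>1 n t = 0" if "t \<le> 1 / a n" for n t
    unfolding \<chi>1_def using that a0[of n] by (intro step_0) (simp add: field_simps)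
  have zero2: "\<chi>2 n t = 0" if "t \<ge> T - 1 / a n" for n t
    unfolding \<chi>2_def using that a0[of n] by (intro step_0) (simp add: field_simps)
  have \<rho>1z: "\<rho>1 n t = 0" if "\<bar>t - 0\<bar> > 2 / a n" for n t
  proof -
    have "a n * t < 1 \<or> a n * t > 2" using that a0[of n]
      by (cases "t \<ge> 0") (auto simp: field_simps abs_if mult_nonneg_nonpos split: if_splits intro: le_less_trans[of _ 0])
    then show ?thesis unfolding \<rho>1_def by (simp add: deriv_step_0)
  qed
  have \<rho>2z: "\<rho>2 n t = 0" if "\<bar>t - T\<bar> > 2 / a n" for n t
  proof -
    have "\<bar>(T - t) - 0\<bar> > 2 / a n" using that by simp
    from \<rho>1z[OF this] show ?thesis unfolding \<rho>1_def \<rho>2_def by (simp add: right_diff_distrib)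
  qed
  have one1: "\<chi>1 n t = 1" if "t \<ge> 2 / a n" for n t
    unfolding \<chi>1_def using that a0[of n] by (intro step_1) (simp add: field_simps)
  have one2: "\<chi>2 n t = 1" if "t \<le> T - 2 / a n" for n t
    unfolding \<chi>2_def using that a0[of n] by (intro step_1) (simp add: field_simps)
  have half: "2 / a n < T - 2 / a n" for n using aT[of n] a0[of n] by (simp add: field_simps)
  \<comment> \<open>Where one cut-off varies, the other is already 1.\<close>
  have m1: "\<rho>1 n t * \<chi>2 n t = \<rho>1 n t" for n t
  proof (cases "t \<le> T - 2 / a n")
    case False
    then have "\<bar>t - 0\<bar> > 2 / a n" using half[of n] by auto
    from \<rho>1z[OF this] show ?thesis by simp
  qed (simp add: one2)
  have m2: "\<chi>1 n t * \<rho>2 n t = \<rho>2 n t" for n t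
  proof (cases "t \<ge> 2 / a n")
    case False
    then have "\<bar>t - T\<bar> > 2 / a n" using half[of n] by auto
    from \<rho>2z[OF this] show ?thesis by simp
  qed (simp add: one1)
  have \<psi>t: "\<psi> n \<in> test_functions {0<..<T}" for n
  proof -
    have "Ck k (\<psi> n)" for k
      unfolding \<psi>_def[abs_def] E_def \<chi>1_def \<chi>2_def
      by (intro Ck_mult Ck_exp Ck_step Ck_diff Ck_const Ck_linear bounded_linear_ident)
    moreover have sub: "closure {t. \<psi> n t \<noteq> 0} \<subseteq> {1 / a n..T - 1 / a n}"
    proof (rule closure_minimal)
      have "\<psi> n t = 0" if "t \<notin> {1 / a n..T - 1 / a n}" for t
        using that zero1[of t n] zero2[of n t] by (auto simp: \<psi>_def not_le)
      then show "{t. \<psi> n t \<noteq> 0} \<subseteq> {1 / a n..T - 1 / a n}" by blast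
    qed simp
    moreover have "compact (closure {t. \<psi> n t \<noteq> 0})"
      using bounded_subset[OF bounded_closed_interval sub] by (simp add: compact_eq_bounded_closed)
    moreover have "{1 / a n..T - 1 / a n} \<subseteq> {0<..<T}"
    proof
      fix t assume "t \<in> {1 / a n..T - 1 / a n}"
      then have "1 / a n \<le> t" "t \<le> T - 1 / a n" by auto
      moreover have "0 < 1 / a n" using a0[of n] by simp
      ultimately have "0 < t" "t < T" by linarith+
      then show "t \<in> {0<..<T}" by simp
    qed
    ultimately show ?thesis unfolding test_functions_def by blast
  qed
  have deriv: "deriv (\<psi> n) t = - \<tau> * E t * (\<chi>1 n t * \<chi>2 n t) + (E t * \<rho>1 n t - E t * \<rho>2 n t)" for n t
  proof -
    have "(\<psi> n has_real_derivative - \<tau> * E t * (\<chi>1 n t * \<chi>2 n t) + E t * (\<chi>1 n t * (- \<rho>2 n t) + \<rho>1 n t * \<chi>2 n t)) (at t)"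
      unfolding \<psi>_def[abs_def]
      by (rule DERIV_cong[OF DERIV_mult[OF dE DERIV_mult[OF d1 d2]]]) (simp add: algebra_simps)
    then have "deriv (\<psi> n) t = - \<tau> * E t * (\<chi>1 n t * \<chi>2 n t) + E t * (\<chi>1 n t * (- \<rho>2 n t) + \<rho>1 n t * \<chi>2 n t)"
      by (rule DERIV_imp_deriv)
    also have "\<chi>1 n t * (- \<rho>2 n t) + \<rho>1 n t * \<chi>2 n t = \<rho>1 n t - \<rho>2 n t"
      unfolding mult_minus_right m1 m2 by simp
    finally show ?thesis by (simp add: right_diff_distrib)
  qed
  have cE: "continuous_on A E" for A unfolding E_def[abs_def] by (intro continuous_intros)
  have c1: "continuous_on A (\<chi>1 n)" for A n using d1 by (meson DERIV_isCont continuous_at_imp_continuous_on)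
  have c2: "continuous_on A (\<chi>2 n)" for A n using d2 by (meson DERIV_isCont continuous_at_imp_continuous_on)
  have cr1: "continuous_on A (\<rho>1 n)" for A n unfolding \<rho>1_def[abs_def]
    by (intro continuous_intros continuous_on_compose2[OF continuous_deriv_step]) auto
  have cr2: "continuous_on A (\<rho>2 n)" for A n unfolding \<rho>2_def[abs_def]
    by (intro continuous_intros continuous_on_compose2[OF continuous_deriv_step]) auto
  obtain M where M: "M > 0" "\<And>t. \<bar>deriv step t\<bar> \<le> M" using deriv_step_bounded by metis
  have cEP: "continuous_on {0..T} (\<lambda>t. E t * P t)" by (intro continuous_intros cE P)
  have D1: "(\<lambda>n. LINT t|tm T. (E t * P t) * \<rho>1 n t) \<longlonglongrightarrow> E 0 * P 0"
  proof (rule tm_delta_limit[where a = a and M = M, OF cEP _ cr1 _ \<rho>1z _ a0 atop])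
    show "\<bar>\<rho>1 n t\<bar> \<le> M * a n" for n t unfolding \<rho>1_def abs_mult using M a0[of n] by (intro mult_mono) auto
    have "\<chi>1 n T = 1" "\<chi>1 n 0 = 0" for n
      using half[of n] a0[of n] by (auto intro!: one1 zero1 less_imp_le simp: field_simps)
    then show "(LINT t|tm T. \<rho>1 n t) = 1" for n using tm_FTC[OF _ cr1 d1, of T n] T by simp
  qed (use T in auto)
  have D2: "(\<lambda>n. LINT t|tm T. (E t * P t) * \<rho>2 n t) \<longlonglongrightarrow> E T * P T"
  proof (rule tm_delta_limit[where a = a and M = M, OF cEP _ cr2 _ \<rho>2z _ a0 atop])
    show "\<bar>\<rho>2 n t\<bar> \<le> M * a n" for n t unfolding \<rho>2_def abs_mult using M a0[of n] by (intro mult_mono) auto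
    have e: "\<chi>2 n T = 0" "\<chi>2 n 0 = 1" for n
      using half[of n] a0[of n] aT[of n] by (auto intro!: one2 zero2 simp: field_simps)
    have "(LINT t|tm T. - \<rho>2 n t) = \<chi>2 n T - \<chi>2 n 0" for n
      by (rule tm_FTC[OF _ continuous_on_minus[OF cr2] d2]) (use T in simp)
    note i = this
    show "(LINT t|tm T. \<rho>2 n t) = 1" for n using i[of n] e[of n] by simp
  qed (use T in auto)
  have b12: "\<bar>\<chi>1 n t * \<chi>2 n t\<bar> \<le> 1" for n t
    unfolding \<chi>1_def \<chi>2_def using step_nonneg step_le_1 by (simp add: mult_le_one)
  have lim12: "AE t in tm T. (\<lambda>n. \<chi>1 n t * \<chi>2 n t) \<longlonglongrightarrow> 1"
  proof (rule AE_I2)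
    fix t assume "t \<in> space (tm T)"
    then have t: "0 < t" "t < T" by auto
    have "\<forall>\<^sub>F n in sequentially. a n > max (2 / t) (2 / (T - t))"
      using atop unfolding filterlim_at_top_dense by blast
    then have "\<forall>\<^sub>F n in sequentially. \<chi>1 n t * \<chi>2 n t = 1"
    proof eventually_elim
      case (elim n)
      then have "t \<ge> 2 / a n" "t \<le> T - 2 / a n" using t a0[of n] by (auto simp: field_simps)
      then show ?case by (simp add: one1 one2)
    qed
    then show "(\<lambda>n. \<chi>1 n t * \<chi>2 n t) \<longlonglongrightarrow> 1" by (rule tendsto_eventually)
  qed
  have c12: "(\<lambda>t. \<chi>1 n t * \<chi>2 n t) \<in> borel_measurable (tm T)" for n
    by (intro tm_continuous_integrable(1) continuous_intros c1 c2)
  have DCT: "(\<lambda>n. LINT t|tm T. h t * (\<chi>1 n t * \<chi>2 n t)) \<longlonglongrightarrow> (LINT t|tm T. h t)" if h: "integrable (tm T) h" for h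
  proof (rule tm_dominated(3))
    show "(\<lambda>t. h t * (\<chi>1 n t * \<chi>2 n t)) \<in> borel_measurable (tm T)" for n
      by (rule borel_measurable_times[OF borel_measurable_integrable[OF h] c12])
    show "AE t in tm T. (\<lambda>n. h t * (\<chi>1 n t * \<chi>2 n t)) \<longlonglongrightarrow> h t"
      using lim12
    proof eventually_elim
      case (elim t)
      from tendsto_mult[OF tendsto_const[of "h t"] elim] show ?case by simp
    qed
    show "integrable (tm T) (\<lambda>t. \<bar>h t\<bar>)" using h by auto
    show "AE t in tm T. \<bar>h t * (\<chi>1 n t * \<chi>2 n t)\<bar> \<le> \<bar>h t\<bar>" for n
    proof (rule AE_I2)
      fix t
      show "\<bar>h t * (\<chi>1 n t * \<chi>2 n t)\<bar> \<le> \<bar>h t\<bar>"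
        unfolding abs_mult[of "h t"] using mult_left_mono[OF b12[of n t] abs_ge_zero[of "h t"]] by simp
    qed
  qed
  have Er: "integrable (tm T) (\<lambda>t. E t * r t)"
  proof -
    have Em: "E \<in> borel_measurable (tm T)" by (rule tm_continuous_integrable(1)[OF cE])
    have "bounded (E ` {0..T})" by (intro compact_imp_bounded compact_continuous_image cE) simp
    then obtain C where C: "\<forall>t\<in>{0..T}. \<bar>E t\<bar> \<le> C" unfolding bounded_iff by auto
    show ?thesis
    proof (rule Bochner_Integration.integrable_bound[OF integrable_mult_right[OF r, of C]])
      show "(\<lambda>t. E t * r t) \<in> borel_measurable (tm T)" using Em r by auto
      show "AE t in tm T. norm (E t * r t) \<le> norm (C * r t)"
      proof (rule AE_I2)
        fix t assume "t \<in> space (tm T)"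
        then have "\<bar>E t\<bar> \<le> C" using C by auto
        then have "\<bar>E t\<bar> \<le> \<bar>C\<bar>" by simp
        then show "norm (E t * r t) \<le> norm (C * r t)" by (simp add: abs_mult mult_right_mono)
      qed
    qed
  qed
  have EP: "integrable (tm T) (\<lambda>t. - \<tau> * E t * P t)" by (intro tm_continuous_integrable(2) continuous_intros cE P)
  have eq: "(LINT t|tm T. (- \<tau> * E t * P t) * (\<chi>1 n t * \<chi>2 n t)) + ((LINT t|tm T. (E t * P t) * \<rho>1 n t) - (LINT t|tm T. (E t * P t) * \<rho>2 n t))
     = - (LINT t|tm T. (E t * r t) * (\<chi>1 n t * \<chi>2 n t))" for n
  proof -
    have i: "integrable (tm T) (\<lambda>t. (- \<tau> * E t * P t) * (\<chi>1 n t * \<chi>2 n t))" "integrable (tm T) (\<lambda>t. (E t * P t) * \<rho>1 n t)"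
       "integrable (tm T) (\<lambda>t. (E t * P t) * \<rho>2 n t)"
      by (intro tm_continuous_integrable(2) continuous_intros cE P c1 c2 cr1 cr2)+
    have cd: "continuous_on {0..T} (\<lambda>t. deriv (\<psi> n) t * P t)"
      unfolding deriv by (intro continuous_intros cE P c1 c2 cr1 cr2)
    have "(LINT t|tm T. (- \<tau> * E t * P t) * (\<chi>1 n t * \<chi>2 n t)) + ((LINT t|tm T. (E t * P t) * \<rho>1 n t) - (LINT t|tm T. (E t * P t) * \<rho>2 n t))
      = (LINT t|tm T. (- \<tau> * E t * P t) * (\<chi>1 n t * \<chi>2 n t) + ((E t * P t) * \<rho>1 n t - (E t * P t) * \<rho>2 n t))"
      using i by simp
    also have "\<dots> = (LINT t|tm T. deriv (\<psi> n) t * P t)"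
      unfolding deriv by (simp add: algebra_simps)
    also have "\<dots> = (LINT t|tm T. deriv (\<psi> n) t * p t)"
    proof -
      have m: "(\<lambda>t. deriv (\<psi> n) t * P t) \<in> borel_measurable (tm T)" by (rule tm_continuous_integrable(1)[OF cd])
      have e: "AE t in tm T. deriv (\<psi> n) t * P t = deriv (\<psi> n) t * p t" using p by eventually_elim simp
      show ?thesis by (rule integral_cong_AE[OF m tm_measurable_AE_cong[OF m e] e])
    qed
    also have "\<dots> = - (LINT t|tm T. \<psi> n t * r t)" by (rule w[OF \<psi>t])
    also have "(LINT t|tm T. \<psi> n t * r t) = (LINT t|tm T. (E t * r t) * (\<chi>1 n t * \<chi>2 n t))"
      by (simp add: \<psi>_def mult_ac)
    finally show ?thesis .
  qed
  have L: "(\<lambda>n. (LINT t|tm T. (- \<tau> * E t * P t) * (\<chi>1 n t * \<chi>2 n t)) + ((LINT t|tm T. (E t * P t) * \<rho>1 n t) - (LINT t|tm T. (E t * P t) * \<rho>2 n t)))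
     \<longlonglongrightarrow> (LINT t|tm T. - \<tau> * E t * P t) + (E 0 * P 0 - E T * P T)"
    by (intro tendsto_add tendsto_diff D1 D2 DCT EP)
  have R: "(\<lambda>n. - (LINT t|tm T. (E t * r t) * (\<chi>1 n t * \<chi>2 n t))) \<longlonglongrightarrow> - (LINT t|tm T. E t * r t)"
    by (intro tendsto_minus DCT Er)
  have "(LINT t|tm T. - \<tau> * E t * P t) + (E 0 * P 0 - E T * P T) = - (LINT t|tm T. E t * r t)"
    by (rule LIMSEQ_unique[OF L R[folded eq]])
  moreover have "(LINT t|tm T. - \<tau> * E t * P t) = - \<tau> * (LINT t|tm T. E t * P t)" by (simp add: mult.assoc)
  moreover have "(LINT t|tm T. E t * P t) = (LINT t|tm T. E t * p t)"
  proof -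
    have m: "(\<lambda>t. E t * P t) \<in> borel_measurable (tm T)" by (rule tm_continuous_integrable(1)[OF cEP])
    have e: "AE t in tm T. E t * P t = E t * p t" using p by eventually_elim simp
    show ?thesis by (rule integral_cong_AE[OF m tm_measurable_AE_cong[OF m e] e])
  qed
  ultimately show ?thesis by (simp add: E_def)
qed

section \<open>The equation satisfied by the Laplace transform\<close>

lemma symmetric_vip:
  fixes A :: "R3 \<Rightarrow> real^3^3"
  assumes "\<And>x. transpose (A x) = A x" "\<And>i j. (\<lambda>x. A x $ i $ j) \<in> Linf" "G \<in> vL2" "H \<in> vL2"
  shows "vip (\<lambda>x. A x *v G x) H = vip G (\<lambda>x. A x *v H x)"
proof -
  have "(A x *v G x) \<bullet> H x = G x \<bullet> (A x *v H x)" for x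
    using dot_lmul_matrix[of "G x" "A x" "H x"] assms(1)[of x]
    by (metis matrix_vector_mul_linear transpose_matrix_vector vector_transpose_matrix)
  then show ?thesis by (simp add: vip_eq assms matrix_mult_vL2)
qed

lemma H1_dual_tendsto:
  assumes "\<And>t. t \<in> S \<Longrightarrow> l t \<in> H1_dual" "\<phi> \<in> H1" "t \<in> S" "((\<lambda>s. H1_dual_norm (l s - l t)) \<longlongrightarrow> 0) (at t within S)"
  shows "((\<lambda>s. l s \<phi>) \<longlongrightarrow> l t \<phi>) (at t within S)"
proof -
  have "((\<lambda>s. l s \<phi> - l t \<phi>) \<longlongrightarrow> 0) (at t within S)"
  proof (rule Lim_null_comparison)
    show "\<forall>\<^sub>F s in at t within S. norm (l s \<phi> - l t \<phi>) \<le> H1_dual_norm (l s - l t) * H1_norm \<phi>"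
      unfolding eventually_at_filter
      by (intro always_eventually allI impI)
         (use H1_dual_bound[OF H1_dual_diff[OF assms(1) assms(1)] assms(2)] assms(3) in auto)
    show "((\<lambda>s. H1_dual_norm (l s - l t) * H1_norm \<phi>) \<longlongrightarrow> 0) (at t within S)"
      using tendsto_mult_left_zero[OF assms(4)] .
  qed
  then show ?thesis by (simp add: LIM_zero_iff)
qed

text \<open>For a fixed \<open>\<phi>\<close> all terms are scalar functions of time. Symmetry moves
  \<open>\<gamma>\<close> onto the gradient of \<open>\<phi>\<close>, so the time integral meets a
  fixed vector field. The values of \<open>u\<close> and its time derivative at \<open>T\<close> are
  those of the continuous representatives; they form \<open>F\<close>, and their norms give a
  \<open>K\<close> independent of \<open>\<tau>\<close>.\<close>

theorem w_fun_equation: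
  fixes \<gamma> :: "R3 \<Rightarrow> real^3^3"
  assumes T: "T > 0" and f: "f \<in> L2" and sym: "\<And>x. transpose (\<gamma> x) = \<gamma> x" and \<gamma>: "\<And>i j. (\<lambda>x. \<gamma> x $ i $ j) \<in> Linf"
    and u: "weak_wave_solution T \<gamma> f u"
  obtains K where "K \<ge> 0" "\<And>\<tau>. \<tau> \<ge> 0 \<Longrightarrow> w_fun T u \<tau> \<in> H1"
    "\<And>\<tau>. \<tau> \<ge> 0 \<Longrightarrow> \<exists>F. (\<forall>\<phi>\<in>H1. \<bar>F \<phi>\<bar> \<le> K * (H1_norm \<phi> + \<tau> * L2_norm \<phi>)) \<and>
      (\<forall>\<phi>\<in>H1. \<forall>\<psi>\<in>H1. F (\<lambda>x. \<phi> x - \<psi> x) = F \<phi> - F \<psi>) \<and>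
      (\<forall>\<phi>\<in>H1. vip (\<lambda>x. \<gamma> x *v weak_gradient (w_fun T u \<tau>) x) (weak_gradient \<phi>) + \<tau>\<^sup>2 * ip (w_fun T u \<tau>) \<phi>
          = ip f \<phi> - exp (- \<tau> * T) * F \<phi>)"
proof -
  from u obtain u' u'' where jm: "(\<lambda>(t, x). u t x) \<in> borel_measurable (lebesgue_on ({0<..<T} \<times> (UNIV :: R3 set)))"
    and B: "Bochner_L2 T H1 H1_norm u" and B': "Bochner_L2 T L2 L2_norm u'"
    and D1: "has_weak_time_derivative T (\<lambda>t. L2_functional (u t)) (\<lambda>t. L2_functional (u' t))"
    and D2: "has_weak_time_derivative T (\<lambda>t. L2_functional (u' t)) u''"
    and eqn: "AE t in tm T. \<forall>\<phi>\<in>H1. u'' t \<phi> + (LINT x|lebesgue. (\<gamma> x *v weak_gradient (u t) x) \<bullet> weak_gradient \<phi> x) = 0"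
    and I1: "has_initial_value T L2 L2_norm u (\<lambda>x. 0)"
    and I2: "has_initial_value T H1_dual H1_dual_norm (\<lambda>t. L2_functional (u' t)) (L2_functional f)"
    unfolding weak_wave_solution_def by blast
  obtain U where U: "\<And>t. t \<in> {0..T} \<Longrightarrow> U t \<in> L2" "\<And>t. t \<in> {0..T} \<Longrightarrow> ((\<lambda>s. L2_norm (U s - U t)) \<longlongrightarrow> 0) (at t within {0..T})"
    "AE t in tm T. L2_norm (U t - u t) = 0" "L2_norm (U 0 - (\<lambda>x. 0)) = 0"
    using I1 unfolding has_initial_value_def by blast
  obtain V where V: "\<And>t. t \<in> {0..T} \<Longrightarrow> V t \<in> H1_dual" "\<And>t. t \<in> {0..T} \<Longrightarrow> ((\<lambda>s. H1_dual_norm (V s - V t)) \<longlongrightarrow> 0) (at t within {0..T})"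
    "AE t in tm T. H1_dual_norm (V t - L2_functional (u' t)) = 0" "H1_dual_norm (V 0 - L2_functional f) = 0"
    using I2 unfolding has_initial_value_def by blast
  have uH: "AE t in tm T. u t \<in> H1" and u'L: "AE t in tm T. u' t \<in> L2"
    using B B' by (auto simp: Bochner_L2_def)
  have T0: "0 \<in> {0..T}" "T \<in> {0..T}" using T by auto
  have inT: "AE t in tm T. t \<in> {0<..<T}" by (rule AE_I2) simp
  \<comment> \<open>The maximum with 0 spares a separate proof that the dual norm, a supremum, is
    nonnegative.\<close>
  define K where "K = max (H1_dual_norm (V T)) 0 + L2_norm (U T)"
  show thesis
  proof (rule that)
    show "K \<ge> 0" using L2_norm_nonneg[of "U T"] by (simp add: K_def)
    fix \<tau> :: real assume tau: "\<tau> \<ge> 0"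
    note w = w_fun_H1[OF jm B tau T]
    show "w_fun T u \<tau> \<in> H1" by (rule w(1))
    define F where "F \<phi> = V T \<phi> + \<tau> * ip (U T) \<phi>" for \<phi>
    have main: "vip (\<lambda>x. \<gamma> x *v weak_gradient (w_fun T u \<tau>) x) (weak_gradient \<phi>) + \<tau>\<^sup>2 * ip (w_fun T u \<tau>) \<phi>
          = ip f \<phi> - exp (- \<tau> * T) * F \<phi>" if p: "\<phi> \<in> H1" for \<phi>
    proof -
      note pL = H1_L2[OF p]
      note gp = matrix_mult_vL2[OF \<gamma> H1_gradient_vL2[OF p]]
      let ?\<Phi> = "\<lambda>x. \<gamma> x *v weak_gradient \<phi> x"
      \<comment> \<open>The stand-in for \<open>u'' t \<phi>\<close>, equal to it almost everywhere
        by the wave equation and integrable in time by \<open>w_fun_H1\<close>.\<close>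
      let ?r = "\<lambda>t. - vip (weak_gradient (u t)) ?\<Phi>"
      have ri: "integrable (tm T) ?r" using w(4)[OF gp] by auto
      have r: "AE t in tm T. ?r t = u'' t \<phi>"
        using eqn uH
      proof eventually_elim
        case (elim t)
        have "(LINT x|lebesgue. (\<gamma> x *v weak_gradient (u t) x) \<bullet> weak_gradient \<phi> x) = vip (\<lambda>x. \<gamma> x *v weak_gradient (u t) x) (weak_gradient \<phi>)"
          by (rule vip_eq[symmetric, OF matrix_mult_vL2[OF \<gamma> H1_gradient_vL2[OF elim(2)]] H1_gradient_vL2[OF p]])
        also have "\<dots> = vip (weak_gradient (u t)) ?\<Phi>"
          by (rule symmetric_vip[OF sym \<gamma> H1_gradient_vL2[OF elim(2)] H1_gradient_vL2[OF p]])
        finally show ?case using elim(1) p by (auto simp: add_eq_0_iff)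
      qed
      let ?P = "\<lambda>t. ip (U t) \<phi>" and ?Q = "\<lambda>t. V t \<phi>"
      have cP: "continuous_on {0..T} ?P"
        unfolding continuous_on_def
      proof
        fix t assume t: "t \<in> {0..T}"
        have "((\<lambda>s. ip (U s) \<phi> - ip (U t) \<phi>) \<longlongrightarrow> 0) (at t within {0..T})"
        proof (rule Lim_null_comparison)
          show "\<forall>\<^sub>F s in at t within {0..T}. norm (ip (U s) \<phi> - ip (U t) \<phi>) \<le> L2_norm (U s - U t) * L2_norm \<phi>"
            unfolding eventually_at_filter
          proof (intro always_eventually allI impI)
            fix s assume "s \<noteq> t" "s \<in> {0..T}"
            then have "\<bar>ip (\<lambda>x. U s x - U t x) \<phi>\<bar> \<le> L2_norm (\<lambda>x. U s x - U t x) * L2_norm \<phi>"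
              using U(1) t pL by (intro ip_Cauchy_Schwarz L2_diff) auto
            then show "norm (ip (U s) \<phi> - ip (U t) \<phi>) \<le> L2_norm (U s - U t) * L2_norm \<phi>"
              using U(1) t \<open>s \<in> {0..T}\<close> pL by (simp add: ip_diff_left fun_diff_def)
          qed
          show "((\<lambda>s. L2_norm (U s - U t) * L2_norm \<phi>) \<longlongrightarrow> 0) (at t within {0..T})"
            using tendsto_mult_left_zero[OF U(2)[OF t]] .
        qed
        then show "((\<lambda>s. ip (U s) \<phi>) \<longlongrightarrow> ip (U t) \<phi>) (at t within {0..T})" by (simp add: LIM_zero_iff)
      qed
      have cQ: "continuous_on {0..T} ?Q"
        unfolding continuous_on_def using H1_dual_tendsto[OF V(1) p _ V(2)] by blast
      have P: "AE t in tm T. ?P t = L2_functional (u t) \<phi>"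
        using U(3) uH inT
      proof eventually_elim
        case (elim t)
        have tt: "t \<in> {0..T}" using elim by auto
        have d: "(\<lambda>x. U t x - u t x) \<in> L2" using U(1)[OF tt] H1_L2[OF elim(2)] by (rule L2_diff)
        have "\<bar>ip (\<lambda>x. U t x - u t x) \<phi>\<bar> \<le> 0"
          using ip_Cauchy_Schwarz[OF d pL] elim(1) by (simp add: fun_diff_def)
        then show ?case using U(1)[OF tt] H1_L2[OF elim(2)] pL by (simp add: ip_diff_left L2_functional_ip)
      qed
      have Q: "AE t in tm T. ?Q t = L2_functional (u' t) \<phi>"
        using V(3) u'L inT
      proof eventually_elim
        case (elim t)
        then have tt: "t \<in> {0..T}" by auto
        have "\<bar>(V t - L2_functional (u' t)) \<phi>\<bar> \<le> 0"
          using H1_dual_bound[OF H1_dual_diff[OF V(1)[OF tt] L2_functional_H1_dual[OF elim(2)]] p] elim(1) by simp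
        then show ?case by simp
      qed
      have P0: "?P 0 = 0"
      proof -
        have "L2_norm (U 0) = 0" using U(4) by (simp add: fun_diff_def)
        then show ?thesis using ip_Cauchy_Schwarz[OF U(1)[OF T0(1)] pL] by simp
      qed
      have Q0: "?Q 0 = ip f \<phi>"
      proof -
        have "\<bar>(V 0 - L2_functional f) \<phi>\<bar> \<le> 0"
          using H1_dual_bound[OF H1_dual_diff[OF V(1)[OF T0(1)] L2_functional_H1_dual[OF f]] p] V(4) by simp
        then show ?thesis by (simp add: L2_functional_ip)
      qed
      have Qi: "integrable (tm T) ?Q" by (rule tm_continuous_integrable(2)[OF cQ])
      have w1: "(LINT t|tm T. deriv \<psi> t * L2_functional (u t) \<phi>) = - (LINT t|tm T. \<psi> t * ?Q t)"
        if ps: "\<psi> \<in> test_functions {0<..<T}" for \<psi>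
      proof -
        have pm: "\<psi> \<in> borel_measurable (tm T)"
          using test_functionsD(1)[OF ps, of 0] by (intro tm_continuous_integrable(1)) (auto intro: continuous_on_subset)
        have m: "(\<lambda>t. \<psi> t * ?Q t) \<in> borel_measurable (tm T)" using pm Qi by auto
        have e: "AE t in tm T. \<psi> t * ?Q t = \<psi> t * L2_functional (u' t) \<phi>" using Q by eventually_elim simp
        have "(LINT t|tm T. \<psi> t * ?Q t) = (LINT t|tm T. \<psi> t * L2_functional (u' t) \<phi>)"
          by (rule integral_cong_AE[OF m tm_measurable_AE_cong[OF m e] e])
        then show ?thesis using D1 ps p by (simp add: has_weak_time_derivative_def)
      qed
      have w2: "(LINT t|tm T. deriv \<psi> t * L2_functional (u' t) \<phi>) = - (LINT t|tm T. \<psi> t * ?r t)"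
        if ps: "\<psi> \<in> test_functions {0<..<T}" for \<psi>
      proof -
        have pm: "\<psi> \<in> borel_measurable (tm T)"
          using test_functionsD(1)[OF ps, of 0] by (intro tm_continuous_integrable(1)) (auto intro: continuous_on_subset)
        have m: "(\<lambda>t. \<psi> t * ?r t) \<in> borel_measurable (tm T)" using pm ri by (intro borel_measurable_times) auto
        have e: "AE t in tm T. \<psi> t * ?r t = \<psi> t * u'' t \<phi>" using r by eventually_elim simp
        have "(LINT t|tm T. \<psi> t * ?r t) = (LINT t|tm T. \<psi> t * u'' t \<phi>)"
          by (rule integral_cong_AE[OF m tm_measurable_AE_cong[OF m e] e])
        then show ?thesis using D2 ps p by (simp add: has_weak_time_derivative_def)
      qed
      \<comment> \<open>The first integration by parts reduces the transform of the first time
        derivative to that of \<open>u\<close>, the second reduces the transform of the second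
        derivative to that of the first. Each contributes one factor \<open>\<tau>\<close>; the
        boundary values at 0 are the initial data.\<close>
      have i1: "(LINT t|tm T. exp (- \<tau> * t) * ?Q t) = exp (- \<tau> * T) * ?P T - ?P 0 + \<tau> * (LINT t|tm T. exp (- \<tau> * t) * L2_functional (u t) \<phi>)"
        by (rule time_integration_by_parts[OF T cP P Qi w1])
      have i2: "(LINT t|tm T. exp (- \<tau> * t) * ?r t) = exp (- \<tau> * T) * ?Q T - ?Q 0 + \<tau> * (LINT t|tm T. exp (- \<tau> * t) * L2_functional (u' t) \<phi>)"
        by (rule time_integration_by_parts[OF T cQ Q ri w2])
      have i3: "(LINT t|tm T. exp (- \<tau> * t) * ?Q t) = (LINT t|tm T. exp (- \<tau> * t) * L2_functional (u' t) \<phi>)"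
      proof -
        have m: "(\<lambda>t. exp (- \<tau> * t) * ?Q t) \<in> borel_measurable (tm T)"
          by (intro tm_continuous_integrable(1) continuous_intros cQ)
        have e: "AE t in tm T. exp (- \<tau> * t) * ?Q t = exp (- \<tau> * t) * L2_functional (u' t) \<phi>" using Q by eventually_elim simp
        show ?thesis by (rule integral_cong_AE[OF m tm_measurable_AE_cong[OF m e] e])
      qed
      have i4: "ip (w_fun T u \<tau>) \<phi> = (LINT t|tm T. exp (- \<tau> * t) * L2_functional (u t) \<phi>)"
        using w(2)[OF pL] by (simp add: L2_functional_ip)
      have i5: "vip (\<lambda>x. \<gamma> x *v weak_gradient (w_fun T u \<tau>) x) (weak_gradient \<phi>) = - (LINT t|tm T. exp (- \<tau> * t) * ?r t)"
        unfolding symmetric_vip[OF sym \<gamma> H1_gradient_vL2[OF w(1)] H1_gradient_vL2[OF p]] w(3)[OF gp] by simp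
      show ?thesis
        unfolding i5 i4 i2 i3[symmetric] i1 P0 Q0 F_def by (simp add: algebra_simps power2_eq_square)
    qed
    have bound: "\<bar>F \<phi>\<bar> \<le> K * (H1_norm \<phi> + \<tau> * L2_norm \<phi>)" if p: "\<phi> \<in> H1" for \<phi>
    proof -
      have "\<bar>V T \<phi>\<bar> \<le> H1_dual_norm (V T) * H1_norm \<phi>" by (rule H1_dual_bound[OF V(1)[OF T0(2)] p])
      also have "\<dots> \<le> K * H1_norm \<phi>"
        unfolding K_def using L2_norm_nonneg[of "U T"] by (intro mult_right_mono H1_norm_ge_0) simp
      finally have 1: "\<bar>V T \<phi>\<bar> \<le> K * H1_norm \<phi>" .
      have "\<bar>ip (U T) \<phi>\<bar> \<le> L2_norm (U T) * L2_norm \<phi>" by (rule ip_Cauchy_Schwarz[OF U(1)[OF T0(2)] H1_L2[OF p]])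
      also have "\<dots> \<le> K * L2_norm \<phi>" unfolding K_def by (intro mult_right_mono L2_norm_nonneg) simp
      finally have "\<tau> * \<bar>ip (U T) \<phi>\<bar> \<le> \<tau> * (K * L2_norm \<phi>)" using tau by (rule mult_left_mono)
      moreover have "\<bar>F \<phi>\<bar> \<le> \<bar>V T \<phi>\<bar> + \<tau> * \<bar>ip (U T) \<phi>\<bar>"
        unfolding F_def using tau by (metis abs_mult abs_of_nonneg abs_triangle_ineq)
      ultimately show ?thesis using 1 by (simp add: algebra_simps)
    qed
    have lin: "F (\<lambda>x. \<phi> x - \<psi> x) = F \<phi> - F \<psi>" if "\<phi> \<in> H1" "\<psi> \<in> H1" for \<phi> \<psi>
    proof -
      have "V T (\<lambda>x. 1 * \<phi> x + (- 1) * \<psi> x) = 1 * V T \<phi> + (- 1) * V T \<psi>"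
        using V(1)[OF T0(2)] that unfolding H1_dual_def by blast
      then show ?thesis
        using U(1)[OF T0(2)] that by (simp add: F_def ip_diff_right H1_L2 algebra_simps)
    qed
    show "\<exists>F. (\<forall>\<phi>\<in>H1. \<bar>F \<phi>\<bar> \<le> K * (H1_norm \<phi> + \<tau> * L2_norm \<phi>)) \<and>
      (\<forall>\<phi>\<in>H1. \<forall>\<psi>\<in>H1. F (\<lambda>x. \<phi> x - \<psi> x) = F \<phi> - F \<psi>) \<and>
      (\<forall>\<phi>\<in>H1. vip (\<lambda>x. \<gamma> x *v weak_gradient (w_fun T u \<tau>) x) (weak_gradient \<phi>) + \<tau>\<^sup>2 * ip (w_fun T u \<tau>) \<phi>
          = ip f \<phi> - exp (- \<tau> * T) * F \<phi>)"
      using main bound lin by blast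
  qed
qed

section \<open>Two-sided bounds of the indicator function\<close>

text \<open>The gradient of \<open>v_fun B f \<tau>\<close>, differentiated under the integral.\<close>

definition vgrad :: "(R3 \<Rightarrow> real) \<Rightarrow> real \<Rightarrow> R3 \<Rightarrow> R3" where
  "vgrad f \<tau> x = (\<chi> i. - (LINT y|lebesgue. ykA \<tau> (norm (x - y)) * (x - y) $ i * f y))"

definition restr :: "R3 set \<Rightarrow> (R3 \<Rightarrow> R3) \<Rightarrow> R3 \<Rightarrow> R3" where
  "restr D G x = indicat_real D x *\<^sub>R G x"

lemma restr_vL2:
  assumes "D \<in> sets lebesgue" "G \<in> vL2"
  shows "restr D G \<in> vL2"
proof -
  have "indicat_real D \<in> Linf" using assms(1) by (auto simp: Linf_def indicator_def intro!: exI[of _ 1])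
  then show ?thesis using Linf_mult_L2 assms(2) by (simp add: vL2_def restr_def)
qed

lemma mat_1_diff_Linf:
  fixes \<gamma> :: "R3 \<Rightarrow> real^3^3"
  assumes "\<And>i j. (\<lambda>x. \<gamma> x $ i $ j) \<in> Linf"
  shows "(\<lambda>x. (\<gamma> x - mat 1) $ i $ j) \<in> Linf"
proof -
  obtain K where K: "AE x in lebesgue. \<bar>\<gamma> x $ i $ j\<bar> \<le> K" using assms by (auto simp: Linf_def)
  have "AE x in lebesgue. \<bar>(\<gamma> x - mat 1) $ i $ j\<bar> \<le> K + 1"
    using K by eventually_elim (auto simp: mat_def)
  moreover have "(\<lambda>x. (\<gamma> x - mat 1) $ i $ j) \<in> borel_measurable lebesgue"
    using assms[of i j] by (auto simp: Linf_def)
  ultimately show ?thesis by (auto simp: Linf_def)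
qed

text \<open>\<open>c / (1 + 2 * c)\<close> is the minimum of the right-hand side over all
  \<open>p + q = 1\<close>, attained at \<open>q = 2 * c * p\<close>. The weight 1/2 on
  \<open>q\<^sup>2\<close> leaves the other half of the energy of \<open>w - v\<close> free to
  absorb the residual.\<close>

lemma scaled_sum_square:
  fixes c p q :: real
  assumes "c > 0"
  shows "c / (1 + 2 * c) * (p + q)\<^sup>2 \<le> c * p\<^sup>2 + q\<^sup>2 / 2"
proof -
  have "0 \<le> (2 * c * p - q)\<^sup>2" by simp
  then have "2 * c * (p + q)\<^sup>2 \<le> (2 * c * p\<^sup>2 + q\<^sup>2) * (1 + 2 * c)"
    by (simp add: power2_eq_square algebra_simps)
  moreover have "(2 * c * p\<^sup>2 + q\<^sup>2) * (1 + 2 * c) = 2 * ((c * p\<^sup>2 + q\<^sup>2 / 2) * (1 + 2 * c))"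
    by (simp add: field_simps)
  ultimately have "2 * ((p + q)\<^sup>2 * c) \<le> 2 * ((c * p\<^sup>2 + q\<^sup>2 / 2) * (1 + 2 * c))"
    by (metis mult.assoc mult.commute)
  then have "(p + q)\<^sup>2 * c \<le> (c * p\<^sup>2 + q\<^sup>2 / 2) * (1 + 2 * c)"
    unfolding mult_le_cancel_left by simp
  then show ?thesis using assms by (simp add: pos_divide_le_eq mult.commute)
qed

text \<open>Completing the square. With \<open>s\<close> the energy norm of \<open>w - v\<close> and
  \<open>b\<close> proportional to \<open>exp (- \<tau> * T)\<close>, a residual linear in
  \<open>s\<close> turns into the square of the exponential.\<close>

lemma absorb_linear:
  fixes c s b :: real
  assumes "c > 0"
  shows "c * s\<^sup>2 - 2 * b * s \<ge> - (b\<^sup>2 / c)"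
proof -
  have "0 \<le> (c * s - b)\<^sup>2 / c" using assms by simp
  also have "(c * s - b)\<^sup>2 / c = c * s\<^sup>2 - 2 * b * s + b\<^sup>2 / c"
    using assms by (simp add: power2_eq_square field_simps)
  finally show ?thesis by simp
qed

text \<open>With \<open>A x = \<gamma> x - mat 1\<close>, which vanishes off \<open>D\<close>, and
  its form \<open>P\<close>, the indicator has several expressions that differ by the equations for
  \<open>w\<close> and \<open>v\<close>. Each inequality uses the one in which every main term has
  the right sign: \<open>I2\<close> under \<open>M_plus\<close>, \<open>I4\<close> under
  \<open>M_minus\<close>, and \<open>I3\<close> for the upper bound.\<close>

theorem indicator_bounds:
  fixes \<gamma> :: "R3 \<Rightarrow> real^3^3"
  assumes T: "T > 0" and D: "D \<in> sets lebesgue" and adm: "admissible_coefficient D \<gamma>"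
    and B: "B \<in> sets lebesgue" and f: "f \<in> L2" and fB: "AE x in lebesgue. x \<notin> B \<longrightarrow> f x = 0"
    and u: "weak_wave_solution T \<gamma> f u"
  obtains C c where "C > 0" "c > 0"
    "\<And>\<tau>. \<tau> \<ge> 1 \<Longrightarrow> vgrad f \<tau> \<in> vL2"
    "\<And>\<tau>. \<tau> \<ge> 1 \<Longrightarrow> \<bar>indicator_function T B f u \<tau>\<bar>
        \<le> C * ((vnorm (restr D (vgrad f \<tau>)))\<^sup>2 + (exp (- \<tau> * T))\<^sup>2 + exp (- \<tau> * T) / \<tau>)"
    "\<And>\<tau>. \<tau> \<ge> 1 \<Longrightarrow> M_plus D \<gamma> \<Longrightarrow> - indicator_function T B f u \<tau>
        \<ge> c * (vnorm (restr D (vgrad f \<tau>)))\<^sup>2 - C * ((exp (- \<tau> * T))\<^sup>2 + exp (- \<tau> * T) / \<tau>)"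
    "\<And>\<tau>. \<tau> \<ge> 1 \<Longrightarrow> M_minus D \<gamma> \<Longrightarrow> indicator_function T B f u \<tau>
        \<ge> c * (vnorm (restr D (vgrad f \<tau>)))\<^sup>2 - C * ((exp (- \<tau> * T))\<^sup>2 + exp (- \<tau> * T) / \<tau>)"
proof -
  have sym: "\<And>x. transpose (\<gamma> x) = \<gamma> x" and \<gamma>L: "\<And>i j. (\<lambda>x. \<gamma> x $ i $ j) \<in> Linf"
    and ell: "\<exists>c\<^sub>0>0. AE x in lebesgue. form_le (c\<^sub>0 *\<^sub>R mat 1) (\<gamma> x)"
    and out: "AE x in lebesgue. x \<notin> D \<longrightarrow> \<gamma> x = mat 1"
    using adm by (auto simp: admissible_coefficient_def)
  obtain c0 where c0: "c0 > 0" "AE x in lebesgue. form_le (c0 *\<^sub>R mat 1) (\<gamma> x)" using ell by blast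
  define A where "A x = \<gamma> x - mat 1" for x
  have AL: "\<And>i j. (\<lambda>x. A x $ i $ j) \<in> Linf" unfolding A_def by (rule mat_1_diff_Linf[OF \<gamma>L])
  have Asym: "transpose (A x) = A x" for x
    using sym[of x] by (simp add: A_def transpose_def vec_eq_iff mat_def eq_commute)
  obtain M where M: "M \<ge> 0" "AE x in lebesgue. \<forall>v. norm (A x *v v) \<le> M * norm v"
    using matrix_norm_bound[OF AL] by blast
  have Aout: "AE x in lebesgue. x \<notin> D \<longrightarrow> A x = 0" using out by eventually_elim (simp add: A_def)
  have mat1: "\<xi> \<bullet> ((r *\<^sub>R mat 1) *v \<xi>) = r * (\<xi> \<bullet> \<xi>)" for r and \<xi> :: R3
    by (simp add: scaleR_matrix_vector_assoc[symmetric])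
  \<comment> \<open>The constants are fixed before the case distinction, as both sign conditions
    appear as premises of the claims; the default 1 makes each constant positive also when its
    condition fails.\<close>
  define cp where "cp = (if M_plus D \<gamma> then (SOME c. c > 0 \<and> (AE x in lebesgue. x \<in> D \<longrightarrow> form_le (c *\<^sub>R mat 1) (\<gamma> x - mat 1))) else 1)"
  define cm where "cm = (if M_minus D \<gamma> then (SOME c. c > 0 \<and> (AE x in lebesgue. x \<in> D \<longrightarrow> form_le (c *\<^sub>R mat 1) (mat 1 - \<gamma> x))) else 1)"
  have cpM: "cp > 0 \<and> (AE x in lebesgue. x \<in> D \<longrightarrow> form_le (cp *\<^sub>R mat 1) (\<gamma> x - mat 1))" if "M_plus D \<gamma>"
    using someI_ex[of "\<lambda>c. c > 0 \<and> (AE x in lebesgue. x \<in> D \<longrightarrow> form_le (c *\<^sub>R mat 1) (\<gamma> x - mat 1))"] that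
    by (simp add: cp_def M_plus_def)
  have cmM: "cm > 0 \<and> (AE x in lebesgue. x \<in> D \<longrightarrow> form_le (cm *\<^sub>R mat 1) (mat 1 - \<gamma> x))" if "M_minus D \<gamma>"
    using someI_ex[of "\<lambda>c. c > 0 \<and> (AE x in lebesgue. x \<in> D \<longrightarrow> form_le (c *\<^sub>R mat 1) (mat 1 - \<gamma> x))"] that
    by (simp add: cm_def M_minus_def)
  have cp0: "cp > 0" and cm0: "cm > 0"
    using cpM cmM by (cases "M_plus D \<gamma>"; cases "M_minus D \<gamma>"; auto simp: cp_def cm_def)+
  obtain K where K: "K \<ge> 0" and wH: "\<And>\<tau>. \<tau> \<ge> 0 \<Longrightarrow> w_fun T u \<tau> \<in> H1"
    and wE: "\<And>\<tau>. \<tau> \<ge> 0 \<Longrightarrow> \<exists>F. (\<forall>\<phi>\<in>H1. \<bar>F \<phi>\<bar> \<le> K * (H1_norm \<phi> + \<tau> * L2_norm \<phi>)) \<and>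
      (\<forall>\<phi>\<in>H1. \<forall>\<psi>\<in>H1. F (\<lambda>x. \<phi> x - \<psi> x) = F \<phi> - F \<psi>) \<and>
      (\<forall>\<phi>\<in>H1. vip (\<lambda>x. \<gamma> x *v weak_gradient (w_fun T u \<tau>) x) (weak_gradient \<phi>) + \<tau>\<^sup>2 * ip (w_fun T u \<tau>) \<phi>
          = ip f \<phi> - exp (- \<tau> * T) * F \<phi>)"
    by (rule w_fun_equation[OF T f sym \<gamma>L u]) (rule that; assumption)
  \<comment> \<open>Ellipticity controls the gradient part of the energy with \<open>c0\<close>,
    while the zeroth-order part has the coefficient 1 on both sides.\<close>
  define c1 where "c1 = min c0 1"
  have c1: "c1 > 0" using c0 by (simp add: c1_def)
  define c2 where "c2 = min (cp / (1 + 2 * cp)) cm"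
  have c2: "c2 > 0" using cp0 cm0 by (simp add: c2_def)
  \<comment> \<open>One summand for every coefficient that arises in \<open>upper\<close> and in the
    two parts of \<open>Cb\<close>; the final 1 makes it positive.\<close>
  define C where "C = M + M\<^sup>2 / c1 + 2 * K * M / c1 + 2 * K * L2_norm f + K\<^sup>2 / c1 + 2 * K\<^sup>2 + 1"
  have C: "C > 0" unfolding C_def using M(1) c1 K L2_norm_nonneg[of f] by (intro add_nonneg_pos add_nonneg_nonneg) auto
  have main: "vgrad f \<tau> \<in> vL2 \<and>
     \<bar>indicator_function T B f u \<tau>\<bar> \<le> C * ((vnorm (restr D (vgrad f \<tau>)))\<^sup>2 + (exp (- \<tau> * T))\<^sup>2 + exp (- \<tau> * T) / \<tau>) \<and>
     (M_plus D \<gamma> \<longrightarrow> - indicator_function T B f u \<tau> \<ge> c2 * (vnorm (restr D (vgrad f \<tau>)))\<^sup>2 - C * ((exp (- \<tau> * T))\<^sup>2 + exp (- \<tau> * T) / \<tau>)) \<and>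
     (M_minus D \<gamma> \<longrightarrow> indicator_function T B f u \<tau> \<ge> c2 * (vnorm (restr D (vgrad f \<tau>)))\<^sup>2 - C * ((exp (- \<tau> * T))\<^sup>2 + exp (- \<tau> * T) / \<tau>))"
    if tau1: "\<tau> \<ge> 1" for \<tau>
  proof -
    have tau: "\<tau> > 0" "\<tau> \<ge> 0" using tau1 by auto
    define v where "v = v_fun B f \<tau>"
    define w where "w = w_fun T u \<tau>"
    define \<epsilon> where "\<epsilon> = exp (- \<tau> * T)"
    have \<epsilon>: "\<epsilon> > 0" by (simp add: \<epsilon>_def)
    obtain G0 where G00: "has_weak_gradient (v_fun B f \<tau>) G0"
      "\<And>x i. G0 x $ i = - (LINT y|lebesgue. ykA \<tau> (norm (x - y)) * (x - y) $ i * f y)"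
      "\<And>\<phi>. \<phi> \<in> H1 \<Longrightarrow> vip G0 (weak_gradient \<phi>) + \<tau>\<^sup>2 * ip (v_fun B f \<tau>) \<phi> = ip f \<phi>"
      by (rule v_fun_equation[OF tau(1) f B fB]) (rule that; assumption)
    note G0 = G00[folded v_def]
    have G0e: "G0 = vgrad f \<tau>" using G0(2) by (auto simp: vgrad_def vec_eq_iff)
    have G0L: "vgrad f \<tau> \<in> vL2" using G0(1) unfolding G0e by (simp add: has_weak_gradient_iff)
    have vH: "v \<in> H1" by (rule H1_I[OF G0(1)])
    have wH': "w \<in> H1" unfolding w_def by (rule wH[OF tau(2)])
    define gv where "gv = weak_gradient v"
    define gw where "gw = weak_gradient w"
    define gz where "gz x = gw x - gv x" for x
    define z where "z x = w x - v x" for x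
    have gvL: "gv \<in> vL2" and gwL: "gw \<in> vL2" unfolding gv_def gw_def by (intro H1_gradient_vL2 vH wH')+
    have gzL: "gz \<in> vL2" unfolding gz_def[abs_def] by (intro vL2_diff gwL gvL)
    have vL: "v \<in> L2" and wL: "w \<in> L2" by (intro H1_L2 vH wH')+
    have zL: "z \<in> L2" unfolding z_def[abs_def] by (intro L2_diff wL vL)
    have zH: "z \<in> H1" unfolding z_def[abs_def] by (intro H1_diff wH' vH)
    have gvG0: "AE x in lebesgue. gv x = vgrad f \<tau> x" unfolding gv_def G0e[symmetric] by (rule weak_gradient_AE[OF G0(1)])
    have ev: "vip gv (weak_gradient \<phi>) + \<tau>\<^sup>2 * ip v \<phi> = ip f \<phi>" if "\<phi> \<in> H1" for \<phi>
    proof -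
      have "vip gv (weak_gradient \<phi>) = vip G0 (weak_gradient \<phi>)"
        by (rule vip_cong_AE[OF gvL H1_gradient_vL2[OF that] gvG0[folded G0e]]) simp
      then show ?thesis using G0(3)[OF that] by simp
    qed
    obtain F where Fb: "\<And>\<phi>. \<phi> \<in> H1 \<Longrightarrow> \<bar>F \<phi>\<bar> \<le> K * (H1_norm \<phi> + \<tau> * L2_norm \<phi>)"
      and Fl: "\<And>\<phi> \<psi>. \<phi> \<in> H1 \<Longrightarrow> \<psi> \<in> H1 \<Longrightarrow> F (\<lambda>x. \<phi> x - \<psi> x) = F \<phi> - F \<psi>"
      and Fe: "\<And>\<phi>. \<phi> \<in> H1 \<Longrightarrow> vip (\<lambda>x. \<gamma> x *v gw x) (weak_gradient \<phi>) + \<tau>\<^sup>2 * ip w \<phi> = ip f \<phi> - \<epsilon> * F \<phi>"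
      using wE[OF tau(2)] unfolding w_def gw_def \<epsilon>_def by blast
    define P where "P g h = vip (\<lambda>x. A x *v g x) h" for g h
    have AvL: "(\<lambda>x. A x *v g x) \<in> vL2" if "g \<in> vL2" for g by (rule matrix_mult_vL2[OF AL that])
    have \<gamma>P: "vip (\<lambda>x. \<gamma> x *v g x) h = vip g h + P g h" if "g \<in> vL2" "h \<in> vL2" for g h
    proof -
      have "(\<lambda>x. \<gamma> x *v g x) = (\<lambda>x. g x + A x *v g x)"
        by (simp add: A_def matrix_vector_mult_diff_rdistrib)
      then show ?thesis unfolding P_def by (simp add: vip_add_left[OF that(1) AvL[OF that(1)] that(2)])
    qed
    have Psym: "P g h = P h g" if "g \<in> vL2" "h \<in> vL2" for g h
      unfolding P_def symmetric_vip[OF Asym AL that] by (rule vip_commute)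
    have Pdr: "P g gz = P g gw - P g gv" if "g \<in> vL2" for g
      unfolding P_def gz_def[abs_def] by (rule vip_diff_right[OF gwL gvL AvL[OF that]])
    have Pdl: "P gz h = P gw h - P gv h" if "h \<in> vL2" for h
      using Pdr[OF that] Psym[OF gzL that] Psym[OF gwL that] Psym[OF gvL that] by simp
    have ew: "vip gw (weak_gradient \<phi>) + P gw (weak_gradient \<phi>) + \<tau>\<^sup>2 * ip w \<phi> = ip f \<phi> - \<epsilon> * F \<phi>" if "\<phi> \<in> H1" for \<phi>
      using Fe[OF that] \<gamma>P[OF gwL H1_gradient_vL2[OF that]] by simp
    define I where "I = indicator_function T B f u \<tau>"
    have I: "I = ip f w - ip f v"
    proof -
      have "I = ip f (\<lambda>x. w x - v x)" by (simp add: I_def indicator_function_def ip_def w_def v_def)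
      then show ?thesis by (simp add: ip_diff_right[OF wL vL f])
    qed
    note e1 = ev[OF wH', folded gw_def] and e2 = ev[OF vH, folded gv_def]
      and e3 = ew[OF wH', folded gw_def] and e4 = ew[OF vH, folded gv_def]
    define a where "a = vip gz gz + \<tau>\<^sup>2 * ip z z"
    have a0: "a \<ge> 0" unfolding a_def using vip_self_nonneg ip_self_nonneg by (simp add: add_nonneg_nonneg)
    have zz: "ip z z = ip w w - ip w v - ip v w + ip v v"
      unfolding z_def[abs_def] by (simp add: ip_diff_left ip_diff_right wL vL L2_diff)
    have gzz: "vip gz gz = vip gw gw - vip gw gv - vip gv gw + vip gv gv"
      unfolding gz_def[abs_def] by (simp add: vip_diff_left vip_diff_right gwL gvL vL2_diff)
    \<comment> \<open>The equation of \<open>v\<close> tested with \<open>w\<close>, minus that of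
      \<open>w\<close> tested with \<open>v\<close>: the symmetric terms cancel.\<close>
    have I1: "I = - P gw gv - \<epsilon> * F v"
      using e1 e4 unfolding I by (simp add: vip_commute[of gw gv] ip_commute[of w v])
    have Fz: "F z = F w - F v" unfolding z_def[abs_def] by (rule Fl[OF wH' vH])
    \<comment> \<open>The difference of the two equations, tested with \<open>z\<close>. The
      quantity \<open>a\<close> is the energy of \<open>z\<close> for the coefficient matrix
      1.\<close>
    have az: "a + P gw gz = - \<epsilon> * F z"
    proof -
      have "a + P gw gz = (vip gw gw + P gw gw + \<tau>\<^sup>2 * ip w w) - (vip gw gv + P gw gv + \<tau>\<^sup>2 * ip w v)
        - (vip gv gw + \<tau>\<^sup>2 * ip v w) + (vip gv gv + \<tau>\<^sup>2 * ip v v)"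
        unfolding a_def zz gzz Pdr[OF gwL] by (simp add: algebra_simps)
      then show ?thesis unfolding e1 e2 e3 e4 Fz by (simp add: algebra_simps)
    qed
    have Pww: "P gw gw = P gw gz + P gw gv" using Pdr[OF gwL] by simp
    \<comment> \<open>In \<open>- I\<close> the main terms are \<open>P gw gw\<close> and
      \<open>a\<close>, both nonnegative under \<open>M_plus\<close>. The first controls the
      gradient of \<open>w\<close> on \<open>D\<close>, the second that of \<open>w - v\<close>, and
      together they control the gradient of \<open>v\<close>.\<close>
    have I2: "I = - P gw gw - a - \<epsilon> * F z - \<epsilon> * F v" using I1 az Pww by simp
    have I3: "I = - P gv gv - P gz gv - \<epsilon> * F v" using I1 Pdl[OF gvL] by simp
    have az2: "a + P gz gz = - P gv gz - \<epsilon> * F z" using az Pdl[OF gzL] by simp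
    \<comment> \<open>Under \<open>M_minus\<close> the first term bounds the gradient of
      \<open>v\<close> on \<open>D\<close> from above, and the bracket is nonnegative by ellipticity
      of \<open>\<gamma>\<close>.\<close>
    have I4: "I = - P gv gv + (a + P gz gz) + \<epsilon> * F z - \<epsilon> * F v"
      using I3 az2 Psym[OF gzL gvL] by simp

    define s where "s = sqrt a"
    have s0: "s \<ge> 0" "s\<^sup>2 = a" using a0 by (auto simp: s_def)
    have tz: "\<tau> * L2_norm z \<le> s"
      unfolding s_def
    proof (rule real_le_rsqrt)
      show "(\<tau> * L2_norm z)\<^sup>2 \<le> a" unfolding a_def by (simp add: ip_self power_mult_distrib vip_self_nonneg)
    qed
    have gzn: "vnorm gz \<le> s"
      unfolding s_def
      by (rule real_le_rsqrt) (simp add: a_def vip_self[symmetric] ip_self_nonneg)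
    have zn: "H1_norm z \<le> s"
      unfolding s_def
    proof (rule real_le_rsqrt)
      have g: "vnorm (weak_gradient z) = vnorm gz"
      proof (rule vnorm_cong_AE[OF H1_gradient_vL2[OF zH]])
        show "AE x in lebesgue. weak_gradient z x = gz x"
          unfolding z_def[abs_def] gz_def gw_def gv_def by (rule weak_gradient_diff_AE[OF wH' vH])
      qed
      have "1 * ip z z \<le> \<tau>\<^sup>2 * ip z z" using tau1 by (intro mult_right_mono ip_self_nonneg) (simp add: one_le_power)
      then show "(H1_norm z)\<^sup>2 \<le> a" unfolding H1_norm_sq[OF zH] g a_def by (simp add: vip_self ip_self)
    qed
    have Fzb: "\<bar>F z\<bar> \<le> 2 * K * s"
    proof -
      have "K * (H1_norm z + \<tau> * L2_norm z) \<le> K * (s + s)" using zn tz K by (intro mult_left_mono add_mono)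
      then show ?thesis using Fb[OF zH] by simp
    qed
    \<comment> \<open>The origin of the factor \<open>1 / \<tau>\<close>: the energy
      \<open>b\<close> of \<open>v\<close> equals \<open>ip f v\<close>, and
      \<open>\<tau> * L2_norm v\<close> is at most \<open>sqrt b\<close>, so \<open>sqrt b\<close>
      is at most \<open>L2_norm f / \<tau>\<close>.\<close>
    have Fvb: "\<bar>F v\<bar> \<le> 2 * K * L2_norm f / \<tau>"
    proof -
      define b where "b = vip gv gv + \<tau>\<^sup>2 * ip v v"
      have b0: "b \<ge> 0" unfolding b_def using vip_self_nonneg ip_self_nonneg by (simp add: add_nonneg_nonneg)
      have tv: "\<tau> * L2_norm v \<le> sqrt b"
      proof (rule real_le_rsqrt)
        show "(\<tau> * L2_norm v)\<^sup>2 \<le> b" unfolding b_def by (simp add: ip_self power_mult_distrib vip_self_nonneg)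
      qed
      have vn: "H1_norm v \<le> sqrt b"
      proof (rule real_le_rsqrt)
        have "1 * ip v v \<le> \<tau>\<^sup>2 * ip v v" using tau1 by (intro mult_right_mono ip_self_nonneg) (simp add: one_le_power)
        then show "(H1_norm v)\<^sup>2 \<le> b" unfolding H1_norm_sq[OF vH] b_def gv_def by (simp add: vip_self ip_self)
      qed
      have "b = ip f v" using e2 by (simp add: b_def)
      also have "\<dots> \<le> L2_norm f * L2_norm v" using ip_Cauchy_Schwarz[OF f vL] by simp
      also have "\<dots> \<le> L2_norm f * (sqrt b / \<tau>)"
        using tv tau by (intro mult_left_mono L2_norm_nonneg) (simp add: field_simps)
      finally have bb: "sqrt b * sqrt b \<le> (L2_norm f / \<tau>) * sqrt b" using b0 by simp
      have "sqrt b \<le> L2_norm f / \<tau>"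
      proof (cases "b = 0")
        case True
        then show ?thesis using L2_norm_nonneg[of f] tau by simp
      next
        case False
        then have "sqrt b > 0" using b0 by simp
        show ?thesis by (rule mult_right_le_imp_le[OF bb \<open>sqrt b > 0\<close>])
      qed
      then have "H1_norm v + \<tau> * L2_norm v \<le> L2_norm f / \<tau> + L2_norm f / \<tau>" using vn tv by linarith
      then have "K * (H1_norm v + \<tau> * L2_norm v) \<le> K * (L2_norm f / \<tau> + L2_norm f / \<tau>)" using K by (rule mult_left_mono)
      with Fb[OF vH] show ?thesis by (simp add: mult_ac)
    qed
    have \<epsilon>Fv: "\<bar>\<epsilon> * F v\<bar> \<le> 2 * K * L2_norm f * (\<epsilon> / \<tau>)"
    proof -
      have "\<epsilon> * \<bar>F v\<bar> \<le> \<epsilon> * (2 * K * L2_norm f / \<tau>)" using Fvb \<epsilon> by (intro mult_left_mono) auto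
      then show ?thesis using \<epsilon> by (simp add: abs_mult mult_ac)
    qed
    have \<epsilon>Fz: "\<bar>\<epsilon> * F z\<bar> \<le> 2 * (K * \<epsilon>) * s"
    proof -
      have "\<epsilon> * \<bar>F z\<bar> \<le> \<epsilon> * (2 * K * s)" using Fzb \<epsilon> by (intro mult_left_mono) auto
      then show ?thesis using \<epsilon> by (simp add: abs_mult mult_ac)
    qed
    have P_bound: "\<bar>P g h\<bar> \<le> M * vnorm g * vnorm h" if "g \<in> vL2" "h \<in> vL2" for g h
    proof -
      have "\<bar>P g h\<bar> \<le> vnorm (\<lambda>x. A x *v g x) * vnorm h" unfolding P_def by (rule vip_Cauchy_Schwarz[OF AvL[OF that(1)] that(2)])
      also have "\<dots> \<le> M * vnorm g * vnorm h"
        by (intro mult_right_mono vnorm_nonneg matrix_vnorm_bound[OF AL that(1) M])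
      finally show ?thesis .
    qed
    define n where "n = vnorm (restr D gv)"
    have n0: "n \<ge> 0" by (simp add: n_def vnorm_nonneg)
    have rL: "restr D gv \<in> vL2" by (rule restr_vL2[OF D gvL])
    have nV: "n = vnorm (restr D (vgrad f \<tau>))"
      unfolding n_def by (rule vnorm_cong_AE[OF rL]) (use gvG0 in \<open>auto elim!: eventually_mono simp: restr_def\<close>)
    \<comment> \<open>As \<open>A\<close> vanishes off \<open>D\<close>, only the part of the
      gradient on \<open>D\<close> enters, and \<open>n\<close> is its norm.\<close>
    have PD: "P gv h = P (restr D gv) h" if "h \<in> vL2" for h
      unfolding P_def
      by (rule vip_cong_AE[OF AvL[OF gvL] that]) (use Aout in \<open>auto elim!: eventually_mono simp: restr_def indicator_def\<close>)
    have Pvh: "\<bar>P gv h\<bar> \<le> M * n * vnorm h" if "h \<in> vL2" for h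
      using P_bound[OF rL that] by (simp add: PD[OF that] n_def)
    have Pvv: "\<bar>P gv gv\<bar> \<le> M * n\<^sup>2"
    proof -
      have "P gv gv = P gv (restr D gv)" using PD[OF gvL] Psym[OF rL gvL] by simp
      then show ?thesis using Pvh[OF rL] by (simp add: n_def[symmetric] power2_eq_square mult.assoc)
    qed
    have Pvz: "\<bar>P gv gz\<bar> \<le> M * n * s"
      using Pvh[OF gzL] mult_left_mono[OF gzn, of "M * n"] M(1) n0 by simp
    have coer: "c1 * a \<le> a + P gz gz"
    proof -
      have "c0 * vip gz gz = vip (\<lambda>x. c0 *\<^sub>R gz x) gz" by (simp add: vip_scaleR_left)
      also have "\<dots> \<le> vip (\<lambda>x. \<gamma> x *v gz x) gz"
      proof (rule vip_mono[OF vL2_scaleR[OF gzL] gzL matrix_mult_vL2[OF \<gamma>L gzL] gzL])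
        show "AE x in lebesgue. (c0 *\<^sub>R gz x) \<bullet> gz x \<le> (\<gamma> x *v gz x) \<bullet> gz x"
          using c0(2)
        proof eventually_elim
          case (elim x)
          then have "gz x \<bullet> ((c0 *\<^sub>R mat 1) *v gz x) \<le> gz x \<bullet> (\<gamma> x *v gz x)" by (simp add: form_le_def)
          then show ?case by (simp add: mat1 inner_commute)
        qed
      qed
      also have "\<dots> = vip gz gz + P gz gz" by (rule \<gamma>P[OF gzL gzL])
      finally have "c0 * vip gz gz \<le> vip gz gz + P gz gz" .
      moreover have "c1 * vip gz gz \<le> c0 * vip gz gz" unfolding c1_def by (intro mult_right_mono vip_self_nonneg) simp
      moreover have "c1 * (\<tau>\<^sup>2 * ip z z) \<le> 1 * (\<tau>\<^sup>2 * ip z z)"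
        unfolding c1_def by (intro mult_right_mono mult_nonneg_nonneg ip_self_nonneg) auto
      ultimately show ?thesis by (simp add: a_def algebra_simps)
    qed
    \<comment> \<open>The energy estimate for \<open>z\<close>: coercivity on the left, and on the
      right the source \<open>A\<close> times the gradient of \<open>v\<close>, of size
      \<open>M * n\<close>, together with the residual.\<close>
    have sb: "c1 * s \<le> M * n + 2 * (K * \<epsilon>)"
    proof (cases "s = 0")
      case True
      then show ?thesis using M(1) n0 K \<epsilon> by simp
    next
      case False
      have "c1 * s\<^sup>2 \<le> M * n * s + 2 * (K * \<epsilon>) * s"
        using coer az2 Pvz \<epsilon>Fz unfolding s0(2) by linarith
      then have "(c1 * s) * s \<le> (M * n + 2 * (K * \<epsilon>)) * s" by (simp add: power2_eq_square algebra_simps)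
      then show ?thesis using False s0(1) by (auto dest: mult_right_le_imp_le)
    qed
    have upper: "\<bar>I\<bar> \<le> C * (n\<^sup>2 + \<epsilon>\<^sup>2 + \<epsilon> / \<tau>)"
    proof -
      have "M * n * s \<le> M * n * ((M * n + 2 * (K * \<epsilon>)) / c1)"
        using sb c1 M(1) n0 by (intro mult_left_mono) (auto simp: field_simps)
      also have "\<dots> = M\<^sup>2 / c1 * n\<^sup>2 + 2 * K * M / c1 * (n * \<epsilon>)" by (simp add: power2_eq_square add_divide_distrib algebra_simps)
      also have "\<dots> \<le> M\<^sup>2 / c1 * n\<^sup>2 + 2 * K * M / c1 * (n\<^sup>2 + \<epsilon>\<^sup>2)"
        using abs_mult_le_squares[of n \<epsilon>] n0 \<epsilon> K M(1) c1 by (intro add_left_mono mult_left_mono) auto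
      finally have 1: "M * n * s \<le> M\<^sup>2 / c1 * n\<^sup>2 + 2 * K * M / c1 * (n\<^sup>2 + \<epsilon>\<^sup>2)" .
      have "\<bar>I\<bar> \<le> M * n\<^sup>2 + M * n * s + 2 * K * L2_norm f * (\<epsilon> / \<tau>)"
        using I3 Pvv Pvz \<epsilon>Fv Psym[OF gzL gvL] by linarith
      also have "\<dots> \<le> M * n\<^sup>2 + (M\<^sup>2 / c1 * n\<^sup>2 + 2 * K * M / c1 * (n\<^sup>2 + \<epsilon>\<^sup>2)) + 2 * K * L2_norm f * (\<epsilon> / \<tau>)"
        using 1 by simp
      also have "\<dots> \<le> C * n\<^sup>2 + C * \<epsilon>\<^sup>2 + C * (\<epsilon> / \<tau>)"
      proof -
        have nn: "0 \<le> M\<^sup>2 / c1" "0 \<le> 2 * K * M / c1" "0 \<le> 2 * K * L2_norm f" "0 \<le> K\<^sup>2 / c1" "0 \<le> 2 * K\<^sup>2"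
          using M(1) c1 K L2_norm_nonneg[of f] by auto
        have "(M + M\<^sup>2 / c1 + 2 * K * M / c1) * n\<^sup>2 \<le> C * n\<^sup>2" unfolding C_def by (intro mult_right_mono) (use nn in auto)
        moreover have "2 * K * M / c1 * \<epsilon>\<^sup>2 \<le> C * \<epsilon>\<^sup>2" unfolding C_def by (intro mult_right_mono) (use nn M(1) in auto)
        moreover have "2 * K * L2_norm f * (\<epsilon> / \<tau>) \<le> C * (\<epsilon> / \<tau>)"
          unfolding C_def by (intro mult_right_mono) (use nn M(1) \<epsilon> tau in auto)
        ultimately show ?thesis by (simp add: algebra_simps)
      qed
      finally show ?thesis by (simp add: algebra_simps)
    qed
    have Cb: "K\<^sup>2 / c1 * \<epsilon>\<^sup>2 + 2 * K * L2_norm f * (\<epsilon> / \<tau>) \<le> C * (\<epsilon>\<^sup>2 + \<epsilon> / \<tau>)"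
      "2 * K\<^sup>2 * \<epsilon>\<^sup>2 + 2 * K * L2_norm f * (\<epsilon> / \<tau>) \<le> C * (\<epsilon>\<^sup>2 + \<epsilon> / \<tau>)"
    proof -
      have nn: "0 \<le> M\<^sup>2 / c1" "0 \<le> 2 * K * M / c1" "0 \<le> 2 * K * L2_norm f" "0 \<le> K\<^sup>2 / c1" "0 \<le> 2 * K\<^sup>2"
        using M(1) c1 K L2_norm_nonneg[of f] by auto
      have "K\<^sup>2 / c1 * \<epsilon>\<^sup>2 \<le> C * \<epsilon>\<^sup>2" "2 * K\<^sup>2 * \<epsilon>\<^sup>2 \<le> C * \<epsilon>\<^sup>2"
        unfolding C_def by (intro mult_right_mono; use nn M(1) in auto)+
      moreover have "2 * K * L2_norm f * (\<epsilon> / \<tau>) \<le> C * (\<epsilon> / \<tau>)"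
        unfolding C_def by (intro mult_right_mono) (use nn M(1) \<epsilon> tau in auto)
      ultimately show "K\<^sup>2 / c1 * \<epsilon>\<^sup>2 + 2 * K * L2_norm f * (\<epsilon> / \<tau>) \<le> C * (\<epsilon>\<^sup>2 + \<epsilon> / \<tau>)"
        "2 * K\<^sup>2 * \<epsilon>\<^sup>2 + 2 * K * L2_norm f * (\<epsilon> / \<tau>) \<le> C * (\<epsilon>\<^sup>2 + \<epsilon> / \<tau>)"
        by (simp_all add: distrib_left)
    qed
    have minus: "I \<ge> c2 * n\<^sup>2 - C * (\<epsilon>\<^sup>2 + \<epsilon> / \<tau>)" if Mm: "M_minus D \<gamma>"
    proof -
      have "cm * n\<^sup>2 = vip (\<lambda>x. cm *\<^sub>R restr D gv x) (restr D gv)" by (simp add: vip_scaleR_left vip_self n_def)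
      also have "\<dots> \<le> vip (\<lambda>x. (- 1) *\<^sub>R (A x *v gv x)) gv"
      proof (rule vip_mono[OF vL2_scaleR[OF rL] rL vL2_scaleR[OF AvL[OF gvL]] gvL])
        have "AE x in lebesgue. x \<in> D \<longrightarrow> form_le (cm *\<^sub>R mat 1) (mat 1 - \<gamma> x)" using cmM[OF Mm] by blast
        then show "AE x in lebesgue. (cm *\<^sub>R restr D gv x) \<bullet> restr D gv x \<le> ((- 1) *\<^sub>R (A x *v gv x)) \<bullet> gv x"
          using Aout
        proof eventually_elim
          case (elim x)
          show ?case
          proof (cases "x \<in> D")
            case True
            then have "gv x \<bullet> ((cm *\<^sub>R mat 1) *v gv x) \<le> gv x \<bullet> ((mat 1 - \<gamma> x) *v gv x)" using elim(1) by (simp add: form_le_def)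
            moreover have "(mat 1 - \<gamma> x) *v gv x = - (A x *v gv x)"
              by (simp add: A_def matrix_vector_mult_diff_rdistrib)
            ultimately show ?thesis using True by (simp add: restr_def mat1 inner_commute)
          next
            case False
            then show ?thesis using elim(2) by (simp add: restr_def)
          qed
        qed
      qed
      also have "\<dots> = - P gv gv" unfolding vip_scaleR_left P_def by simp
      finally have "cm * n\<^sup>2 \<le> - P gv gv" .
      moreover have "c2 * n\<^sup>2 \<le> cm * n\<^sup>2" unfolding c2_def by (intro mult_right_mono) auto
      moreover have "c1 * s\<^sup>2 - 2 * (K * \<epsilon>) * s \<ge> - ((K * \<epsilon>)\<^sup>2 / c1)" by (rule absorb_linear[OF c1])
      moreover have "(K * \<epsilon>)\<^sup>2 / c1 = K\<^sup>2 / c1 * \<epsilon>\<^sup>2" by (simp add: power_mult_distrib)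
      ultimately show ?thesis using I4 coer \<epsilon>Fz \<epsilon>Fv Cb(1) unfolding s0(2) by linarith
    qed
    have plus: "- I \<ge> c2 * n\<^sup>2 - C * (\<epsilon>\<^sup>2 + \<epsilon> / \<tau>)" if Mp: "M_plus D \<gamma>"
    proof -
      let ?c = "cp / (1 + 2 * cp)"
      have i: "integrable lebesgue (\<lambda>x. (A x *v gw x) \<bullet> gw x)" "integrable lebesgue (\<lambda>x. gz x \<bullet> gz x)"
        "integrable lebesgue (\<lambda>x. restr D gv x \<bullet> restr D gv x)"
        by (intro vip_integrable AvL gwL gzL rL)+
      have "?c * n\<^sup>2 = (LINT x|lebesgue. ?c * (restr D gv x \<bullet> restr D gv x))"
        by (simp add: n_def vip_self[symmetric] vip_eq[OF rL rL])
      also have "\<dots> \<le> (LINT x|lebesgue. (A x *v gw x) \<bullet> gw x + (1/2) * (gz x \<bullet> gz x))"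
      proof (rule integral_mono_AE)
        have "AE x in lebesgue. x \<in> D \<longrightarrow> form_le (cp *\<^sub>R mat 1) (\<gamma> x - mat 1)" using cpM[OF Mp] by blast
        then show "AE x in lebesgue. ?c * (restr D gv x \<bullet> restr D gv x) \<le> (A x *v gw x) \<bullet> gw x + (1/2) * (gz x \<bullet> gz x)"
          using Aout
        proof eventually_elim
          case (elim x)
          show ?case
          proof (cases "x \<in> D")
            case True
            then have "gw x \<bullet> ((cp *\<^sub>R mat 1) *v gw x) \<le> gw x \<bullet> ((\<gamma> x - mat 1) *v gw x)" using elim(1) by (simp add: form_le_def)
            then have 1: "cp * (norm (gw x))\<^sup>2 \<le> (A x *v gw x) \<bullet> gw x"
              unfolding mat1 A_def power2_norm_eq_inner by (simp add: inner_commute)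
            have "gv x = gw x - gz x" by (simp add: gz_def)
            then have "norm (gv x) \<le> norm (gw x) + norm (gz x)" by (simp add: norm_triangle_ineq4)
            then have "(norm (gv x))\<^sup>2 \<le> (norm (gw x) + norm (gz x))\<^sup>2" by (intro power_mono) auto
            then have "?c * (norm (gv x))\<^sup>2 \<le> ?c * (norm (gw x) + norm (gz x))\<^sup>2" using cp0 by (intro mult_left_mono) auto
            also have "\<dots> \<le> cp * (norm (gw x))\<^sup>2 + (norm (gz x))\<^sup>2 / 2" by (rule scaled_sum_square[OF cp0])
            finally have "?c * (norm (gv x))\<^sup>2 \<le> (A x *v gw x) \<bullet> gw x + (norm (gz x))\<^sup>2 / 2" using 1 by simp
            then show ?thesis using True unfolding power2_norm_eq_inner by (simp add: restr_def)
          next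
            case False
            then show ?thesis using elim(2) by (simp add: restr_def)
          qed
        qed
      qed (use i in \<open>auto intro!: Bochner_Integration.integrable_add\<close>)
      also have "\<dots> = P gw gw + (1/2) * vip gz gz"
        unfolding P_def vip_eq[OF AvL[OF gwL] gwL] vip_eq[OF gzL gzL]
        using i(1,2) by (subst Bochner_Integration.integral_add) auto
      also have "\<dots> \<le> P gw gw + (1/2) * a"
        unfolding a_def using ip_self_nonneg[of z] by simp
      finally have "?c * n\<^sup>2 \<le> P gw gw + (1/2) * a" .
      moreover have "c2 * n\<^sup>2 \<le> ?c * n\<^sup>2" unfolding c2_def by (intro mult_right_mono) auto
      moreover have "(1/2) * s\<^sup>2 - 2 * (K * \<epsilon>) * s \<ge> - ((K * \<epsilon>)\<^sup>2 / (1/2))" by (rule absorb_linear) simp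
      moreover have "(K * \<epsilon>)\<^sup>2 / (1/2) = 2 * K\<^sup>2 * \<epsilon>\<^sup>2" by (simp add: power_mult_distrib)
      ultimately show ?thesis using I2 \<epsilon>Fz \<epsilon>Fv Cb(2) unfolding s0(2) by linarith
    qed
    show ?thesis
      using G0L upper minus plus unfolding I_def nV \<epsilon>_def by blast
  qed
  show thesis by (rule that[OF C c2]) (use main in blast)+
qed

section \<open>Geometry of the nearest points\<close>

text \<open>This is all that is used of a cone with vertex \<open>x\<close> in \<open>A\<close>; unlike the cone condition it also follows from
  a \<open>C\<^sup>1\<close> boundary.\<close>

definition fat :: "R3 set \<Rightarrow> R3 \<Rightarrow> bool" where
  "fat A x \<longleftrightarrow> (\<exists>\<kappa>>0. \<exists>r0>0. \<forall>s. 0 < s \<and> s \<le> r0 \<longrightarrow> (\<exists>c. ball c (\<kappa> * s) \<subseteq> A \<inter> ball x s))"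

text \<open>At scale \<open>s\<close> the ball is centred at \<open>x + (s / 2) *\<^sub>R m\<close>
  with radius \<open>q / 2 * s\<close>; dividing the offset of a point by \<open>s / 2\<close> gives
  the perturbation \<open>\<zeta>\<close> of the direction.\<close>

lemma fat_direction:
  assumes m: "norm m = 1" and q: "0 < q" "q \<le> 1" and h: "h > 0"
    and A: "\<And>t \<zeta>. 0 < t \<Longrightarrow> t \<le> h \<Longrightarrow> norm \<zeta> < q \<Longrightarrow> x + t *\<^sub>R (m + \<zeta>) \<in> A"
  shows "fat A x"
  unfolding fat_def
proof (intro exI conjI allI impI)
  show "q / 2 > 0" using q by simp
  show "2 * h > 0" using h by simp
  fix s :: real assume s: "0 < s \<and> s \<le> 2 * h"
  show "ball (x + (s / 2) *\<^sub>R m) (q / 2 * s) \<subseteq> A \<inter> ball x s"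
  proof
    fix y assume "y \<in> ball (x + (s / 2) *\<^sub>R m) (q / 2 * s)"
    then have yn: "norm (y - (x + (s / 2) *\<^sub>R m)) < q / 2 * s" by (simp add: dist_norm norm_minus_commute)
    define \<zeta> where "\<zeta> = (2 / s) *\<^sub>R (y - (x + (s / 2) *\<^sub>R m))"
    have "norm \<zeta> = (2 / s) * norm (y - (x + (s / 2) *\<^sub>R m))" using s by (simp add: \<zeta>_def)
    also have "\<dots> < (2 / s) * (q / 2 * s)" using s by (intro mult_strict_left_mono yn) auto
    also have "\<dots> = q" using s by simp
    finally have z: "norm \<zeta> < q" .
    have y: "y = x + (s / 2) *\<^sub>R (m + \<zeta>)" using s by (simp add: \<zeta>_def algebra_simps)
    have "y \<in> A" unfolding y by (rule A[OF _ _ z]) (use s in auto)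
    moreover have "dist x y < s"
    proof -
      have "dist x y = (s / 2) * norm (m + \<zeta>)" using s by (simp add: y dist_norm)
      also have "norm (m + \<zeta>) < 2" using norm_triangle_ineq[of m \<zeta>] m z q by linarith
      finally show ?thesis using s by simp
    qed
    ultimately show "y \<in> A \<inter> ball x s" by simp
  qed
qed

lemma cone_imp_direction:
  assumes n: "norm n = 1" and h: "h > 0" and th: "0 < \<theta>" "\<theta> < pi" and A: "cone_at x n h \<theta> - {x} \<subseteq> A"
  obtains q k where "0 < q" "q \<le> 1" "k > 0"
    "\<And>t \<zeta>. 0 < t \<Longrightarrow> t \<le> k \<Longrightarrow> norm \<zeta> < q \<Longrightarrow> x + t *\<^sub>R (n + \<zeta>) \<in> A"
proof -
  have c1: "cos \<theta> < 1" using cos_monotone_0_pi[of 0 \<theta>] th by simp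
  have c2: "cos \<theta> \<ge> -1" by simp
  \<comment> \<open>For a nonnegative cosine the cone inequality follows from
    \<open>cos \<theta> + norm \<zeta> \<le> 1 - norm \<zeta>\<close>, which holds below this bound.
    For a negative cosine it is enough that \<open>norm \<zeta>\<close> is at most 1.\<close>
  define q where "q = (1 - cos \<theta>) / 2"
  have q: "0 < q" "q \<le> 1" using c1 c2 by (auto simp: q_def)
  show thesis
  proof (rule that[OF q, of "h / 2"])
    show "h / 2 > 0" using h by simp
    fix t and \<zeta> :: R3 assume t: "0 < t" "t \<le> h / 2" and z: "norm \<zeta> < q"
    let ?y = "x + t *\<^sub>R (n + \<zeta>)"
    have nz: "norm (n + \<zeta>) \<le> 1 + norm \<zeta>" using norm_triangle_ineq[of n \<zeta>] n by simp
    have nn: "n \<bullet> n = 1" using n by (simp add: norm_eq_1)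
    have "\<zeta> \<bullet> n \<ge> - norm \<zeta>" using Cauchy_Schwarz_ineq2[of \<zeta> n] n by simp
    then have in1: "(n + \<zeta>) \<bullet> n \<ge> 1 - norm \<zeta>" using nn by (simp add: inner_add_left)
    have "norm (n + \<zeta>) * cos \<theta> \<le> 1 - norm \<zeta>"
    proof (cases "cos \<theta> \<ge> 0")
      case True
      then have "norm (n + \<zeta>) * cos \<theta> \<le> (1 + norm \<zeta>) * cos \<theta>" using nz by (intro mult_right_mono)
      also have "\<dots> \<le> cos \<theta> + norm \<zeta> * 1" using mult_left_mono[of "cos \<theta>" 1 "norm \<zeta>"] c1 by (simp add: distrib_right)
      also have "\<dots> \<le> 1 - norm \<zeta>" using z by (simp add: q_def)
      finally show ?thesis .
    next
      case False
      then have "norm (n + \<zeta>) * cos \<theta> \<le> 0" by (intro mult_nonneg_nonpos) auto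
      then show ?thesis using z q by linarith
    qed
    then have "norm (n + \<zeta>) * cos \<theta> \<le> (n + \<zeta>) \<bullet> n" using in1 by linarith
    then have "t * (norm (n + \<zeta>) * cos \<theta>) \<le> t * ((n + \<zeta>) \<bullet> n)" using t by (intro mult_left_mono) auto
    then have 1: "(?y - x) \<bullet> n \<ge> norm (?y - x) * cos \<theta>" using t by (simp add: mult.assoc)
    have "norm (?y - x) = t * norm (n + \<zeta>)" using t by simp
    also have "\<dots> \<le> (h / 2) * 2" using t nz z q by (intro mult_mono) auto
    finally have 2: "norm (?y - x) \<le> h" by simp
    have "n + \<zeta> \<noteq> 0" using in1 z q by auto
    then have "?y \<noteq> x" using t by simp
    with 1 2 have "?y \<in> cone_at x n h \<theta> - {x}" by (simp add: cone_at_def)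
    then show "?y \<in> A" using A by blast
  qed
qed

lemma cone_condition_fat:
  assumes "cone_condition A" "x \<in> frontier A"
  shows "fat A x"
proof -
  obtain n h \<theta> where c: "norm n = 1" "h > 0" "0 < \<theta>" "\<theta> < pi" "cone_at x n h \<theta> - {x} \<subseteq> A"
    using assms unfolding cone_condition_def by blast
  obtain q k where "0 < q" "q \<le> 1" "k > 0"
    "\<And>t \<zeta>. 0 < t \<Longrightarrow> t \<le> k \<Longrightarrow> norm \<zeta> < q \<Longrightarrow> x + t *\<^sub>R (n + \<zeta>) \<in> A"
    by (rule cone_imp_direction[OF c]) (rule that; assumption)
  then show ?thesis using fat_direction[OF c(1)] by blast
qed

text \<open>From an interior point one could move a little towards \<open>y\<close> without leaving
  \<open>A\<close>, and the distance would drop below the minimum.\<close>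

lemma nearest_frontier:
  fixes x y :: R3
  assumes d: "setdist A B > 0" and x: "x \<in> closure A" and y: "y \<in> closure B" and xy: "dist x y = setdist A B"
  shows "x \<in> frontier A"
proof -
  have "x \<notin> interior A"
  proof
    assume "x \<in> interior A"
    then obtain e where e: "e > 0" "ball x e \<subseteq> A" by (meson mem_interior)
    define d where "d = dist x y"
    have d0: "d > 0" using assms by (simp add: d_def)
    define t where "t = min (1/2) (e / (2 * d))"
    have t: "0 < t" "t < 1" using e d0 by (auto simp: t_def)
    define x' where "x' = x + t *\<^sub>R (y - x)"
    have td: "t * d < e"
    proof -
      have "t * d \<le> e / (2 * d) * d" unfolding t_def using d0 by (intro mult_right_mono) auto
      then show ?thesis using d0 e by simp
    qed
    have "dist x x' = t * d" using t by (simp add: x'_def d_def dist_norm norm_minus_commute)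
    then have "x' \<in> A" using e td by auto
    then have "setdist A B \<le> dist x' y"
      using setdist_le_dist[of x' "closure A" y "closure B"] closure_subset[of A] y by (auto simp: setdist_closure_1 setdist_closure_2)
    moreover have "x' - y = (1 - t) *\<^sub>R (x - y)" by (simp add: x'_def algebra_simps)
    then have "dist x' y = (1 - t) * d" using t by (simp add: d_def dist_norm)
    moreover have "(1 - t) * d < d" using t d0 by simp
    ultimately show False using xy by (simp add: d_def)
  qed
  then show ?thesis using x by (simp add: frontier_def)
qed

text \<open>Two first-order consequences of the graph description. The axis of the graph, perturbed
  by less than \<open>q\<close>, leads into \<open>D\<close>, which replaces a cone. The gradient
  \<open>N\<close> of the defining function points into \<open>D\<close>: a direction with positive
  component along \<open>N\<close> enters \<open>D\<close> at once and cannot stay outside its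
  closure on short segments.\<close>

lemma C1_boundary_local:
  assumes D: "has_C1_boundary D" and x: "x \<in> frontier D"
  obtains N m :: R3 and q k :: real where "norm m = 1" "0 < q" "q \<le> 1" "k > 0"
    "\<And>t \<zeta>. 0 < t \<Longrightarrow> t \<le> k \<Longrightarrow> norm \<zeta> < q \<Longrightarrow> x + t *\<^sub>R (m + \<zeta>) \<in> D"
    "N \<noteq> 0"
    "\<And>\<omega>. (\<And>t0. t0 > 0 \<Longrightarrow> \<exists>t. 0 < t \<and> t < t0 \<and> (\<forall>t'. 0 < t' \<and> t' \<le> t \<longrightarrow> x + t' *\<^sub>R \<omega> \<notin> closure D)) \<Longrightarrow> N \<bullet> \<omega> \<le> 0"
proof -
  obtain S and R :: "R3 \<Rightarrow> R3" and b and g :: "real \<times> real \<Rightarrow> real" where S: "open S" "x \<in> S" and R: "orthogonal_transformation R" and g: "Ck 1 g"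
    and loc: "\<forall>x\<in>S. let y = R x + b in (x \<in> frontier D \<longleftrightarrow> y $ 3 = g (y $ 1, y $ 2)) \<and>
           (x \<notin> frontier D \<longrightarrow> (x \<in> D \<longleftrightarrow> y $ 3 > g (y $ 1, y $ 2)))"
    using bspec[OF D[unfolded has_C1_boundary_def] x] by (elim exE conjE) (rule that; assumption)
  have fr: "z \<in> frontier D \<longleftrightarrow> (R z + b) $ 3 = g ((R z + b) $ 1, (R z + b) $ 2)"
    and inD: "z \<notin> frontier D \<Longrightarrow> z \<in> D \<longleftrightarrow> (R z + b) $ 3 > g ((R z + b) $ 1, (R z + b) $ 2)" if "z \<in> S" for z
    using loc that by (auto simp: Let_def)
  obtain r where r: "r > 0" "ball x r \<subseteq> S" using S by (meson open_contains_ball)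
  have linR: "linear R" using R by (simp add: orthogonal_transformation_def)
  have nR: "norm (R z) = norm z" for z using R by (simp add: orthogonal_transformation_norm)
  define p0 where "p0 = ((R x + b) $ 1, (R x + b) $ 2)"
  have "g differentiable (at p0)" using g by (cases p0) (simp add: differentiable_on_def One_nat_def)
  then obtain g' where g': "(g has_derivative g') (at p0)" by (auto simp: differentiable_def)
  have bl: "bounded_linear g'" using g' by (rule has_derivative_bounded_linear)
  have ling: "linear g'" using bl by (rule bounded_linear.linear)
  obtain Bd where Bd: "Bd > 0" "\<And>h. norm (g' h) \<le> norm h * Bd" using bounded_linear.pos_bounded[OF bl] by blast
  have alt: "\<exists>d>0. \<forall>y. norm (y - p0) < d \<longrightarrow> norm (g y - g p0 - g' (y - p0)) \<le> e * norm (y - p0)" if "e > 0" for e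
    using g' that unfolding has_derivative_at_alt by blast
  define pr :: "R3 \<Rightarrow> real \<times> real" where "pr v = (v $ 1, v $ 2)" for v
  have npr: "norm (pr v) \<le> norm v" for v :: R3
  proof -
    have "(norm (pr v))\<^sup>2 \<le> (norm v)\<^sup>2"
      by (simp only: pr_def norm_Pair power2_norm_eq_inner inner_vec_def sum_3)
         (simp add: power2_eq_square real_sqrt_mult_self)
    then show ?thesis by (rule power2_le_imp_le) simp
  qed
  have prs: "pr (t *\<^sub>R v) = t *\<^sub>R pr v" "pr (v + w) = pr v + pr w" for t v w by (simp_all add: pr_def)
  have coord: "R (x + t *\<^sub>R \<omega>) + b = (R x + b) + t *\<^sub>R R \<omega>" for t \<omega>
    using linear_add[OF linR] linear_cmul[OF linR] by simp
  have gp: "(((R (x + t *\<^sub>R \<omega>) + b) $ 1, (R (x + t *\<^sub>R \<omega>) + b) $ 2)) = p0 + t *\<^sub>R pr (R \<omega>)" for t \<omega>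
    unfolding coord by (simp add: p0_def pr_def)
  have xfr: "(R x + b) $ 3 = g p0" using fr[OF S(2)] x by (simp add: p0_def)
  \<comment> \<open>The derivative at \<open>x\<close> of the third coordinate minus
    \<open>g\<close>, in the rotated frame. Its value 1 on the axis \<open>m\<close> shows that
    \<open>N\<close> is not 0.\<close>
  define \<phi> where "\<phi> v = (R v) $ 3 - g' (pr (R v))" for v
  have lin\<phi>: "linear \<phi>"
    by (rule linearI) (simp_all add: \<phi>_def linear_add[OF linR] linear_cmul[OF linR] prs linear_add[OF ling] linear_cmul[OF ling] algebra_simps)
  define N where "N = adjoint \<phi> 1"
  have N: "\<phi> v = N \<bullet> v" for v
    using adjoint_works[OF lin\<phi>, of v 1] by (simp add: N_def inner_commute)
  have "surj R" using R orthogonal_transformation_surj by blast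
  then obtain m where m: "R m = axis 3 1" by (metis surjD)
  have mn: "norm m = 1" using nR[of m] by (simp add: m)
  have "\<phi> m = 1 - g' 0" by (simp add: \<phi>_def m pr_def axis_def zero_prod_def[symmetric])
  then have phim: "\<phi> m = 1" using linear_0[OF ling] by simp
  have "N \<noteq> 0" using phim N[of m] by auto
  obtain d1 where d1: "d1 > 0" "\<And>y. norm (y - p0) < d1 \<Longrightarrow> norm (g y - g p0 - g' (y - p0)) \<le> 1 * norm (y - p0)"
    using alt[of 1] by auto
  \<comment> \<open>A Lipschitz bound at the single point \<open>p0\<close>: the bound of the
    derivative plus the relative error 1 allowed by differentiability.\<close>
  define L where "L = Bd + 1"
  have L0: "L > 0" using Bd by (simp add: L_def)
  have Lip: "\<bar>g y - g p0\<bar> \<le> L * norm (y - p0)" if "norm (y - p0) < d1" for y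
    using d1(2)[OF that] Bd(2)[of "y - p0"] by (simp add: L_def algebra_simps abs_le_iff)
  \<comment> \<open>With \<open>(L + 1) * q = 1 / 2\<close> the graph rises over the perturbed
    direction by less than the vertical gain \<open>1 - norm \<zeta>\<close>.\<close>
  define q where "q = 1 / (2 * (L + 1))"
  have q: "0 < q" "q \<le> 1" using L0 by (auto simp: q_def field_simps)
  define k where "k = min (r / 4) (d1 / 2)"
  have k: "k > 0" using r d1 by (simp add: k_def)
  show thesis
  proof (rule that[OF mn q k])
    fix t and \<zeta> :: R3 assume t: "0 < t" "t \<le> k" and z: "norm \<zeta> < q"
    let ?y = "x + t *\<^sub>R (m + \<zeta>)"
    have "norm (m + \<zeta>) \<le> 2" using norm_triangle_ineq[of m \<zeta>] mn z q by linarith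
    then have "t * norm (m + \<zeta>) \<le> (r / 4) * 2" using t r by (intro mult_mono) (auto simp: k_def)
    then have "dist x ?y < r" using t r by (simp add: dist_norm)
    then have yS: "?y \<in> S" using r by auto
    have Rm: "R (m + \<zeta>) = axis 3 1 + R \<zeta>" by (simp add: linear_add[OF linR] m)
    have prm: "pr (R (m + \<zeta>)) = pr (R \<zeta>)" unfolding Rm by (simp add: pr_def axis_def)
    have pz: "norm (pr (R \<zeta>)) \<le> norm \<zeta>" using npr[of "R \<zeta>"] nR by simp
    have "norm ((p0 + t *\<^sub>R pr (R \<zeta>)) - p0) = t * norm (pr (R \<zeta>))" using t by simp
    moreover have "t * norm (pr (R \<zeta>)) \<le> t * norm \<zeta>" using pz t by (intro mult_left_mono) auto
    moreover have "t * norm \<zeta> \<le> (d1 / 2) * 1" using t z q by (intro mult_mono) (auto simp: k_def)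
    ultimately have np: "norm ((p0 + t *\<^sub>R pr (R \<zeta>)) - p0) < d1" "norm ((p0 + t *\<^sub>R pr (R \<zeta>)) - p0) \<le> t * norm \<zeta>"
      using d1(1) by auto
    have "g (p0 + t *\<^sub>R pr (R \<zeta>)) - g p0 \<le> L * (t * norm \<zeta>)"
      using Lip[OF np(1)] mult_left_mono[OF np(2), of L] L0 by linarith
    then have gy: "g (p0 + t *\<^sub>R pr (R (m + \<zeta>))) \<le> g p0 + L * (t * norm \<zeta>)" by (simp add: prm)
    have "\<bar>(R \<zeta>) $ 3\<bar> \<le> norm \<zeta>" using component_le_norm_cart[of "R \<zeta>" 3] nR by simp
    then have "(R (m + \<zeta>)) $ 3 \<ge> 1 - norm \<zeta>" unfolding Rm by (simp add: axis_def)
    then have "t * (R (m + \<zeta>)) $ 3 \<ge> t * (1 - norm \<zeta>)" using t by (intro mult_left_mono) auto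
    then have y3: "(R ?y + b) $ 3 \<ge> g p0 + t * (1 - norm \<zeta>)" unfolding coord using xfr by simp
    have "(L + 1) * norm \<zeta> < (L + 1) * q" using L0 z by (intro mult_strict_left_mono) auto
    also have "\<dots> = 1 / 2" using L0 by (simp add: q_def)
    finally have "L * norm \<zeta> < 1 - norm \<zeta>" by (simp add: algebra_simps)
    then have "t * (L * norm \<zeta>) < t * (1 - norm \<zeta>)" using t by (intro mult_strict_left_mono) auto
    then have "g (p0 + t *\<^sub>R pr (R (m + \<zeta>))) < (R ?y + b) $ 3" using gy y3 by (simp add: mult_ac)
    then show "?y \<in> D" using fr[OF yS] inD[OF yS] unfolding gp by auto
  next
    show "N \<noteq> 0" by fact
    fix \<omega> :: R3
    assume out: "\<And>t0. t0 > 0 \<Longrightarrow> \<exists>t. 0 < t \<and> t < t0 \<and> (\<forall>t'. 0 < t' \<and> t' \<le> t \<longrightarrow> x + t' *\<^sub>R \<omega> \<notin> closure D)"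
    have "\<phi> \<omega> \<le> e * (norm \<omega> + 1)" if e: "e > 0" for e
    proof -
      obtain d where d: "d > 0" "\<And>y. norm (y - p0) < d \<Longrightarrow> norm (g y - g p0 - g' (y - p0)) \<le> e * norm (y - p0)"
        using alt[OF e] by blast
      define t0 where "t0 = min r d / (norm \<omega> + 1)"
      have nw: "norm \<omega> + 1 > 0" using norm_ge_zero[of \<omega>] by linarith
      have "t0 > 0" using r d nw by (simp add: t0_def)
      then obtain t where t: "0 < t" "t < t0" "x + t *\<^sub>R \<omega> \<notin> closure D" using out by blast
      have tw: "t * (norm \<omega> + 1) < min r d" using t(2) nw by (simp add: t0_def pos_less_divide_eq)
      have tn: "t * norm \<omega> < min r d" using tw t(1) by (simp add: distrib_left)
      let ?y = "x + t *\<^sub>R \<omega>"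
      have "dist x ?y < r" using tn t by (simp add: dist_norm)
      then have yS: "?y \<in> S" using r by auto
      have "?y \<notin> frontier D" "?y \<notin> D" using t(3) closure_subset by (auto simp: frontier_def)
      then have lt: "(R ?y + b) $ 3 < g (p0 + t *\<^sub>R pr (R \<omega>))"
        using fr[OF yS] inD[OF yS] unfolding gp by auto
      have pz: "norm (pr (R \<omega>)) \<le> norm \<omega>" using npr[of "R \<omega>"] nR by simp
      have nn: "norm ((p0 + t *\<^sub>R pr (R \<omega>)) - p0) = t * norm (pr (R \<omega>))" using t by simp
      have "t * norm (pr (R \<omega>)) \<le> t * norm \<omega>" using pz t by (intro mult_left_mono) auto
      then have "norm ((p0 + t *\<^sub>R pr (R \<omega>)) - p0) < d" using nn tn min.cobounded2[of r d] by linarith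
      from d(2)[OF this] have "g (p0 + t *\<^sub>R pr (R \<omega>)) - g p0 - g' (t *\<^sub>R pr (R \<omega>)) \<le> e * (t * norm (pr (R \<omega>)))"
        using t by (simp add: abs_le_iff)
      also have "\<dots> \<le> e * (t * norm \<omega>)" using e pz t by (intro mult_left_mono) auto
      finally have "g (p0 + t *\<^sub>R pr (R \<omega>)) - g p0 \<le> t * g' (pr (R \<omega>)) + e * (t * norm \<omega>)"
        by (simp add: linear_cmul[OF ling])
      moreover have "(R ?y + b) $ 3 = g p0 + t * (R \<omega>) $ 3" unfolding coord using xfr by simp
      ultimately have "t * (R \<omega>) $ 3 < t * g' (pr (R \<omega>)) + t * (e * norm \<omega>)" using lt by (simp add: mult_ac)
      then have "t * \<phi> \<omega> < t * (e * norm \<omega>)" by (simp add: \<phi>_def right_diff_distrib)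
      then have "\<phi> \<omega> < e * norm \<omega>" using t(1) by (simp only: mult_less_cancel_left_pos)
      then show ?thesis using e by (simp add: distrib_left)
    qed
    then have "\<phi> \<omega> \<le> 0 + e" if "e > 0" for e
    proof -
      have nw: "norm \<omega> + 1 > 0" using norm_ge_zero[of \<omega>] by linarith
      then have "e / (norm \<omega> + 1) > 0" using that by simp
      from \<open>\<And>e. e > 0 \<Longrightarrow> \<phi> \<omega> \<le> e * (norm \<omega> + 1)\<close>[OF this] nw show ?thesis by simp
    qed
    then have "\<phi> \<omega> \<le> 0" by (rule field_le_epsilon)
    then show "N \<bullet> \<omega> \<le> 0" by (simp add: N)
  qed
qed

lemma C1_boundary_fat: "has_C1_boundary D \<Longrightarrow> x \<in> frontier D \<Longrightarrow> fat D x"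
proof -
  assume "has_C1_boundary D" "x \<in> frontier D"
  then obtain N m :: R3 and q k :: real where "norm m = 1" "0 < q" "q \<le> 1" "k > 0"
    "\<And>t \<zeta>. 0 < t \<Longrightarrow> t \<le> k \<Longrightarrow> norm \<zeta> < q \<Longrightarrow> x + t *\<^sub>R (m + \<zeta>) \<in> D"
    by (rule C1_boundary_local) (rule that; assumption)
  then show "fat D x" by (rule fat_direction)
qed

text \<open>The ball around a nearest point \<open>y\<close> touches \<open>D\<close> from outside at \<open>x\<close>, which determines the direction
  of \<open>y - x\<close> up to sign by the tangent plane, and the side by \<open>N\<close>.\<close>

lemma C1_boundary_touching_ball:
  assumes N0: "N \<noteq> 0"
    and N: "\<And>\<omega>. (\<And>t0. t0 > 0 \<Longrightarrow> \<exists>t. 0 < t \<and> t < t0 \<and> (\<forall>t'. 0 < t' \<and> t' \<le> t \<longrightarrow> x + t' *\<^sub>R \<omega> \<notin> closure D)) \<Longrightarrow> N \<bullet> \<omega> \<le> 0"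
    and ball: "ball y d \<inter> closure D = {}" and xy: "dist x y = d" and d: "d > 0"
  shows "y = x - (d / norm N) *\<^sub>R N"
proof -
  define \<omega>0 where "\<omega>0 = (1 / d) *\<^sub>R (y - x)"
  have n0: "norm \<omega>0 = 1" using xy d by (simp add: \<omega>0_def dist_norm norm_minus_commute)
  have y: "y = x + d *\<^sub>R \<omega>0" using d by (simp add: \<omega>0_def)
  \<comment> \<open>A direction with a positive component towards \<open>y\<close> enters the ball
    at once and stays in it for \<open>t' \<le> d * (\<omega> \<bullet> \<omega>0) / (\<omega>
    \<bullet> \<omega>)\<close>, hence outside the closure of \<open>D\<close>.\<close>
  have key: "N \<bullet> \<omega> \<le> 0" if w: "\<omega> \<bullet> \<omega>0 > 0" for \<omega>
  proof (rule N)
    fix t0 :: real assume "t0 > 0"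
    have w0: "\<omega> \<noteq> 0" using w by auto
    then have w2: "\<omega> \<bullet> \<omega> > 0" by simp
    define t where "t = min (t0 / 2) (d * (\<omega> \<bullet> \<omega>0) / (\<omega> \<bullet> \<omega>))"
    have t: "0 < t" "t < t0" using \<open>t0 > 0\<close> d w w2 by (auto simp: t_def)
    have "x + t' *\<^sub>R \<omega> \<notin> closure D" if t': "0 < t'" "t' \<le> t" for t'
    proof -
      have "t' \<le> d * (\<omega> \<bullet> \<omega>0) / (\<omega> \<bullet> \<omega>)" using t' by (simp add: t_def)
      then have "t' * (\<omega> \<bullet> \<omega>) \<le> d * (\<omega> \<bullet> \<omega>0)" using w2 by (simp add: pos_le_divide_eq)
      moreover have "d * (\<omega> \<bullet> \<omega>0) > 0" using d w by simp
      ultimately have "t' * (\<omega> \<bullet> \<omega>) < 2 * d * (\<omega> \<bullet> \<omega>0)" by (simp only: mult.assoc)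
      then have "t' * (t' * (\<omega> \<bullet> \<omega>)) < t' * (2 * d * (\<omega> \<bullet> \<omega>0))" using t' by (intro mult_strict_left_mono)
      moreover have "(dist y (x + t' *\<^sub>R \<omega>))\<^sup>2 = d\<^sup>2 - t' * (2 * d * (\<omega> \<bullet> \<omega>0)) + t' * (t' * (\<omega> \<bullet> \<omega>))"
      proof -
        have "\<omega>0 \<bullet> \<omega>0 = 1" using n0 by (simp add: norm_eq_1)
        then show ?thesis
          unfolding dist_norm power2_norm_eq_inner y
          by (simp add: inner_diff_left inner_diff_right inner_commute[of \<omega> \<omega>0] power2_eq_square algebra_simps)
      qed
      ultimately have "(dist y (x + t' *\<^sub>R \<omega>))\<^sup>2 < d\<^sup>2" by linarith
      then have "dist y (x + t' *\<^sub>R \<omega>) < d" using d by (auto intro: power2_less_imp_less)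
      then show ?thesis using ball by auto
    qed
    then show "\<exists>t. 0 < t \<and> t < t0 \<and> (\<forall>t'. 0 < t' \<and> t' \<le> t \<longrightarrow> x + t' *\<^sub>R \<omega> \<notin> closure D)" using t by blast
  qed
  have nN: "norm N > 0" using N0 by simp
  have le: "N \<bullet> \<omega>0 \<le> - norm N"
  proof (rule ccontr)
    assume "\<not> N \<bullet> \<omega>0 \<le> - norm N"
    then have p: "N \<bullet> \<omega>0 + norm N > 0" by simp
    \<comment> \<open>The direction bisecting \<open>N\<close> and \<open>\<omega>0\<close>. If
      \<open>N\<close> were not opposite to \<open>\<omega>0\<close>, it would have positive inner
      products with both, against \<open>key\<close>.\<close>
    let ?w = "N + norm N *\<^sub>R \<omega>0"
    have oo: "\<omega>0 \<bullet> \<omega>0 = 1" using n0 by (simp add: norm_eq_1)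
    have "?w \<bullet> \<omega>0 > 0" using p oo by (simp add: inner_add_left)
    from key[OF this] have "N \<bullet> N + norm N * (N \<bullet> \<omega>0) \<le> 0" by (simp add: inner_add_right)
    then have "norm N * (norm N + N \<bullet> \<omega>0) \<le> 0" by (simp add: dot_square_norm power2_eq_square distrib_left)
    moreover have "norm N * (norm N + N \<bullet> \<omega>0) > 0" using p nN by (intro mult_pos_pos) auto
    ultimately show False by simp
  qed
  have "(norm (N + norm N *\<^sub>R \<omega>0))\<^sup>2 = (norm N)\<^sup>2 + 2 * norm N * (N \<bullet> \<omega>0) + (norm N)\<^sup>2"
  proof -
    have oo: "\<omega>0 \<bullet> \<omega>0 = 1" using n0 by (simp add: norm_eq_1)
    have NN: "N \<bullet> N = norm N * norm N" by (simp add: dot_square_norm power2_eq_square)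
    have "(N + norm N *\<^sub>R \<omega>0) \<bullet> (N + norm N *\<^sub>R \<omega>0) = norm N * norm N + 2 * norm N * (N \<bullet> \<omega>0) + norm N * norm N"
      unfolding inner_add_left inner_add_right inner_scaleR_left inner_scaleR_right oo NN inner_commute[of \<omega>0 N] by (simp add: distrib_left)
    then show ?thesis by (simp only: power2_norm_eq_inner[of "N + norm N *\<^sub>R \<omega>0"] power2_eq_square[of "norm N"])
  qed
  also have "\<dots> \<le> (norm N)\<^sup>2 + 2 * norm N * (- norm N) + (norm N)\<^sup>2"
    using le nN by (intro add_right_mono add_left_mono mult_left_mono) auto
  also have "\<dots> = 0" by (simp add: power2_eq_square)
  finally have "N + norm N *\<^sub>R \<omega>0 = 0" by simp
  then have "norm N *\<^sub>R \<omega>0 = - N" by (simp add: eq_neg_iff_add_eq_0 add.commute)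
  then have "(1 / norm N) *\<^sub>R (norm N *\<^sub>R \<omega>0) = (1 / norm N) *\<^sub>R (- N)" by (rule arg_cong)
  then have "\<omega>0 = - ((1 / norm N) *\<^sub>R N)" using nN by simp
  then show ?thesis by (simp add: y)
qed

text \<open>A nearest pair exists by compactness; the issue is uniqueness of \<open>y0\<close> for
  the chosen \<open>x0\<close>. A tangent plane of \<open>D\<close> at \<open>x0\<close> determines
  the direction in which a nearest point of \<open>B\<close> lies, and a convex \<open>B\<close> has
  a unique nearest point to any given point.\<close>

theorem nearest_points:
  assumes D: "D \<noteq> {}" "bounded D" and B: "B \<noteq> {}" "bounded B" and cl: "closure B \<inter> closure D = {}"
    and g: "(has_C1_boundary D \<and> cone_condition B) \<or> (cone_condition D \<and> cone_condition B \<and> convex B)"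
  obtains x0 y0 where "x0 \<in> closure D" "y0 \<in> closure B" "dist x0 y0 = setdist D B" "setdist D B > 0"
    "\<And>y. y \<in> closure B \<Longrightarrow> dist x0 y \<ge> setdist D B" "\<And>y. y \<in> closure B \<Longrightarrow> dist x0 y = setdist D B \<Longrightarrow> y = y0"
    "fat D x0" "fat B y0"
proof -
  let ?d = "setdist D B"
  have cD: "compact (closure D)" and cB: "compact (closure B)" using D B by (simp_all add: compact_closure)
  have ne: "closure D \<noteq> {}" "closure B \<noteq> {}" using D B by auto
  obtain x0 y0 where xy: "x0 \<in> closure D" "y0 \<in> closure B" "dist x0 y0 = setdist (closure D) (closure B)"
    using setdist_compact_closed[OF cD closed_closure ne] by blast
  then have xyd: "dist x0 y0 = ?d" by (simp add: setdist_closure_1 setdist_closure_2)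
  have d0: "?d > 0" using xy xyd cl by (metis IntI empty_iff zero_less_dist_iff)
  have le: "dist x y \<ge> ?d" if "x \<in> closure D" "y \<in> closure B" for x y
    using setdist_le_dist[OF that] by (simp add: setdist_closure_1 setdist_closure_2)
  have xf: "x0 \<in> frontier D" by (rule nearest_frontier[OF d0 xy(1,2) xyd])
  have yf: "y0 \<in> frontier B"
    by (rule nearest_frontier[of B D y0 x0]) (use d0 xy xyd in \<open>auto simp: setdist_sym dist_commute\<close>)
  have fB: "fat B y0" using g cone_condition_fat yf by blast
  have fD: "fat D x0" using g cone_condition_fat C1_boundary_fat xf by blast
  have uniq: "y = y0" if y: "y \<in> closure B" "dist x0 y = ?d" for y
    using g
  proof
    assume "has_C1_boundary D \<and> cone_condition B"
    then have C: "has_C1_boundary D" by simp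
    have "\<exists>N::R3. N \<noteq> 0 \<and> (\<forall>\<omega>. (\<forall>t0>0. \<exists>t. 0 < t \<and> t < t0 \<and> (\<forall>t'. 0 < t' \<and> t' \<le> t \<longrightarrow> x0 + t' *\<^sub>R \<omega> \<notin> closure D)) \<longrightarrow> N \<bullet> \<omega> \<le> 0)"
      by (rule C1_boundary_local[OF C xf]) blast
    then obtain N :: R3 where N: "N \<noteq> 0"
      "\<And>\<omega>. (\<And>t0. t0 > 0 \<Longrightarrow> \<exists>t. 0 < t \<and> t < t0 \<and> (\<forall>t'. 0 < t' \<and> t' \<le> t \<longrightarrow> x0 + t' *\<^sub>R \<omega> \<notin> closure D)) \<Longrightarrow> N \<bullet> \<omega> \<le> 0"
      by blast
    have ball: "ball z ?d \<inter> closure D = {}" if "z \<in> closure B" for z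
      using le[OF _ that] by (force simp: dist_commute)
    have "y = x0 - (?d / norm N) *\<^sub>R N"
      by (rule C1_boundary_touching_ball[OF N(1) N(2) ball[OF y(1)] y(2) d0])
    moreover have "y0 = x0 - (?d / norm N) *\<^sub>R N"
      by (rule C1_boundary_touching_ball[OF N(1) N(2) ball[OF xy(2)] xyd d0])
    ultimately show "y = y0" by simp
  next
    assume "cone_condition D \<and> cone_condition B \<and> convex B"
    then have cv: "convex (closure B)" by (simp add: convex_closure)
    show "y = y0"
      by (rule any_closest_point_unique[OF cv closed_closure y(1) xy(2), of x0]) (use y xyd le[OF xy(1)] in auto)
  qed
  show thesis
    by (rule that[OF xy(1,2) xyd d0 le[OF xy(1)] uniq fD fB])
qed

text \<open>The frontier of an open set can have positive measure, so the cones are essential. Each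
  frontier point has a vector \<open>p\<close> from a countable dense set along which it enters
  \<open>B\<close>. For fixed \<open>p\<close> these points form a set whose translates along
  \<open>p\<close> are disjoint, since a common point would make a frontier point lie in the open
  set \<open>B\<close>. Infinitely many disjoint translates of equal measure fit into a bounded
  region only if the measure is 0.\<close>

lemma cone_condition_frontier_null:
  assumes B: "open B" "bounded B" and c: "cone_condition B"
  shows "frontier B \<in> null_sets lebesgue"
proof -
  define Q where "Q = (\<lambda>q::rat \<times> rat \<times> rat. (\<chi> i::3. if i = 1 then of_rat (fst q) else if i = 2 then of_rat (fst (snd q)) else of_rat (snd (snd q))) :: R3) ` UNIV"
  have cQ: "countable Q" unfolding Q_def by (intro countable_image) simp
  have dense: "\<exists>p\<in>Q. norm (p - v) < e" if "e > 0" for v and e :: real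
  proof -
    have "\<exists>r::rat. \<bar>of_rat r - v $ i\<bar> < e / 3" for i
    proof -
      obtain q :: rat where "v $ i - e/3 < of_rat q" "of_rat q < v $ i + e/3"
        using of_rat_dense[of "v $ i - e/3" "v $ i + e/3"] \<open>e > 0\<close> by auto
      then have "\<bar>of_rat q - v $ i\<bar> < e / 3" by linarith
      then show ?thesis ..
    qed
    then have "\<forall>i. \<exists>r::rat. \<bar>of_rat r - v $ i\<bar> < e / 3" ..
    then obtain r :: "3 \<Rightarrow> rat" where r: "\<forall>i. \<bar>of_rat (r i) - v $ i\<bar> < e / 3" unfolding choice_iff ..
    let ?p = "(\<chi> i. of_rat (r i)) :: R3"
    have "?p \<in> Q" unfolding Q_def
      by (rule image_eqI[of _ _ "(r 1, r 2, r 3)"]) (auto simp: vec_eq_iff forall_3)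
    moreover have "norm (?p - v) \<le> (\<Sum>i\<in>UNIV. \<bar>(?p - v) $ i\<bar>)" by (rule norm_le_l1_cart)
    moreover have "\<dots> < e" using spec[OF r, of 1] spec[OF r, of 2] spec[OF r, of 3] by (simp add: sum_3)
    ultimately show ?thesis by (intro bexI[of _ ?p]) auto
  qed
  \<comment> \<open>Restricting to rational multiples of \<open>p\<close> makes \<open>G p\<close> a
    countable intersection of Borel sets with the frontier; the translation vectors below differ by
    rational multiples of \<open>p\<close> as well.\<close>
  define G where "G p = {x \<in> frontier B. \<forall>s\<in>{0<..1} \<inter> \<rat>. x + s *\<^sub>R p \<in> B}" for p
  have Gm: "G p \<in> sets lebesgue" for p
  proof -
    have "G p = frontier B \<inter> (\<Inter>s\<in>{0<..1} \<inter> \<rat>. (\<lambda>x. x + s *\<^sub>R p) -` B)"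
      by (auto simp: G_def)
    also have "\<dots> \<in> sets borel"
    proof (rule sets.Int)
      show "frontier B \<in> sets borel" by (intro borel_closed frontier_closed)
    next
      have "countable ({0<..1} \<inter> \<rat> :: real set)" by (rule countable_subset[OF _ countable_rat]) auto
      moreover have "{0<..1} \<inter> \<rat> \<noteq> ({} :: real set)"
      proof -
        have "(1::real) \<in> {0<..1} \<inter> \<rat>" by auto
        then show ?thesis by blast
      qed
      moreover have "(\<lambda>x. x + s *\<^sub>R p) -` B \<in> sets borel" for s
        by (intro borel_open open_vimage B continuous_intros)
      ultimately show "(\<Inter>s\<in>{0<..1} \<inter> \<rat>. (\<lambda>x. x + s *\<^sub>R p) -` B) \<in> sets borel"
        by (intro sets.countable_INT') auto
    qed
    finally show ?thesis by simp
  qed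
  have cover: "frontier B \<subseteq> (\<Union>p\<in>Q. G p)"
  proof
    fix x assume x: "x \<in> frontier B"
    obtain n h \<theta> where c: "norm n = 1" "h > 0" "0 < \<theta>" "\<theta> < pi" "cone_at x n h \<theta> - {x} \<subseteq> B"
      using c x unfolding cone_condition_def by blast
    obtain q k where qk: "0 < q" "q \<le> 1" "k > 0"
      "\<And>t \<zeta>. 0 < t \<Longrightarrow> t \<le> k \<Longrightarrow> norm \<zeta> < q \<Longrightarrow> x + t *\<^sub>R (n + \<zeta>) \<in> B"
      by (rule cone_imp_direction[OF c]) (rule that; assumption)
    obtain p where p: "p \<in> Q" "norm (p - k *\<^sub>R n) < k * q" using dense[of "k * q" "k *\<^sub>R n"] qk by auto
    define \<zeta> where "\<zeta> = (1 / k) *\<^sub>R (p - k *\<^sub>R n)"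
    have z: "norm \<zeta> < q" using p(2) qk by (simp add: \<zeta>_def pos_divide_less_eq mult.commute)
    have pe: "p = k *\<^sub>R (n + \<zeta>)" using qk by (simp add: \<zeta>_def algebra_simps)
    have "x + s *\<^sub>R p \<in> B" if "0 < s" "s \<le> 1" for s
      using qk(4)[of "s * k" \<zeta>] that qk(3) z by (simp add: pe mult_left_le_one_le)
    then have "x \<in> G p" using x by (auto simp: G_def)
    then show "x \<in> (\<Union>p\<in>Q. G p)" using p(1) by blast
  qed
  have "G p \<in> null_sets lebesgue" for p
  proof -
    define \<mu> where "\<mu> = measure lebesgue (G p)"
    have bG: "bounded (G p)" using bounded_closure[OF B(2)] by (rule bounded_subset) (auto simp: G_def frontier_def)
    have lm: "G p \<in> lmeasurable" using Gm bG by (simp add: bounded_set_imp_lmeasurable)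
    \<comment> \<open>The factors \<open>1 / (i + 1)\<close> are distinct and lie in the unit
      interval, so their differences are admissible in \<open>G\<close> and all translates stay in
      one ball.\<close>
    define tr where "tr i = (+) ((1 / real (i + 1)) *\<^sub>R p) ` G p" for i :: nat
    have trm: "tr i \<in> lmeasurable" "measure lebesgue (tr i) = \<mu>" for i
      unfolding tr_def \<mu>_def using lm measurable_translation measure_translation by auto
    have disj: "tr i \<inter> tr j = {}" if ij: "i < j" for i j
    proof (rule ccontr)
      assume "tr i \<inter> tr j \<noteq> {}"
      then obtain x y where xy: "x \<in> G p" "y \<in> G p" "(1 / real (i + 1)) *\<^sub>R p + x = (1 / real (j + 1)) *\<^sub>R p + y"
        by (auto simp: tr_def)
      let ?s = "1 / real (i + 1) - 1 / real (j + 1)"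
      have "1 / real (j + 1) < 1 / real (i + 1)" using ij by (intro divide_strict_left_mono) auto
      moreover have "1 / real (i + 1) \<le> 1" by simp
      moreover have "1 / real (j + 1) > 0" by simp
      ultimately have "0 < ?s" "?s \<le> 1" by linarith+
      moreover have "?s \<in> \<rat>" by auto
      ultimately have "?s \<in> {0<..1} \<inter> \<rat>" by simp
      then have "x + ?s *\<^sub>R p \<in> B" using xy(1) unfolding G_def by blast
      moreover have "x + ?s *\<^sub>R p = y" using xy(3) by (simp add: algebra_simps)
      ultimately have "y \<in> B" by simp
      moreover have "y \<in> frontier B" using xy(2) by (simp add: G_def)
      ultimately show False using B(1) by (simp add: frontier_def interior_open)
    qed
    obtain R where R: "\<And>x. x \<in> G p \<Longrightarrow> norm x \<le> R" using bG by (auto simp: bounded_iff)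
    have sub: "tr i \<subseteq> cball 0 (R + norm p)" for i
    proof
      fix z assume "z \<in> tr i"
      then obtain x where x: "x \<in> G p" "z = (1 / real (i + 1)) *\<^sub>R p + x" by (auto simp: tr_def)
      have "norm z \<le> norm ((1 / real (i + 1)) *\<^sub>R p) + norm x" unfolding x(2) by (rule norm_triangle_ineq)
      also have "norm ((1 / real (i + 1)) *\<^sub>R p) \<le> 1 * norm p" unfolding norm_scaleR by (intro mult_right_mono) auto
      finally show "z \<in> cball 0 (R + norm p)" using R[OF x(1)] by simp
    qed
    have "real n * \<mu> \<le> measure lebesgue (cball (0::R3) (R + norm p))" for n
    proof -
      have "measure lebesgue (\<Union>i<n. tr i) = (\<Sum>i<n. measure lebesgue (tr i))"
      proof (rule measure_UNION')
        have "tr i \<inter> tr j = {}" if "i \<noteq> j" for i j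
          using disj[of i j] disj[of j i] that by (cases "i < j") (auto simp: Int_commute)
        then show "pairwise (\<lambda>i j. disjnt (tr i) (tr j)) {..<n}" by (simp add: pairwise_def disjnt_def)
      qed (simp_all add: trm)
      also have "\<dots> = real n * \<mu>" by (simp add: trm)
      finally have "real n * \<mu> = measure lebesgue (\<Union>i<n. tr i)" by simp
      also have "\<dots> \<le> measure lebesgue (cball (0::R3) (R + norm p))"
      proof (rule measure_mono_fmeasurable)
        show "(\<Union>i<n. tr i) \<subseteq> cball 0 (R + norm p)" using sub by blast
        show "(\<Union>i<n. tr i) \<in> sets lebesgue" using trm(1) by (intro sets.finite_UN) (auto simp: fmeasurableD)
      qed simp
      finally show ?thesis .
    qed
    then have "\<not> \<mu> > 0" using reals_Archimedean3[of \<mu>] by (meson linorder_not_less)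
    then have "\<mu> = 0" using measure_nonneg[of lebesgue "G p"] by (simp add: \<mu>_def)
    then have "emeasure lebesgue (G p) = 0" using emeasure_eq_measure2[OF lm] by (simp add: \<mu>_def)
    then show ?thesis using Gm by (simp add: null_sets_def)
  qed
  then have "(\<Union>p\<in>Q. G p) \<in> null_sets lebesgue" using cQ by (intro null_sets_UN') auto
  then show ?thesis using cover by (rule null_sets_completion_subset[rotated])
qed

section \<open>The gradient of the free field near the obstacle\<close>

lemma ykA_nonneg: "\<tau> \<ge> 0 \<Longrightarrow> s \<ge> 0 \<Longrightarrow> 0 \<le> ykA \<tau> s"
  by (simp add: ykA_def)

lemma ykA_upper:
  assumes t: "\<tau> > 0" and r: "0 < r" "r \<le> s"
  shows "ykA \<tau> s * s \<le> (\<tau> / r + 1 / r\<^sup>2) * exp (- \<tau> * r)"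
proof -
  have s: "s > 0" using r by simp
  have "ykA \<tau> s * s = (0 + \<tau> / s + 1 / s\<^sup>2) * exp (- \<tau> * s) / (4 * pi)"
    using s by (simp add: ykA_def field_simps power2_eq_square power3_eq_cube)
  also have "\<dots> \<le> (0 + \<tau> / s + 1 / s\<^sup>2) * exp (- \<tau> * s)" using s t by (intro pi4_ge) auto
  also have "\<dots> \<le> (0 + \<tau> / r + 1 / r\<^sup>2) * exp (- \<tau> * r)" by (rule poly_exp_antimono) (use r t in auto)
  finally show ?thesis by simp
qed

lemma ykA_lower:
  assumes t: "\<tau> \<ge> 0" and s: "0 < s" "s \<le> R"
  shows "exp (- \<tau> * R) / (4 * pi * R ^ 3) \<le> ykA \<tau> s"
proof -
  have "1 / R ^ 3 \<le> 1 / s ^ 3" using s by (intro divide_left_mono power_mono) auto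
  also have "\<dots> \<le> \<tau> / s\<^sup>2 + 1 / s ^ 3" using t by simp
  finally have 1: "1 / R ^ 3 \<le> \<tau> / s\<^sup>2 + 1 / s ^ 3" .
  have "exp (- \<tau> * R) \<le> exp (- \<tau> * s)" using t s by (simp add: mult_left_mono)
  then have "1 / R ^ 3 * exp (- \<tau> * R) \<le> (\<tau> / s\<^sup>2 + 1 / s ^ 3) * exp (- \<tau> * s)"
    using 1 s t by (intro mult_mono) auto
  then have "1 / R ^ 3 * exp (- \<tau> * R) / (4 * pi) \<le> (\<tau> / s\<^sup>2 + 1 / s ^ 3) * exp (- \<tau> * s) / (4 * pi)"
    by (intro divide_right_mono) auto
  then show ?thesis by (simp add: ykA_def mult_ac)
qed

lemma L2_bounded_support_integrable:
  assumes f: "f \<in> L2" and B: "B \<in> sets lebesgue" "bounded B" and z: "AE x in lebesgue. x \<notin> B \<longrightarrow> f x = 0"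
  shows "integrable lebesgue f"
proof (rule integrable_cong_AE_imp)
  show "integrable lebesgue (\<lambda>x. f x * indicat_real B x)" by (rule L2_mult[OF f indicator_L2[OF B]])
  show "f \<in> borel_measurable lebesgue" by (rule L2_measurable[OF f])
  show "AE x in lebesgue. f x * indicat_real B x = f x" using z by eventually_elim (auto simp: indicator_def)
qed

lemma kernel_measurable:
  "(\<lambda>y. ykA \<tau> (norm (x - y)) * ((x - y) \<bullet> e)) \<in> borel_measurable lebesgue"
  unfolding ykA_def by (intro measurable_completion) simp

text \<open>The modulus of the kernel decreases with the distance, so its value at the least
  distance \<open>r\<close> bounds it on the set carrying \<open>f\<close>. The set \<open>S\<close>
  is a parameter because the bound is applied to all of \<open>B\<close> and to the part of
  \<open>B\<close> away from the nearest point.\<close>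

lemma kernel_bound:
  assumes t: "\<tau> > 0" and r: "r > 0" "\<And>y. y \<in> S \<Longrightarrow> r \<le> norm (x - y)" and e: "norm e \<le> 1"
    and z: "AE y in lebesgue. y \<notin> S \<longrightarrow> f y = 0" and f: "integrable lebesgue f"
  shows "integrable lebesgue (\<lambda>y. ykA \<tau> (norm (x - y)) * ((x - y) \<bullet> e) * f y)"
    and "\<bar>LINT y|lebesgue. ykA \<tau> (norm (x - y)) * ((x - y) \<bullet> e) * f y\<bar>
      \<le> (\<tau> / r + 1 / r\<^sup>2) * exp (- \<tau> * r) * (LINT y|lebesgue. \<bar>f y\<bar>)"
proof -
  let ?K = "(\<tau> / r + 1 / r\<^sup>2) * exp (- \<tau> * r)"
  let ?g = "\<lambda>y. ykA \<tau> (norm (x - y)) * ((x - y) \<bullet> e) * f y"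
  have b: "AE y in lebesgue. \<bar>?g y\<bar> \<le> ?K * \<bar>f y\<bar>"
    using z
  proof eventually_elim
    case (elim y)
    show ?case
    proof (cases "y \<in> S")
      case True
      have A: "ykA \<tau> (norm (x - y)) \<ge> 0" using t by (simp add: ykA_nonneg)
      have "\<bar>(x - y) \<bullet> e\<bar> \<le> norm (x - y) * norm e" by (rule Cauchy_Schwarz_ineq2)
      also have "\<dots> \<le> norm (x - y)" using e by (simp add: mult_left_le)
      finally have "ykA \<tau> (norm (x - y)) * \<bar>(x - y) \<bullet> e\<bar> \<le> ykA \<tau> (norm (x - y)) * norm (x - y)"
        using A by (rule mult_left_mono)
      also have "\<dots> \<le> ?K" by (rule ykA_upper[OF t r(1) r(2)[OF True]])
      finally have "ykA \<tau> (norm (x - y)) * \<bar>(x - y) \<bullet> e\<bar> * \<bar>f y\<bar> \<le> ?K * \<bar>f y\<bar>" by (rule mult_right_mono) simp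
      then show ?thesis using A by (simp add: abs_mult)
    next
      case False
      then show ?thesis using elim by simp
    qed
  qed
  have Ki: "integrable lebesgue (\<lambda>y. ?K * \<bar>f y\<bar>)" using f by (intro integrable_mult_right integrable_abs)
  have m: "?g \<in> borel_measurable lebesgue"
    by (intro borel_measurable_times[OF kernel_measurable] borel_measurable_integrable[OF f])
  have "AE y in lebesgue. norm (?g y) \<le> norm (?K * \<bar>f y\<bar>)"
    using b by eventually_elim (simp only: real_norm_def order_trans[OF _ abs_ge_self])
  then show i: "integrable lebesgue ?g" by (rule Bochner_Integration.integrable_bound[OF Ki m])
  have "\<bar>LINT y|lebesgue. ?g y\<bar> \<le> (LINT y|lebesgue. \<bar>?g y\<bar>)" by (rule integral_abs_bound)
  also have "\<dots> \<le> (LINT y|lebesgue. ?K * \<bar>f y\<bar>)"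
    by (rule integral_mono_AE[OF integrable_abs[OF i] Ki b])
  also have "\<dots> = ?K * (LINT y|lebesgue. \<bar>f y\<bar>)" by simp
  finally show "\<bar>LINT y|lebesgue. ?g y\<bar> \<le> ?K * (LINT y|lebesgue. \<bar>f y\<bar>)" .
qed

lemma vgrad_component: "vgrad f \<tau> x $ i = - (LINT y|lebesgue. ykA \<tau> (norm (x - y)) * ((x - y) \<bullet> axis i 1) * f y)"
  by (simp add: vgrad_def inner_axis)

lemma vgrad_inner:
  assumes "\<tau> > 0" "r > 0" "\<And>y. y \<in> S \<Longrightarrow> r \<le> norm (x - y)"
    and "AE y in lebesgue. y \<notin> S \<longrightarrow> f y = 0" and "integrable lebesgue f"
  shows "vgrad f \<tau> x \<bullet> e = - (LINT y|lebesgue. ykA \<tau> (norm (x - y)) * ((x - y) \<bullet> e) * f y)"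
proof -
  have i: "integrable lebesgue (\<lambda>y. ykA \<tau> (norm (x - y)) * (x - y) $ i * f y)" for i
    using kernel_bound(1)[OF assms(1-3) _ assms(4,5), where e = "axis i 1"] by (simp add: inner_axis norm_Basis)
  have "(LINT y|lebesgue. ykA \<tau> (norm (x - y)) * ((x - y) \<bullet> e) * f y)
      = (LINT y|lebesgue. (\<Sum>i\<in>UNIV. e $ i * (ykA \<tau> (norm (x - y)) * (x - y) $ i * f y)))"
    by (intro Bochner_Integration.integral_cong refl) (simp add: inner_vec_def sum_distrib_left sum_distrib_right mult_ac)
  also have "\<dots> = (\<Sum>i\<in>UNIV. e $ i * (LINT y|lebesgue. ykA \<tau> (norm (x - y)) * (x - y) $ i * f y))"
    using i by (subst Bochner_Integration.integral_sum) auto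
  also have "\<dots> = - (vgrad f \<tau> x \<bullet> e)"
    by (simp add: vgrad_def inner_vec_def sum_negf mult_ac)
  finally show ?thesis by simp
qed

text \<open>Every point of \<open>D\<close> has at least the distance \<open>setdist D B\<close>
  from the source, so the pointwise kernel bound is uniform on \<open>D\<close>; squaring and
  integrating over the bounded set only costs its measure.\<close>

lemma vgrad_vnorm_upper:
  assumes D: "D \<in> sets lebesgue" "bounded D" and B: "B \<in> sets lebesgue" "bounded B"
    and f: "f \<in> L2" and z: "AE x in lebesgue. x \<notin> B \<longrightarrow> f x = 0" and d: "setdist D B > 0"
    and v: "\<And>\<tau>. \<tau> \<ge> 1 \<Longrightarrow> vgrad f \<tau> \<in> vL2"
  obtains C where "C > 0"
    "\<And>\<tau>. \<tau> \<ge> 1 \<Longrightarrow> (vnorm (restr D (vgrad f \<tau>)))\<^sup>2 \<le> C * \<tau>\<^sup>2 * exp (- 2 * setdist D B * \<tau>)"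
proof -
  let ?d = "setdist D B"
  define F where "F = (LINT y|lebesgue. \<bar>f y\<bar>)"
  have F: "F \<ge> 0" unfolding F_def by (rule Bochner_Integration.integral_nonneg) simp
  have fi: "integrable lebesgue f" by (rule L2_bounded_support_integrable[OF f B z])
  \<comment> \<open>For \<open>\<tau> \<ge> 1\<close> both terms of the kernel bound together are at
    most \<open>a * \<tau>\<close>.\<close>
  define a where "a = 1 / ?d + 1 / ?d\<^sup>2"
  define \<mu> where "\<mu> = measure lebesgue D"
  define C where "C = 3 * \<mu> * (a * F)\<^sup>2 + 1"
  have "C > 0" unfolding C_def \<mu>_def by (intro add_nonneg_pos mult_nonneg_nonneg) auto
  moreover have "(vnorm (restr D (vgrad f \<tau>)))\<^sup>2 \<le> C * \<tau>\<^sup>2 * exp (- 2 * ?d * \<tau>)" if t: "\<tau> \<ge> 1" for \<tau>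
  proof -
    have t0: "\<tau> > 0" using t by simp
    define k where "k = a * F * \<tau> * exp (- \<tau> * ?d)"
    have comp: "\<bar>vgrad f \<tau> x $ i\<bar> \<le> k" if x: "x \<in> D" for x i
    proof -
      have r: "?d \<le> norm (x - y)" if "y \<in> B" for y using setdist_le_dist[OF x that] by (simp add: dist_norm)
      have "\<bar>vgrad f \<tau> x $ i\<bar> \<le> (\<tau> / ?d + 1 / ?d\<^sup>2) * exp (- \<tau> * ?d) * F"
        unfolding vgrad_component abs_minus_cancel F_def
        by (rule kernel_bound(2)[OF t0 d r _ z fi]) (simp_all add: norm_Basis)
      also have "\<dots> \<le> (a * \<tau>) * exp (- \<tau> * ?d) * F"
      proof (intro mult_right_mono F)
        have "1 / ?d\<^sup>2 * 1 \<le> 1 / ?d\<^sup>2 * \<tau>" using t by (intro mult_left_mono) auto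
        then show "\<tau> / ?d + 1 / ?d\<^sup>2 \<le> a * \<tau>" by (simp add: a_def distrib_right)
      qed simp
      finally show ?thesis by (simp add: k_def mult_ac)
    qed
    have rL: "restr D (vgrad f \<tau>) \<in> vL2" by (rule restr_vL2[OF D(1) v[OF t]])
    have ipb: "ip (\<lambda>x. restr D (vgrad f \<tau>) x $ i) (\<lambda>x. restr D (vgrad f \<tau>) x $ i) \<le> k\<^sup>2 * \<mu>" for i
    proof -
      have "ip (\<lambda>x. restr D (vgrad f \<tau>) x $ i) (\<lambda>x. restr D (vgrad f \<tau>) x $ i) \<le> (LINT x|lebesgue. k\<^sup>2 * indicat_real D x)"
        unfolding ip_def
      proof (rule integral_mono_AE)
        show "integrable lebesgue (\<lambda>x. restr D (vgrad f \<tau>) x $ i * restr D (vgrad f \<tau>) x $ i)"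
          by (intro L2_mult vL2_D rL)
        show "integrable lebesgue (\<lambda>x. k\<^sup>2 * indicat_real D x)"
          using bounded_set_imp_lmeasurable[OF D(2,1)] by (intro integrable_mult_right) (auto simp: fmeasurable_def)
        have "vgrad f \<tau> x $ i * vgrad f \<tau> x $ i \<le> k\<^sup>2" if "x \<in> D" for x
        proof -
          have "\<bar>vgrad f \<tau> x $ i\<bar>\<^sup>2 \<le> k\<^sup>2" using comp[OF that] by (intro power_mono) auto
          then show ?thesis by (simp add: power2_eq_square)
        qed
        then show "AE x in lebesgue. restr D (vgrad f \<tau>) x $ i * restr D (vgrad f \<tau>) x $ i \<le> k\<^sup>2 * indicat_real D x"
          by (intro AE_I2) (auto simp: restr_def indicator_def)
      qed
      also have "\<dots> = k\<^sup>2 * \<mu>" using D by (simp add: \<mu>_def)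
      finally show ?thesis .
    qed
    have "(vnorm (restr D (vgrad f \<tau>)))\<^sup>2 \<le> 3 * (k\<^sup>2 * \<mu>)"
      unfolding vip_self[symmetric] vip_def sum_3 using ipb[of 1] ipb[of 2] ipb[of 3] by linarith
    also have "\<dots> = 3 * \<mu> * (a * F)\<^sup>2 * (\<tau>\<^sup>2 * exp (- 2 * ?d * \<tau>))"
    proof -
      have "(exp (- \<tau> * ?d))\<^sup>2 = exp (- 2 * ?d * \<tau>)" by (simp add: power2_eq_square exp_add[symmetric])
      then show ?thesis by (simp add: k_def power_mult_distrib)
    qed
    also have "\<dots> \<le> C * (\<tau>\<^sup>2 * exp (- 2 * ?d * \<tau>))" unfolding C_def by (intro mult_right_mono) auto
    finally show ?thesis by simp
  qed
  ultimately show thesis by (rule that)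
qed

lemma measure_ball_R3: "r \<ge> 0 \<Longrightarrow> measure lebesgue (ball (c::R3) r) = unit_ball_vol 3 * r ^ 3"
  using content_ball[of r c] by simp

text \<open>The natural scale is \<open>1 / \<tau>\<close>: displacements of this size change
  \<open>exp (- \<tau> * dist)\<close> by a bounded factor only. For \<open>x\<close> so close to
  \<open>x0\<close>, the component of the gradient along \<open>x0 - y0\<close> receives
  contributions of one sign from the part of \<open>B\<close> near \<open>y0\<close>, because
  \<open>f\<close> has a fixed sign. The rest of \<open>B\<close> is farther away by a fixed amount,
  thanks to the uniqueness of \<open>y0\<close>, and is exponentially smaller.\<close>

theorem vgrad_vnorm_lower:
  assumes D: "D \<in> sets lebesgue" and B: "B \<in> sets lebesgue" "bounded B"
    and f: "f \<in> L2" and z: "AE x in lebesgue. x \<notin> B \<longrightarrow> f x = 0" and d: "d > 0"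
    and v: "\<And>\<tau>. \<tau> \<ge> 1 \<Longrightarrow> vgrad f \<tau> \<in> vL2"
    and xy: "dist x0 y0 = d" "\<And>y. y \<in> closure B \<Longrightarrow> dist x0 y \<ge> d" "\<And>y. y \<in> closure B \<Longrightarrow> dist x0 y = d \<Longrightarrow> y = y0"
    and fat: "fat D x0" "fat B y0"
    and c1: "c1 > 0" and \<sigma>: "\<bar>\<sigma>\<bar> = 1" "AE x in lebesgue. x \<in> B \<longrightarrow> \<sigma> * f x \<ge> c1"
  obtains c where "c > 0"
    "\<forall>\<^sub>F \<tau> in at_top. c * exp (- 2 * d * \<tau>) / \<tau> ^ 9 \<le> (vnorm (restr D (vgrad f \<tau>)))\<^sup>2"
proof -
  have fi: "integrable lebesgue f" by (rule L2_bounded_support_integrable[OF f B z])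
  define F where "F = (LINT y|lebesgue. \<bar>f y\<bar>)"
  have F: "F \<ge> 0" unfolding F_def by (rule Bochner_Integration.integral_nonneg) simp
  define e where "e = (1 / d) *\<^sub>R (x0 - y0)"
  have e1: "norm e = 1" using xy(1) d by (simp add: e_def dist_norm)
  have ee: "(x0 - y0) \<bullet> e = d"
  proof -
    have "(x0 - y0) \<bullet> e = (1 / d) * (norm (x0 - y0))\<^sup>2" by (simp add: e_def power2_norm_eq_inner)
    then show ?thesis using xy(1) d by (simp add: dist_norm power2_eq_square)
  qed
  \<comment> \<open>If \<open>x\<close> and \<open>y\<close> stay within \<open>\<eta>\<close> of
    \<open>x0\<close> and \<open>y0\<close>, the component of \<open>x - y\<close> along
    \<open>e\<close> is at least \<open>d - 2 * \<eta> = d / 2\<close>.\<close>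
  define \<eta> where "\<eta> = d / 4"
  have \<eta>: "\<eta> > 0" using d by (simp add: \<eta>_def)
  \<comment> \<open>On the compact set left after removing a ball around \<open>y0\<close> the
    distance to \<open>x0\<close> has a minimum larger than \<open>d\<close>. One
    \<open>\<delta>\<close> of the excess pays for moving from \<open>x0\<close> to
    \<open>x\<close>, the other remains in \<open>b\<close>.\<close>
  obtain \<delta> where \<delta>: "\<delta> > 0" "\<And>y. y \<in> closure B \<Longrightarrow> dist y y0 \<ge> \<eta> \<Longrightarrow> dist x0 y \<ge> d + 2 * \<delta>"
  proof (cases "closure B - ball y0 \<eta> = {}")
    case True
    then show thesis by (intro that[of 1]) (auto simp: dist_commute)
  next
    case False
    have "compact (closure B - ball y0 \<eta>)" using B(2) by (intro compact_diff) (auto simp: compact_closure)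
    then obtain p where p: "p \<in> closure B - ball y0 \<eta>" "\<And>y. y \<in> closure B - ball y0 \<eta> \<Longrightarrow> dist x0 p \<le> dist x0 y"
      using continuous_attains_inf[OF _ False, of "dist x0"] continuous_on_dist[OF continuous_on_const continuous_on_id] by blast
    have "p \<noteq> y0" using p(1) \<eta> by auto
    then have "dist x0 p > d" using xy(2,3)[of p] p(1) by force
    show thesis
    proof (rule that[of "(dist x0 p - d) / 2"])
      show "(dist x0 p - d) / 2 > 0" using \<open>dist x0 p > d\<close> by simp
      fix y assume "y \<in> closure B" "dist y y0 \<ge> \<eta>"
      then show "d + 2 * ((dist x0 p - d) / 2) \<le> dist x0 y" using p(2)[of y] by (simp add: dist_commute field_simps)
    qed
  qed
  obtain \<kappa>1 r1 where k1: "\<kappa>1 > 0" "r1 > 0" "\<And>s. 0 < s \<Longrightarrow> s \<le> r1 \<Longrightarrow> \<exists>c. ball c (\<kappa>1 * s) \<subseteq> D \<inter> ball x0 s"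
    using fat(1) unfolding fat_def by blast
  obtain \<kappa>2 r2 where k2: "\<kappa>2 > 0" "r2 > 0" "\<And>s. 0 < s \<Longrightarrow> s \<le> r2 \<Longrightarrow> \<exists>c. ball c (\<kappa>2 * s) \<subseteq> B \<inter> ball y0 s"
    using fat(2) unfolding fat_def by blast
  define \<omega> where "\<omega> = unit_ball_vol 3"
  have \<omega>: "\<omega> > 0" by (simp add: \<omega>_def)
  \<comment> \<open>The factors are the loss \<open>exp (-2)\<close> over the distance
    \<open>2 / \<tau>\<close>, the kernel constant with \<open>1 / \<tau> \<le> 1\<close>, the
    component \<open>d / 2\<close> along \<open>e\<close>, the size \<open>c1\<close> of the source,
    and the volume of the ball inside \<open>B\<close> up to
    \<open>\<tau>\<^sup>-\<^sup>3\<close>.\<close>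
  define m where "m = exp (-2) / (4 * pi * (d + 2) ^ 3) * (d / 2) * c1 * (\<omega> * \<kappa>2 ^ 3)"
  have m: "m > 0" unfolding m_def using d c1 \<omega> k2 by simp
  define c where "c = (m / 2)\<^sup>2 * (\<omega> * \<kappa>1 ^ 3)"
  have c: "c > 0" using m \<omega> k1 by (simp add: c_def)
  define b where "b = d + \<delta>"
  have b: "b > 0" using d \<delta> by (simp add: b_def)
  have "((\<lambda>\<tau>. \<tau> ^ 3 * ((\<tau> / b + 1 / b\<^sup>2) * exp (- \<tau> * \<delta>) * F)) \<longlongrightarrow> 0) at_top"
    using \<delta>(1) b by real_asymp
  then have ev1: "\<forall>\<^sub>F \<tau> in at_top. \<tau> ^ 3 * ((\<tau> / b + 1 / b\<^sup>2) * exp (- \<tau> * \<delta>) * F) < m / 2"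
    by (rule order_tendstoD(2)) (use m in simp)
  have ev2: "\<forall>\<^sub>F \<tau> in at_top. \<tau> \<ge> max 1 (max (1 / \<delta>) (max (1 / \<eta>) (max (1 / r1) (1 / r2))))"
    by (rule eventually_ge_at_top)
  have "\<forall>\<^sub>F \<tau> in at_top. c * exp (- 2 * d * \<tau>) / \<tau> ^ 9 \<le> (vnorm (restr D (vgrad f \<tau>)))\<^sup>2"
    using ev1 ev2
  proof eventually_elim
    case (elim \<tau>)
    have t: "\<tau> \<ge> 1" "\<tau> > 0" using elim(2) by auto
    define s where "s = 1 / \<tau>"
    have s0: "s > 0" using t by (simp add: s_def)
    have sle: "s \<le> q" if "q > 0" "1 / q \<le> \<tau>" for q
      using that t by (simp add: s_def field_simps)
    have s: "s \<le> 1" "s \<le> \<delta>" "s \<le> \<eta>" "s \<le> r1" "s \<le> r2"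
      using elim(2) \<delta>(1) \<eta> k1(2) k2(2) by (intro sle; simp)+
    obtain p where p: "ball p (\<kappa>1 * s) \<subseteq> D \<inter> ball x0 s" using k1(3)[OF s0 s(4)] by blast
    obtain q where q: "ball q (\<kappa>2 * s) \<subseteq> B \<inter> ball y0 s" using k2(3)[OF s0 s(5)] by blast
    \<comment> \<open>Half of the near contribution \<open>2 * L\<close>; the other half makes up
      for the far part, which is eventually at most \<open>L\<close>.\<close>
    define L where "L = m / 2 * exp (- \<tau> * d) / \<tau> ^ 3"
    have L0: "L \<ge> 0" using m t by (simp add: L_def)
    have low: "norm (vgrad f \<tau> x) \<ge> L" if x: "x \<in> ball x0 s" for x
    proof -
      define N where "N = B \<inter> ball y0 \<eta>"
      define R where "R = B - ball y0 \<eta>"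
      define K where "K y = ykA \<tau> (norm (x - y)) * ((x - y) \<bullet> e)" for y
      define f1 where "f1 y = indicat_real (ball y0 \<eta>) y * f y" for y
      define f2 where "f2 y = indicat_real (- ball y0 \<eta>) y * f y" for y
      have bl: "ball y0 \<eta> \<in> sets lebesgue" "- ball y0 \<eta> \<in> sets lebesgue" using lmeasurable_ball by (auto simp: fmeasurableD)
      have f1i: "integrable lebesgue f1" and f2i: "integrable lebesgue f2"
        unfolding f1_def[abs_def] f2_def[abs_def]
        using integrable_mult_indicator[OF bl(1) fi] integrable_mult_indicator[OF bl(2) fi] by auto
      have xs: "norm (x - x0) < s" using x by (simp add: dist_norm norm_minus_commute)
      have rB: "norm (x - y) \<ge> d - s" if "y \<in> closure B" for y
      proof -
        have "dist x0 y \<le> norm (x - x0) + norm (x - y)" 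
          using dist_triangle[of x0 y x] by (simp add: dist_norm norm_minus_commute)
        then show ?thesis using xy(2)[OF that] xs by linarith
      qed
      have ds: "d - s > 0" using s(3) d by (simp add: \<eta>_def)
      have BC: "y \<in> closure B" if "y \<in> B" for y using that closure_subset by blast
      have rR: "b \<le> norm (x - y)" if "y \<in> R" for y
      proof -
        have "dist x0 y \<le> norm (x - x0) + norm (x - y)" 
          using dist_triangle[of x0 y x] by (simp add: dist_norm norm_minus_commute)
        moreover have "dist x0 y \<ge> d + 2 * \<delta>" using that by (intro \<delta>(2) BC) (auto simp: R_def dist_commute)
        ultimately show ?thesis using xs s(2) by (simp add: b_def)
      qed
      have z1: "AE y in lebesgue. y \<notin> B \<longrightarrow> f1 y = 0" using z by eventually_elim (simp add: f1_def)
      have z2: "AE y in lebesgue. y \<notin> R \<longrightarrow> f2 y = 0" using z by eventually_elim (auto simp: f2_def R_def indicator_def)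
      have K1i: "integrable lebesgue (\<lambda>y. K y * f1 y)"
        unfolding K_def by (rule kernel_bound(1)[OF t(2) ds rB[OF BC] _ z1 f1i]) (simp_all add: e1)
      have K2i: "integrable lebesgue (\<lambda>y. K y * f2 y)"
        unfolding K_def by (rule kernel_bound(1)[OF t(2) b rR _ z2 f2i]) (simp_all add: e1)
      have "\<bar>LINT y|lebesgue. K y * f2 y\<bar> \<le> (\<tau> / b + 1 / b\<^sup>2) * exp (- \<tau> * b) * (LINT y|lebesgue. \<bar>f2 y\<bar>)"
        unfolding K_def by (rule kernel_bound(2)[OF t(2) b rR _ z2 f2i]) (simp_all add: e1)
      also have "\<dots> \<le> (\<tau> / b + 1 / b\<^sup>2) * exp (- \<tau> * b) * F"
      proof (rule mult_left_mono)
        show "(LINT y|lebesgue. \<bar>f2 y\<bar>) \<le> F"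
          unfolding F_def
          by (rule integral_mono[OF integrable_abs[OF f2i] integrable_abs[OF fi]]) (simp add: f2_def indicator_def)
      qed (use t b in auto)
      also have "\<dots> = (\<tau> / b + 1 / b\<^sup>2) * exp (- \<tau> * \<delta>) * F * exp (- \<tau> * d)"
        by (simp add: b_def algebra_simps exp_add[symmetric])
      also have "\<dots> \<le> (m / 2 / \<tau> ^ 3) * exp (- \<tau> * d)"
        using elim(1) t by (intro mult_right_mono) (simp_all add: pos_le_divide_eq mult.commute)
      finally have far: "\<bar>LINT y|lebesgue. K y * f2 y\<bar> \<le> L" by (simp add: L_def)
      have Kpos: "K y \<ge> exp (- \<tau> * (d + 2 * s)) / (4 * pi * (d + 2 * s) ^ 3) * (d / 2)" if y: "y \<in> ball y0 s" for y
      proof -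
        have ys: "norm (y - y0) < s" using y by (simp add: dist_norm norm_minus_commute)
        have "x - y = (x0 - y0) + ((x - x0) - (y - y0))" by simp
        then have "norm (x - y) \<le> norm (x0 - y0) + (norm (x - x0) + norm (y - y0))"
          by (smt (verit) norm_triangle_ineq norm_triangle_ineq4)
        then have le: "norm (x - y) \<le> d + 2 * s" using xs ys xy(1) by (simp add: dist_norm)
        have ge: "(x - y) \<bullet> e \<ge> d / 2"
        proof -
          have "(x - y) \<bullet> e = d + (x - x0) \<bullet> e - (y - y0) \<bullet> e" using ee by (simp add: inner_diff_left)
          moreover have "\<bar>(x - x0) \<bullet> e\<bar> \<le> norm (x - x0)" "\<bar>(y - y0) \<bullet> e\<bar> \<le> norm (y - y0)"
            using Cauchy_Schwarz_ineq2[of _ e] e1 by (metis mult.right_neutral)+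
          ultimately show ?thesis using xs ys s(3) by (simp add: \<eta>_def)
        qed
        have "x \<noteq> y" using ge d by auto
        then have "exp (- \<tau> * (d + 2 * s)) / (4 * pi * (d + 2 * s) ^ 3) \<le> ykA \<tau> (norm (x - y))"
          using t le by (intro ykA_lower) auto
        then show ?thesis unfolding K_def using ge d t by (intro mult_mono) (auto simp: ykA_nonneg)
      qed
      have Knn: "K y \<ge> 0" if y: "y \<in> ball y0 \<eta>" for y
      proof -
        have ys: "norm (y - y0) < \<eta>" using y by (simp add: dist_norm norm_minus_commute)
        have "(x - y) \<bullet> e = d + (x - x0) \<bullet> e - (y - y0) \<bullet> e" using ee by (simp add: inner_diff_left)
        moreover have "\<bar>(x - x0) \<bullet> e\<bar> \<le> norm (x - x0)" "\<bar>(y - y0) \<bullet> e\<bar> \<le> norm (y - y0)"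
          using Cauchy_Schwarz_ineq2[of _ e] e1 by (metis mult.right_neutral)+
        ultimately have "(x - y) \<bullet> e \<ge> 0" using xs ys s(3) by (simp add: \<eta>_def)
        then show ?thesis unfolding K_def using t by (simp add: ykA_nonneg)
      qed
      define k where "k = exp (-2) * exp (- \<tau> * d) / (4 * pi * (d + 2) ^ 3) * (d / 2)"
      have k0: "k \<ge> 0" using d by (simp add: k_def)
      have kK: "k \<le> K y" if "y \<in> ball y0 s" for y
      proof -
        have "- \<tau> * (d + 2 * s) = -2 + - \<tau> * d" using t by (simp add: s_def field_simps)
        then have "exp (- \<tau> * (d + 2 * s)) = exp (-2) * exp (- \<tau> * d)" by (simp only: exp_add)
        moreover have "exp (- \<tau> * (d + 2 * s)) / (4 * pi * (d + 2) ^ 3) \<le> exp (- \<tau> * (d + 2 * s)) / (4 * pi * (d + 2 * s) ^ 3)"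
          using d s0 s(1) by (intro divide_left_mono mult_left_mono power_mono mult_pos_pos zero_less_power) auto
        ultimately have "k \<le> exp (- \<tau> * (d + 2 * s)) / (4 * pi * (d + 2 * s) ^ 3) * (d / 2)"
          unfolding k_def using d by (intro mult_right_mono) auto
        then show ?thesis using Kpos[OF that] by linarith
      qed
      have bq: "ball q (\<kappa>2 * s) \<in> lmeasurable" by (rule lmeasurable_ball)
      have "2 * L = k * c1 * (\<omega> * (\<kappa>2 * s) ^ 3)"
        using t by (simp add: L_def m_def k_def s_def power_mult_distrib power_divide mult_ac)
      also have "\<dots> = (LINT y|lebesgue. k * c1 * indicat_real (ball q (\<kappa>2 * s)) y)"
        using measure_ball_R3[of "\<kappa>2 * s" q] k2(1) s0 by (simp add: \<omega>_def)
      also have "\<dots> \<le> (LINT y|lebesgue. \<sigma> * (K y * f1 y))"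
      proof (rule integral_mono_AE)
        show "integrable lebesgue (\<lambda>y. k * c1 * indicat_real (ball q (\<kappa>2 * s)) y)"
          using bq by (intro integrable_mult_right) (auto simp: fmeasurable_def)
        show "integrable lebesgue (\<lambda>y. \<sigma> * (K y * f1 y))" using K1i by (rule integrable_mult_right)
        show "AE y in lebesgue. k * c1 * indicat_real (ball q (\<kappa>2 * s)) y \<le> \<sigma> * (K y * f1 y)"
          using \<sigma>(2) z
        proof eventually_elim
          case (elim y)
          have e: "\<sigma> * (K y * f1 y) = K y * (\<sigma> * f y) * indicat_real (ball y0 \<eta>) y" by (simp add: f1_def)
          show ?case
          proof (cases "y \<in> ball q (\<kappa>2 * s)")
            case True
            then have "y \<in> B" "y \<in> ball y0 s" using q by auto
            moreover have "y \<in> ball y0 \<eta>" using \<open>y \<in> ball y0 s\<close> s(3) by simp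
            ultimately have "k * c1 \<le> K y * (\<sigma> * f y)"
              using kK k0 c1 elim Knn by (intro mult_mono) auto
            then show ?thesis unfolding e using True \<open>y \<in> ball y0 \<eta>\<close> by simp
          next
            case False
            have "K y * (\<sigma> * f y) \<ge> 0" if "y \<in> ball y0 \<eta>"
            proof (cases "y \<in> B")
              case True
              then show ?thesis using elim(1) c1 Knn[OF that] by simp
            qed (use elim(2) in simp)
            then show ?thesis unfolding e using False by (simp add: indicator_def)
          qed
        qed
      qed
      also have "\<dots> = \<sigma> * (LINT y|lebesgue. K y * f1 y)" by simp
      also have "\<dots> \<le> \<bar>\<sigma> * (LINT y|lebesgue. K y * f1 y)\<bar>" by simp
      also have "\<dots> = \<bar>LINT y|lebesgue. K y * f1 y\<bar>" using \<sigma>(1) by (simp add: abs_mult)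
      finally have near: "2 * L \<le> \<bar>LINT y|lebesgue. K y * f1 y\<bar>" .
      have "vgrad f \<tau> x \<bullet> e = - (LINT y|lebesgue. K y * f y)"
        unfolding K_def by (rule vgrad_inner[OF t(2) ds rB[OF BC] z fi]) assumption+
      also have "(LINT y|lebesgue. K y * f y) = (LINT y|lebesgue. K y * f1 y + K y * f2 y)"
        by (intro Bochner_Integration.integral_cong refl) (simp add: f1_def f2_def indicator_def)
      also have "\<dots> = (LINT y|lebesgue. K y * f1 y) + (LINT y|lebesgue. K y * f2 y)"
        by (rule Bochner_Integration.integral_add[OF K1i K2i])
      finally have "L \<le> \<bar>vgrad f \<tau> x \<bullet> e\<bar>" using near far by linarith
      also have "\<dots> \<le> norm (vgrad f \<tau> x)" using Cauchy_Schwarz_ineq2[of "vgrad f \<tau> x" e] e1 by simp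
      finally show ?thesis .
    qed
    have bp: "ball p (\<kappa>1 * s) \<in> lmeasurable" by (rule lmeasurable_ball)
    have rL: "restr D (vgrad f \<tau>) \<in> vL2" by (rule restr_vL2[OF D v[OF t(1)]])
    have "c * exp (- 2 * d * \<tau>) / \<tau> ^ 9 = L\<^sup>2 * (\<omega> * (\<kappa>1 * s) ^ 3)"
    proof -
      have "(exp (- \<tau> * d))\<^sup>2 = exp (- 2 * d * \<tau>)" by (simp add: power2_eq_square exp_add[symmetric])
      then show ?thesis
        using t by (simp add: L_def c_def s_def power_mult_distrib power_divide power_mult[symmetric] power_add[symmetric] mult_ac)
    qed
    also have "\<dots> = (LINT x|lebesgue. L\<^sup>2 * indicat_real (ball p (\<kappa>1 * s)) x)"
      using measure_ball_R3[of "\<kappa>1 * s" p] k1(1) s0 by (simp add: \<omega>_def)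
    also have "\<dots> \<le> (LINT x|lebesgue. (norm (restr D (vgrad f \<tau>) x))\<^sup>2)"
    proof (rule integral_mono_AE)
      show "integrable lebesgue (\<lambda>x. L\<^sup>2 * indicat_real (ball p (\<kappa>1 * s)) x)"
        using bp by (intro integrable_mult_right) (auto simp: fmeasurable_def)
      show "integrable lebesgue (\<lambda>x. (norm (restr D (vgrad f \<tau>) x))\<^sup>2)"
        unfolding power2_norm_eq_inner by (rule vip_integrable[OF rL rL])
      have "L\<^sup>2 \<le> (norm (restr D (vgrad f \<tau>) x))\<^sup>2" if "x \<in> ball p (\<kappa>1 * s)" for x
      proof -
        have "x \<in> D" "x \<in> ball x0 s" using that p by auto
        then show ?thesis using low L0 by (intro power_mono) (auto simp: restr_def)
      qed
      then show "AE x in lebesgue. L\<^sup>2 * indicat_real (ball p (\<kappa>1 * s)) x \<le> (norm (restr D (vgrad f \<tau>) x))\<^sup>2"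
        by (intro AE_I2) (simp add: indicator_def)
    qed
    also have "\<dots> = (vnorm (restr D (vgrad f \<tau>)))\<^sup>2" by (simp add: vip_norm_sq[OF rL] vip_self)
    finally show ?case .
  qed
  with c show thesis by (rule that)
qed

section \<open>Asymptotics of the indicator function\<close>

text \<open>The complement of the support is a union of possibly uncountably many open sets on which
  \<open>f\<close> vanishes almost everywhere; by Lindelof's theorem countably many of them suffice,
  and so do countably many null sets.\<close>

lemma AE_zero_outside_ess_support: "AE x in lebesgue. x \<notin> ess_support f \<longrightarrow> f x = 0"
proof -
  define \<F> where "\<F> = {S. open S \<and> (AE x in lebesgue. x \<in> S \<longrightarrow> f x = 0)}"
  obtain \<G> where G: "\<G> \<subseteq> \<F>" "countable \<G>" "\<Union>\<G> = \<Union>\<F>"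
    by (rule Lindelof[of \<F>]) (auto simp: \<F>_def)
  have "\<forall>S\<in>\<G>. AE x in lebesgue. x \<in> S \<longrightarrow> f x = 0" using G(1) by (auto simp: \<F>_def)
  then have "AE x in lebesgue. \<forall>S\<in>\<G>. x \<in> S \<longrightarrow> f x = 0" by (subst AE_ball_countable[OF G(2)])
  then show ?thesis
  proof eventually_elim
    case (elim x)
    have "ess_support f = - \<Union>\<G>" unfolding G(3) by (simp add: ess_support_def \<F>_def)
    then show ?case using elim by blast
  qed
qed

lemma emission_AE_zero_outside:
  assumes "emission_condition B f" "frontier B \<in> null_sets lebesgue"
  shows "AE x in lebesgue. x \<notin> B \<longrightarrow> f x = 0"
  using AE_zero_outside_ess_support[of f] AE_not_in[OF assms(2)]
proof eventually_elim
  case (elim x)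
  have "ess_support f \<subseteq> closure B" using assms(1) by (simp add: emission_condition_def)
  moreover have "x \<in> B" if "x \<in> closure B" using that elim(2) interior_subset by (auto simp: frontier_def)
  ultimately show ?case using elim(1) by blast
qed

text \<open>After scaling, the main term decays like
  \<open>\<tau>\<^sup>2 * exp (- (2 * d - T) * \<tau>)\<close>, while the linear error becomes
  exactly \<open>1 / \<tau>\<close>: it has no exponential left to lose.\<close>

lemma scaled_tendsto_zero:
  fixes I V :: "real \<Rightarrow> real"
  assumes I: "\<And>\<tau>. \<tau> \<ge> 1 \<Longrightarrow> \<bar>I \<tau>\<bar> \<le> C * (V \<tau> + (exp (- \<tau> * T))\<^sup>2 + exp (- \<tau> * T) / \<tau>)"
    and V: "\<And>\<tau>. \<tau> \<ge> 1 \<Longrightarrow> V \<tau> \<le> K * \<tau>\<^sup>2 * exp (- 2 * d * \<tau>)"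
    and C: "C > 0" and T: "T > 0" "T < 2 * d"
  shows "((\<lambda>\<tau>. exp (\<tau> * T) * I \<tau>) \<longlongrightarrow> 0) at_top"
proof (rule Lim_null_comparison)
  define a where "a = 2 * d - T"
  have a: "a > 0" using T by (simp add: a_def)
  show "((\<lambda>\<tau>. C * (K * \<tau>\<^sup>2 * exp (- a * \<tau>) + exp (- T * \<tau>) + 1 / \<tau>)) \<longlongrightarrow> 0) at_top"
  proof -
    have 1: "((\<lambda>\<tau>. \<tau>\<^sup>2 * exp (- a * \<tau>)) \<longlongrightarrow> 0) at_top" using a by real_asymp
    have 2: "((\<lambda>\<tau>. exp (- T * \<tau>)) \<longlongrightarrow> 0) at_top" using T(1) by real_asymp
    have 3: "((\<lambda>\<tau>::real. 1 / \<tau>) \<longlongrightarrow> 0) at_top" by real_asymp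
    have "((\<lambda>\<tau>. C * (K * (\<tau>\<^sup>2 * exp (- a * \<tau>)) + exp (- T * \<tau>) + 1 / \<tau>)) \<longlongrightarrow> C * (K * 0 + 0 + 0)) at_top"
      by (intro tendsto_mult tendsto_add tendsto_const 1 2 3)
    then show ?thesis by (simp add: mult.assoc)
  qed
  show "\<forall>\<^sub>F \<tau> in at_top. norm (exp (\<tau> * T) * I \<tau>) \<le> C * (K * \<tau>\<^sup>2 * exp (- a * \<tau>) + exp (- T * \<tau>) + 1 / \<tau>)"
    using eventually_ge_at_top[of "1::real"]
  proof eventually_elim
    case (elim \<tau>)
    have "\<bar>I \<tau>\<bar> \<le> C * (K * \<tau>\<^sup>2 * exp (- 2 * d * \<tau>) + (exp (- \<tau> * T))\<^sup>2 + exp (- \<tau> * T) / \<tau>)"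
      by (rule order_trans[OF I[OF elim]]) (use V[OF elim] C in \<open>intro mult_left_mono add_right_mono; simp\<close>)
    then have "exp (\<tau> * T) * \<bar>I \<tau>\<bar> \<le> exp (\<tau> * T) * (C * (K * \<tau>\<^sup>2 * exp (- 2 * d * \<tau>) + (exp (- \<tau> * T))\<^sup>2 + exp (- \<tau> * T) / \<tau>))"
      by (rule mult_left_mono) simp
    also have "\<dots> = C * (K * \<tau>\<^sup>2 * (exp (\<tau> * T) * exp (- 2 * d * \<tau>)) + exp (\<tau> * T) * (exp (- \<tau> * T))\<^sup>2 + exp (\<tau> * T) * exp (- \<tau> * T) / \<tau>)"
      by (simp add: algebra_simps)
    also have "exp (\<tau> * T) * exp (- 2 * d * \<tau>) = exp (- a * \<tau>)" by (simp add: exp_add[symmetric] a_def algebra_simps)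
    also have "exp (\<tau> * T) * (exp (- \<tau> * T))\<^sup>2 = exp (- T * \<tau>)"
      by (simp add: exp_add[symmetric] power2_eq_square algebra_simps)
    also have "exp (\<tau> * T) * exp (- \<tau> * T) = 1" by (simp add: exp_add[symmetric])
    finally show ?case by (simp add: abs_mult)
  qed
qed

text \<open>\<open>J\<close> is the indicator function or its negative, according to the sign
  condition. The exponential \<open>exp ((T - 2 * d) * \<tau>)\<close> outgrows the ninth power, and
  the scaled errors tend to 0.\<close>

lemma scaled_at_top:
  fixes J V :: "real \<Rightarrow> real"
  assumes J: "\<And>\<tau>. \<tau> \<ge> 1 \<Longrightarrow> J \<tau> \<ge> c * V \<tau> - C * ((exp (- \<tau> * T))\<^sup>2 + exp (- \<tau> * T) / \<tau>)"
    and V: "\<forall>\<^sub>F \<tau> in at_top. k * exp (- 2 * d * \<tau>) / \<tau> ^ 9 \<le> V \<tau>"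
    and c: "c > 0" "k > 0" and T: "T > 0" "T > 2 * d"
  shows "filterlim (\<lambda>\<tau>. exp (\<tau> * T) * J \<tau>) at_top at_top"
proof (rule filterlim_at_top_mono)
  define a where "a = T - 2 * d"
  have a: "a > 0" using T by (simp add: a_def)
  have "c * k > 0" using c by simp
  then show "filterlim (\<lambda>\<tau>. c * k * exp (a * \<tau>) / \<tau> ^ 9 - C * (exp (- T * \<tau>) + 1 / \<tau>)) at_top at_top"
    using a T by real_asymp
  show "\<forall>\<^sub>F \<tau> in at_top. c * k * exp (a * \<tau>) / \<tau> ^ 9 - C * (exp (- T * \<tau>) + 1 / \<tau>) \<le> exp (\<tau> * T) * J \<tau>"
    using eventually_ge_at_top[of "1::real"] V
  proof eventually_elim
    case (elim \<tau>)
    have e1: "exp (\<tau> * T) * exp (- 2 * d * \<tau>) = exp (a * \<tau>)" by (simp add: exp_add[symmetric] a_def algebra_simps)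
    have e2: "exp (\<tau> * T) * (exp (- \<tau> * T))\<^sup>2 = exp (- T * \<tau>)"
      by (simp add: exp_add[symmetric] power2_eq_square algebra_simps)
    have e3: "exp (\<tau> * T) * exp (- \<tau> * T) = 1" by (simp add: exp_add[symmetric])
    have "c * k * exp (a * \<tau>) / \<tau> ^ 9 - C * (exp (- T * \<tau>) + 1 / \<tau>)
      = exp (\<tau> * T) * (c * (k * exp (- 2 * d * \<tau>) / \<tau> ^ 9) - C * ((exp (- \<tau> * T))\<^sup>2 + exp (- \<tau> * T) / \<tau>))"
      unfolding e1[symmetric] e2[symmetric] e3[symmetric] by (simp add: algebra_simps)
    also have "\<dots> \<le> exp (\<tau> * T) * (c * V \<tau> - C * ((exp (- \<tau> * T))\<^sup>2 + exp (- \<tau> * T) / \<tau>))"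
      using elim(2) c by (intro mult_left_mono diff_right_mono) auto
    also have "\<dots> \<le> exp (\<tau> * T) * J \<tau>" using J[OF elim(1)] by (intro mult_left_mono) auto
    finally show ?case .
  qed
qed

text \<open>Both bounds of \<open>\<bar>I \<tau>\<bar>\<close> are
  \<open>exp (- 2 * d * \<tau>)\<close> times a power of \<open>\<tau>\<close>, which adds only
  multiples of \<open>ln \<tau> / \<tau>\<close> after taking logarithms. The lower bound also shows
  that the logarithm is eventually taken of a positive number.\<close>

lemma log_tendsto:
  fixes I J V :: "real \<Rightarrow> real"
  assumes I: "\<And>\<tau>. \<tau> \<ge> 1 \<Longrightarrow> \<bar>I \<tau>\<bar> \<le> C * (V \<tau> + (exp (- \<tau> * T))\<^sup>2 + exp (- \<tau> * T) / \<tau>)"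
    and J: "\<And>\<tau>. \<tau> \<ge> 1 \<Longrightarrow> J \<tau> \<ge> c * V \<tau> - C * ((exp (- \<tau> * T))\<^sup>2 + exp (- \<tau> * T) / \<tau>)"
    and IJ: "\<And>\<tau>. \<bar>I \<tau>\<bar> = \<bar>J \<tau>\<bar>"
    and Vu: "\<And>\<tau>. \<tau> \<ge> 1 \<Longrightarrow> V \<tau> \<le> K * \<tau>\<^sup>2 * exp (- 2 * d * \<tau>)"
    and Vl: "\<forall>\<^sub>F \<tau> in at_top. k * exp (- 2 * d * \<tau>) / \<tau> ^ 9 \<le> V \<tau>"
    and c: "c > 0" "k > 0" "C > 0" "K > 0" "d > 0" and T: "T > 2 * d"
  shows "((\<lambda>\<tau>. 1 / \<tau> * ln \<bar>I \<tau>\<bar>) \<longlongrightarrow> - 2 * d) at_top"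
proof (rule tendsto_sandwich)
  \<comment> \<open>Half of the coefficient \<open>c * k\<close> of the main term; the other half
    absorbs the errors, which are smaller than the main term by the factor
    \<open>exp (- a * \<tau>)\<close> up to powers of \<open>\<tau>\<close>.\<close>
  define m where "m = c * k / 2"
  have m: "m > 0" using c by (simp add: m_def)
  define M where "M = C * (K + 2)"
  have M: "M > 0" using c by (simp add: M_def)
  define a where "a = T - 2 * d"
  have a: "a > 0" using T by (simp add: a_def)
  have up: "\<bar>I \<tau>\<bar> \<le> M * \<tau>\<^sup>2 * exp (- 2 * d * \<tau>)" if t: "\<tau> \<ge> 1" for \<tau>
  proof -
    have e: "exp (- \<tau> * T) \<le> exp (- 2 * d * \<tau>)" using t T by simp
    have e1: "exp (- 2 * d * \<tau>) \<le> 1" using t c by simp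
    have t2: "1 \<le> \<tau>\<^sup>2" using t by (simp add: one_le_power)
    have x: "exp (- 2 * d * \<tau>) \<le> \<tau>\<^sup>2 * exp (- 2 * d * \<tau>)" using mult_right_mono[OF t2, of "exp (- 2 * d * \<tau>)"] by simp
    have "(exp (- \<tau> * T))\<^sup>2 \<le> exp (- \<tau> * T) * 1" unfolding power2_eq_square
    proof (rule mult_left_mono)
      show "exp (- \<tau> * T) \<le> 1" using e e1 by linarith
    qed simp
    moreover have "exp (- \<tau> * T) / \<tau> \<le> exp (- \<tau> * T) / 1" using t by (intro divide_left_mono) auto
    ultimately have "V \<tau> + (exp (- \<tau> * T))\<^sup>2 + exp (- \<tau> * T) / \<tau>
        \<le> K * \<tau>\<^sup>2 * exp (- 2 * d * \<tau>) + \<tau>\<^sup>2 * exp (- 2 * d * \<tau>) + \<tau>\<^sup>2 * exp (- 2 * d * \<tau>)"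
      using Vu[OF t] e x by linarith
    also have "\<dots> = (K + 2) * \<tau>\<^sup>2 * exp (- 2 * d * \<tau>)" by (simp add: algebra_simps)
    finally have "C * (V \<tau> + (exp (- \<tau> * T))\<^sup>2 + exp (- \<tau> * T) / \<tau>) \<le> C * ((K + 2) * \<tau>\<^sup>2 * exp (- 2 * d * \<tau>))"
      using c by (intro mult_left_mono) auto
    then show ?thesis using I[OF t] by (simp add: M_def mult_ac)
  qed
  have "((\<lambda>\<tau>. \<tau> ^ 9 * (C * (exp (- (2 * d + 2 * a) * \<tau>) + exp (- a * \<tau>) / \<tau>))) \<longlongrightarrow> 0) at_top"
  proof -
    have "((\<lambda>\<tau>. C * (\<tau> ^ 9 * exp (- (2 * d + 2 * a) * \<tau>) + \<tau> ^ 9 * (exp (- a * \<tau>) / \<tau>))) \<longlongrightarrow> C * (0 + 0)) at_top"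
    proof (intro tendsto_mult tendsto_add tendsto_const)
      have "2 * d + 2 * a > 0" using a c by simp
      then show "((\<lambda>\<tau>. \<tau> ^ 9 * exp (- (2 * d + 2 * a) * \<tau>)) \<longlongrightarrow> 0) at_top" by real_asymp
      show "((\<lambda>\<tau>. \<tau> ^ 9 * (exp (- a * \<tau>) / \<tau>)) \<longlongrightarrow> 0) at_top" using a by real_asymp
    qed
    then show ?thesis by (simp only: distrib_left mult.left_commute add_0 mult_zero_right)
  qed
  then have sm: "\<forall>\<^sub>F \<tau> in at_top. \<tau> ^ 9 * (C * (exp (- (2 * d + 2 * a) * \<tau>) + exp (- a * \<tau>) / \<tau>)) < m"
    by (rule order_tendstoD(2)) (rule m)
  have low: "\<forall>\<^sub>F \<tau> in at_top. m * exp (- 2 * d * \<tau>) / \<tau> ^ 9 \<le> \<bar>I \<tau>\<bar>"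
    using eventually_ge_at_top[of "1::real"] Vl sm
  proof eventually_elim
    case (elim \<tau>)
    let ?e = "exp (- 2 * d * \<tau>)"
    have e1: "exp (- \<tau> * T) = ?e * exp (- a * \<tau>)" by (simp add: exp_add[symmetric] a_def algebra_simps)
    have e2: "(exp (- \<tau> * T))\<^sup>2 = ?e * exp (- (2 * d + 2 * a) * \<tau>)"
      by (simp add: power2_eq_square exp_add[symmetric] a_def algebra_simps)
    have "C * (exp (- (2 * d + 2 * a) * \<tau>) + exp (- a * \<tau>) / \<tau>) \<le> m / \<tau> ^ 9"
      using elim(1,3) by (simp add: pos_le_divide_eq mult.commute)
    then have "?e * (C * (exp (- (2 * d + 2 * a) * \<tau>) + exp (- a * \<tau>) / \<tau>)) \<le> ?e * (m / \<tau> ^ 9)"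
      by (rule mult_left_mono) simp
    then have 1: "C * ((exp (- \<tau> * T))\<^sup>2 + exp (- \<tau> * T) / \<tau>) \<le> m * ?e / \<tau> ^ 9"
      unfolding e1 e2[unfolded e1] by (simp add: algebra_simps)
    have "c * (k * ?e / \<tau> ^ 9) \<le> c * V \<tau>" using elim(2) c by (intro mult_left_mono) auto
    then have "2 * (m * ?e / \<tau> ^ 9) \<le> c * V \<tau>" by (simp add: m_def)
    moreover have "X \<le> Z" if "2 * X \<le> Y" "Y - W \<le> Z" "W \<le> X" for X Y Z W :: real using that by linarith
    ultimately have "m * ?e / \<tau> ^ 9 \<le> J \<tau>" using J[OF elim(1)] 1 by blast
    then show ?case using IJ[of \<tau>] by linarith
  qed
  show "((\<lambda>\<tau>. (ln m - 9 * ln \<tau> - 2 * d * \<tau>) / \<tau>) \<longlongrightarrow> - 2 * d) at_top"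
    by real_asymp
  show "((\<lambda>\<tau>. (ln M + 2 * ln \<tau> - 2 * d * \<tau>) / \<tau>) \<longlongrightarrow> - 2 * d) at_top"
    by real_asymp
  show "\<forall>\<^sub>F \<tau> in at_top. (ln m - 9 * ln \<tau> - 2 * d * \<tau>) / \<tau> \<le> 1 / \<tau> * ln \<bar>I \<tau>\<bar>"
    using eventually_ge_at_top[of "1::real"] low
  proof eventually_elim
    case (elim \<tau>)
    have t: "\<tau> > 0" using elim(1) by simp
    have p: "m * exp (- 2 * d * \<tau>) / \<tau> ^ 9 > 0" using m t by simp
    have "ln (m * exp (- 2 * d * \<tau>) / \<tau> ^ 9) \<le> ln \<bar>I \<tau>\<bar>" using p elim(2) by (subst ln_le_cancel_iff) auto
    moreover have "ln (m * exp (- 2 * d * \<tau>) / \<tau> ^ 9) = ln m - 2 * d * \<tau> - 9 * ln \<tau>"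
      using m t by (simp add: ln_div ln_mult ln_realpow)
    ultimately have "(ln m - 9 * ln \<tau> - 2 * d * \<tau>) / \<tau> \<le> ln \<bar>I \<tau>\<bar> / \<tau>" using t by (intro divide_right_mono) auto
    then show ?case by simp
  qed
  show "\<forall>\<^sub>F \<tau> in at_top. 1 / \<tau> * ln \<bar>I \<tau>\<bar> \<le> (ln M + 2 * ln \<tau> - 2 * d * \<tau>) / \<tau>"
    using eventually_ge_at_top[of "1::real"] low
  proof eventually_elim
    case (elim \<tau>)
    have t: "\<tau> > 0" using elim(1) by simp
    have "m * exp (- 2 * d * \<tau>) / \<tau> ^ 9 > 0" using m t by simp
    then have p: "\<bar>I \<tau>\<bar> > 0" using elim(2) by linarith
    have "ln \<bar>I \<tau>\<bar> \<le> ln (M * \<tau>\<^sup>2 * exp (- 2 * d * \<tau>))" using p up[OF elim(1)] by (subst ln_le_cancel_iff) auto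
    also have "\<dots> = ln M + 2 * ln \<tau> - 2 * d * \<tau>"
      using M t by (simp add: ln_mult ln_realpow)
    finally have "ln \<bar>I \<tau>\<bar> / \<tau> \<le> (ln M + 2 * ln \<tau> - 2 * d * \<tau>) / \<tau>" using t by (intro divide_right_mono) auto
    then show ?case by simp
  qed
qed

theorem theorem2p1:
  fixes D B :: "(real^3) set"
    and \<gamma> :: "real^3 \<Rightarrow> real^3^3"
    and f :: "real^3 \<Rightarrow> real"
    and u :: "real \<Rightarrow> real^3 \<Rightarrow> real"
    and T :: real
  assumes "D \<noteq> {}" and "bounded D" and "D \<in> sets lebesgue" and "connected (- D)"
    and "admissible_coefficient D \<gamma>"
    and "M_plus D \<gamma> \<or> M_minus D \<gamma>"
    and "B \<noteq> {}" and "bounded B" and "open B" and "closure B \<inter> closure D = {}"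
    and "f \<in> L2" and "emission_condition B f"
    and "T > 0" and "weak_wave_solution T \<gamma> f u"
    and "(has_C1_boundary D \<and> cone_condition B) \<or>
         (cone_condition D \<and> cone_condition B \<and> convex B)"
  shows "(T < 2 * setdist D B \<longrightarrow>
            ((\<lambda>\<tau>. exp (\<tau> * T) * indicator_function T B f u \<tau>) \<longlongrightarrow> 0) at_top) \<and>
         (T > 2 * setdist D B \<longrightarrow>
            (M_plus D \<gamma> \<longrightarrow>
               filterlim (\<lambda>\<tau>. exp (\<tau> * T) * indicator_function T B f u \<tau>) at_bot at_top) \<and>
            (M_minus D \<gamma> \<longrightarrow>
               filterlim (\<lambda>\<tau>. exp (\<tau> * T) * indicator_function T B f u \<tau>) at_top at_top)) \<and>
         (T > 2 * setdist D B \<longrightarrow>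
            ((\<lambda>\<tau>. 1 / \<tau> * ln \<bar>indicator_function T B f u \<tau>\<bar>) \<longlongrightarrow> - 2 * setdist D B) at_top)"
proof -
  let ?d = "setdist D B"
  let ?I = "indicator_function T B f u"
  let ?V = "\<lambda>\<tau>. (vnorm (restr D (vgrad f \<tau>)))\<^sup>2"
  have cB: "cone_condition B" using assms(15) by blast
  have Bm: "B \<in> sets lebesgue" using \<open>open B\<close> by (simp add: borel_open)
  have z: "AE x in lebesgue. x \<notin> B \<longrightarrow> f x = 0"
    by (rule emission_AE_zero_outside[OF assms(12) cone_condition_frontier_null[OF assms(9,8) cB]])
  obtain x0 y0 where x: "x0 \<in> closure D" "y0 \<in> closure B" "dist x0 y0 = ?d" "?d > 0"
    "\<And>y. y \<in> closure B \<Longrightarrow> dist x0 y \<ge> ?d" "\<And>y. y \<in> closure B \<Longrightarrow> dist x0 y = ?d \<Longrightarrow> y = y0"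
    "fat D x0" "fat B y0"
    by (rule nearest_points[OF assms(1,2,7,8,10,15)]) (rule that; assumption)
  obtain C c where Cc: "C > 0" "c > 0"
    and v: "\<And>\<tau>. \<tau> \<ge> 1 \<Longrightarrow> vgrad f \<tau> \<in> vL2"
    and Iu: "\<And>\<tau>. \<tau> \<ge> 1 \<Longrightarrow> \<bar>?I \<tau>\<bar> \<le> C * (?V \<tau> + (exp (- \<tau> * T))\<^sup>2 + exp (- \<tau> * T) / \<tau>)"
    and Ip: "\<And>\<tau>. \<tau> \<ge> 1 \<Longrightarrow> M_plus D \<gamma> \<Longrightarrow> - ?I \<tau> \<ge> c * ?V \<tau> - C * ((exp (- \<tau> * T))\<^sup>2 + exp (- \<tau> * T) / \<tau>)"
    and Im: "\<And>\<tau>. \<tau> \<ge> 1 \<Longrightarrow> M_minus D \<gamma> \<Longrightarrow> ?I \<tau> \<ge> c * ?V \<tau> - C * ((exp (- \<tau> * T))\<^sup>2 + exp (- \<tau> * T) / \<tau>)"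
    by (rule indicator_bounds[OF assms(13,3,5) Bm assms(11) z assms(14)]) (rule that; assumption)
  obtain K where K: "K > 0" "\<And>\<tau>. \<tau> \<ge> 1 \<Longrightarrow> ?V \<tau> \<le> K * \<tau>\<^sup>2 * exp (- 2 * ?d * \<tau>)"
    by (rule vgrad_vnorm_upper[OF assms(3,2) Bm assms(8,11) z x(4) v]) (assumption | rule that; assumption)+
  \<comment> \<open>The sign \<open>\<sigma>\<close> merges the two alternatives of the emission
    condition.\<close>
  obtain c1 \<sigma> :: real where s: "c1 > 0" "\<bar>\<sigma>\<bar> = 1" "AE x in lebesgue. x \<in> B \<longrightarrow> \<sigma> * f x \<ge> c1"
  proof -
    obtain c1 where "c1 > 0" "(AE x in lebesgue. x \<in> B \<longrightarrow> f x \<ge> c1) \<or> (AE x in lebesgue. x \<in> B \<longrightarrow> - f x \<ge> c1)"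
      using assms(12) by (auto simp: emission_condition_def)
    then show thesis using that[of c1 1] that[of c1 "-1"] by auto
  qed
  obtain k where k: "k > 0" "\<forall>\<^sub>F \<tau> in at_top. k * exp (- 2 * ?d * \<tau>) / \<tau> ^ 9 \<le> ?V \<tau>"
    using vgrad_vnorm_lower[OF assms(3) Bm assms(8,11) z x(4) v x(3,5,6,7,8) s] by blast
  show ?thesis
  proof (intro conjI impI)
    assume T: "T < 2 * ?d"
    show "((\<lambda>\<tau>. exp (\<tau> * T) * ?I \<tau>) \<longlongrightarrow> 0) at_top"
      by (rule scaled_tendsto_zero[OF Iu K(2) Cc(1) assms(13) T])
  next
    assume T: "T > 2 * ?d" and M: "M_plus D \<gamma>"
    have "filterlim (\<lambda>\<tau>. exp (\<tau> * T) * - ?I \<tau>) at_top at_top"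
      by (rule scaled_at_top[OF Ip[OF _ M] k(2) Cc(2) k(1) assms(13) T])
    then show "filterlim (\<lambda>\<tau>. exp (\<tau> * T) * ?I \<tau>) at_bot at_top"
      by (simp add: filterlim_uminus_at_bot)
  next
    assume T: "T > 2 * ?d" and M: "M_minus D \<gamma>"
    show "filterlim (\<lambda>\<tau>. exp (\<tau> * T) * ?I \<tau>) at_top at_top"
      by (rule scaled_at_top[OF Im[OF _ M] k(2) Cc(2) k(1) assms(13) T])
  next
    assume T: "T > 2 * ?d"
    from assms(6) show "((\<lambda>\<tau>. 1 / \<tau> * ln \<bar>?I \<tau>\<bar>) \<longlongrightarrow> - 2 * ?d) at_top"
    proof
      assume M: "M_plus D \<gamma>"
      show ?thesis by (rule log_tendsto[OF Iu Ip[OF _ M] _ K(2) k(2) Cc(2) k(1) Cc(1) K(1) x(4) T]) simp_all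
    next
      assume M: "M_minus D \<gamma>"
      show ?thesis by (rule log_tendsto[OF Iu Im[OF _ M] _ K(2) k(2) Cc(2) k(1) Cc(1) K(1) x(4) T]) simp_all
    qed
  qed
qed

end
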